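(* Every definable bounded distributive lattice $(H,\sqsubseteq)$ with $\dim H=1$ is isomorphic to the cohesive tower determined by some cohesive blueprint.
   Context: Fix an o-minimal structure $R$ expanding a real-closed field. "Definable" means definable in $R$ with parameters; a definable lattice is a lattice whose underlying set is a definable subset of some $R^d$ and whose order relation is definable; $\dim$ is o-minimal dimension. A cohesive blueprint consists of - positive integers $n$ and $N$; - a definable subset $M\subseteq R$ that has a minimum and a maximum element; - a decomposition of $M$ into points and intervals $M_1<\dots<M_n$; - for each $i\in\{1,\dots,n\}$, a finite distributive lattice $(H_i,\sqsubseteq_i)$ with $H_i\subseteq\{1,\dots,N\}$ (operations $\sqcap_i,\sqcup_i$, least element $\bot_i$, greatest element $\top_i$); - for each $i\le j$ in $\{1,\dots,n\}$, a morphism of bounded-below distributive lattices $l_{i,j}:H_i\to H_j$ (preserving binary meets, binary joins and $\bot$); subject to the cohesion conditions: 1. $l_{i,k}=l_{j,k}\circ l_{i,j}$ for all $i\le j\le k$ (in particular $l_{i,i}\circ l_{i,i}=l_{i,i}$; $l_{i,i}$ need not be the identity); 2. for each $i\le j$, the map $r_{j,i}:H_j\to H_i$ defined by $r_{j,i}(x)=\bigsqcup_i\{y\in H_i : l_{i,j}(y)\sqsubseteq_j x\}$ satisfies $r_{j,i}(l_{i,j}(p))=p\sqcup_i r_{j,i}(\bot_j)$ and $l_{i,j}(r_{j,i}(q))=q\sqcap_j l_{i,j}(\top_i)$ for all $p\in H_i$, $q\in H_j$. The cohesive tower determined by the blueprint is the structure with underlying set $\{(i,m,p) : 1\le i\le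 n,\ m\in M_i,\ p\in H_i\}$, with commutative operations given, for $m_1\le m$ in $R$, by $(i,m_1,p)\sqcup(j,m,q)=(j,m,p\sqcup_i q)$ if $m_1=m$ and $(j,m,l_{i,j}(p)\sqcup_j q)$ otherwise; $(i,m_1,p)\sqcap(j,m,q)=(i,m_1,p\sqcap_i q)$ if $m_1=m$ and $(i,m_1,p\sqcap_i r_{j,i}(q))$ otherwise; and with $\bot=(1,\min M,\bot_1)$, $\top=(n,\max M,\top_n)$. *)

theory Defs
  imports Main "HOL-Library.Extended_Real" "HOL-Algebra.Lattice"
begin

section \<open>O-minimal structures expanding a real closed field\<close>

text \<open>A real closed field is an ordered field in which nonnegative elements have square roots and
  (monic) polynomials of odd degree have roots.\<close>

class real_closed_field = linordered_field +
  assumes nonneg_has_sqrt: "0 \<le> a \<Longrightarrow> \<exists>b. b * b = a"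
    and odd_degree_has_root: "odd n \<Longrightarrow> \<exists>x. x ^ n + (\<Sum>i<n. c i * x ^ i) = 0"

text \<open>First-order structures on \<open>'a\<close> expanding its ordered field structure: arbitrary families of
  further functions and relations, indexed by \<open>'f\<close> and \<open>'r\<close>. Symbols carry no arities: a symbol
  applied to argument lists of different lengths plays the role of different symbols, and a symbol
  of arity \<open>k\<close> is obtained by interpreting it trivially on lists whose length is not \<open>k\<close>.\<close>

record ('a, 'f, 'r) expansion =
  fun_interp :: "'f \<Rightarrow> 'a list \<Rightarrow> 'a"
  rel_interp :: "'r \<Rightarrow> 'a list \<Rightarrow> bool"

datatype ('a, 'f) tm =
  Var nat
| Param 'a
| Plus "('a, 'f) tm" "('a, 'f) tm"
| Times "('a, 'f) tm" "('a, 'f) tm"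
| App 'f "('a, 'f) tm list"

text \<open>Variables are de Bruijn indices.\<close>

datatype ('a, 'f, 'r) fm =
  Equal "('a, 'f) tm" "('a, 'f) tm"
| Below "('a, 'f) tm" "('a, 'f) tm"
| Rel 'r "('a, 'f) tm list"
| Neg "('a, 'f, 'r) fm"
| Conj "('a, 'f, 'r) fm" "('a, 'f, 'r) fm"
| Exist "('a, 'f, 'r) fm"

primrec tm_val :: "('a::linordered_field, 'f, 'r) expansion \<Rightarrow> (nat \<Rightarrow> 'a) \<Rightarrow> ('a, 'f) tm \<Rightarrow> 'a" where
  "tm_val R e (Var i) = e i"
| "tm_val R e (Param a) = a"
| "tm_val R e (Plus s t) = tm_val R e s + tm_val R e t"
| "tm_val R e (Times s t) = tm_val R e s * tm_val R e t"
| "tm_val R e (App f ts) = fun_interp R f (map (tm_val R e) ts)"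

primrec sat :: "('a::linordered_field, 'f, 'r) expansion \<Rightarrow> (nat \<Rightarrow> 'a) \<Rightarrow> ('a, 'f, 'r) fm \<Rightarrow> bool" where
  "sat R e (Equal s t) \<longleftrightarrow> tm_val R e s = tm_val R e t"
| "sat R e (Below s t) \<longleftrightarrow> tm_val R e s < tm_val R e t"
| "sat R e (Rel r ts) \<longleftrightarrow> rel_interp R r (map (tm_val R e) ts)"
| "sat R e (Neg p) \<longleftrightarrow> \<not> sat R e p"
| "sat R e (Conj p q) \<longleftrightarrow> sat R e p \<and> sat R e q"
| "sat R e (Exist p) \<longleftrightarrow> (\<exists>x. sat R (case_nat x e) p)"

text \<open>Points of \<open>R\<^sup>d\<close> are lists of length \<open>d\<close>. The truth of the defining formula must only depend on
  the variables \<open>0, \<dots>, d - 1\<close>.\<close>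

definition definable :: "('a::linordered_field, 'f, 'r) expansion \<Rightarrow> nat \<Rightarrow> 'a list set \<Rightarrow> bool" where
  "definable R d X \<longleftrightarrow> (\<forall>x\<in>X. length x = d) \<and>
     (\<exists>p :: ('a, 'f, 'r) fm. \<forall>e. sat R e p \<longleftrightarrow> map e [0..<d] \<in> X)"

text \<open>As usual in o-minimality, intervals are nonempty and open, with endpoints in
  \<open>R \<union> {-\<infinity>, \<infinity>}\<close>.\<close>

definition is_point :: "'a::linorder set \<Rightarrow> bool" where
  "is_point I \<longleftrightarrow> (\<exists>a. I = {a})"

definition is_interval :: "'a::linorder set \<Rightarrow> bool" where
  "is_interval I \<longleftrightarrow> I \<noteq> {} \<and>
     ((\<exists>a b. I = {a<..<b}) \<or> (\<exists>b. I = {..<b}) \<or> (\<exists>a. I = {a<..}) \<or> I = UNIV)"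

definition o_minimal :: "('a::linordered_field, 'f, 'r) expansion \<Rightarrow> bool" where
  "o_minimal R \<longleftrightarrow> (\<forall>X. definable R 1 ((\<lambda>a. [a]) ` X) \<longrightarrow>
     (\<exists>F. finite F \<and> (\<forall>I\<in>F. is_point I \<or> is_interval I) \<and> X = \<Union>F))"


section \<open>Cells and dimension\<close>

definition definable_fun ::
  "('a::linordered_field, 'f, 'r) expansion \<Rightarrow> nat \<Rightarrow> 'a list set \<Rightarrow> ('a list \<Rightarrow> 'a) \<Rightarrow> bool" where
  "definable_fun R d X f \<longleftrightarrow> definable R (Suc d) {x @ [f x] | x. x \<in> X}"

definition cont_on :: "'a::linordered_field list set \<Rightarrow> ('a list \<Rightarrow> 'a) \<Rightarrow> bool" where
  "cont_on X f \<longleftrightarrow> (\<forall>x\<in>X. \<forall>\<epsilon>>0. \<exists>\<delta>>0. \<forall>y\<in>X.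
     (\<forall>i<length x. \<bar>y ! i - x ! i\<bar> < \<delta>) \<longrightarrow> \<bar>f y - f x\<bar> < \<epsilon>)"

text \<open>\<open>cell R ds C\<close>: \<open>C\<close> is a \<open>(i\<^sub>1, \<dots>, i\<^sub>m)\<close>-cell where \<open>ds = [i\<^sub>1, \<dots>, i\<^sub>m]\<close>. The value \<open>None\<close> of the
  lower (upper) bound of a band stands for \<open>-\<infinity>\<close> (\<open>\<infinity>\<close>).\<close>

inductive cell :: "('a::linordered_field, 'f, 'r) expansion \<Rightarrow> nat list \<Rightarrow> 'a list set \<Rightarrow> bool"
  for R where
  origin: "cell R [] {[]}"
| graph: "cell R ds C \<Longrightarrow> definable_fun R (length ds) C f \<Longrightarrow> cont_on C f \<Longrightarrow>
    cell R (ds @ [0]) {x @ [f x] | x. x \<in> C}"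
| band: "cell R ds C \<Longrightarrow>
    pred_option (\<lambda>f. definable_fun R (length ds) C f \<and> cont_on C f) lo \<Longrightarrow>
    pred_option (\<lambda>g. definable_fun R (length ds) C g \<and> cont_on C g) hi \<Longrightarrow>
    (\<And>f g x. lo = Some f \<Longrightarrow> hi = Some g \<Longrightarrow> x \<in> C \<Longrightarrow> f x < g x) \<Longrightarrow>
    cell R (ds @ [1])
      {x @ [r] | x r. x \<in> C \<and> pred_option (\<lambda>f. f x < r) lo \<and> pred_option (\<lambda>g. r < g x) hi}"

text \<open>The largest \<open>i\<^sub>1 + \<dots> + i\<^sub>m\<close> such that \<open>X\<close> contains a \<open>(i\<^sub>1, \<dots>, i\<^sub>m)\<close>-cell, with the empty set
  having dimension \<open>-\<infinity>\<close>.\<close>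

definition o_dim :: "('a::linordered_field, 'f, 'r) expansion \<Rightarrow> 'a list set \<Rightarrow> ereal" where
  "o_dim R X = (SUP ds \<in> {ds. \<exists>C. cell R ds C \<and> C \<subseteq> X}. ereal (real (sum_list ds)))"


section \<open>Bounded distributive lattices\<close>

locale bounded_distrib_lattice = bounded_lattice +
  assumes meet_join_distrib: "\<lbrakk>x \<in> carrier L; y \<in> carrier L; z \<in> carrier L\<rbrakk> \<Longrightarrow>
    x \<sqinter> (y \<squnion> z) = (x \<sqinter> y) \<squnion> (x \<sqinter> z)"

definition definable_lattice ::
  "('a::linordered_field, 'f, 'r) expansion \<Rightarrow> nat \<Rightarrow> 'a list gorder \<Rightarrow> bool" where
  "definable_lattice R d H \<longleftrightarrow> lattice H \<and> definable R d (carrier H) \<and>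
     definable R (d + d) {x @ y | x y. x \<in> carrier H \<and> y \<in> carrier H \<and> x \<sqsubseteq>\<^bsub>H\<^esub> y}"

text \<open>Morphisms of bounded-below distributive lattices; the top need not be preserved.\<close>

definition bot_lattice_hom :: "'b gorder \<Rightarrow> 'c gorder \<Rightarrow> ('b \<Rightarrow> 'c) \<Rightarrow> bool" where
  "bot_lattice_hom H K f \<longleftrightarrow> f \<in> carrier H \<rightarrow> carrier K \<and> join_pres H K f \<and> meet_pres H K f \<and>
     f \<bottom>\<^bsub>H\<^esub> = \<bottom>\<^bsub>K\<^esub>"

record 'b lattice_alg = "'b partial_object" +
  Join :: "'b \<Rightarrow> 'b \<Rightarrow> 'b"
  Meet :: "'b \<Rightarrow> 'b \<Rightarrow> 'b"
  Bot :: 'b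
  Top :: 'b

definition alg_of :: "'b gorder \<Rightarrow> 'b lattice_alg" where
  "alg_of H = \<lparr>carrier = carrier H, Join = join H, Meet = meet H, Bot = \<bottom>\<^bsub>H\<^esub>, Top = \<top>\<^bsub>H\<^esub>\<rparr>"

definition isomorphic_alg :: "'b lattice_alg \<Rightarrow> 'c lattice_alg \<Rightarrow> bool" where
  "isomorphic_alg A B \<longleftrightarrow> (\<exists>\<phi>. bij_betw \<phi> (carrier A) (carrier B) \<and>
     (\<forall>x\<in>carrier A. \<forall>y\<in>carrier A. \<phi> (Join A x y) = Join B (\<phi> x) (\<phi> y)) \<and>
     (\<forall>x\<in>carrier A. \<forall>y\<in>carrier A. \<phi> (Meet A x y) = Meet B (\<phi> x) (\<phi> y)) \<and>
     \<phi> (Bot A) = Bot B \<and> \<phi> (Top A) = Top B)"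


section \<open>Cohesive blueprints and towers\<close>

text \<open>Indices range over \<open>{1..bp_n B}\<close>; components at other indices are irrelevant.\<close>

record 'a blueprint =
  bp_n :: nat
  bp_N :: nat
  bp_M :: "'a set"
  bp_part :: "nat \<Rightarrow> 'a set"
  bp_H :: "nat \<Rightarrow> nat gorder"
  bp_l :: "nat \<Rightarrow> nat \<Rightarrow> nat \<Rightarrow> nat"

definition bp_r :: "'a blueprint \<Rightarrow> nat \<Rightarrow> nat \<Rightarrow> nat \<Rightarrow> nat" where
  "bp_r B j i x = \<Squnion>\<^bsub>bp_H B i\<^esub> {y \<in> carrier (bp_H B i). bp_l B i j y \<sqsubseteq>\<^bsub>bp_H B j\<^esub> x}"

locale cohesive_blueprint =
  fixes R :: "('a::linordered_field, 'f, 'r) expansion" and B :: "'a blueprint"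
  assumes n_pos: "1 \<le> bp_n B" and N_pos: "1 \<le> bp_N B"
    and M_definable: "definable R 1 ((\<lambda>m. [m]) ` bp_M B)"
    and M_min: "\<exists>a\<in>bp_M B. \<forall>m\<in>bp_M B. a \<le> m"
    and M_max: "\<exists>b\<in>bp_M B. \<forall>m\<in>bp_M B. m \<le> b"
    and M_decomp: "bp_M B = (\<Union>i\<in>{1..bp_n B}. bp_part B i)"
    and part: "i \<in> {1..bp_n B} \<Longrightarrow> is_point (bp_part B i) \<or> is_interval (bp_part B i)"
    and part_less: "\<lbrakk>i \<in> {1..bp_n B}; j \<in> {1..bp_n B}; i < j; x \<in> bp_part B i; y \<in> bp_part B j\<rbrakk> \<Longrightarrow> x < y"
    and H_lattice: "i \<in> {1..bp_n B} \<Longrightarrow> bounded_distrib_lattice (bp_H B i)"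
    and H_carrier: "i \<in> {1..bp_n B} \<Longrightarrow> carrier (bp_H B i) \<subseteq> {1..bp_N B}"
    and l_hom: "\<lbrakk>i \<in> {1..bp_n B}; j \<in> {1..bp_n B}; i \<le> j\<rbrakk> \<Longrightarrow>
      bot_lattice_hom (bp_H B i) (bp_H B j) (bp_l B i j)"
    and l_comp: "\<lbrakk>i \<in> {1..bp_n B}; j \<in> {1..bp_n B}; k \<in> {1..bp_n B}; i \<le> j; j \<le> k;
      p \<in> carrier (bp_H B i)\<rbrakk> \<Longrightarrow> bp_l B i k p = bp_l B j k (bp_l B i j p)"
    and r_l: "\<lbrakk>i \<in> {1..bp_n B}; j \<in> {1..bp_n B}; i \<le> j; p \<in> carrier (bp_H B i)\<rbrakk> \<Longrightarrow>
      bp_r B j i (bp_l B i j p) = p \<squnion>\<^bsub>bp_H B i\<^esub> bp_r B j i \<bottom>\<^bsub>bp_H B j\<^esub>"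
    and l_r: "\<lbrakk>i \<in> {1..bp_n B}; j \<in> {1..bp_n B}; i \<le> j; q \<in> carrier (bp_H B j)\<rbrakk> \<Longrightarrow>
      bp_l B i j (bp_r B j i q) = q \<sqinter>\<^bsub>bp_H B j\<^esub> bp_l B i j \<top>\<^bsub>bp_H B i\<^esub>"

text \<open>The last case of each operation is the one obtained from the middle case by commutativity.\<close>

fun tower_join :: "'a::linorder blueprint \<Rightarrow> nat \<times> 'a \<times> nat \<Rightarrow> nat \<times> 'a \<times> nat \<Rightarrow> nat \<times> 'a \<times> nat" where
  "tower_join B (i, m\<^sub>1, p) (j, m, q) =
     (if m\<^sub>1 = m then (j, m, p \<squnion>\<^bsub>bp_H B i\<^esub> q)
      else if m\<^sub>1 < m then (j, m, bp_l B i j p \<squnion>\<^bsub>bp_H B j\<^esub> q)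
      else (i, m\<^sub>1, bp_l B j i q \<squnion>\<^bsub>bp_H B i\<^esub> p))"

fun tower_meet :: "'a::linorder blueprint \<Rightarrow> nat \<times> 'a \<times> nat \<Rightarrow> nat \<times> 'a \<times> nat \<Rightarrow> nat \<times> 'a \<times> nat" where
  "tower_meet B (i, m\<^sub>1, p) (j, m, q) =
     (if m\<^sub>1 = m then (i, m\<^sub>1, p \<sqinter>\<^bsub>bp_H B i\<^esub> q)
      else if m\<^sub>1 < m then (i, m\<^sub>1, p \<sqinter>\<^bsub>bp_H B i\<^esub> bp_r B j i q)
      else (j, m, q \<sqinter>\<^bsub>bp_H B j\<^esub> bp_r B i j p))"

definition tower :: "'a::linorder blueprint \<Rightarrow> (nat \<times> 'a \<times> nat) lattice_alg" where
  "tower B = \<lparr>carrier = {(i, m, p). i \<in> {1..bp_n B} \<and> m \<in> bp_part B i \<and> p \<in> carrier (bp_H B i)},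
     Join = tower_join B, Meet = tower_meet B,
     Bot = (1, (LEAST m. m \<in> bp_M B), \<bottom>\<^bsub>bp_H B 1\<^esub>),
     Top = (bp_n B, (GREATEST m. m \<in> bp_M B), \<top>\<^bsub>bp_H B (bp_n B)\<^esub>)\<rparr>"

end

theory Submission
  imports Defs
begin

text \<open>Call \<open>a\<close> and \<open>b\<close> commensurable if the intervals \<open>[a \<sqinter> b, a]\<close> and \<open>[a \<sqinter> b, b]\<close> are finite. In
  dimension one they are never both infinite, since \<open>(x, y) \<mapsto> x \<squnion> y\<close> is injective on their product, and a
  set of dimension one contains no definable finite-to-one image of a product of two infinite
  definable sets. So commensurability classes are linearly ordered. They are finite, since joins of
  elements above a fixed member, and meets of elements below it, are also finite-to-one within its
  class. The least elements of the classes form a definable dense chain, the spine.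

  Every infinite definable subset of the spine contains a spine interval parametrized by one of its
  coordinates, because the gaps of a monotone curve in the spine are empty or infinite, and only
  finitely many can be infinite. Together with uniform finiteness this bounds the size of the classes,
  so that definable choice labels the elements of each class by \<open>1, \<dots>, k\<close>. By a Ramsey argument the
  spine splits into finitely many convex pieces on which \<open>k\<close>, the order of the labels, and the map
  \<open>p \<mapsto> p \<squnion> y\<close> from the class of \<open>x\<close> to that of \<open>y\<close> (for \<open>x < y\<close>) are constant. A coordinate embeds each piece
  into the line as a point or an interval; these label lattices and maps are the blueprint, with
  \<open>r\<close> given by \<open>q \<mapsto> q \<sqinter> \<top>\<close> for the top \<open>\<top>\<close> of the lower class.\<close>

section \<open>Definable predicates and functions\<close>

text \<open>O-minimality speaks only about subsets of the line, and the hypothesis on the dimension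
  can be contradicted only by exhibiting a cell. So no general cell decomposition is developed:
  every appeal to dimension one runs through a single statement, that a definable finite-to-one map
  cannot send a box into the lattice. Facts about one variable are extended to families by shrinking
  to subintervals on which a choice becomes uniform.

  A monotone curve in the spine may jump over part of the spine, and then its coordinate does not
  chart a convex piece; hence the study of gaps. The bound on class sizes needs such charts and the
  labels need the bound, so the spine is decomposed twice.

  On an interval piece the map \<open>l\<close> from \<open>i\<close> to \<open>i\<close> compares
  two different points of the piece. A third point between them forces it to be idempotent, but it
  need not be the identity; on a one-point piece it is. Both cohesion laws for \<open>r\<close> are
  instances of the modular law.\<close>

primrec tm_ren :: "(nat \<Rightarrow> nat) \<Rightarrow> ('a, 'f) tm \<Rightarrow> ('a, 'f) tm" where
  "tm_ren g (Var i) = Var (g i)"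
| "tm_ren g (Param a) = Param a"
| "tm_ren g (Plus s t) = Plus (tm_ren g s) (tm_ren g t)"
| "tm_ren g (Times s t) = Times (tm_ren g s) (tm_ren g t)"
| "tm_ren g (App f ts) = App f (map (tm_ren g) ts)"

primrec fm_ren :: "(nat \<Rightarrow> nat) \<Rightarrow> ('a, 'f, 'r) fm \<Rightarrow> ('a, 'f, 'r) fm" where
  "fm_ren g (Equal s t) = Equal (tm_ren g s) (tm_ren g t)"
| "fm_ren g (Below s t) = Below (tm_ren g s) (tm_ren g t)"
| "fm_ren g (Rel r ts) = Rel r (map (tm_ren g) ts)"
| "fm_ren g (Neg p) = Neg (fm_ren g p)"
| "fm_ren g (Conj p q) = Conj (fm_ren g p) (fm_ren g q)"
| "fm_ren g (Exist p) = Exist (fm_ren (case_nat 0 (\<lambda>i. Suc (g i))) p)"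

lemma tm_val_ren: "tm_val R e (tm_ren g t) = tm_val R (\<lambda>i. e (g i)) t"
proof (induction t)
  case (App f ts)
  then have "map (tm_val R e \<circ> tm_ren g) ts = map (tm_val R (\<lambda>i. e (g i))) ts"
    by (intro map_cong) auto
  then show ?case by (simp only: tm_ren.simps tm_val.simps map_map)
qed simp_all

lemma sat_ren: "sat R e (fm_ren g p) = sat R (\<lambda>i. e (g i)) p"
proof (induction p arbitrary: e g)
  case (Exist p)
  have "(\<lambda>i. case_nat x e (case_nat 0 (\<lambda>i. Suc (g i)) i)) = case_nat x (\<lambda>i. e (g i))" for x
    by (auto simp: fun_eq_iff split: nat.splits)
  then show ?case using Exist by simp
next
  case (Rel r ts)
  have "map (tm_val R e \<circ> tm_ren g) ts = map (tm_val R (\<lambda>i. e (g i))) ts"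
    by (simp add: tm_val_ren)
  then show ?case by (simp only: fm_ren.simps sat.simps map_map)
qed (simp_all add: tm_val_ren)

definition depends_below :: "nat \<Rightarrow> ((nat \<Rightarrow> 'a) \<Rightarrow> 'b) \<Rightarrow> bool" where
  "depends_below n f \<longleftrightarrow> (\<forall>e e'. (\<forall>i<n. e i = e' i) \<longrightarrow> f e = f e')"

lemma depends_below_comp: "depends_below n f \<Longrightarrow> depends_below n (\<lambda>e. h (f e))"
  unfolding depends_below_def by metis

lemma depends_below_comp2:
  assumes "depends_below m f" "depends_below n g"
  shows "depends_below (max m n) (\<lambda>e. h (f e) (g e))"
  unfolding depends_below_def
proof (intro allI impI)
  fix e e' :: "nat \<Rightarrow> 'a" assume e: "\<forall>i<max m n. e i = e' i"
  have "f e = f e'" using assms(1) e unfolding depends_below_def by simp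
  moreover have "g e = g e'" using assms(2) e unfolding depends_below_def by simp
  ultimately show "h (f e) (g e) = h (f e') (g e')" by simp
qed

lemma depends_below_map:
  "(\<And>t. t \<in> set ts \<Longrightarrow> \<exists>n. depends_below n (\<lambda>e. F e t)) \<Longrightarrow> \<exists>n. depends_below n (\<lambda>e. map (F e) ts)"
proof (induction ts)
  case Nil
  then show ?case by (simp add: depends_below_def)
next
  case (Cons t ts)
  then obtain m n where "depends_below m (\<lambda>e. F e t)" "depends_below n (\<lambda>e. map (F e) ts)"
    by fastforce
  from depends_below_comp2[OF this, of Cons] show ?case by auto
qed

lemma tm_val_support: "\<exists>n. depends_below n (\<lambda>e. tm_val R e t)"
proof (induction t)
  case (Var i)
  show ?case by (rule exI[of _ "Suc i"]) (simp add: depends_below_def)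
next
  case (Param a)
  show ?case by (simp add: depends_below_def)
next
  case (Plus s t)
  then obtain m n where "depends_below m (\<lambda>e. tm_val R e s)" "depends_below n (\<lambda>e. tm_val R e t)"
    by blast
  from depends_below_comp2[OF this, of "(+)"] show ?case by auto
next
  case (Times s t)
  then obtain m n where "depends_below m (\<lambda>e. tm_val R e s)" "depends_below n (\<lambda>e. tm_val R e t)"
    by blast
  from depends_below_comp2[OF this, of "(*)"] show ?case by auto
next
  case (App f ts)
  then obtain n where "depends_below n (\<lambda>e. map (tm_val R e) ts)"
    using depends_below_map[of ts "tm_val R"] by blast
  from depends_below_comp[OF this, of "fun_interp R f"] show ?case by auto
qed

text \<open>A formula mentions finitely many variables; this reduces the simultaneous substitution
  in \<open>dfn_subst\<close> to finitely many single ones.\<close>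

lemma sat_support: "\<exists>n. depends_below n (\<lambda>e. sat R e p)"
proof (induction p)
  case (Equal s t)
  obtain m n where "depends_below m (\<lambda>e. tm_val R e s)" "depends_below n (\<lambda>e. tm_val R e t)"
    using tm_val_support by blast
  from depends_below_comp2[OF this, of "(=)"] show ?case by auto
next
  case (Below s t)
  obtain m n where "depends_below m (\<lambda>e. tm_val R e s)" "depends_below n (\<lambda>e. tm_val R e t)"
    using tm_val_support by blast
  from depends_below_comp2[OF this, of "(<)"] show ?case by auto
next
  case (Rel r ts)
  obtain n where "depends_below n (\<lambda>e. map (tm_val R e) ts)"
    using depends_below_map[of ts "tm_val R"] tm_val_support[of R] by blast
  from depends_below_comp[OF this, of "rel_interp R r"] show ?case by auto
next
  case (Neg p)
  then obtain n where "depends_below n (\<lambda>e. sat R e p)" by blast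
  from depends_below_comp[OF this, of Not] show ?case by auto
next
  case (Conj p q)
  then obtain m n where "depends_below m (\<lambda>e. sat R e p)" "depends_below n (\<lambda>e. sat R e q)"
    by blast
  from depends_below_comp2[OF this, of "(\<and>)"] show ?case by auto
next
  case (Exist p)
  then obtain n where n: "depends_below n (\<lambda>e. sat R e p)" by blast
  have "depends_below n (\<lambda>e. sat R e (Exist p))"
    unfolding depends_below_def
  proof (intro allI impI)
    fix e e' :: "nat \<Rightarrow> 'a" assume e: "\<forall>i<n. e i = e' i"
    have "sat R (case_nat x e) p = sat R (case_nat x e') p" for x
    proof -
      have "\<forall>i<n. case_nat x e i = case_nat x e' i" using e by (simp split: nat.split)
      then show ?thesis using n unfolding depends_below_def by blast
    qed
    then show "sat R e (Exist p) = sat R e' (Exist p)" by simp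
  qed
  then show ?case by blast
qed

section \<open>Definability of predicates and functions on environments\<close>

locale omin =
  fixes R :: "('a::real_closed_field, 'f, 'r) expansion" and d :: nat
  assumes om: "o_minimal R"
begin

text \<open>An environment is read as a sequence of blocks, each holding a vector of length \<open>d\<close> and a
  scalar; \<open>sh\<close> drops the first block.\<close>

definition vc :: "nat \<Rightarrow> (nat \<Rightarrow> 'a) \<Rightarrow> 'a list" where
  "vc n e = map (\<lambda>i. e (n * Suc d + i)) [0..<d]"

definition sc :: "nat \<Rightarrow> (nat \<Rightarrow> 'a) \<Rightarrow> 'a" where
  "sc n e = e (n * Suc d + d)"

definition sh :: "(nat \<Rightarrow> 'a) \<Rightarrow> nat \<Rightarrow> 'a" where
  "sh e = (\<lambda>i. e (i + Suc d))"

text \<open>A semantic notion: closure rules for predicates on environments take the place of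
  explicit formulas, and parameters stay hidden in the formula.\<close>

definition dfn :: "((nat \<Rightarrow> 'a) \<Rightarrow> bool) \<Rightarrow> bool" where
  "dfn P \<longleftrightarrow> (\<exists>p :: ('a, 'f, 'r) fm. \<forall>e. sat R e p \<longleftrightarrow> P e)"

text \<open>Functions are definable through their graphs; the value occupies variable 0 and the
  arguments are shifted up, as under a quantifier.\<close>

definition dsc :: "((nat \<Rightarrow> 'a) \<Rightarrow> 'a) \<Rightarrow> bool" where
  "dsc f \<longleftrightarrow> dfn (\<lambda>e. e 0 = f (\<lambda>i. e (Suc i)))"

definition dvec :: "((nat \<Rightarrow> 'a) \<Rightarrow> 'a list) \<Rightarrow> bool" where
  "dvec f \<longleftrightarrow> (\<forall>e. length (f e) = d) \<and> (\<forall>i<d. dsc (\<lambda>e. f e ! i))"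

definition dset :: "'a list set \<Rightarrow> bool" where
  "dset A \<longleftrightarrow> (\<forall>x\<in>A. length x = d) \<and> dfn (\<lambda>e. vc 0 e \<in> A)"

lemma vc_sh [simp]: "vc n (sh e) = vc (Suc n) e"
  by (auto simp: vc_def sh_def algebra_simps)

lemma sc_sh [simp]: "sc n (sh e) = sc (Suc n) e"
  by (auto simp: sc_def sh_def algebra_simps)

lemma length_vc [simp]: "length (vc n e) = d"
  by (simp add: vc_def)

lemma dfn_not: "dfn P \<Longrightarrow> dfn (\<lambda>e. \<not> P e)"
  unfolding dfn_def by (metis sat.simps(4))

lemma dfn_conj: "dfn P \<Longrightarrow> dfn Q \<Longrightarrow> dfn (\<lambda>e. P e \<and> Q e)"
  unfolding dfn_def by (metis sat.simps(5))

lemma dfn_disj: "dfn P \<Longrightarrow> dfn Q \<Longrightarrow> dfn (\<lambda>e. P e \<or> Q e)"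
  using dfn_not[OF dfn_conj[OF dfn_not dfn_not], of P Q] by simp

lemma dfn_imp: "dfn P \<Longrightarrow> dfn Q \<Longrightarrow> dfn (\<lambda>e. P e \<longrightarrow> Q e)"
  using dfn_disj[OF dfn_not, of P Q] by (simp only: imp_conv_disj)

lemma dfn_iff: "dfn P \<Longrightarrow> dfn Q \<Longrightarrow> dfn (\<lambda>e. P e \<longleftrightarrow> Q e)"
  using dfn_conj[OF dfn_imp dfn_imp, of P Q Q P] by (simp only: iff_conv_conj_imp)

lemma dfn_const: "dfn (\<lambda>e. P)"
proof -
  have "dfn (\<lambda>e. True)" unfolding dfn_def by (rule exI[of _ "Equal (Var 0) (Var 0)"]) simp
  then show ?thesis using dfn_not[of "\<lambda>e. True"] by (cases P) simp_all
qed

lemma dfn_ren: "dfn P \<Longrightarrow> dfn (\<lambda>e. P (\<lambda>i. e (g i)))"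
  unfolding dfn_def by (metis sat_ren)

lemma dfn_ex0: "dfn P \<Longrightarrow> dfn (\<lambda>e. \<exists>x. P (case_nat x e))"
  unfolding dfn_def by (metis sat.simps(6))

lemma dsc_var: "dsc (\<lambda>e. e i)"
  unfolding dsc_def dfn_def by (rule exI[of _ "Equal (Var 0) (Var (Suc i))"]) simp

lemma dsc_tail: "dsc f \<Longrightarrow> dsc (\<lambda>e. f (\<lambda>i. e (g i)))"
  unfolding dsc_def using dfn_ren[of _ "case_nat 0 (\<lambda>i. Suc (g i))"] by fastforce

text \<open>A definable function is in general not a term, so it is substituted by quantifying over
  its graph.\<close>

lemma dfn_let0:
  assumes "dfn P" "dsc f"
  shows "dfn (\<lambda>e. P (case_nat (f e) e))"
proof -
  have "dfn (\<lambda>e. \<exists>x. (case_nat x e) 0 = f (\<lambda>i. (case_nat x e) (Suc i)) \<and> P (case_nat x e))"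
    by (rule dfn_ex0[OF dfn_conj[OF assms(2)[unfolded dsc_def] assms(1)]])
  then show ?thesis by simp
qed

lemma dfn_subst:
  assumes "dfn P" and "\<And>i. dsc (\<sigma> i)"
  shows "dfn (\<lambda>e. P (\<lambda>i. \<sigma> i e))"
proof -
  \<comment> \<open>Each use of \<open>dfn_let0\<close> consumes one variable, so the variables from
    \<open>n\<close> on move down by \<open>n\<close>. Once \<open>n\<close> reaches the support of
    the formula this shift is invisible.\<close>
  have *: "dfn Q \<Longrightarrow> (\<And>i. dsc (\<sigma> i)) \<Longrightarrow> dfn (\<lambda>e. Q (\<lambda>i. if i < n then \<sigma> i e else e (i - n)))"
    for Q n \<sigma>
  proof (induction n arbitrary: \<sigma>)
    case (Suc n)
    have "dfn (\<lambda>e. Q (\<lambda>i. if i < n then \<sigma> i (\<lambda>j. e (Suc j)) else e (i - n)))"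
      by (rule Suc.IH[OF Suc.prems(1)]) (rule dsc_tail[OF Suc.prems(2)])
    note * = dfn_let0[OF this Suc.prems(2)[of n]]
    have "(\<lambda>i. if i < n then \<sigma> i (\<lambda>j. case_nat (\<sigma> n e) e (Suc j)) else case_nat (\<sigma> n e) e (i - n)) =
        (\<lambda>i. if i < Suc n then \<sigma> i e else e (i - Suc n))" for e
    proof
      fix i
      consider "i < n" | "i = n" | "i - n = Suc (i - Suc n)" "n < i" by linarith
      then show "(if i < n then \<sigma> i (\<lambda>j. case_nat (\<sigma> n e) e (Suc j)) else case_nat (\<sigma> n e) e (i - n)) =
          (if i < Suc n then \<sigma> i e else e (i - Suc n))" by cases simp_all
    qed
    then show ?case using * by simp
  qed simp
  obtain p :: "('a, 'f, 'r) fm" where p: "\<And>e. sat R e p \<longleftrightarrow> P e"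
    using assms(1) unfolding dfn_def by blast
  obtain n where "depends_below n (\<lambda>e. sat R e p)"
    using sat_support by blast
  then have n: "P e = P e'" if "\<forall>i<n. e i = e' i" for e e'
    using that by (simp add: p depends_below_def)
  have "P (\<lambda>i. if i < n then \<sigma> i e else e (i - n)) = P (\<lambda>i. \<sigma> i e)" for e
    by (rule n) simp
  then show ?thesis using *[of P \<sigma> n, OF assms] by simp
qed

lemma dsc_subst: "dsc f \<Longrightarrow> (\<And>i. dsc (\<sigma> i)) \<Longrightarrow> dsc (\<lambda>e. f (\<lambda>i. \<sigma> i e))"
proof -
  assume f: "dsc f" and s: "\<And>i. dsc (\<sigma> i)"
  have "dfn (\<lambda>e. (\<lambda>e'. e' 0 = f (\<lambda>i. e' (Suc i)))
     (\<lambda>i. (case i of 0 \<Rightarrow> (\<lambda>e. e 0) | Suc j \<Rightarrow> (\<lambda>e. \<sigma> j (\<lambda>k. e (Suc k)))) e))"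
    by (rule dfn_subst[OF f[unfolded dsc_def]])
      (auto split: nat.splits intro: dsc_var dsc_tail s)
  then show ?thesis unfolding dsc_def by simp
qed

lemma dsc_const: "dsc (\<lambda>e. c)"
  unfolding dsc_def dfn_def by (rule exI[of _ "Equal (Var 0) (Param c)"]) simp

lemma dsc_from_vars:
  assumes "dsc (\<lambda>e. F (e 0) (e 1))" "dsc f" "dsc g"
  shows "dsc (\<lambda>e. F (f e) (g e))"
  using dsc_subst[OF assms(1), of "\<lambda>i. case i of 0 \<Rightarrow> f | Suc j \<Rightarrow> g"] assms(2,3)
  by (auto split: nat.splits)

lemma dfn_from_vars:
  assumes "dfn (\<lambda>e. F (e 0) (e 1))" "dsc f" "dsc g"
  shows "dfn (\<lambda>e. F (f e) (g e))"
  using dfn_subst[OF assms(1), of "\<lambda>i. case i of 0 \<Rightarrow> f | Suc j \<Rightarrow> g"] assms(2,3)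
  by (auto split: nat.splits)

lemma dsc_plus: "dsc f \<Longrightarrow> dsc g \<Longrightarrow> dsc (\<lambda>e. f e + g e)"
  by (rule dsc_from_vars[of "(+)"])
    (auto simp: dsc_def dfn_def intro!: exI[of _ "Equal (Var 0) (Plus (Var 1) (Var 2))"] simp: numeral_2_eq_2)

lemma dsc_times: "dsc f \<Longrightarrow> dsc g \<Longrightarrow> dsc (\<lambda>e. f e * g e)"
  by (rule dsc_from_vars[of "(*)"])
    (auto simp: dsc_def dfn_def intro!: exI[of _ "Equal (Var 0) (Times (Var 1) (Var 2))"] simp: numeral_2_eq_2)

lemma dsc_uminus: "dsc f \<Longrightarrow> dsc (\<lambda>e. - f e)"
  using dsc_times[OF dsc_const[of "- 1"], of f] by simp

lemma dsc_minus: "dsc f \<Longrightarrow> dsc g \<Longrightarrow> dsc (\<lambda>e. f e - g e)"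
  using dsc_plus[OF _ dsc_uminus, of f g] by simp

lemma dfn_eq: "dsc f \<Longrightarrow> dsc g \<Longrightarrow> dfn (\<lambda>e. f e = g e)"
  by (rule dfn_from_vars[of "(=)"])
    (auto simp: dfn_def intro!: exI[of _ "Equal (Var 0) (Var 1)"])

lemma dfn_less: "dsc f \<Longrightarrow> dsc g \<Longrightarrow> dfn (\<lambda>e. f e < g e)"
  by (rule dfn_from_vars[of "(<)"])
    (auto simp: dfn_def intro!: exI[of _ "Below (Var 0) (Var 1)"])

lemma dfn_le: "dsc f \<Longrightarrow> dsc g \<Longrightarrow> dfn (\<lambda>e. f e \<le> g e)"
  using dfn_not[OF dfn_less, of g f] by (simp add: not_less)

lemma dsc_sh: "dsc f \<Longrightarrow> dsc (\<lambda>e. f (sh e))"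
  unfolding sh_def by (rule dsc_tail)

lemma dfn_sh: "dfn f \<Longrightarrow> dfn (\<lambda>e. f (sh e))"
  unfolding sh_def by (rule dfn_ren)

lemma dvec_sh: "dvec f \<Longrightarrow> dvec (\<lambda>e. f (sh e))"
  unfolding dvec_def using dsc_sh by fastforce

lemma dsc_sc: "dsc (sc n)"
  unfolding sc_def by (rule dsc_var)

lemma dsc_sc1: "dsc (\<lambda>e. sc n (sh e))" by (intro dsc_sc dsc_sh)
lemma dsc_sc2: "dsc (\<lambda>e. sc n (sh (sh e)))" using dsc_sc by simp
lemma dsc_sc3: "dsc (\<lambda>e. sc n (sh (sh (sh e))))" using dsc_sc by simp
lemma dsc_sc4: "dsc (\<lambda>e. sc n (sh (sh (sh (sh e)))))" using dsc_sc by simp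
lemma dsc_sc6: "dsc (\<lambda>e. sc n (sh (sh (sh (sh (sh (sh e)))))))" using dsc_sc by simp

lemma dvec_vc: "dvec (vc n)"
  unfolding dvec_def by (auto simp: vc_def intro: dsc_var)

lemma dvec_vc1: "dvec (\<lambda>e. vc n (sh e))" using dvec_vc by simp
lemma dvec_vc2: "dvec (\<lambda>e. vc n (sh (sh e)))" using dvec_vc by simp
lemma dvec_const: "length c = d \<Longrightarrow> dvec (\<lambda>e. c)"
  unfolding dvec_def by (auto intro: dsc_const)

lemma dsc_nth: "dvec f \<Longrightarrow> i < d \<Longrightarrow> dsc (\<lambda>e. f e ! i)"
  unfolding dvec_def by blast

lemma dfn_all_less: "(\<And>i. i < n \<Longrightarrow> dfn (P i)) \<Longrightarrow> dfn (\<lambda>e. \<forall>i<n. P i e)" for n :: nat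
proof (induction n)
  case 0
  then show ?case using dfn_const[of True] by simp
next
  case (Suc n)
  have "dfn (\<lambda>e. (\<forall>i<n. P i e) \<and> P n e)" by (intro dfn_conj Suc) auto
  then show ?case by (simp add: less_Suc_eq all_conj_distrib imp_disjL conj_commute)
qed

lemma dfn_ball_finite: "finite K \<Longrightarrow> (\<And>i. i \<in> K \<Longrightarrow> dfn (P i)) \<Longrightarrow> dfn (\<lambda>e. \<forall>i\<in>K. P i e)"
  by (induction K rule: finite_induct) (auto intro: dfn_const dfn_conj)

lemma dfn_bex_finite: "finite K \<Longrightarrow> (\<And>i. i \<in> K \<Longrightarrow> dfn (P i)) \<Longrightarrow> dfn (\<lambda>e. \<exists>i\<in>K. P i e)"
  by (induction K rule: finite_induct) (auto intro: dfn_const dfn_disj)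

lemma dfn_veq: "dvec f \<Longrightarrow> dvec g \<Longrightarrow> dfn (\<lambda>e. f e = g e)"
proof -
  assume f: "dvec f" and g: "dvec g"
  have "dfn (\<lambda>e. \<forall>i<d. f e ! i = g e ! i)" by (intro dfn_all_less dfn_eq dsc_nth f g)
  moreover have "(f e = g e) = (\<forall>i<d. f e ! i = g e ! i)" for e
    using f g unfolding dvec_def by (auto intro: nth_equalityI)
  ultimately show ?thesis by simp
qed

section \<open>Quantification over blocks of variables\<close>

definition prep :: "'a list \<Rightarrow> (nat \<Rightarrow> 'a) \<Rightarrow> nat \<Rightarrow> 'a" where
  "prep xs e = (\<lambda>i. if i < length xs then xs ! i else e (i - length xs))"

lemma dfn_ex_prep: "dfn P \<Longrightarrow> dfn (\<lambda>e. \<exists>xs. length xs = k \<and> P (prep xs e))"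
proof (induction k)
  case (Suc k)
  have *: "prep (xs @ [x]) e = prep xs (case_nat x e)" for xs x e
  proof
    fix i
    consider "i < length xs" | "i = length xs" | "i - length xs = Suc (i - Suc (length xs))" "length xs < i"
      by linarith
    then show "prep (xs @ [x]) e i = prep xs (case_nat x e) i"
      by cases (simp_all add: prep_def nth_append)
  qed
  have "dfn (\<lambda>e. \<exists>x xs. length xs = k \<and> P (prep xs (case_nat x e)))"
    by (rule dfn_ex0[OF Suc.IH[OF Suc.prems]])
  moreover have "(\<exists>x xs. length xs = k \<and> P (prep xs (case_nat x e))) =
      (\<exists>xs. length xs = Suc k \<and> P (prep xs e))" for e
    by (auto simp: *[symmetric] length_Suc_conv_rev)
  ultimately show ?case by simp
qed (simp add: prep_def)

lemma sh_prep: "length xs = Suc d \<Longrightarrow> sh (prep xs e) = e"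
  by (auto simp: sh_def prep_def)

lemma sc_prep: "length xs = Suc d \<Longrightarrow> sc 0 (prep xs e) = xs ! d"
  by (auto simp: sc_def prep_def)

lemma vc_prep: "length xs = Suc d \<Longrightarrow> vc 0 (prep xs e) = take d xs"
  by (rule nth_equalityI) (auto simp: vc_def prep_def)

text \<open>A scalar quantifier binds a whole block of \<open>Suc d\<close> variables, so that
  passing under any quantifier is the same shift \<open>sh\<close>.\<close>

lemma dfn_ex:
  assumes "dfn (\<lambda>e. P (sh e) (sc 0 e))"
  shows "dfn (\<lambda>e. \<exists>t. P e t)"
proof -
  have "(\<exists>xs. length xs = Suc d \<and> P (sh (prep xs e)) (sc 0 (prep xs e))) = (\<exists>t. P e t)" for e
    using sh_prep sc_prep by (metis length_replicate lessI nth_replicate)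
  then show ?thesis using dfn_ex_prep[OF assms, of "Suc d"] by simp
qed

lemma dfn_all:
  assumes "dfn (\<lambda>e. P (sh e) (sc 0 e))"
  shows "dfn (\<lambda>e. \<forall>t. P e t)"
  using dfn_not[OF dfn_ex[OF dfn_not[OF assms]]] by simp

lemma dfn_vex:
  assumes "dfn (\<lambda>e. P (sh e) (vc 0 e))"
  shows "dfn (\<lambda>e. \<exists>v. length v = d \<and> P e v)"
proof -
  have "(\<exists>xs. length xs = Suc d \<and> P (sh (prep xs e)) (vc 0 (prep xs e))) = (\<exists>v. length v = d \<and> P e v)"
    (is "?l = ?r") for e
  proof
    assume ?r
    then obtain v where v: "length v = d" "P e v" by blast
    then have "length (v @ [0]) = Suc d" "P (sh (prep (v @ [0]) e)) (vc 0 (prep (v @ [0]) e))"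
      by (simp_all add: sh_prep vc_prep)
    then show ?l by blast
  next
    assume ?l
    then obtain xs where xs: "length xs = Suc d" "P (sh (prep xs e)) (vc 0 (prep xs e))" by blast
    then have "P e (take d xs)" by (simp add: sh_prep vc_prep)
    then show ?r using xs(1) by (intro exI[of _ "take d xs"]) simp
  qed
  then show ?thesis using dfn_ex_prep[OF assms, of "Suc d"] by simp
qed

lemma dfn_vbex:
  assumes "dset A" "dfn (\<lambda>e. P (sh e) (vc 0 e))"
  shows "dfn (\<lambda>e. \<exists>v\<in>A. P e v)"
proof -
  have "dfn (\<lambda>e. \<exists>v. length v = d \<and> (v \<in> A \<and> P e v))"
    by (intro dfn_vex dfn_conj assms assms(1)[unfolded dset_def, THEN conjunct2])
  moreover have "(\<exists>v. length v = d \<and> (v \<in> A \<and> P e v)) = (\<exists>v\<in>A. P e v)" for e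
    using assms(1) unfolding dset_def by blast
  ultimately show ?thesis by simp
qed

lemma dfn_vball:
  assumes "dset A" "dfn (\<lambda>e. P (sh e) (vc 0 e))"
  shows "dfn (\<lambda>e. \<forall>v\<in>A. P e v)"
  using dfn_not[OF dfn_vbex[OF assms(1) dfn_not[OF assms(2)]]] by simp

text \<open>Inverse to reading off all blocks (\<open>env_eta\<close>); through it, substitution for
  vectors and scalars becomes substitution for variables.\<close>

definition env :: "(nat \<Rightarrow> 'a list) \<Rightarrow> (nat \<Rightarrow> 'a) \<Rightarrow> nat \<Rightarrow> 'a" where
  "env v s = (\<lambda>i. if i mod Suc d = d then s (i div Suc d) else v (i div Suc d) ! (i mod Suc d))"

lemma sc_env [simp]: "sc n (env v s) = s n"
proof -
  have "(n * Suc d + d) mod Suc d = d" "(n * Suc d + d) div Suc d = n"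
    by (metis lessI mod_less mod_mult_self3) (rule div_nat_eqI, auto)
  then show ?thesis unfolding sc_def env_def by (simp only: refl if_True)
qed

lemma vc_env [simp]: "length (v n) = d \<Longrightarrow> vc n (env v s) = v n"
proof (rule nth_equalityI)
  fix i assume v: "length (v n) = d" and "i < length (vc n (env v s))"
  then have i: "i < d" by simp
  have "(n * Suc d + i) mod Suc d = i"
    using i by (simp only: mod_mult_self3 mod_less less_SucI)
  moreover have "(n * Suc d + i) div Suc d = n"
    using i by (intro div_nat_eqI) auto
  ultimately show "vc n (env v s) ! i = v n ! i"
    using i unfolding vc_def env_def by (simp del: mult_Suc_right)
qed simp

lemma dfn_env:
  assumes "dfn P" "\<And>n. dvec (v n)" "\<And>n. dsc (s n)"
  shows "dfn (\<lambda>e. P (env (\<lambda>n. v n e) (\<lambda>n. s n e)))"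
proof -
  have "dsc (\<lambda>e. env (\<lambda>n. v n e) (\<lambda>n. s n e) i)" for i
  proof (cases "i mod Suc d = d")
    case False
    then have "i mod Suc d < d" using mod_less_divisor[of "Suc d" i] by linarith
    then show ?thesis using False assms(2) by (auto simp: env_def intro: dsc_nth)
  qed (use assms(3) in \<open>simp add: env_def\<close>)
  from dfn_subst[OF assms(1) this] show ?thesis by simp
qed

lemma dvec_length: "dvec f \<Longrightarrow> length (f e) = d"
  unfolding dvec_def by blast

lemma dset_mem: "dset A \<Longrightarrow> dvec f \<Longrightarrow> dfn (\<lambda>e. f e \<in> A)"
proof -
  assume A: "dset A" and f: "dvec f"
  have "dfn (\<lambda>e. vc 0 (env (\<lambda>n. f e) (\<lambda>n. 0)) \<in> A)"
    using A unfolding dset_def by (intro dfn_env[where P = "\<lambda>e. vc 0 e \<in> A"] f dsc_const) auto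
  then show ?thesis using f by (simp add: dvec_length)
qed

lemma sh_env: "sh (env v s) = env (\<lambda>n. v (Suc n)) (\<lambda>n. s (Suc n))"
  by (simp only: sh_def env_def mod_add_self2 div_add_self2 nat.distinct not_False_eq_True Suc_eq_plus1)

lemma env_eta: "env (\<lambda>n. vc n e) (\<lambda>n. sc n e) = e"
proof
  fix i
  have *: "i div Suc d * Suc d + i mod Suc d = i" by (rule div_mult_mod_eq)
  show "env (\<lambda>n. vc n e) (\<lambda>n. sc n e) i = e i"
  proof (cases "i mod Suc d = d")
    case True
    then show ?thesis using * by (simp only: env_def sc_def refl if_True)
  next
    case False
    then have "i mod Suc d < d" using mod_less_divisor[of "Suc d" i] by linarith
    then show ?thesis using * False by (simp add: env_def vc_def del: mult_Suc_right)
  qed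
qed

lemma env_eta2: "env (\<lambda>n. vc (Suc (Suc n)) e) (\<lambda>n. sc (Suc (Suc n)) e) = sh (sh e)"
  using env_eta[of "sh (sh e)"] by simp

text \<open>Three prescribed entries and a constant tail, so that every entry of an environment
  built from it is definable.\<close>

definition pick :: "'b \<Rightarrow> 'b \<Rightarrow> 'b \<Rightarrow> 'b \<Rightarrow> nat \<Rightarrow> 'b" where
  "pick a b c z n = (if n = 0 then a else if n = 1 then b else if n = 2 then c else z)"

lemma pick_simps [simp]: "pick a b c z 0 = a" "pick a b c z (Suc 0) = b" "pick a b c z 1 = b" "pick a b c z 2 = c"
  by (simp_all add: pick_def)

lemma dfn_pick:
  assumes "dfn P" "dvec u" "dvec v" "dvec w" "dsc f" "dsc g" "dsc h" "dsc k"
  shows "dfn (\<lambda>e. P (env (pick (u e) (v e) (w e) (w e)) (pick (f e) (g e) (h e) (k e))))"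
proof -
  have "dfn (\<lambda>e. P (env (\<lambda>n. pick u v w w n e) (\<lambda>n. pick f g h k n e)))"
    by (rule dfn_env) (use assms in \<open>auto simp: pick_def\<close>)
  moreover have "(\<lambda>n. pick u v w w n e) = pick (u e) (v e) (w e) (w e)"
    "(\<lambda>n. pick f g h k n e) = pick (f e) (g e) (h e) (k e)" for e
    by (auto simp: pick_def)
  ultimately show ?thesis by simp
qed

lemma dvec0: "dvec (\<lambda>e. replicate d 0)" by (rule dvec_const) simp

text \<open>Definability of predicates of given arities in scalars (\<open>s\<close>) and vectors (\<open>v\<close>).\<close>

definition "ds1 P \<longleftrightarrow> dfn (\<lambda>e. P (sc 0 e))"
definition "ds2 P \<longleftrightarrow> dfn (\<lambda>e. P (sc 0 e) (sc 1 e))"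
definition "ds3 P \<longleftrightarrow> dfn (\<lambda>e. P (sc 0 e) (sc 1 e) (sc 2 e))"
definition "dv1 P \<longleftrightarrow> dfn (\<lambda>e. P (vc 0 e))"
definition "dv2 P \<longleftrightarrow> dfn (\<lambda>e. P (vc 0 e) (vc 1 e))"
definition "dsv P \<longleftrightarrow> dfn (\<lambda>e. P (sc 0 e) (vc 0 e))"
lemma ds1D: "ds1 P \<Longrightarrow> dsc f \<Longrightarrow> dfn (\<lambda>e. P (f e))"
  unfolding ds1_def by (drule dfn_pick[OF _ dvec0 dvec0 dvec0, of _ f f f f]) simp_all

lemma ds2D: "ds2 P \<Longrightarrow> dsc f \<Longrightarrow> dsc g \<Longrightarrow> dfn (\<lambda>e. P (f e) (g e))"
  unfolding ds2_def by (drule dfn_pick[OF _ dvec0 dvec0 dvec0, of _ f g g g]) simp_all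

lemma ds3D: "ds3 P \<Longrightarrow> dsc f \<Longrightarrow> dsc g \<Longrightarrow> dsc h \<Longrightarrow> dfn (\<lambda>e. P (f e) (g e) (h e))"
  unfolding ds3_def by (drule dfn_pick[OF _ dvec0 dvec0 dvec0, of _ f g h h]) simp_all

lemma dv2D: "dv2 P \<Longrightarrow> dvec f \<Longrightarrow> dvec g \<Longrightarrow> dfn (\<lambda>e. P (f e) (g e))"
  unfolding dv2_def
  by (drule dfn_pick[OF _ _ _ _ dsc_const[of 0] dsc_const[of 0] dsc_const[of 0] dsc_const[of 0], of _ f g g])
    (simp_all add: dvec_length)

lemma dsvD: "dsv P \<Longrightarrow> dsc f \<Longrightarrow> dvec g \<Longrightarrow> dfn (\<lambda>e. P (f e) (g e))"
  unfolding dsv_def by (drule dfn_pick[of _ g g g f f f f]) (simp_all add: dvec_length)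

text \<open>The renaming collapses the first block to variable 0, which turns a graph in block form
  into the form required by \<open>dsc\<close>.\<close>

lemma dsc_graph:
  assumes "dfn (\<lambda>e. P (sh e) (sc 0 e))" "\<And>e t. P e t \<longleftrightarrow> t = f e"
  shows "dsc f"
  using dfn_ren[OF assms(1), of "\<lambda>j. if j \<le> d then 0 else Suc (j - Suc d)"]
  unfolding dsc_def assms(2) by (simp add: sh_def sc_def)

lemma dsc_the:
  assumes "dfn (\<lambda>e. P (sh e) (sc 0 e))" "\<And>e. \<exists>!t. P e t"
  shows "dsc (\<lambda>e. THE t. P e t)"
  by (rule dsc_graph[OF assms(1)]) (metis assms(2) the_equality)

lemma dsc_if: "dfn P \<Longrightarrow> dsc f \<Longrightarrow> dsc g \<Longrightarrow> dsc (\<lambda>e. if P e then f e else g e)"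
  by (rule dsc_graph[where P = "\<lambda>e t. (P e \<longrightarrow> t = f e) \<and> (\<not> P e \<longrightarrow> t = g e)"])
    (auto intro!: dfn_conj dfn_imp dfn_not dfn_eq dsc_sc dfn_sh dsc_sh)

lemma dvec_graph:
  assumes "dfn (\<lambda>e. P (sh e) (vc 0 e))" "\<And>e. length (f e) = d" "\<And>e x. length x = d \<Longrightarrow> P e x \<longleftrightarrow> x = f e"
  shows "dvec f"
  unfolding dvec_def
proof (intro conjI allI impI assms(2))
  fix i assume i: "i < d"
  \<comment> \<open>Makes room for one block: the bound vector is in block 0, the coordinate value
    in block 1, and the environment of \<open>f\<close> starts at block 2.\<close>
  have "dfn (\<lambda>e. P (sh (sh e)) (vc 0 e))"
    using dfn_env[OF assms(1), of "\<lambda>n. if n = 0 then vc 0 else vc (Suc n)" "\<lambda>n. sc (Suc n)"]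
    by (simp add: dvec_vc dsc_sc sh_env env_eta2)
  then have "dfn (\<lambda>e. \<exists>v. length v = d \<and> (P (sh e) v \<and> sc 0 e = v ! i))"
    by (intro dfn_vex dfn_conj dfn_eq dsc_nth dvec_vc dsc_sc1 i)
  moreover have "(\<exists>v. length v = d \<and> (P e v \<and> t = v ! i)) \<longleftrightarrow> t = f e ! i" for e t
    using assms(2,3) by metis
  ultimately show "dsc (\<lambda>e. f e ! i)" by (rule dsc_graph)
qed

lemmas dfn_rules = dfn_not dfn_conj dfn_disj dfn_imp dfn_iff dfn_const dfn_eq dfn_less dfn_le
  dfn_veq dfn_ex dfn_all dfn_vbex dfn_vball dfn_all_less dset_mem
  dsc_const dsc_plus dsc_times dsc_uminus dsc_minus dsc_nth dsc_if
  dsc_sc dsc_sc1 dsc_sc2 dsc_sc3 dsc_sc4 dsc_sc6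
  dvec_vc dvec_vc1 dvec_vc2 dvec_const

end


section \<open>Substitution under quantifiers and sections of definable families\<close>

context omin
begin

lemma sh_pow_nth: "(sh ^^ k) e i = e (i + k * Suc d)"
  by (induction k arbitrary: i) (simp_all add: sh_def algebra_simps)

lemma dsc_sh_pow: "dsc (\<lambda>e. (sh ^^ k) e i)"
  unfolding sh_pow_nth by (rule dsc_var)

lemma sc_block: "sc 0 (\<lambda>i. if i < d then f i else if i = d then x else g i) = x"
  by (simp add: sc_def)

text \<open>Below \<open>k\<close> quantifiers the environment of \<open>P\<close> has become
  \<open>(sh ^^ k) e\<close>, while the substituted value may depend on the bound variables; each
  depth that occurs gets its own instance.\<close>

lemma dfn_let_gen:
  assumes "dfn (\<lambda>e. P (sh e) (sc 0 e))" "dsc f"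
  shows "dfn (\<lambda>e. P ((sh ^^ k) e) (f e))"
proof -
  let ?s = "\<lambda>i e. if i < d then 0 else if i = d then f e else (sh ^^ k) e (i - Suc d)"
  have "dsc (?s i)" for i
    using assms(2) by (cases "i < d"; cases "i = d") (simp_all add: dsc_const dsc_sh_pow)
  from dfn_subst[where \<sigma> = ?s, OF assms(1) this] show ?thesis by (simp add: sh_def[of "\<lambda>i. _ i"] sc_def)
qed

lemma dfn_vlet_gen:
  assumes "dfn (\<lambda>e. P (sh e) (vc 0 e))" "dvec f"
  shows "dfn (\<lambda>e. P ((sh ^^ k) e) (f e))"
proof -
  let ?s = "\<lambda>i e. if i < d then f e ! i else if i = d then 0 else (sh ^^ k) e (i - Suc d)"
  have "dsc (?s i)" for i
    using assms(2) by (cases "i < d"; cases "i = d") (simp_all add: dsc_const dsc_sh_pow dsc_nth)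
  note * = dfn_subst[where \<sigma> = ?s, OF assms(1) this]
  have "vc 0 (\<lambda>i. ?s i e) = f e" for e
    by (rule nth_equalityI) (simp_all add: vc_def dvec_length[OF assms(2)])
  with * show ?thesis by (simp add: sh_def[of "\<lambda>i. _ i"])
qed

lemmas dfn_let = dfn_let_gen[where k = 0, simplified]
  and dfn_let1 = dfn_let_gen[where k = 1, simplified]
  and dfn_let2 = dfn_let_gen[where k = 2, simplified numeral_2_eq_2 funpow.simps comp_apply id_apply]
  and dfn_let3 = dfn_let_gen[where k = 3, simplified numeral_3_eq_3 funpow.simps comp_apply id_apply]
  and dfn_let4 = dfn_let_gen[where k = "Suc (Suc (Suc (Suc 0)))", simplified funpow.simps comp_apply id_apply]

lemmas dfn_vlet2 = dfn_vlet_gen[where k = 2, simplified numeral_2_eq_2 funpow.simps comp_apply id_apply]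

text \<open>Freezing the environment turns its entries into parameters, so every fibre of a
  definable family is definable.\<close>

lemma ds1_section: "dfn (\<lambda>e. P (sh e) (sc 0 e)) \<Longrightarrow> ds1 (P e)"
proof -
  assume P: "dfn (\<lambda>e. P (sh e) (sc 0 e))"
  let ?s = "\<lambda>i e'. if i < d then 0 else if i = d then sc 0 e' else e (i - Suc d)"
  have "dsc (?s i)" for i
    by (cases "i < d"; cases "i = d") (simp_all add: dsc_const dsc_sc)
  from dfn_subst[where \<sigma> = ?s, OF P this] show ?thesis by (simp add: sh_def[of "\<lambda>i. _ i"] sc_block ds1_def)
qed

lemma dv1_section: "dfn (\<lambda>e. P (sh e) (vc 0 e)) \<Longrightarrow> dv1 (P e)"
proof -
  assume P: "dfn (\<lambda>e. P (sh e) (vc 0 e))"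
  let ?s = "\<lambda>i e'. if i < d then vc 0 e' ! i else if i = d then 0 else e (i - Suc d)"
  have "dsc (?s i)" for i
    by (cases "i < d"; cases "i = d") (simp_all add: dsc_const dsc_nth dvec_vc)
  note * = dfn_subst[where \<sigma> = ?s, OF P this]
  have "vc 0 (\<lambda>i. ?s i e') = vc 0 e'" for e'
    by (rule nth_equalityI) (simp_all add: vc_def)
  with * show ?thesis by (simp add: sh_def[of "\<lambda>i. _ i"] dv1_def)
qed

section \<open>Definable subsets of the line\<close>

lemma ds1_pieces:
  assumes "ds1 P"
  obtains F where "finite F" "\<And>I. I \<in> F \<Longrightarrow> is_point I \<or> is_interval I" "\<And>t. P t \<longleftrightarrow> t \<in> \<Union>F"
proof -
  have "dfn (\<lambda>e. P (e 0))"
    using dfn_ren[OF assms[unfolded ds1_def], of "\<lambda>_. 0"] by (simp add: sc_def)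
  then have "definable R 1 ((\<lambda>a. [a]) ` {t. P t})"
    unfolding definable_def dfn_def by (auto simp: image_iff)
  then obtain F where "finite F" "\<forall>I\<in>F. is_point I \<or> is_interval I" "{t. P t} = \<Union>F"
    using om[unfolded o_minimal_def, rule_format, of "{t. P t}"] by blast
  then show ?thesis using that[of F] by (metis mem_Collect_eq)
qed

lemma is_interval_cases:
  assumes "is_interval I"
  obtains a b :: 'a where "a < b" "I = {a<..<b}" | b where "I = {..<b}" | a where "I = {a<..}" | "I = UNIV"
  using assms unfolding is_interval_def by (metis greaterThanLessThan_empty_iff not_le)

lemma germ_piece:
  fixes I :: "'a set"
  assumes "is_point I \<or> is_interval I"
  shows "\<exists>b>a. {a<..<b} \<subseteq> I \<or> {a<..<b} \<inter> I = {}"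
  using assms
proof
  assume "is_point I"
  then obtain c where c: "I = {c}" unfolding is_point_def by blast
  show ?thesis
    by (rule exI[of _ "if a < c then c else a + 1"]) (auto simp: c less_add_one)
next
  assume "is_interval I"
  then show ?thesis
  proof (cases rule: is_interval_cases)
    case (1 p q)
    show ?thesis
      by (rule exI[of _ "if q \<le> a then a + 1 else if a < p then p else q"]) (auto simp: 1 less_add_one)
  next
    case (2 q)
    show ?thesis
      by (rule exI[of _ "if q \<le> a then a + 1 else q"]) (auto simp: 2 less_add_one)
  next
    case (3 p)
    show ?thesis
      by (rule exI[of _ "if a < p then p else a + 1"]) (auto simp: 3 less_add_one)
  next
    case 4
    show ?thesis by (rule exI[of _ "a + 1"]) (auto simp: 4 less_add_one)
  qed
qed

text \<open>Each of the finitely many pieces contains or misses a right neighbourhood of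
  \<open>a\<close>, hence so does their union. Later arguments about behaviour near a point rest on
  this eventual constancy.\<close>

lemma germ_right:
  assumes "ds1 P"
  obtains b where "a < b" "\<And>t. a < t \<Longrightarrow> t < b \<Longrightarrow> P t" | b where "a < b" "\<And>t. a < t \<Longrightarrow> t < b \<Longrightarrow> \<not> P t"
proof -
  obtain F where F: "finite F" "\<And>I. I \<in> F \<Longrightarrow> is_point I \<or> is_interval I" "\<And>t. P t \<longleftrightarrow> t \<in> \<Union>F"
    using ds1_pieces[OF assms] by blast
  have "\<exists>b>a. {a<..<b} \<subseteq> \<Union>F \<or> {a<..<b} \<inter> \<Union>F = {}"
    using F(1,2)
  proof (induction F rule: finite_induct)
    case empty
    show ?case by (rule exI[of _ "a + 1"]) (auto simp: less_add_one)
  next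
    case (insert I F)
    obtain b c where bc: "b > a" "{a<..<b} \<subseteq> \<Union>F \<or> {a<..<b} \<inter> \<Union>F = {}"
       "c > a" "{a<..<c} \<subseteq> I \<or> {a<..<c} \<inter> I = {}"
      using insert germ_piece[of I a] by auto
    have sub: "{a<..<min b c} \<subseteq> {a<..<b}" "{a<..<min b c} \<subseteq> {a<..<c}" by auto
    have *: "S \<subseteq> \<Union>(insert I F) \<or> S \<inter> \<Union>(insert I F) = {}"
      if "S \<subseteq> B" "S \<subseteq> C" "B \<subseteq> \<Union>F \<or> B \<inter> \<Union>F = {}" "C \<subseteq> I \<or> C \<inter> I = {}" for S B C
    proof (cases "B \<subseteq> \<Union>F \<or> C \<subseteq> I")
      case False
      then have "S \<inter> \<Union>F = {}" "S \<inter> I = {}" using that by fast+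
      then show ?thesis by auto
    next
      case True
      then have "S \<subseteq> \<Union>(insert I F)"
      proof
        assume "B \<subseteq> \<Union>F"
        then show ?thesis using that(1) by auto
      next
        assume "C \<subseteq> I"
        then show ?thesis using that(2) by auto
      qed
      then show ?thesis ..
    qed
    have "{a<..<min b c} \<subseteq> \<Union>(insert I F) \<or> {a<..<min b c} \<inter> \<Union>(insert I F) = {}"
      by (rule *[OF sub bc(2,4)])
    then show ?case using bc(1,3) by (intro exI[of _ "min b c"]) auto
  qed
  then obtain b where "a < b" "{a<..<b} \<subseteq> \<Union>F \<or> {a<..<b} \<inter> \<Union>F = {}" by blast
  then show ?thesis using that F(3) by (auto simp: subset_iff disjoint_iff)
qed

lemma germ_left:
  assumes "ds1 P"
  obtains b where "b < a" "\<And>t. b < t \<Longrightarrow> t < a \<Longrightarrow> P t" | b where "b < a" "\<And>t. b < t \<Longrightarrow> t < a \<Longrightarrow> \<not> P t"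
proof -
  have "ds1 (\<lambda>t. P (- t))"
    using ds1D[OF assms dsc_uminus[OF dsc_sc]] unfolding ds1_def .
  then show ?thesis
  proof (cases rule: germ_right[where a = "- a"])
    case (1 b)
    then show ?thesis using that(1)[of "- b"] 1(2)[of "- t" for t] by (metis minus_less_iff less_minus_iff minus_minus)
  next
    case (2 b)
    then show ?thesis using that(2)[of "- b"] 2(2)[of "- t" for t] by (metis minus_less_iff less_minus_iff minus_minus)
  qed
qed

lemma interval_infinite: "a < b \<Longrightarrow> (\<And>t::'a. a < t \<Longrightarrow> t < b \<Longrightarrow> P t) \<Longrightarrow> infinite {t. P t}"
proof -
  assume "a < b" and *: "\<And>t. a < t \<Longrightarrow> t < b \<Longrightarrow> P t"
  then have "infinite {a<..<b}" "{a<..<b} \<subseteq> {t. P t}" by (auto simp: infinite_Ioo)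
  then show ?thesis using infinite_super by blast
qed

text \<open>A finite union of points is finite, so one of the pieces is an interval; an unbounded
  one is cut down to a bounded part.\<close>

lemma infinite_interval:
  assumes "ds1 P" "infinite {t. P t}"
  obtains a b where "a < b" "\<And>t. a < t \<Longrightarrow> t < b \<Longrightarrow> P t"
proof -
  obtain F where F: "finite F" "\<And>I. I \<in> F \<Longrightarrow> is_point I \<or> is_interval I" "\<And>t. P t \<longleftrightarrow> t \<in> \<Union>F"
    using ds1_pieces[OF assms(1)] by blast
  have "{t. P t} = \<Union>F" using F(3) by blast
  then have "\<not> (\<forall>I\<in>F. finite I)" using assms(2) F(1) by auto
  then obtain I where I: "I \<in> F" "infinite I" by blast
  then have "is_interval I" using F(2)[OF I(1)] by (auto simp: is_point_def)
  then obtain a b where "a < b" "{a<..<b} \<subseteq> I"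
  proof (cases rule: is_interval_cases)
    case (2 b)
    show ?thesis by (rule that[of "b - 1" b]) (auto simp: 2)
  next
    case (3 a)
    show ?thesis by (rule that[of a "a + 1"]) (auto simp: 3 less_add_one)
  next
    case 4
    show ?thesis by (rule that[of 0 1]) (auto simp: 4)
  qed (use that in blast)
  then show ?thesis using that F(3) I(1) by fastforce
qed

definition is_lub :: "('a \<Rightarrow> bool) \<Rightarrow> 'a \<Rightarrow> bool" where
  "is_lub P s \<longleftrightarrow> (\<forall>t. P t \<longrightarrow> t \<le> s) \<and> (\<forall>u<s. \<exists>t. u < t \<and> P t)"

text \<open>The field need not be complete, but definable bounded sets have suprema: each piece has
  its right end, and the largest of these finitely many ends is the supremum of the union.\<close>

lemma lub_exists:
  assumes "ds1 P" "P c" "\<And>t. P t \<Longrightarrow> t \<le> B"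
  obtains s where "is_lub P s"
proof -
  obtain F where F: "finite F" "\<And>I. I \<in> F \<Longrightarrow> is_point I \<or> is_interval I" "\<And>t. P t \<longleftrightarrow> t \<in> \<Union>F"
    using ds1_pieces[OF assms(1)] by blast
  have "\<exists>s. is_lub (\<lambda>t. t \<in> I) s" if I: "I \<in> F" for I
  proof -
    have B: "t \<le> B" if "t \<in> I" for t using that F(3) assms(3) I by blast
    show ?thesis using F(2)[OF I]
    proof
      assume "is_point I"
      then show ?thesis unfolding is_point_def is_lub_def by auto
    next
      assume "is_interval I"
      then show ?thesis
      proof (cases rule: is_interval_cases)
        case (1 a b)
        show ?thesis
        proof (intro exI[of _ b], unfold is_lub_def, intro conjI allI impI)
          fix u assume u: "u < b"
          then have "max u a < b" using 1 by simp
          then obtain t where "max u a < t" "t < b" using dense by blast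
          then show "\<exists>t>u. t \<in> I" using 1 by auto
        qed (auto simp: 1)
      next
        case (2 b)
        show ?thesis
          by (intro exI[of _ b]) (auto simp: 2 is_lub_def dense)
      next
        case (3 a)
        \<comment> \<open>A piece unbounded to the right would contain a point beyond the bound
          \<open>B\<close>.\<close>
        have "max a B + 1 \<in> I" by (auto simp: 3 less_add_one intro: le_less_trans)
        then show ?thesis using B[of "max a B + 1"] by (simp add: add_le_same_cancel2 max_def split: if_splits)
      next
        case 4
        then show ?thesis using B[of "B + 1"] by simp
      qed
    qed
  qed
  then obtain s where s: "\<And>I. I \<in> F \<Longrightarrow> is_lub (\<lambda>t. t \<in> I) (s I)" by metis
  have "s ` F \<noteq> {}" using assms(2) F(3) by blast
  then have "Max (s ` F) \<in> s ` F" using F(1) by simp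
  then obtain J where J: "J \<in> F" "Max (s ` F) = s J" by blast
  have le: "s I \<le> s J" if "I \<in> F" for I using F(1) that unfolding J(2)[symmetric] by simp
  have "is_lub P (s J)"
    unfolding is_lub_def
  proof (intro conjI allI impI)
    fix t assume "P t"
    then obtain I where "I \<in> F" "t \<in> I" using F(3) by blast
    then show "t \<le> s J" using s le unfolding is_lub_def by (meson order_trans)
  next
    fix u assume "u < s J"
    then obtain t where "u < t" "t \<in> J" using s[OF J(1)] unfolding is_lub_def by blast
    then show "\<exists>t. u < t \<and> P t" using F(3) J(1) by blast
  qed
  then show ?thesis by (rule that)
qed

lemma glb_exists:
  assumes "ds1 P" "P c" "\<And>t. P t \<Longrightarrow> B \<le> t"
  obtains s where "\<And>t. P t \<Longrightarrow> s \<le> t" "\<And>u. s < u \<Longrightarrow> \<exists>t. t < u \<and> P t"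
proof -
  have "ds1 (\<lambda>t. P (- t))"
    using ds1D[OF assms(1) dsc_uminus[OF dsc_sc]] unfolding ds1_def .
  then obtain s where s: "is_lub (\<lambda>t. P (- t)) s"
    using lub_exists[of "\<lambda>t. P (- t)" "- c" "- B"] assms(2,3) by (metis le_minus_iff minus_minus)
  show ?thesis
  proof (rule that[of "- s"])
    fix t assume "P t"
    then show "- s \<le> t" using s unfolding is_lub_def by (metis minus_minus minus_le_iff)
  next
    fix u assume "- s < u"
    then have "- u < s" by (simp add: minus_less_iff)
    then obtain t where "- u < t" "P (- t)" using s unfolding is_lub_def by blast
    then show "\<exists>t. t < u \<and> P t" by (metis minus_less_iff)
  qed
qed

section \<open>Definable choice\<close>

text \<open>The chosen element of a nonempty set of nonnegative elements: its minimum, or the middle of its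
  leftmost interval, cut off at length 1.\<close>

definition choice0 :: "('a \<Rightarrow> bool) \<Rightarrow> 'a \<Rightarrow> bool" where
  "choice0 P x \<longleftrightarrow> (P x \<and> (\<forall>t. P t \<longrightarrow> x \<le> t)) \<or>
     (\<not> (\<exists>m. P m \<and> (\<forall>t. P t \<longrightarrow> m \<le> t)) \<and>
      (\<exists>a b. (\<forall>t. P t \<longrightarrow> a \<le> t) \<and> (\<forall>u. a < u \<longrightarrow> (\<exists>t. t < u \<and> P t)) \<and> a < b \<and> b \<le> a + 1 \<and>
        (\<forall>t. a < t \<longrightarrow> t < b \<longrightarrow> P t) \<and>
        (\<forall>c. a < c \<longrightarrow> c \<le> a + 1 \<longrightarrow> (\<forall>t. a < t \<longrightarrow> t < c \<longrightarrow> P t) \<longrightarrow> c \<le> b) \<and> x + x = a + b))"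

text \<open>Preferring nonnegative elements, and reflecting a set of negative ones, provides a lower
  bound before \<open>choice0\<close> is applied. The value 0 on the empty set makes the choice
  total.\<close>

definition choice :: "('a \<Rightarrow> bool) \<Rightarrow> 'a \<Rightarrow> bool" where
  "choice P x \<longleftrightarrow> ((\<exists>t. P t \<and> 0 \<le> t) \<longrightarrow> choice0 (\<lambda>t. P t \<and> 0 \<le> t) x) \<and>
     (\<not> (\<exists>t. P t \<and> 0 \<le> t) \<longrightarrow> ((\<exists>t. P t) \<longrightarrow> choice0 (\<lambda>t. P (- t) \<and> 0 \<le> t) (- x)) \<and>
       (\<not> (\<exists>t. P t) \<longrightarrow> x = 0))"

definition sel :: "('a \<Rightarrow> bool) \<Rightarrow> 'a" where
  "sel P = (THE x. choice P x)"

lemma choice0_unique: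
  assumes "ds1 P" "P c" "\<And>t. P t \<Longrightarrow> 0 \<le> t"
  shows "\<exists>!x. choice0 P x" "choice0 P x \<Longrightarrow> P x"
proof -
  have "(\<exists>!x. choice0 P x) \<and> (\<forall>x. choice0 P x \<longrightarrow> P x)"
  proof (cases "\<exists>m. P m \<and> (\<forall>t. P t \<longrightarrow> m \<le> t)")
    case True
    then obtain m where "P m" "\<forall>t. P t \<longrightarrow> m \<le> t" by blast
    then have "choice0 P x \<longleftrightarrow> x = m" for x
      unfolding choice0_def by (auto intro: antisym)
    then show ?thesis using \<open>P m\<close> by simp
  next
    case False
    obtain a where a: "\<And>t. P t \<Longrightarrow> a \<le> t" "\<And>u. a < u \<Longrightarrow> \<exists>t. t < u \<and> P t"
      using glb_exists[OF assms] by blast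
    have aP: "\<not> P a" using False a(1) by blast
    \<comment> \<open>The infimum \<open>a\<close> is not attained, so points of \<open>P\<close>
      accumulate at it from the right, and eventual constancy gives an interval of \<open>P\<close>
      starting at \<open>a\<close>.\<close>
    obtain b0 where b0: "a < b0" "\<And>t. a < t \<Longrightarrow> t < b0 \<Longrightarrow> P t"
    proof (cases rule: germ_right[OF assms(1), of a, consumes 0])
      case (2 b)
      then obtain t where "t < b" "P t" using a(2) by blast
      then have "a < t" using a(1)[of t] aP by (metis order_le_less)
      then show ?thesis using 2 \<open>t < b\<close> \<open>P t\<close> by blast
    qed (use that in blast)
    \<comment> \<open>The admissible right ends of the leftmost interval. The cut-off makes them
      bounded, and their supremum is again admissible.\<close>
    let ?Q = "\<lambda>c. a < c \<and> c \<le> a + 1 \<and> (\<forall>t. a < t \<longrightarrow> t < c \<longrightarrow> P t)"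
    have "ds1 ?Q"
      unfolding ds1_def by (intro dfn_rules ds1D[OF assms(1)])
    moreover have "?Q (min b0 (a + 1))" using b0 by (auto simp: less_add_one)
    ultimately obtain b where b: "is_lub ?Q b"
      using lub_exists[of ?Q _ "a + 1"] by blast
    have bQ: "?Q b"
    proof (intro conjI allI impI)
      show "a < b" using b \<open>?Q (min b0 (a + 1))\<close> unfolding is_lub_def by (meson order_less_le_trans)
      show "b \<le> a + 1"
        using b unfolding is_lub_def by (meson not_le)
      fix t assume "a < t" "t < b"
      then show "P t" using b unfolding is_lub_def by blast
    qed
    have a': "a' = a" if "\<forall>t. P t \<longrightarrow> a' \<le> t" "\<forall>u. a' < u \<longrightarrow> (\<exists>t. t < u \<and> P t)" for a'
    proof (rule ccontr)
      assume "a' \<noteq> a"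
      then consider "a < a'" | "a' < a" by fastforce
      then show False
      proof cases
        case 1
        then show False using a(2) that(1) by (meson not_le)
      next
        case 2
        then show False using a(1) that(2) by (meson not_le)
      qed
    qed
    have b': "b' = b" if "?Q b'" "\<forall>c. a < c \<longrightarrow> c \<le> a + 1 \<longrightarrow> (\<forall>t. a < t \<longrightarrow> t < c \<longrightarrow> P t) \<longrightarrow> c \<le> b'" for b'
      using that bQ b unfolding is_lub_def by (meson antisym)
    have half: "x + x = a + b \<longleftrightarrow> x = (a + b) / 2" for x by auto
    have "choice0 P x \<longleftrightarrow> x = (a + b) / 2" for x
    proof
      assume "choice0 P x"
      then obtain a1 b1 where 1: "\<forall>t. P t \<longrightarrow> a1 \<le> t" "\<forall>u. a1 < u \<longrightarrow> (\<exists>t. t < u \<and> P t)" "a1 < b1" "b1 \<le> a1 + 1"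
        "\<forall>t. a1 < t \<longrightarrow> t < b1 \<longrightarrow> P t"
        "\<forall>c. a1 < c \<longrightarrow> c \<le> a1 + 1 \<longrightarrow> (\<forall>t. a1 < t \<longrightarrow> t < c \<longrightarrow> P t) \<longrightarrow> c \<le> b1" "x + x = a1 + b1"
        unfolding choice0_def using False by blast
      have "a1 = a" by (rule a'[OF 1(1,2)])
      moreover have "b1 = b" by (rule b') (use 1 \<open>a1 = a\<close> in blast)+
      ultimately show "x = (a + b) / 2" using 1 half by simp
    next
      assume "x = (a + b) / 2"
      then have "x + x = a + b" using half by simp
      moreover have "\<forall>c. a < c \<longrightarrow> c \<le> a + 1 \<longrightarrow> (\<forall>t. a < t \<longrightarrow> t < c \<longrightarrow> P t) \<longrightarrow> c \<le> b"
        using b unfolding is_lub_def by blast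
      ultimately show "choice0 P x"
        unfolding choice0_def using False a bQ by blast
    qed
    moreover have "P ((a + b) / 2)" using bQ by (simp add: field_simps)
    ultimately show ?thesis by metis
  qed
  then show "\<exists>!x. choice0 P x" "choice0 P x \<Longrightarrow> P x" by blast+
qed

lemma choice0_ex: "ds1 P \<Longrightarrow> P c \<Longrightarrow> (\<And>t. P t \<Longrightarrow> 0 \<le> t) \<Longrightarrow> \<exists>y. P y \<and> (\<forall>x. choice0 P x \<longleftrightarrow> x = y)"
  using choice0_unique[of P c] by blast

lemma choice_unique:
  assumes P: "ds1 P"
  shows "\<exists>!x. choice P x" and "choice P x \<Longrightarrow> P c \<Longrightarrow> P x"
proof -
  have 1: "ds1 (\<lambda>t. P t \<and> 0 \<le> t)" "ds1 (\<lambda>t. P (- t) \<and> 0 \<le> t)"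
    unfolding ds1_def by (intro dfn_rules ds1D[OF P])+
  have "\<exists>y. (P c \<longrightarrow> P y) \<and> (\<forall>x. choice P x \<longleftrightarrow> x = y)"
  proof (cases "\<exists>t. P t \<and> 0 \<le> t")
    case True
    then obtain c where "P c \<and> 0 \<le> c" by blast
    then obtain y where y: "P y" "\<forall>x. choice0 (\<lambda>t. P t \<and> 0 \<le> t) x \<longleftrightarrow> x = y"
      using choice0_ex[OF 1(1), of c] by blast
    have "choice P x \<longleftrightarrow> x = y" for x
      unfolding choice_def using True y(2) by blast
    then show ?thesis using y(1) by blast
  next
    case False
    show ?thesis
    proof (cases "\<exists>t. P t")
      case True
      then obtain c where "P c" by blast
      then have c: "P (- (- c)) \<and> 0 \<le> - c" using False by (metis le_cases minus_minus neg_0_le_iff_le)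
      then obtain y where y: "P (- y)" "\<forall>x. choice0 (\<lambda>t. P (- t) \<and> 0 \<le> t) x \<longleftrightarrow> x = y"
        using choice0_ex[OF 1(2), of "- c"] by blast
      have "choice P x \<longleftrightarrow> - x = y" for x
        unfolding choice_def using True False y(2) by blast
      then have "choice P x \<longleftrightarrow> x = - y" for x by (metis minus_minus)
      then show ?thesis using y(1) by blast
    next
      case False
      then have "choice P x \<longleftrightarrow> x = 0" for x
        unfolding choice_def by blast
      then show ?thesis using False by blast
    qed
  qed
  then obtain y where y: "P c \<longrightarrow> P y" "\<And>x. choice P x \<longleftrightarrow> x = y" by blast
  show "\<exists>!x. choice P x" by (rule ex1I[of _ y]) (simp_all add: y(2))
  show "choice P x \<Longrightarrow> P c \<Longrightarrow> P x" using y(1) by (simp add: y(2))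
qed

lemma sel_in: "ds1 P \<Longrightarrow> P c \<Longrightarrow> P (sel P)"
  unfolding sel_def using choice_unique theI'[of "choice P"] by metis

lemma dsc_sel:
  assumes P: "dfn (\<lambda>e. P (sh e) (sc 0 e))"
  shows "dsc (\<lambda>e. sel (P e))"
  unfolding sel_def
proof (rule dsc_the)
  show "\<exists>!t. choice (P e) t" for e
    by (rule choice_unique(1)[OF ds1_section[OF P]])
  show "dfn (\<lambda>e. choice (P (sh e)) (sc 0 e))"
    unfolding choice_def choice0_def
    by (intro dfn_rules dfn_let1[OF P] dfn_let2[OF P] dfn_let3[OF P] dfn_let4[OF P]
      dfn_let_gen[OF P, where k = "Suc (Suc (Suc (Suc (Suc 0))))", simplified funpow.simps comp_apply id_apply])
qed

definition vsec :: "('a list \<Rightarrow> bool) \<Rightarrow> nat \<Rightarrow> 'a \<Rightarrow> bool" where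
  "vsec P k t \<longleftrightarrow> (\<exists>y. length y = d \<and> (P y \<and> y ! k = t))"

text \<open>Lexicographic choice: coordinate \<open>k\<close> is selected from the projection of the
  tuples that survive the earlier stages, so for a nonempty definable \<open>P\<close> some tuple
  always survives, and after \<open>d\<close> stages only one.\<close>

primrec vfil :: "('a list \<Rightarrow> bool) \<Rightarrow> nat \<Rightarrow> 'a list \<Rightarrow> bool" where
  "vfil P 0 x = P x"
| "vfil P (Suc k) x = (vfil P k x \<and> x ! k = sel (vsec (vfil P k) k))"

definition vsel :: "('a list \<Rightarrow> bool) \<Rightarrow> 'a list" where
  "vsel P = (if \<exists>y. length y = d \<and> P y then THE x. length x = d \<and> vfil P d x else replicate d 0)"

lemma dfn_vsec: "dfn (\<lambda>e. P (sh e) (vc 0 e)) \<Longrightarrow> k < d \<Longrightarrow> dfn (\<lambda>e. vsec (P (sh e)) k (sc 0 e))"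
  unfolding vsec_def
  by (intro dfn_vex dfn_conj dfn_eq dsc_nth dvec_vc dsc_sc1 dfn_vlet2)

lemma dfn_vfil: "dfn (\<lambda>e. P (sh e) (vc 0 e)) \<Longrightarrow> k \<le> d \<Longrightarrow> dfn (\<lambda>e. vfil (P (sh e)) k (vc 0 e))"
proof (induction k)
  case (Suc k)
  then have IH: "dfn (\<lambda>e. vfil (P (sh e)) k (vc 0 e))" by simp
  have k: "k < d" using Suc by simp
  have "dsc (\<lambda>e. sel (vsec (vfil (P (sh e)) k) k))"
    using dsc_sh[OF dsc_sel[OF dfn_vsec[OF IH k]]] .
  then show ?case unfolding vfil.simps by (intro dfn_conj IH dfn_eq dsc_nth dvec_vc k)
qed simp

lemma vsel_unique:
  assumes P: "dv1 P" and y: "length y = d" "P y"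
  shows "\<exists>!x. length x = d \<and> vfil P d x" and "length x = d \<Longrightarrow> vfil P d x \<Longrightarrow> P x"
proof -
  have P': "dfn (\<lambda>e. (\<lambda>_. P) (sh e) (vc 0 e))" using P unfolding dv1_def .
  have ex: "\<exists>x. length x = d \<and> vfil P k x" if "k \<le> d" for k
    using that
  proof (induction k)
    case (Suc k)
    then obtain x where x: "length x = d" "vfil P k x" by auto
    have "ds1 (vsec (vfil P k) k)"
      using ds1_section[OF dfn_vsec[OF dfn_vfil[OF P', of k], of k]] Suc by simp
    moreover have "vsec (vfil P k) k (x ! k)" unfolding vsec_def using x by blast
    ultimately have "vsec (vfil P k) k (sel (vsec (vfil P k) k))" by (rule sel_in)
    then show ?case unfolding vsec_def[of _ _ "sel _"] by auto
  qed (use y in auto)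
  have imp: "vfil P k x \<Longrightarrow> P x" for k x by (induction k) auto
  have un: "vfil P k x \<Longrightarrow> vfil P k x' \<Longrightarrow> i < k \<Longrightarrow> x ! i = x' ! i" for k x x' i
    by (induction k) (auto simp: less_Suc_eq)
  show "\<exists>!x. length x = d \<and> vfil P d x"
    using ex[of d] un[of d] by (metis nth_equalityI order_refl)
  show "length x = d \<Longrightarrow> vfil P d x \<Longrightarrow> P x" using imp .
qed

lemma vsel_in:
  assumes "dv1 P" "length y = d" "P y"
  shows "P (vsel P)"
proof -
  have "length (THE x. length x = d \<and> vfil P d x) = d \<and> vfil P d (THE x. length x = d \<and> vfil P d x)"
    by (rule theI'[OF vsel_unique(1)[OF assms]])
  then show ?thesis unfolding vsel_def using vsel_unique(2)[OF assms] assms(2,3) by auto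
qed

lemma dvec_vsel:
  assumes P: "dfn (\<lambda>e. P (sh e) (vc 0 e))"
  shows "dvec (\<lambda>e. vsel (P e))"
proof -
  let ?P = "\<lambda>e x. ((\<exists>y. length y = d \<and> P e y) \<longrightarrow> vfil (P e) d x) \<and>
    (\<not> (\<exists>y. length y = d \<and> P e y) \<longrightarrow> x = replicate d 0)"
  have u: "\<exists>!x. length x = d \<and> vfil (P e) d x" if "\<exists>y. length y = d \<and> P e y" for e
    using that vsel_unique(1)[OF dv1_section[OF P]] by blast
  have the: "vsel (P e) = (THE x. length x = d \<and> vfil (P e) d x)" if "\<exists>y. length y = d \<and> P e y" for e
    using that by (simp add: vsel_def)
  have l: "length (vsel (P e)) = d" for e
  proof (cases "\<exists>y. length y = d \<and> P e y")
    case True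
    then show ?thesis unfolding the[OF True] using theI'[OF u[OF True]] by blast
  next
    case False
    then show ?thesis unfolding vsel_def by auto
  qed
  show ?thesis
  proof (rule dvec_graph[where P = ?P])
    show "dfn (\<lambda>e. ?P (sh e) (vc 0 e))"
      by (intro dfn_rules dfn_vex dfn_vfil[OF P] dfn_vlet2[OF P]) auto
    show "length (vsel (P e)) = d" for e by (rule l)
    show "?P e x \<longleftrightarrow> x = vsel (P e)" if x: "length x = d" for e x
    proof (cases "\<exists>y. length y = d \<and> P e y")
      case True
      have "vfil (P e) d x \<longleftrightarrow> x = vsel (P e)"
        unfolding the[OF True] using x theI'[OF u[OF True]] u[OF True] by blast
      then show ?thesis using True by blast
    next
      case False
      then have "vsel (P e) = replicate d 0" unfolding vsel_def by (simp only: if_False)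
      then show ?thesis using False by metis
    qed
  qed
qed

lemma finite_coords:
  assumes "\<And>x. P x \<Longrightarrow> length x = d"
  shows "finite {x. P x} \<longleftrightarrow> (\<forall>i<d. finite {x ! i | x. P x})"
proof
  assume "finite {x. P x}"
  then show "\<forall>i<d. finite {x ! i | x. P x}" by (simp add: setcompr_eq_image)
next
  assume f: "\<forall>i<d. finite {x ! i | x. P x}"
  have "{x. P x} \<subseteq> {xs. set xs \<subseteq> (\<Union>i\<in>{..<d}. {x ! i | x. P x}) \<and> length xs = d}"
    using assms by (fastforce simp: set_conv_nth)
  moreover have "finite (\<Union>i\<in>{..<d}. {x ! i | x. P x})" using f by blast
  ultimately show "finite {x. P x}" by (rule finite_subset[OF _ finite_lists_length_eq])
qed

text \<open>By o-minimality a projection is infinite exactly when it contains an interval, and this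
  is a first-order condition.\<close>

lemma finite_coords_interval:
  assumes P: "dv1 P" and l: "\<And>x. P x \<Longrightarrow> length x = d"
  shows "finite {x. P x} \<longleftrightarrow>
    (\<forall>i<d. \<not> (\<exists>a b. a < b \<and> (\<forall>t. a < t \<longrightarrow> t < b \<longrightarrow> vsec P i t)))"
proof -
  have "finite {x ! i | x. P x} \<longleftrightarrow> \<not> (\<exists>a b. a < b \<and> (\<forall>t. a < t \<longrightarrow> t < b \<longrightarrow> vsec P i t))"
    if i: "i < d" for i
  proof -
    have eq: "{x ! i | x. P x} = {t. vsec P i t}"
      unfolding vsec_def using l by blast
    have "dfn (\<lambda>e. (\<lambda>_. P) (sh e) (vc 0 e))" using P unfolding dv1_def .
    from ds1_section[OF dfn_vsec[OF this i]] have "ds1 (vsec P i)" .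
    have "infinite {t. vsec P i t} \<longleftrightarrow> (\<exists>a b. a < b \<and> (\<forall>t. a < t \<longrightarrow> t < b \<longrightarrow> vsec P i t))"
    proof
      assume "infinite {t. vsec P i t}"
      from infinite_interval[OF \<open>ds1 (vsec P i)\<close> this]
      show "\<exists>a b. a < b \<and> (\<forall>t. a < t \<longrightarrow> t < b \<longrightarrow> vsec P i t)" by metis
    next
      assume "\<exists>a b. a < b \<and> (\<forall>t. a < t \<longrightarrow> t < b \<longrightarrow> vsec P i t)"
      then obtain a b where "a < b" "\<forall>t. a < t \<longrightarrow> t < b \<longrightarrow> vsec P i t" by blast
      then show "infinite {t. vsec P i t}" using interval_infinite[of a b "vsec P i"] by simp
    qed
    then show ?thesis unfolding eq by blast
  qed
  then show ?thesis using finite_coords[OF l] by simp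
qed

text \<open>Finiteness of the fibres is a definable condition on the parameters; commensurability is
  definable for this reason.\<close>

lemma dfn_finite:
  assumes P: "dfn (\<lambda>e. P (sh e) (vc 0 e))" and l: "\<And>e x. P e x \<Longrightarrow> length x = d"
  shows "dfn (\<lambda>e. finite {x. P e x})"
proof -
  have "finite {x. P e x} \<longleftrightarrow>
    (\<forall>i<d. \<not> (\<exists>a b. a < b \<and> (\<forall>t. a < t \<longrightarrow> t < b \<longrightarrow> vsec (P e) i t)))" for e
    by (rule finite_coords_interval[OF dv1_section[OF P] l])
  moreover have "dfn (\<lambda>e. \<forall>i<d. \<not> (\<exists>a b. a < b \<and> (\<forall>t. a < t \<longrightarrow> t < b \<longrightarrow> vsec (P e) i t)))"
    by (intro dfn_rules dfn_let3[OF dfn_vsec[OF P]])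
  ultimately show ?thesis by simp
qed

end


section \<open>Uniformity and monotonicity in one variable\<close>

context omin
begin

definition dfun1 :: "('a \<Rightarrow> 'a) \<Rightarrow> bool" where
  "dfun1 f \<longleftrightarrow> dsc (\<lambda>e. f (sc 0 e))"

definition dfun2 :: "('a \<Rightarrow> 'a \<Rightarrow> 'a) \<Rightarrow> bool" where
  "dfun2 f \<longleftrightarrow> dsc (\<lambda>e. f (sc 0 e) (sc 1 e))"

lemma dfun1D: "dfun1 f \<Longrightarrow> dsc g \<Longrightarrow> dsc (\<lambda>e. f (g e))"
proof -
  assume f: "dfun1 f" and g: "dsc g"
  have "dfn (\<lambda>e. (\<lambda>e t. sc 0 e = f t) (sh e) (sc 0 e))"
    using f unfolding dfun1_def by (intro dfn_eq dsc_sc1)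
  from dfn_let[OF this dsc_sh[OF g]] have "dfn (\<lambda>e. sc 0 e = f (g (sh e)))" .
  then show ?thesis by (rule dsc_graph[where P = "\<lambda>e t. t = f (g e)"]) simp
qed

lemma dfun2D: "dfun2 f \<Longrightarrow> dsc g \<Longrightarrow> dsc h \<Longrightarrow> dsc (\<lambda>e. f (g e) (h e))"
proof -
  assume f: "dfun2 f" and g: "dsc g" and h: "dsc h"
  have "ds3 (\<lambda>x y z. z = f x y)"
    using f unfolding ds3_def dfun2_def by (intro dfn_eq dsc_sc)
  from ds3D[OF this dsc_sh[OF g] dsc_sh[OF h] dsc_sc] show ?thesis
    by (rule dsc_graph[where P = "\<lambda>e t. t = f (g e) (h e)"]) simp
qed

lemma sub_interval:
  assumes "a' < (b'::'a)" "\<And>t. a' < t \<Longrightarrow> t < b' \<Longrightarrow> a < t \<and> t < b"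
  shows "a \<le> a'" "b' \<le> b"
proof -
  show "a \<le> a'"
  proof (rule ccontr)
    assume "\<not> a \<le> a'"
    then have "a' < min a b'" using assms(1) by simp
    then obtain t where "a' < t" "t < min a b'" using dense by blast
    then show False using assms(2)[of t] by simp
  qed
  show "b' \<le> b"
  proof (rule ccontr)
    assume "\<not> b' \<le> b"
    then have "max b a' < b'" using assms(1) by simp
    then obtain t where "max b a' < t" "t < b'" using dense by blast
    then show False using assms(2)[of t] by simp
  qed
qed

text \<open>Exchanges quantifiers on a subinterval. If no single \<open>s\<close> served infinitely
  many \<open>t\<close>, each \<open>s\<close> that occurs would have a last \<open>t\<close>. Then
  near \<open>b\<close> every \<open>t\<close> has a bound that fails at all later points, and
  comparison with the bound \<open>s'\<close> of a fixed later \<open>t'\<close> shows that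
  \<open>s'\<close> serves a whole interval after all.\<close>

lemma uniform_bound:
  assumes P: "ds2 P" and ab: "a < b"
    and down: "\<And>t s s'. P t s \<Longrightarrow> 0 < s' \<Longrightarrow> s' \<le> s \<Longrightarrow> P t s'"
    and ex: "\<And>t. a < t \<Longrightarrow> t < b \<Longrightarrow> \<exists>s>0. P t s"
  obtains a' b' s where "a \<le> a'" "a' < b'" "b' \<le> b" "0 < s" "\<And>t. a' < t \<Longrightarrow> t < b' \<Longrightarrow> P t s"
proof (cases "\<exists>s>0. infinite {t. a < t \<and> t < b \<and> P t s}")
  case True
  then obtain s where s: "0 < s" "infinite {t. a < t \<and> t < b \<and> P t s}" by blast
  have "ds1 (\<lambda>t. a < t \<and> t < b \<and> P t s)"
    unfolding ds1_def by (intro dfn_rules ds2D[OF P])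
  from infinite_interval[OF this s(2)] obtain a' b' where
    "a' < b'" "\<And>t. a' < t \<Longrightarrow> t < b' \<Longrightarrow> a < t \<and> t < b \<and> P t s" by blast
  then show ?thesis using that[of a' b' s] sub_interval[of a' b' a b] s(1) by blast
next
  case False
  then have fin: "finite {t. a < t \<and> t < b \<and> P t s}" if "0 < s" for s using that by blast
  \<comment> \<open>Points with a bound that is valid there and at no later point.\<close>
  let ?M = "\<lambda>t. a < t \<and> t < b \<and> (\<exists>s. 0 < s \<and> P t s \<and> (\<forall>t'. t < t' \<longrightarrow> t' < b \<longrightarrow> \<not> P t' s))"
  have M: "ds1 ?M" unfolding ds1_def by (intro dfn_rules ds2D[OF P])
  have cof: "\<exists>t\<ge>t0. ?M t" if t0: "a < t0" "t0 < b" for t0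
  proof -
    obtain s where s: "0 < s" "P t0 s" using ex t0 by blast
    let ?S = "{t. a < t \<and> t < b \<and> P t s}"
    have "t0 \<in> ?S" using t0 s by simp
    then have m: "Max ?S \<in> ?S" "t0 \<le> Max ?S" using fin[OF s(1)] Max_in Max_ge by blast+
    moreover have "\<not> P t' s" if "Max ?S < t'" "t' < b" for t'
    proof
      assume "P t' s"
      then have "t' \<in> ?S" using that m by auto
      then show False using Max_ge[OF fin[OF s(1)]] that(1) by (meson not_le)
    qed
    ultimately show ?thesis using s(1) by blast
  qed
  obtain c where c: "c < b" "\<And>t. c < t \<Longrightarrow> t < b \<Longrightarrow> ?M t"
  proof (cases rule: germ_left[OF M, of b, consumes 0])
    case (2 c)
    have "max a c < b" using ab 2 by simp
    then obtain t0 where "max a c < t0" "t0 < b" using dense by blast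
    moreover from this obtain t where "t0 \<le> t" "?M t" using cof[of t0] by auto
    ultimately have False using 2(2)[of t] by simp
    then show ?thesis ..
  qed (use that in blast)
  obtain t' where t': "c < t'" "t' < b" using c(1) dense by blast
  then obtain s' where s': "0 < s'" "P t' s'" using c(2) by blast
  have "a < t \<and> t < b \<and> P t s'" if "c < t" "t < t'" for t
  proof -
    \<comment> \<open>The bound \<open>s\<close> of \<open>t\<close> fails at \<open>t'\<close>,
      where \<open>s'\<close> and everything smaller is valid; hence \<open>s\<close> is at least
      \<open>s'\<close> and \<open>s'\<close> is valid at \<open>t\<close>.\<close>
    obtain s where s: "0 < s" "P t s" "\<not> P t' s" using c(2)[of t] \<open>c < t\<close> \<open>t < t'\<close> t' by auto
    then have "s' \<le> s" using down[OF s'(2) s(1)] by (meson le_cases)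
    then show ?thesis using down[OF s(2) s'(1)] c(2)[of t] that t' by simp
  qed
  then have "infinite {t. a < t \<and> t < b \<and> P t s'}" using t'(1) by (rule interval_infinite[rotated])
  then show ?thesis using fin[OF s'(1)] by blast
qed

lemma interval_pigeonhole:
  assumes "finite K" "\<And>k. k \<in> K \<Longrightarrow> ds1 (P k)" "a < b" "\<And>t. a < t \<Longrightarrow> t < b \<Longrightarrow> \<exists>k\<in>K. P k t"
  obtains k a' b' where "k \<in> K" "a \<le> a'" "a' < b'" "b' \<le> b" "\<And>t. a' < t \<Longrightarrow> t < b' \<Longrightarrow> P k t"
proof -
  have "{a<..<b} \<subseteq> (\<Union>k\<in>K. {t. a < t \<and> t < b \<and> P k t})" using assms(4) by fastforce
  moreover have "infinite {a<..<b}" using assms(3) by (simp add: infinite_Ioo)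
  ultimately have "\<not> (\<forall>k\<in>K. finite {t. a < t \<and> t < b \<and> P k t})"
    using assms(1) by (meson finite_UN finite_subset)
  then obtain k where k: "k \<in> K" "infinite {t. a < t \<and> t < b \<and> P k t}" by blast
  have "ds1 (\<lambda>t. a < t \<and> t < b \<and> P k t)"
    unfolding ds1_def by (intro dfn_rules ds1D[OF assms(2)[OF k(1)]])
  from infinite_interval[OF this k(2)] obtain a' b' where
    "a' < b'" "\<And>t. a' < t \<Longrightarrow> t < b' \<Longrightarrow> a < t \<and> t < b \<and> P k t" by blast
  then show ?thesis using that[of k a' b'] k(1) sub_interval[of a' b' a b] by blast
qed

lemma germ_pigeonhole:
  assumes "finite K" "\<And>k. k \<in> K \<Longrightarrow> ds1 (P k)" "a < b" "\<And>t. a < t \<Longrightarrow> t < b \<Longrightarrow> \<exists>k\<in>K. P k t"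
  obtains k c where "k \<in> K" "a < c" "c \<le> b" "\<And>t. a < t \<Longrightarrow> t < c \<Longrightarrow> P k t"
proof -
  have "\<exists>c>a. (\<forall>t. a < t \<longrightarrow> t < c \<longrightarrow> P k t) \<or> (\<forall>t. a < t \<longrightarrow> t < c \<longrightarrow> \<not> P k t)" if "k \<in> K" for k
    by (cases rule: germ_right[OF assms(2)[OF that], of a, consumes 0]) blast+
  then obtain c where c: "\<And>k. k \<in> K \<Longrightarrow> c k > a"
      "\<And>k. k \<in> K \<Longrightarrow> (\<forall>t. a < t \<longrightarrow> t < c k \<longrightarrow> P k t) \<or> (\<forall>t. a < t \<longrightarrow> t < c k \<longrightarrow> \<not> P k t)"
    by metis
  let ?m = "Min (insert b (c ` K))"
  have m: "a < ?m" "?m \<le> b" "\<And>k. k \<in> K \<Longrightarrow> ?m \<le> c k" using assms(1,3) c(1) by auto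
  then obtain t where t: "a < t" "t < ?m" using dense by blast
  then obtain k where k: "k \<in> K" "P k t" using assms(4)[of t] m by auto
  have "P k t'" if "a < t'" "t' < ?m" for t'
    using c(2)[OF k(1)] k t that m(3)[OF k(1)] by (meson order_less_le_trans)
  then show ?thesis using that[of k ?m] k(1) m(1,2) by blast
qed

text \<open>For fixed \<open>s\<close> some colour holds for all \<open>t\<close> just to the right
  of \<open>s\<close>. Pigeonhole makes the colour independent of \<open>s\<close>,
  \<open>uniform_bound\<close> makes the length of the germ independent of \<open>s\<close>, and an
  interval no longer than that length is homogeneous.\<close>

lemma interval_ramsey:
  assumes K: "finite K" and Q: "\<And>k. k \<in> K \<Longrightarrow> ds2 (Q k)" and ab: "a < b"
    and ex: "\<And>s t. a < s \<Longrightarrow> s < t \<Longrightarrow> t < b \<Longrightarrow> \<exists>k\<in>K. Q k s t"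
  obtains k a' b' where "k \<in> K" "a \<le> a'" "a' < b'" "b' \<le> b"
    "\<And>s t. a' < s \<Longrightarrow> s < t \<Longrightarrow> t < b' \<Longrightarrow> Q k s t"
proof -
  let ?U = "\<lambda>k s h. \<forall>t. s < t \<longrightarrow> t < s + h \<longrightarrow> Q k s t"
  have U: "ds2 (?U k)" if "k \<in> K" for k
    unfolding ds2_def by (intro dfn_rules ds2D[OF Q[OF that]])
  have 1: "ds1 (\<lambda>s. \<exists>h. 0 < h \<and> ?U k s h)" if "k \<in> K" for k
    unfolding ds1_def by (intro dfn_rules ds2D[OF Q[OF that]])
  have 2: "\<exists>k\<in>K. \<exists>h. 0 < h \<and> ?U k s h" if s: "a < s" "s < b" for s
  proof -
    have 3: "ds1 (Q k s)" if "k \<in> K" for k unfolding ds1_def by (intro dfn_rules ds2D[OF Q[OF that]])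
    have 4: "\<exists>k\<in>K. Q k s t" if "s < t" "t < b" for t using ex s(1) that by blast
    obtain k c where "k \<in> K" "s < c" "\<And>t. s < t \<Longrightarrow> t < c \<Longrightarrow> Q k s t"
      by (rule germ_pigeonhole[where P = "\<lambda>k. Q k s", OF K 3 s(2) 4]) (assumption | (rule that; (assumption | blast)))+
    then show ?thesis by (intro bexI[of _ k] exI[of _ "c - s"]) auto
  qed
  obtain k a1 b1 where k: "k \<in> K" "a \<le> a1" "a1 < b1" "b1 \<le> b"
    "\<And>s. a1 < s \<Longrightarrow> s < b1 \<Longrightarrow> \<exists>h. 0 < h \<and> ?U k s h"
    by (rule interval_pigeonhole[where P = "\<lambda>k s. \<exists>h. 0 < h \<and> ?U k s h", OF K 1 ab 2]) (assumption | (rule that; (assumption | blast)))+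
  obtain a2 b2 h where h: "a1 \<le> a2" "a2 < b2" "b2 \<le> b1" "0 < h" "\<And>s. a2 < s \<Longrightarrow> s < b2 \<Longrightarrow> ?U k s h"
  proof (rule uniform_bound[OF U[OF k(1)] k(3) _ k(5)])
    fix s h h' assume U: "?U k s h" and h': "h' \<le> (h::'a)"
    show "?U k s h'"
    proof (intro allI impI)
      fix t assume "s < t" "t < s + h'"
      moreover have "s + h' \<le> s + h" using h' by simp
      ultimately show "Q k s t" using U by (meson order_less_le_trans)
    qed
  qed (assumption | (rule that; (assumption | blast)))+
  show ?thesis
  proof (rule that[of k a2 "min b2 (a2 + h)"])
    fix s t assume st: "a2 < s" "s < t" "t < min b2 (a2 + h)"
    then have "t < s + h" by (meson add_strict_right_mono less_trans min_less_iff_conj)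
    then show "Q k s t" using h(5)[of s] st by simp
  qed (use k h in auto)
qed

section \<open>Local monotonicity and continuity of definable functions\<close>

definition ty :: "nat \<Rightarrow> 'a \<Rightarrow> 'a \<Rightarrow> bool" where
  "ty m x y \<longleftrightarrow> (m = 0 \<and> x = y) \<or> (m = 1 \<and> x < y) \<or> (m = 2 \<and> y < x)"

text \<open>The types 0, 1 and 2 stand for constant, strictly increasing and strictly
  decreasing.\<close>

definition mt :: "nat \<Rightarrow> ('a \<Rightarrow> 'a) \<Rightarrow> 'a \<Rightarrow> 'a \<Rightarrow> bool" where
  "mt m f a b \<longleftrightarrow> (\<forall>s t. a < s \<longrightarrow> s < t \<longrightarrow> t < b \<longrightarrow> ty m (f s) (f t))"

definition cts :: "('a \<Rightarrow> 'a) \<Rightarrow> 'a \<Rightarrow> 'a \<Rightarrow> bool" where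
  "cts f a b \<longleftrightarrow> (\<forall>t h. a < t \<longrightarrow> t < b \<longrightarrow> 0 < h \<longrightarrow> (\<exists>u v. u < t \<and> t < v \<and>
     (\<forall>w. u < w \<longrightarrow> w < v \<longrightarrow> a < w \<longrightarrow> w < b \<longrightarrow> f t - h < f w \<and> f w < f t + h)))"

lemma dfn_ty: "dsc f \<Longrightarrow> dsc g \<Longrightarrow> dfn (\<lambda>e. ty m (f e) (g e))"
  unfolding ty_def by (intro dfn_rules)

lemma mt_sub: "mt m f a b \<Longrightarrow> a \<le> a' \<Longrightarrow> b' \<le> b \<Longrightarrow> mt m f a' b'"
  unfolding mt_def by (meson order_le_less_trans order_less_le_trans)

lemma cts_sub:
  assumes "cts f a b" "a \<le> a'" "b' \<le> b"
  shows "cts f a' b'"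
  unfolding cts_def
proof (intro allI impI)
  fix t h :: 'a assume th: "a' < t" "t < b'" "0 < h"
  then have "a < t" "t < b" using assms by auto
  then obtain u v where uv: "u < t" "t < v"
     "\<forall>w. u < w \<longrightarrow> w < v \<longrightarrow> a < w \<longrightarrow> w < b \<longrightarrow> f t - h < f w \<and> f w < f t + h"
    using assms(1) th(3) unfolding cts_def by blast
  moreover have "\<forall>w. u < w \<longrightarrow> w < v \<longrightarrow> a' < w \<longrightarrow> w < b' \<longrightarrow> f t - h < f w \<and> f w < f t + h"
    using uv(3) assms(2,3) by (meson order_le_less_trans order_less_le_trans)
  ultimately show "\<exists>u v. u < t \<and> t < v \<and>
     (\<forall>w. u < w \<longrightarrow> w < v \<longrightarrow> a' < w \<longrightarrow> w < b' \<longrightarrow> f t - h < f w \<and> f w < f t + h)" by blast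
qed

lemma cts_uminus:
  assumes "cts (\<lambda>t. - f t) a b"
  shows "cts f a b"
  unfolding cts_def
proof (intro allI impI)
  fix t h :: 'a assume th: "a < t" "t < b" "0 < h"
  then obtain u v where uv: "u < t" "t < v"
     "\<forall>w. u < w \<longrightarrow> w < v \<longrightarrow> a < w \<longrightarrow> w < b \<longrightarrow> - f t - h < - f w \<and> - f w < - f t + h"
    using assms unfolding cts_def by blast
  have "f t - h < f w \<and> f w < f t + h" if "- f t - h < - f w \<and> - f w < - f t + h" for w
    using that by (auto simp: algebra_simps)
  then show "\<exists>u v. u < t \<and> t < v \<and>
     (\<forall>w. u < w \<longrightarrow> w < v \<longrightarrow> a < w \<longrightarrow> w < b \<longrightarrow> f t - h < f w \<and> f w < f t + h)"
    using uv by blast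
qed

text \<open>The image of an injective function is infinite and contains an interval. On the preimage
  of a smaller interval the function is monotone and takes all intermediate values, hence is
  continuous.\<close>

lemma increasing_cts:
  assumes f: "dfun1 f" and ab: "a < b" and m: "mt 1 f a b"
  obtains a' b' where "a \<le> a'" "a' < b'" "b' \<le> b" "cts f a' b'"
proof -
  have mono: "f s < f t \<longleftrightarrow> s < t" if "a < s" "s < b" "a < t" "t < b" for s t
    using m that unfolding mt_def ty_def by (metis less_asym linorder_neqE_linordered_idom less_irrefl zero_neq_one
        one_eq_numeral_iff semiring_norm(85))
  let ?I = "\<lambda>y. \<exists>t. a < t \<and> t < b \<and> f t = y"
  have I: "ds1 ?I" unfolding ds1_def by (intro dfn_rules dfun1D[OF f])
  have "inj_on f {a<..<b}" using mono by (auto simp: inj_on_def) (metis linorder_neqE_linordered_idom less_irrefl)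
  then have "infinite (f ` {a<..<b})" using ab finite_imageD infinite_Ioo by blast
  moreover have "f ` {a<..<b} = {y. ?I y}" by auto
  ultimately have "infinite {y. ?I y}" by simp
  from infinite_interval[OF I this] obtain p q where pq: "p < q" "\<And>y. p < y \<Longrightarrow> y < q \<Longrightarrow> ?I y" by blast
  \<comment> \<open>Values strictly inside \<open>(p, q)\<close> are attained, so the smaller
    interval of values has ends of the form \<open>f \<alpha>\<close> and
    \<open>f \<beta>\<close>.\<close>
  obtain y1 where y1: "p < y1" "y1 < q" using pq(1) dense by blast
  obtain y2 where y2: "y1 < y2" "y2 < q" using y1(2) dense by blast
  obtain \<alpha> where \<alpha>: "a < \<alpha>" "\<alpha> < b" "f \<alpha> = y1" using pq(2) y1 by blast
  obtain \<beta> where \<beta>: "a < \<beta>" "\<beta> < b" "f \<beta> = y2" using pq(2)[of y2] y1 y2 by auto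
  have inv: "\<exists>t. \<alpha> < t \<and> t < \<beta> \<and> f t = y" if "y1 < y" "y < y2" for y
    using pq(2)[of y] that y1 y2 mono \<alpha> \<beta> by (metis less_trans)
  have "\<alpha> < \<beta>" using mono[of \<alpha> \<beta>] \<alpha> \<beta> y2 by simp
  have "cts f \<alpha> \<beta>"
    unfolding cts_def
  proof (intro allI impI)
    fix t h assume t: "\<alpha> < t" "t < \<beta>" and h: "0 < (h::'a)"
    have tab: "a < t" "t < b" using t \<alpha> \<beta> by auto
    have "y1 < f t" "f t < y2" using mono[of \<alpha> t] mono[of t \<beta>] t \<alpha> \<beta> tab by simp_all
    then have lr: "max y1 (f t - h) < f t" "f t < min y2 (f t + h)" using h by auto
    obtain yl where yl: "max y1 (f t - h) < yl" "yl < f t" using dense[OF lr(1)] by blast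
    obtain yr where yr: "f t < yr" "yr < min y2 (f t + h)" using dense[OF lr(2)] by blast
    have "y1 < yl" "yl < y2" "y1 < yr" "yr < y2" using yl yr \<open>y1 < f t\<close> \<open>f t < y2\<close> by auto
    then obtain u v where u: "\<alpha> < u" "u < \<beta>" "f u = yl" and v: "\<alpha> < v" "v < \<beta>" "f v = yr"
      using inv[of yl] inv[of yr] by blast
    have uv: "a < u" "u < b" "a < v" "v < b" using u v \<alpha> \<beta> by auto
    have "u < t" "t < v" using mono[of u t] mono[of t v] uv tab u v yl yr by simp_all
    moreover have "f t - h < f w \<and> f w < f t + h" if w: "u < w" "w < v" for w
    proof -
      have wab: "a < w" "w < b" using w uv by auto
      have "yl < f w" "f w < yr" using mono[of u w] mono[of w v] wab uv w u v by simp_all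
      then show ?thesis using yl yr by auto
    qed
    ultimately show "\<exists>u v. u < t \<and> t < v \<and>
       (\<forall>w. u < w \<longrightarrow> w < v \<longrightarrow> \<alpha> < w \<longrightarrow> w < \<beta> \<longrightarrow> f t - h < f w \<and> f w < f t + h)" by blast
  qed
  then show ?thesis using that[of \<alpha> \<beta>] \<alpha> \<beta> \<open>\<alpha> < \<beta>\<close> by simp
qed

text \<open>A local form of the monotonicity theorem: the order type of \<open>(f s, f t)\<close> is
  a colouring of pairs by three colours, and a homogeneous subinterval gives monotonicity.
  Continuity follows from \<open>increasing_cts\<close>, after a sign change in the decreasing
  case.\<close>

lemma monotonicity:
  assumes f: "dfun1 f" and ab: "a < b"
  obtains m a' b' where "m \<in> {0, 1, 2}" "a \<le> a'" "a' < b'" "b' \<le> b" "mt m f a' b'" "cts f a' b'"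
proof -
  have 1: "\<exists>m\<in>{0, 1, 2}. ty m (f s) (f t)" for s t by (auto simp: ty_def)
  have 2: "ds2 (\<lambda>s t. ty m (f s) (f t))" for m
    unfolding ds2_def by (intro dfn_ty dfun1D[OF f] dfn_rules)
  have 3: "finite {0, 1, 2::nat}" by simp
  obtain m a1 b1 where m: "m \<in> {0, 1, 2}" "a \<le> a1" "a1 < b1" "b1 \<le> b"
    "\<And>s t. a1 < s \<Longrightarrow> s < t \<Longrightarrow> t < b1 \<Longrightarrow> ty m (f s) (f t)"
    by (rule interval_ramsey[where Q = "\<lambda>m s t. ty m (f s) (f t)", OF 3 2 ab 1])
      (assumption | (rule that; (assumption | blast)))+
  have mm: "mt m f a1 b1" unfolding mt_def using m(5) by blast
  consider "m = 0" | "m = 1" | "m = 2" using m(1) by auto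
  then show ?thesis
  proof cases
    case 1
    have eq: "f s = f t" if "a1 < s" "s < b1" "a1 < t" "t < b1" for s t
      using m(5)[of s t] m(5)[of t s] that 1 unfolding ty_def by (cases s t rule: linorder_cases) auto
    have "cts f a1 b1"
      unfolding cts_def
    proof (intro allI impI)
      fix t h assume t: "a1 < t" "t < b1" and h: "0 < (h::'a)"
      have "\<forall>w. t - 1 < w \<longrightarrow> w < t + 1 \<longrightarrow> a1 < w \<longrightarrow> w < b1 \<longrightarrow> f t - h < f w \<and> f w < f t + h"
        using eq[OF t] h by (metis diff_less_eq less_add_same_cancel1)
      then show "\<exists>u v. u < t \<and> t < v \<and>
          (\<forall>w. u < w \<longrightarrow> w < v \<longrightarrow> a1 < w \<longrightarrow> w < b1 \<longrightarrow> f t - h < f w \<and> f w < f t + h)"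
        by (intro exI[of _ "t - 1"] exI[of _ "t + 1"]) (auto simp: less_add_one)
    qed
    then show ?thesis using that[of m a1 b1] m mm by blast
  next
    case 2
    then obtain a' b' where "a1 \<le> a'" "a' < b'" "b' \<le> b1" "cts f a' b'"
      using increasing_cts[OF f m(3)] mm by blast
    then show ?thesis using that[of m a' b'] m mt_sub[OF mm] by (meson order_trans)
  next
    case 3
    have f': "dfun1 (\<lambda>t. - f t)" using f unfolding dfun1_def by (rule dsc_uminus)
    have "mt 1 (\<lambda>t. - f t) a1 b1" using mm 3 unfolding mt_def ty_def by auto
    then obtain a' b' where "a1 \<le> a'" "a' < b'" "b' \<le> b1" "cts (\<lambda>t. - f t) a' b'"
      using increasing_cts[OF f' m(3)] by blast
    then show ?thesis using that[of m a' b'] m mt_sub[OF mm] cts_uminus by (meson order_trans)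
  qed
qed

text \<open>\<open>uniform_bound\<close> provides a common length \<open>s\<close> of the intervals.
  Their left ends, chosen definably, vary continuously over a smaller interval, so neighbouring
  intervals overlap in a common part.\<close>

lemma uniform_interval:
  assumes P: "ds3 P" and ab: "a < b"
    and sub: "\<And>x p q p' q'. P x p q \<Longrightarrow> p \<le> p' \<Longrightarrow> p' < q' \<Longrightarrow> q' \<le> q \<Longrightarrow> P x p' q'"
    and ex: "\<And>x. a < x \<Longrightarrow> x < b \<Longrightarrow> \<exists>p q. p < q \<and> P x p q"
  obtains a' b' p q where "a \<le> a'" "a' < b'" "b' \<le> b" "p < q" "\<And>x. a' < x \<Longrightarrow> x < b' \<Longrightarrow> P x p q"
proof -
  let ?S = "\<lambda>x s. \<exists>p. P x p (p + s)"
  have S: "ds2 ?S" unfolding ds2_def by (intro dfn_rules ds3D[OF P])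
  obtain a1 b1 s where s: "a \<le> a1" "a1 < b1" "b1 \<le> b" "0 < s" "\<And>x. a1 < x \<Longrightarrow> x < b1 \<Longrightarrow> ?S x s"
  proof (rule uniform_bound[OF S ab])
    fix x s s' assume "\<exists>p. P x p (p + s)" and s': "0 < (s'::'a)" "s' \<le> s"
    then obtain p where "P x p (p + s)" by blast
    then have "P x p (p + s')" by (rule sub) (use s' in auto)
    then show "\<exists>p. P x p (p + s')" ..
  next
    fix x assume "a < x" "x < b"
    then obtain p q where "p < q" "P x p q" using ex by blast
    moreover have "p + (q - p) = q" by simp
    ultimately have "0 < q - p \<and> P x p (p + (q - p))" by simp
    then show "\<exists>s>0. \<exists>p. P x p (p + s)" by blast
  qed (assumption | (rule that; (assumption | blast)))+
  define f where "f x = sel (\<lambda>p. P x p (p + s))" for x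
  have f: "dfun1 f"
    unfolding dfun1_def f_def by (intro dsc_sel dfn_rules ds3D[OF P])
  have fP: "P x (f x) (f x + s)" if x: "a1 < x" "x < b1" for x
  proof -
    obtain p where "P x p (p + s)" using s(5)[OF x] by blast
    moreover have "ds1 (\<lambda>p. P x p (p + s))" unfolding ds1_def by (intro dfn_rules ds3D[OF P])
    ultimately show ?thesis unfolding f_def using sel_in[of "\<lambda>p. P x p (p + s)"] by blast
  qed
  obtain m a2 b2 where ab2: "a1 \<le> a2" "a2 < b2" "b2 \<le> b1" "cts f a2 b2"
    using monotonicity[OF f s(2)] by metis
  obtain x0 where x0: "a2 < x0" "x0 < b2" using ab2(2) dense by blast
  have s4: "0 < s / 4" using s(4) by simp
  obtain u v where uv: "u < x0" "x0 < v"
     "\<forall>w. u < w \<longrightarrow> w < v \<longrightarrow> a2 < w \<longrightarrow> w < b2 \<longrightarrow> f x0 - s / 4 < f w \<and> f w < f x0 + s / 4"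
    using ab2(4) x0 s4 unfolding cts_def by blast
  show ?thesis
  \<comment> \<open>For \<open>x\<close> near \<open>x0\<close> the left end \<open>f x\<close> is
    within \<open>s / 4\<close> of \<open>f x0\<close>, so the second quarter after
    \<open>f x0\<close> lies between \<open>f x\<close> and \<open>f x + s\<close>.\<close>
  proof (rule that[of "max u a2" "min v b2" "f x0 + s / 4" "f x0 + s / 4 + s / 4"])
    fix x assume x: "max u a2 < x" "x < min v b2"
    then have b: "f x0 - s / 4 < f x" "f x < f x0 + s / 4" using uv(3) by auto
    have "P x (f x) (f x + s)" using fP x ab2 by auto
    then show "P x (f x0 + s / 4) (f x0 + s / 4 + s / 4)"
    proof (rule sub)
      have "f x0 + s / 4 + s / 4 = f x0 - s / 4 + (s / 4 + s / 4 + s / 4)" by simp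
      also have "\<dots> \<le> f x + s" using b(1) s4 by (intro add_mono) auto
      finally show "f x0 + s / 4 + s / 4 \<le> f x + s" .
    qed (use b s4 in auto)
  qed (use s ab2 uv x0 s4 in auto)
qed

end


section \<open>Definable boxes in sets of dimension one\<close>

context omin
begin

definition dvfun1 :: "('a \<Rightarrow> 'a list) \<Rightarrow> bool" where
  "dvfun1 f \<longleftrightarrow> dvec (\<lambda>e. f (sc 0 e))"

definition dvfun2 :: "('a \<Rightarrow> 'a \<Rightarrow> 'a list) \<Rightarrow> bool" where
  "dvfun2 f \<longleftrightarrow> dvec (\<lambda>e. f (sc 0 e) (sc 1 e))"

definition dvvfun2 :: "('a list \<Rightarrow> 'a list \<Rightarrow> 'a list) \<Rightarrow> bool" where
  "dvvfun2 f \<longleftrightarrow> dvec (\<lambda>e. f (vc 0 e) (vc 1 e))"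

lemma dvfun1_length: "dvfun1 f \<Longrightarrow> length (f t) = d"
  using dvec_length[of "\<lambda>e. f (sc 0 e)" "env (\<lambda>_. []) (\<lambda>_. t)"] by (simp add: dvfun1_def)

lemma dvfun2_length: "dvfun2 f \<Longrightarrow> length (f s t) = d"
  using dvec_length[of "\<lambda>e. f (sc 0 e) (sc 1 e)" "env (\<lambda>_. []) (\<lambda>n. if n = 0 then s else t)"]
  by (simp add: dvfun2_def)

lemma dvfun1_nth: "dvfun1 f \<Longrightarrow> i < d \<Longrightarrow> dfun1 (\<lambda>t. f t ! i)"
  unfolding dvfun1_def dfun1_def dvec_def by blast

lemma dvfun2_nth: "dvfun2 f \<Longrightarrow> i < d \<Longrightarrow> dfun2 (\<lambda>s t. f s t ! i)"
  unfolding dvfun2_def dfun2_def dvec_def by blast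

lemma dvfun1D: "dvfun1 f \<Longrightarrow> dsc g \<Longrightarrow> dvec (\<lambda>e. f (g e))"
  unfolding dvec_def using dvfun1_length dfun1D[OF dvfun1_nth] by blast

lemma dvfun2D: "dvfun2 f \<Longrightarrow> dsc g \<Longrightarrow> dsc h \<Longrightarrow> dvec (\<lambda>e. f (g e) (h e))"
  unfolding dvec_def using dvfun2_length dfun2D[OF dvfun2_nth] by blast

lemma dvvfun2D:
  assumes f: "dvvfun2 f" and g: "dvec g" and h: "dvec h"
  shows "dvec (\<lambda>e. f (g e) (h e))"
  unfolding dvec_def
proof (intro conjI allI impI)
  fix e
  show "length (f (g e) (h e)) = d"
    using dvec_length[OF f[unfolded dvvfun2_def], of "env (\<lambda>n. if n = 0 then g e else h e) (\<lambda>_. 0)"]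
    by (simp add: dvec_length[OF g] dvec_length[OF h])
next
  fix i assume i: "i < d"
  have "dfn (\<lambda>e. sc 0 e = f (vc 0 e) (vc 1 e) ! i)"
    using f i unfolding dvvfun2_def dvec_def by (intro dfn_eq dsc_sc) blast
  from dfn_pick[OF this dvec_sh[OF g] dvec_sh[OF h] dvec_sh[OF h] dsc_sc[of 0] dsc_sc[of 0] dsc_sc[of 0] dsc_sc[of 0]]
  have "dfn (\<lambda>e. sc 0 e = f (g (sh e)) (h (sh e)) ! i)"
    by (simp add: dvec_length[OF g] dvec_length[OF h])
  then show "dsc (\<lambda>e. f (g e) (h e) ! i)"
    by (rule dsc_graph[where P = "\<lambda>e t. t = f (g e) (h e) ! i"]) simp
qed

lemma dfun2_swap: assumes f: "dfun2 f" shows "dfun2 (\<lambda>s t. f t s)"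
  unfolding dfun2_def[of "\<lambda>s t. f t s"] by (intro dfun2D[OF f] dsc_sc)

lemma dvfun2_swap: assumes f: "dvfun2 f" shows "dvfun2 (\<lambda>s t. f t s)"
  unfolding dvfun2_def[of "\<lambda>s t. f t s"] by (intro dvfun2D[OF f] dsc_sc)

lemma dsc_sh2: "dsc f \<Longrightarrow> dsc (\<lambda>e. f (sh (sh e)))"
  by (rule dsc_sh[OF dsc_sh])

lemma dsc_sh3: "dsc f \<Longrightarrow> dsc (\<lambda>e. f (sh (sh (sh e))))"
  by (rule dsc_sh[OF dsc_sh2])

lemma dsc_sh4: "dsc f \<Longrightarrow> dsc (\<lambda>e. f (sh (sh (sh (sh e)))))"
  by (rule dsc_sh[OF dsc_sh3])

lemma dsc_sh5: "dsc f \<Longrightarrow> dsc (\<lambda>e. f (sh (sh (sh (sh (sh e))))))"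
  by (rule dsc_sh[OF dsc_sh4])

lemmas dsc_shifts = dsc_sh dsc_sh2 dsc_sh3 dsc_sh4 dsc_sh5

lemma dfn_mt:
  assumes f: "dfun2 f" and x: "dsc x" and p: "dsc p" and q: "dsc q"
  shows "dfn (\<lambda>e. mt m (f (x e)) (p e) (q e))"
  unfolding mt_def
  by (intro dfn_rules dfn_ty dfun2D[OF f] dsc_shifts[OF x] dsc_shifts[OF p] dsc_shifts[OF q])

lemma dfn_cts:
  assumes f: "dfun2 f" and x: "dsc x" and p: "dsc p" and q: "dsc q"
  shows "dfn (\<lambda>e. cts (f (x e)) (p e) (q e))"
  unfolding cts_def
  by (intro dfn_rules dfun2D[OF f] dsc_shifts[OF x] dsc_shifts[OF p] dsc_shifts[OF q])

text \<open>Each section has a monotone continuous stretch; pigeonhole makes its type independent of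
  \<open>x\<close>, and \<open>uniform_interval\<close> makes the stretch itself independent of
  \<open>x\<close>.\<close>

lemma section_types:
  assumes f: "dfun2 f" and ab: "a < b" and ce: "c < e"
  shows "\<exists>m a' b' c' e'. a \<le> a' \<and> a' < b' \<and> b' \<le> b \<and> c \<le> c' \<and> c' < e' \<and> e' \<le> e \<and>
    (\<forall>x. a' < x \<longrightarrow> x < b' \<longrightarrow> mt m (f x) c' e' \<and> cts (f x) c' e')"
proof -
  let ?P = "\<lambda>m x p q. c \<le> p \<and> q \<le> e \<and> mt m (f x) p q \<and> cts (f x) p q"
  have P: "ds3 (?P m)" for m unfolding ds3_def by (intro dfn_rules dfn_mt[OF f] dfn_cts[OF f])
  have 1: "ds1 (\<lambda>x. \<exists>p q. p < q \<and> ?P m x p q)" for m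
    unfolding ds1_def by (intro dfn_rules dfn_mt[OF f] dfn_cts[OF f])
  have 2: "\<exists>m\<in>{0,1,2::nat}. \<exists>p q. p < q \<and> ?P m x p q" for x
  proof -
    have "dfun1 (f x)" unfolding dfun1_def by (intro dfun2D[OF f] dfn_rules)
    from monotonicity[OF this ce] obtain m p q where "m \<in> {0,1,2}" "c \<le> p" "p < q" "q \<le> e" "mt m (f x) p q" "cts (f x) p q"
      by metis
    then show ?thesis by blast
  qed
  have 3: "finite {0,1,2::nat}" by simp
  obtain m a1 b1 where m: "a \<le> a1" "a1 < b1" "b1 \<le> b" "\<forall>x. a1 < x \<longrightarrow> x < b1 \<longrightarrow> (\<exists>p q. p < q \<and> ?P m x p q)"
    by (rule interval_pigeonhole[where P = "\<lambda>m x. \<exists>p q. p < q \<and> ?P m x p q", OF 3 1 ab 2])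
      (assumption | (rule that; (assumption | blast)))+
  have m4: "\<exists>p q. p < q \<and> ?P m x p q" if "a1 < x" "x < b1" for x using m(4) that by blast
  have sub: "?P m x p' q'" if "?P m x p q" "p \<le> p'" "p' < q'" "q' \<le> q" for x p q p' q'
    using that mt_sub[of m "f x" p q p' q'] cts_sub[of "f x" p q p' q'] by auto
  obtain a' b' p q where "a1 \<le> a'" "a' < b'" "b' \<le> b1" "p < q" "\<forall>x. a' < x \<longrightarrow> x < b' \<longrightarrow> ?P m x p q"
    by (rule uniform_interval[where P = "?P m", OF P m(2) sub m4])
      (assumption | (rule that; (assumption | blast)))+
  moreover from this obtain x where "a' < x" "x < b'" using dense by blast
  ultimately show ?thesis using m by (intro exI[of _ m] exI[of _ a'] exI[of _ b'] exI[of _ p] exI[of _ q]) auto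
qed

definition typed_on :: "('a \<Rightarrow> 'a \<Rightarrow> 'a) \<Rightarrow> nat \<Rightarrow> nat \<Rightarrow> 'a \<Rightarrow> 'a \<Rightarrow> 'a \<Rightarrow> 'a \<Rightarrow> bool" where
  "typed_on f m n a b c e \<longleftrightarrow>
     (\<forall>y. c < y \<longrightarrow> y < e \<longrightarrow> mt m (\<lambda>x. f x y) a b \<and> cts (\<lambda>x. f x y) a b) \<and>
     (\<forall>x. a < x \<longrightarrow> x < b \<longrightarrow> mt n (f x) c e \<and> cts (f x) c e)"

lemma typed_on_sub:
  assumes "typed_on f m n a b c e" "a \<le> a'" "b' \<le> b" "c \<le> c'" "e' \<le> e"
  shows "typed_on f m n a' b' c' e'"
  unfolding typed_on_def
proof (intro conjI allI impI)
  fix y assume "c' < y" "y < e'"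
  then have "mt m (\<lambda>x. f x y) a b \<and> cts (\<lambda>x. f x y) a b"
    using assms unfolding typed_on_def by (meson order_le_less_trans order_less_le_trans)
  then show "mt m (\<lambda>x. f x y) a' b'" "cts (\<lambda>x. f x y) a' b'"
    using mt_sub cts_sub assms(2,3) by blast+
next
  fix x assume "a' < x" "x < b'"
  then have "mt n (f x) c e \<and> cts (f x) c e"
    using assms unfolding typed_on_def by (meson order_le_less_trans order_less_le_trans)
  then show "mt n (f x) c' e'" "cts (f x) c' e'"
    using mt_sub cts_sub assms(4,5) by blast+
qed

text \<open>\<open>section_types\<close> is applied in each variable in turn; shrinking the box a
  second time keeps what was obtained first.\<close>

lemma box_types:
  assumes f: "dfun2 f" and ab: "a < b" and ce: "c < e"
  shows "\<exists>m n a' b' c' e'. a \<le> a' \<and> a' < b' \<and> b' \<le> b \<and> c \<le> c' \<and> c' < e' \<and> e' \<le> e \<and>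
    typed_on f m n a' b' c' e'"
proof -
  obtain n a1 b1 c1 e1 where 1: "a \<le> a1" "a1 < b1" "b1 \<le> b" "c \<le> c1" "c1 < e1" "e1 \<le> e"
    "\<forall>x. a1 < x \<longrightarrow> x < b1 \<longrightarrow> mt n (f x) c1 e1 \<and> cts (f x) c1 e1"
    using section_types[OF f ab ce] by blast
  obtain m a2 b2 c2 e2 where 2: "a1 \<le> a2" "a2 < b2" "b2 \<le> b1" "c1 \<le> c2" "c2 < e2" "e2 \<le> e1"
    "\<forall>y. c2 < y \<longrightarrow> y < e2 \<longrightarrow> mt m (\<lambda>x. f x y) a2 b2 \<and> cts (\<lambda>x. f x y) a2 b2"
    using section_types[OF dfun2_swap[OF f] 1(5) 1(2)] by blast
  have "typed_on f m n a2 b2 c2 e2"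
    unfolding typed_on_def
  proof (rule conjI[OF 2(7)], intro allI impI)
    fix x assume "a2 < x" "x < b2"
    then have "mt n (f x) c1 e1 \<and> cts (f x) c1 e1" using 1 2 by auto
    then show "mt n (f x) c2 e2 \<and> cts (f x) c2 e2" using mt_sub cts_sub 2(4,6) by blast
  qed
  then show ?thesis
    using 1(1-6) 2(1-6) by (intro exI[of _ m] exI[of _ n] exI[of _ a2] exI[of _ b2] exI[of _ c2] exI[of _ e2]) auto
qed

lemma box_types_all:
  assumes f: "dvfun2 F" and ab: "a < b" and ce: "c < e"
  shows "\<exists>m n a' b' c' e'. a \<le> a' \<and> a' < b' \<and> b' \<le> b \<and> c \<le> c' \<and> c' < e' \<and> e' \<le> e \<and>
    (\<forall>i<d. typed_on (\<lambda>s t. F s t ! i) (m i) (n i) a' b' c' e')"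
proof -
  have "k \<le> d \<Longrightarrow> \<exists>m n a' b' c' e'. a \<le> a' \<and> a' < b' \<and> b' \<le> b \<and> c \<le> c' \<and> c' < e' \<and> e' \<le> e \<and>
    (\<forall>i<k. typed_on (\<lambda>s t. F s t ! i) (m i) (n i) a' b' c' e')" for k
  proof (induction k)
    case 0
    show ?case using ab ce by blast
  next
    case (Suc k)
    then have k: "k < d" "k \<le> d" by auto
    from Suc.IH[OF k(2)] obtain m n a1 b1 c1 e1 where 1: "a \<le> a1" "a1 < b1" "b1 \<le> b" "c \<le> c1" "c1 < e1" "e1 \<le> e"
      "\<forall>i<k. typed_on (\<lambda>s t. F s t ! i) (m i) (n i) a1 b1 c1 e1"
      by blast
    from box_types[OF dvfun2_nth[OF f k(1)] 1(2,5)]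
    obtain m' n' a2 b2 c2 e2 where 2: "a1 \<le> a2" "a2 < b2" "b2 \<le> b1" "c1 \<le> c2" "c2 < e2" "e2 \<le> e1"
      "typed_on (\<lambda>s t. F s t ! k) m' n' a2 b2 c2 e2" by blast
    have "typed_on (\<lambda>s t. F s t ! i) ((m(k := m')) i) ((n(k := n')) i) a2 b2 c2 e2" if "i < Suc k" for i
    proof (cases "i = k")
      case True
      then show ?thesis using 2(7) by simp
    next
      case False
      then show ?thesis
        using typed_on_sub[OF 1(7)[rule_format, of i] 2(1,3,4,6)] that by simp
    qed
    then show ?case
      using 1(1-6) 2(1-6) by (intro exI[of _ "m(k := m')"] exI[of _ "n(k := n')"] exI[of _ a2] exI[of _ b2] exI[of _ c2] exI[of _ e2]) auto
  qed
  from this[of d] show ?thesis by simp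
qed

lemma ctsD:
  assumes "cts f a b" "a < t" "t < b" "0 < h"
  shows "\<exists>u v. u < t \<and> t < v \<and> (\<forall>w. u < w \<longrightarrow> w < v \<longrightarrow> a < w \<longrightarrow> w < b \<longrightarrow> f t - h < f w \<and> f w < f t + h)"
  using assms(1)[unfolded cts_def, rule_format, OF assms(2-4)] .

text \<open>Separate continuity is enough because \<open>f u'\<close> is monotone: its value at
  \<open>v'\<close> lies between those at two fixed points \<open>v1 < v < v2\<close>, and these are
  controlled by continuity in the first variable.\<close>

lemma joint_continuity:
  assumes f: "typed_on f m n a b c e" and u: "a < u" "u < b" and v: "c < v" "v < e" and h: "0 < h"
  shows "\<exists>\<delta>>0. \<forall>u' v'. a < u' \<longrightarrow> u' < b \<longrightarrow> c < v' \<longrightarrow> v' < e \<longrightarrow> \<bar>u' - u\<bar> < \<delta> \<longrightarrow> \<bar>v' - v\<bar> < \<delta> \<longrightarrow>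
    \<bar>f u' v' - f u v\<bar> < h"
proof -
  have h2: "0 < h / 2" using h by simp
  have cu: "cts (f u) c e" using f u unfolding typed_on_def by blast
  obtain p q where pq: "p < v" "v < q"
    "\<forall>w. p < w \<longrightarrow> w < q \<longrightarrow> c < w \<longrightarrow> w < e \<longrightarrow> f u v - h / 2 < f u w \<and> f u w < f u v + h / 2"
    using ctsD[OF cu v h2] by blast
  have "max p c < v" "v < min q e" using pq(1,2) v by simp_all
  then obtain v1 where v1: "max p c < v1" "v1 < v" using dense[of "max p c" v] by blast
  obtain v2 where v2: "v < v2" "v2 < min q e" using dense[OF \<open>v < min q e\<close>] by blast
  have near: "f u v - h / 2 < f u v1 \<and> f u v1 < f u v + h / 2" "f u v - h / 2 < f u v2 \<and> f u v2 < f u v + h / 2"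
    using pq(3)[rule_format, of v1] pq(3)[rule_format, of v2] v1 v2 v pq(1,2) by simp_all
  have c12: "cts (\<lambda>x. f x v1) a b" "cts (\<lambda>x. f x v2) a b" using f[unfolded typed_on_def, THEN conjunct1, rule_format, of v1]
      f[unfolded typed_on_def, THEN conjunct1, rule_format, of v2] v1 v2 v by simp_all
  obtain p1 q1 where 1: "p1 < u" "u < q1"
    "\<forall>w. p1 < w \<longrightarrow> w < q1 \<longrightarrow> a < w \<longrightarrow> w < b \<longrightarrow> f u v1 - h / 2 < f w v1 \<and> f w v1 < f u v1 + h / 2"
    using ctsD[OF c12(1) u h2] by blast
  obtain p2 q2 where 2: "p2 < u" "u < q2"
    "\<forall>w. p2 < w \<longrightarrow> w < q2 \<longrightarrow> a < w \<longrightarrow> w < b \<longrightarrow> f u v2 - h / 2 < f w v2 \<and> f w v2 < f u v2 + h / 2"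
    using ctsD[OF c12(2) u h2] by blast
  \<comment> \<open>Keeps \<open>u'\<close> inside both neighbourhoods of \<open>u\<close> and
    \<open>v'\<close> strictly between \<open>v1\<close> and \<open>v2\<close>.\<close>
  let ?d = "Min {u - p1, q1 - u, u - p2, q2 - u, v - v1, v2 - v}"
  have "0 < ?d" using 1(1,2) 2(1,2) v1(2) v2(1) by simp
  moreover have "\<bar>f u' v' - f u v\<bar> < h"
    if B: "a < u'" "u' < b" "c < v'" "v' < e" "\<bar>u' - u\<bar> < ?d" "\<bar>v' - v\<bar> < ?d" for u' v'
  proof -
    have U: "p1 < u'" "u' < q1" "p2 < u'" "u' < q2" "v1 < v'" "v' < v2"
    proof -
      have m: "?d \<le> u - p1" "?d \<le> q1 - u" "?d \<le> u - p2" "?d \<le> q2 - u" "?d \<le> v - v1" "?d \<le> v2 - v"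
        by (intro Min_le; simp)+
      have "u' - u < ?d" "- (u' - u) < ?d" "v' - v < ?d" "- (v' - v) < ?d"
        using B(5,6) unfolding abs_less_iff by blast+
      then show "p1 < u'" "u' < q1" "p2 < u'" "u' < q2" "v1 < v'" "v' < v2" using m by linarith+
    qed
    have A: "f u v1 - h / 2 < f u' v1 \<and> f u' v1 < f u v1 + h / 2"
      using 1(3)[rule_format, OF U(1,2) B(1,2)] .
    have B': "f u v2 - h / 2 < f u' v2 \<and> f u' v2 < f u v2 + h / 2"
      using 2(3)[rule_format, OF U(3,4) B(1,2)] .
    have A1: "f u v - h < f u' v1" "f u' v1 < f u v + h" using A near(1) by linarith+
    have B1: "f u v - h < f u' v2" "f u' v2 < f u v + h" using B' near(2) by linarith+
    have mt: "mt n (f u') c e" using f B(1,2) unfolding typed_on_def by blast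
    have "c < v1" "v2 < e" using v1 v2 by simp_all
    then have "ty n (f u' v1) (f u' v')" "ty n (f u' v') (f u' v2)"
      using mt[unfolded mt_def, rule_format, of v1 v'] mt[unfolded mt_def, rule_format, of v' v2] U(5,6) B(3,4)
      by simp_all
    then have "f u v - h < f u' v'" "f u' v' < f u v + h"
      using A1 B1 unfolding ty_def by (elim disjE conjE; linarith)+
    then show ?thesis unfolding abs_less_iff by linarith
  qed
  ultimately show ?thesis by blast
qed

section \<open>Images of boxes as cells\<close>

definition image_box :: "('a \<Rightarrow> 'a \<Rightarrow> 'a list) \<Rightarrow> 'a \<Rightarrow> 'a \<Rightarrow> 'a \<Rightarrow> 'a \<Rightarrow> nat \<Rightarrow> 'a list set" where
  "image_box F a b c e k = {take k (F u v) | u v. a < u \<and> u < b \<and> c < v \<and> v < e}"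

lemma definable_image_box:
  assumes F: "dvfun2 F" and h: "dfun2 h" and k: "k \<le> d"
  shows "definable R (Suc k) {take k (F u v) @ [h u v] | u v. a < u \<and> u < b \<and> c < v \<and> v < e}"
proof -
  have D: "dfn (\<lambda>e'. \<exists>u v. ((a < u \<and> u < b) \<and> (c < v \<and> v < e)) \<and> (\<forall>l<k. e' l = F u v ! l) \<and> e' k = h u v)"
    using k by (intro dfn_rules dsc_sh[OF dsc_sh[OF dsc_var]] dvfun2D[OF F] dfun2D[OF h]) auto
  have "(\<exists>u v. ((a < u \<and> u < b) \<and> (c < v \<and> v < e)) \<and> (\<forall>l<k. e' l = F u v ! l) \<and> e' k = h u v) \<longleftrightarrow>
    map e' [0..<Suc k] \<in> {take k (F u v) @ [h u v] | u v. a < u \<and> u < b \<and> c < v \<and> v < e}" for e'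
  proof -
    have "(\<forall>l<k. e' l = F u v ! l) \<longleftrightarrow> map e' [0..<k] = take k (F u v)" for u v
      using dvfun2_length[OF F] k by (auto simp: list_eq_iff_nth_eq)
    then show ?thesis by auto
  qed
  then show ?thesis
    using D dvfun2_length[OF F] k unfolding definable_def dfn_def by auto
qed

text \<open>The cell is built one coordinate at a time. Coordinates \<open>i\<close> and
  \<open>j\<close> contribute bands; every other coordinate is a continuous function of the
  parameters that can be read off from earlier coordinates, and contributes a graph.\<close>

lemma image_box_cell:
  assumes F: "dvfun2 F" and ab: "a < b" and ce: "c < e" and ij: "i < j" "j < d"
    and Fi: "\<And>u v. a < u \<Longrightarrow> u < b \<Longrightarrow> c < v \<Longrightarrow> v < e \<Longrightarrow> F u v ! i = u"
    and Fj: "\<And>u v. a < u \<Longrightarrow> u < b \<Longrightarrow> c < v \<Longrightarrow> v < e \<Longrightarrow> F u v ! j = v"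
    and c1: "\<And>k u v u' v'. k < i \<Longrightarrow> a < u \<Longrightarrow> u < b \<Longrightarrow> c < v \<Longrightarrow> v < e \<Longrightarrow>
      a < u' \<Longrightarrow> u' < b \<Longrightarrow> c < v' \<Longrightarrow> v' < e \<Longrightarrow> F u v ! k = F u' v' ! k"
    and c2: "\<And>k u v v'. k < j \<Longrightarrow> a < u \<Longrightarrow> u < b \<Longrightarrow> c < v \<Longrightarrow> v < e \<Longrightarrow>
      c < v' \<Longrightarrow> v' < e \<Longrightarrow> F u v ! k = F u v' ! k"
    and T: "\<forall>k<d. typed_on (\<lambda>u v. F u v ! k) (m k) (n k) a b c e"
    and k: "k \<le> d"
  shows "cell R (map (\<lambda>l. if l = i \<or> l = j then 1 else 0) [0..<k]) (image_box F a b c e k)"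
  using k
proof (induction k)
  case 0
  obtain u v where "a < u" "u < b" "c < v" "v < e" using dense[OF ab] dense[OF ce] by blast
  then have "image_box F a b c e 0 = {[]}" unfolding image_box_def by auto
  then show ?case by (simp add: cell.origin)
next
  case (Suc k)
  let ?ds = "map (\<lambda>l. if l = i \<or> l = j then 1 else (0::nat)) [0..<k]"
  let ?C = "image_box F a b c e k"
  have k: "k < d" "k \<le> d" using Suc by auto
  note IH = Suc.IH[OF k(2)]
  have len: "length ?ds = k" by simp
  have take_Suc: "take (Suc k) (F u v) = take k (F u v) @ [F u v ! k]" for u v
    using dvfun2_length[OF F] k by (simp add: take_Suc_conv_app_nth)
  have CI: "take k (F u v) \<in> ?C" if "a < u" "u < b" "c < v" "v < e" for u v
    using that unfolding image_box_def by blast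
  have CE: "\<exists>u v. a < u \<and> u < b \<and> c < v \<and> v < e \<and> x = take k (F u v)" if "x \<in> ?C" for x
    using that unfolding image_box_def by blast
  have const_def: "definable_fun R k ?C (\<lambda>_. z)" for z
  proof -
    have "dfun2 (\<lambda>_ _. z)" unfolding dfun2_def by (rule dsc_const)
    from definable_image_box[OF F this k(2), of a b c e]
    show ?thesis unfolding definable_fun_def
      by (rule back_subst[of "definable R (Suc k)"]) (auto simp: image_box_def)
  qed
  have const_cont: "cont_on ?C (\<lambda>_. z)" for z
    unfolding cont_on_def by (auto intro: exI[of _ 1])
  have band: "cell R (?ds @ [1]) {x @ [r] | x r. x \<in> ?C \<and> p < r \<and> r < q}" if "p < q" for p q
  proof -
    have "cell R (?ds @ [1]) {x @ [r] | x r. x \<in> ?C \<and> pred_option (\<lambda>f. f x < r) (Some (\<lambda>_. p)) \<and>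
        pred_option (\<lambda>g. r < g x) (Some (\<lambda>_. q))}"
      by (rule cell.band[OF IH]) (use const_def const_cont that in \<open>auto simp: len\<close>)
    then show ?thesis by simp
  qed
  consider "k = i" | "k = j" | "k \<noteq> i" "k \<noteq> j" by blast
  then show ?case
  proof cases
    case 1
    have "image_box F a b c e (Suc k) = {x @ [r] | x r. x \<in> ?C \<and> a < r \<and> r < b}"
    proof (intro equalityI subsetI)
      fix y assume "y \<in> image_box F a b c e (Suc k)"
      then obtain u v where u: "a < u" "u < b" "c < v" "v < e" "y = take (Suc k) (F u v)"
        unfolding image_box_def by blast
      then have "y = take k (F u v) @ [u]" using take_Suc Fi 1 by simp
      then show "y \<in> {x @ [r] | x r. x \<in> ?C \<and> a < r \<and> r < b}" using CI u by blast
    next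
      fix y assume "y \<in> {x @ [r] | x r. x \<in> ?C \<and> a < r \<and> r < b}"
      then obtain x r where y: "y = x @ [r]" "x \<in> ?C" "a < r" "r < b" by blast
      then obtain u v where u: "a < u" "u < b" "c < v" "v < e" "x = take k (F u v)" using CE by blast
      \<comment> \<open>Coordinates before \<open>i\<close> are constant, so the parameter
        \<open>u\<close> may be replaced by the prescribed value \<open>r\<close>.\<close>
      have "take k (F u v) = take k (F r v)"
        using c1[of _ u v r v] u y 1 k dvfun2_length[OF F] by (auto simp: list_eq_iff_nth_eq)
      then have "y = take (Suc k) (F r v)" using y u Fi[of r v] take_Suc 1 by simp
      then show "y \<in> image_box F a b c e (Suc k)" unfolding image_box_def using y u by blast
    qed
    then show ?thesis using band[OF ab] 1 by simp
  next
    case 2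
    have "image_box F a b c e (Suc k) = {x @ [r] | x r. x \<in> ?C \<and> c < r \<and> r < e}"
    proof (intro equalityI subsetI)
      fix y assume "y \<in> image_box F a b c e (Suc k)"
      then obtain u v where u: "a < u" "u < b" "c < v" "v < e" "y = take (Suc k) (F u v)"
        unfolding image_box_def by blast
      then have "y = take k (F u v) @ [v]" using take_Suc Fj 2 by simp
      then show "y \<in> {x @ [r] | x r. x \<in> ?C \<and> c < r \<and> r < e}" using CI u by blast
    next
      fix y assume "y \<in> {x @ [r] | x r. x \<in> ?C \<and> c < r \<and> r < e}"
      then obtain x r where y: "y = x @ [r]" "x \<in> ?C" "c < r" "r < e" by blast
      then obtain u v where u: "a < u" "u < b" "c < v" "v < e" "x = take k (F u v)" using CE by blast
      have "take k (F u v) = take k (F u r)"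
        using c2[of _ u v r] u y 2 k dvfun2_length[OF F] by (auto simp: list_eq_iff_nth_eq)
      then have "y = take (Suc k) (F u r)" using y u Fj[of u r] take_Suc 2 by simp
      then show "y \<in> image_box F a b c e (Suc k)" unfolding image_box_def using y u by blast
    qed
    then show ?thesis using band[OF ce] 2 by simp
  next
    case 3
    obtain u0 v0 where u0: "a < u0" "u0 < b" and v0: "c < v0" "v0 < e" using dense[OF ab] dense[OF ce] by blast
    \<comment> \<open>Recovers \<open>u\<close> from coordinate \<open>i\<close> and
      \<open>v\<close> from coordinate \<open>j\<close> once these are available. Before that fixed
      values \<open>u0\<close> and \<open>v0\<close> do, because the coordinate does not depend on
      the missing parameter.\<close>
    define g where "g x = F (if i < k then x ! i else u0) (if j < k then x ! j else v0) ! k" for x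
    have g: "g (take k (F u v)) = F u v ! k" if B: "a < u" "u < b" "c < v" "v < e" for u v
    proof -
      consider "k < i" | "i < k" "k < j" | "j < k" using 3 by linarith
      then show ?thesis
      proof cases
        case 1
        then show ?thesis unfolding g_def using c1[OF 1 u0 v0 B] ij by simp
      next
        case 2
        then show ?thesis unfolding g_def using c2[OF 2(2) B(1,2) v0 B(3,4)] Fi[OF B] by simp
      next
        case 3
        then show ?thesis unfolding g_def using Fi[OF B] Fj[OF B] ij by simp
      qed
    qed
    have eq: "{x @ [g x] | x. x \<in> ?C} = image_box F a b c e (Suc k)"
      unfolding image_box_def take_Suc using g by fastforce
    have "definable R (Suc k) (image_box F a b c e (Suc k))"
      using definable_image_box[OF F dvfun2_nth[OF F k(1)] k(2), of a b c e]
      unfolding image_box_def take_Suc .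
    then have "definable_fun R (length ?ds) ?C g"
      unfolding definable_fun_def eq len .
    moreover have "cont_on ?C g"
      unfolding cont_on_def
    proof (intro ballI allI impI)
      fix x \<epsilon> assume x: "x \<in> ?C" and \<epsilon>: "0 < (\<epsilon>::'a)"
      then obtain u v where u: "a < u" "u < b" "c < v" "v < e" "x = take k (F u v)" using CE by blast
      let ?u = "if i < k then u else u0" and ?v = "if j < k then v else v0"
      have uv: "a < ?u" "?u < b" "c < ?v" "?v < e" using u u0 v0 by auto
      from joint_continuity[OF T[rule_format, OF k(1)] uv \<epsilon>]
      obtain \<delta> where \<delta>: "\<delta> > 0" "\<forall>u' v'. a < u' \<longrightarrow> u' < b \<longrightarrow> c < v' \<longrightarrow> v' < e \<longrightarrow> \<bar>u' - ?u\<bar> < \<delta> \<longrightarrow>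
        \<bar>v' - ?v\<bar> < \<delta> \<longrightarrow> \<bar>F u' v' ! k - F ?u ?v ! k\<bar> < \<epsilon>" by blast
      have lx: "length x = k" using u dvfun2_length[OF F] k by simp
      have gg: "g y = F (if i < k then u' else u0) (if j < k then v' else v0) ! k"
        if "a < u'" "u' < b" "c < v'" "v' < e" "y = take k (F u' v')" for y u' v'
        unfolding g_def using that Fi[OF that(1-4)] Fj[OF that(1-4)] by simp
      show "\<exists>\<delta>>0. \<forall>y\<in>?C. (\<forall>i<length x. \<bar>y ! i - x ! i\<bar> < \<delta>) \<longrightarrow> \<bar>g y - g x\<bar> < \<epsilon>"
      proof (intro exI conjI ballI impI)
        fix y assume y: "y \<in> ?C" and near: "\<forall>i<length x. \<bar>y ! i - x ! i\<bar> < \<delta>"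
        then obtain u' v' where u': "a < u'" "u' < b" "c < v'" "v' < e" "y = take k (F u' v')" using CE by blast
        have "\<bar>(if i < k then u' else u0) - ?u\<bar> < \<delta>"
          using near[unfolded lx, rule_format, of i] u u' Fi \<delta>(1) by auto
        moreover have "\<bar>(if j < k then v' else v0) - ?v\<bar> < \<delta>"
          using near[unfolded lx, rule_format, of j] u u' Fj \<delta>(1) by auto
        ultimately show "\<bar>g y - g x\<bar> < \<epsilon>"
          using \<delta>(2)[rule_format, of "if i < k then u' else u0" "if j < k then v' else v0"]
          unfolding gg[OF u'] gg[OF u] using u' u0 v0 by auto
      qed (rule \<delta>(1))
    qed
    ultimately have "cell R (?ds @ [0]) {x @ [g x] | x. x \<in> ?C}" by (rule cell.graph[OF IH])
    then show ?thesis unfolding eq using 3 by simp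
  qed
qed

end


section \<open>Finite-to-one boxes contradict dimension one\<close>

context omin
begin

text \<open>Dimension at most one, stated for individual cells so that a single cell refutes
  it.\<close>

definition thin :: "'a list set \<Rightarrow> bool" where
  "thin X \<longleftrightarrow> (\<forall>ds C. cell R ds C \<longrightarrow> C \<subseteq> X \<longrightarrow> sum_list ds \<le> 1)"

lemma mt_const:
  assumes "mt 0 f a b" "a < s" "s < b" "a < t" "t < b"
  shows "f s = f t"
proof (cases s t rule: linorder_cases)
  case less
  then show ?thesis using assms(1)[unfolded mt_def, rule_format, of s t] assms(2-5) by (simp add: ty_def)
next
  case greater
  then show ?thesis using assms(1)[unfolded mt_def, rule_format, of t s] assms(2-5) by (simp add: ty_def)
qed simp

lemma mt_inj:
  assumes "mt m f a b" "m \<noteq> 0" "a < s" "s < b" "a < t" "t < b" "f s = f t"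
  shows "s = t"
proof (cases s t rule: linorder_cases)
  case less
  then show ?thesis using assms(1)[unfolded mt_def, rule_format, of s t] assms(2-7) by (simp add: ty_def)
next
  case greater
  then show ?thesis using assms(1)[unfolded mt_def, rule_format, of t s] assms(2-7) by (simp add: ty_def)
qed simp

lemma sum_two_ones:
  assumes "i < j" "j < d"
  shows "sum_list (map (\<lambda>l. if l = i \<or> l = j then 1 else (0::nat)) [0..<d]) = 2"
proof -
  have "sum_list (map (\<lambda>l. if l = i \<or> l = j then 1 else (0::nat)) [0..<d]) =
      (\<Sum>l\<in>{0..<d}. if l \<in> {i, j} then 1 else 0)"
    by (simp add: interv_sum_list_conv_sum_set_nat)
  also have "\<dots> = card ({0..<d} \<inter> {i, j})" by (subst sum.inter_restrict[symmetric]) simp_all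
  also have "{0..<d} \<inter> {i, j} = {i, j}" using assms by auto
  finally show ?thesis using assms by simp
qed

text \<open>On a smaller box all coordinates are monotone and continuous, and the image is a cell
  whose type contains two ones.\<close>

lemma no_box_coordinates:
  assumes F: "dvfun2 F" and X: "thin X" and ab: "a < b" and ce: "c < e" and ij: "i < j" "j < d"
    and FX: "\<And>u v. a < u \<Longrightarrow> u < b \<Longrightarrow> c < v \<Longrightarrow> v < e \<Longrightarrow> F u v \<in> X"
    and Fi: "\<And>u v. a < u \<Longrightarrow> u < b \<Longrightarrow> c < v \<Longrightarrow> v < e \<Longrightarrow> F u v ! i = u"
    and Fj: "\<And>u v. a < u \<Longrightarrow> u < b \<Longrightarrow> c < v \<Longrightarrow> v < e \<Longrightarrow> F u v ! j = v"
    and c1: "\<And>k u v u' v'. k < i \<Longrightarrow> a < u \<Longrightarrow> u < b \<Longrightarrow> c < v \<Longrightarrow> v < e \<Longrightarrow>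
      a < u' \<Longrightarrow> u' < b \<Longrightarrow> c < v' \<Longrightarrow> v' < e \<Longrightarrow> F u v ! k = F u' v' ! k"
    and c2: "\<And>k u v v'. k < j \<Longrightarrow> a < u \<Longrightarrow> u < b \<Longrightarrow> c < v \<Longrightarrow> v < e \<Longrightarrow>
      c < v' \<Longrightarrow> v' < e \<Longrightarrow> F u v ! k = F u v' ! k"
  shows False
proof -
  obtain m n a' b' c' e' where B: "a \<le> a'" "a' < b'" "b' \<le> b" "c \<le> c'" "c' < e'" "e' \<le> e"
    and T: "\<forall>i<d. typed_on (\<lambda>s t. F s t ! i) (m i) (n i) a' b' c' e'"
    using box_types_all[OF F ab ce] by blast
  have L: "a < u" "u < b" if "a' < u" "u < b'" for u using that B by auto
  have L': "c < u" "u < e" if "c' < u" "u < e'" for u using that B by auto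
  have "cell R (map (\<lambda>l. if l = i \<or> l = j then 1 else 0) [0..<d]) (image_box F a' b' c' e' d)"
    by (rule image_box_cell[OF F B(2,5) ij _ _ _ _ T order_refl])
      (use Fi Fj c1 c2 L L' in \<open>simp_all\<close>)
  moreover have "image_box F a' b' c' e' d \<subseteq> X"
    unfolding image_box_def using FX L L' dvfun2_length[OF F] by auto
  ultimately have "sum_list (map (\<lambda>l. if l = i \<or> l = j then 1 else (0::nat)) [0..<d]) \<le> 1"
    using X unfolding thin_def by blast
  then show False unfolding sum_two_ones[OF ij] by simp
qed

text \<open>For fixed \<open>t\<close> the values of an injective function fill an interval;
  \<open>uniform_interval\<close> finds one that serves all \<open>t\<close> of a subinterval, and
  \<open>\<sigma>\<close> is the inverse obtained by choice.\<close>

lemma reparametrize: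
  assumes g: "dfun2 g" and ab: "a < b" and ce: "c < e"
    and inj: "\<forall>s s' t. a < s \<longrightarrow> s < b \<longrightarrow> a < s' \<longrightarrow> s' < b \<longrightarrow> c < t \<longrightarrow> t < e \<longrightarrow> g s t = g s' t \<longrightarrow> s = s'"
  shows "\<exists>\<sigma> p q c' e'. dfun2 \<sigma> \<and> p < q \<and> c \<le> c' \<and> c' < e' \<and> e' \<le> e \<and>
    (\<forall>u t. p < u \<longrightarrow> u < q \<longrightarrow> c' < t \<longrightarrow> t < e' \<longrightarrow> a < \<sigma> u t \<and> \<sigma> u t < b \<and> g (\<sigma> u t) t = u)"
proof -
  let ?S = "\<lambda>t u s. (a < s \<and> s < b) \<and> g s t = u"
  let ?P = "\<lambda>t p q. \<forall>u. p < u \<longrightarrow> u < q \<longrightarrow> (\<exists>s. ?S t u s)"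
  have P: "ds3 ?P" unfolding ds3_def by (intro dfn_rules dfun2D[OF g])
  have ex: "\<exists>p q. p < q \<and> ?P t p q" if t: "c < t" "t < e" for t
  proof -
    have I: "ds1 (\<lambda>u. \<exists>s. ?S t u s)" unfolding ds1_def by (intro dfn_rules dfun2D[OF g])
    have "inj_on (\<lambda>s. g s t) {a<..<b}"
      by (rule inj_onI) (use inj t in auto)
    then have "infinite ((\<lambda>s. g s t) ` {a<..<b})" using ab finite_imageD infinite_Ioo by blast
    moreover have "(\<lambda>s. g s t) ` {a<..<b} = {u. \<exists>s. ?S t u s}" by auto
    ultimately have inf: "infinite {u. \<exists>s. ?S t u s}" by simp
    obtain p q where pq: "p < q" "\<And>u. p < u \<Longrightarrow> u < q \<Longrightarrow> \<exists>s. ?S t u s"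
      by (rule infinite_interval[OF I inf]) (rule that; (assumption | blast))
    have "?P t p q" using pq(2) by blast
    then show ?thesis using pq(1) by blast
  qed
  have sub: "?P t p' q'" if "?P t p q" "p \<le> p'" "p' < q'" "q' \<le> q" for t p q p' q'
  proof (intro allI impI)
    fix u assume "p' < u" "u < q'"
    then have "p < u" "u < q" using that(2,4) by auto
    then show "\<exists>s. ?S t u s" using that(1)[rule_format, of u] by blast
  qed
  obtain c' e' p q where B: "c \<le> c'" "c' < e'" "e' \<le> e" "p < q" "\<forall>t. c' < t \<longrightarrow> t < e' \<longrightarrow> ?P t p q"
    by (rule uniform_interval[where P = ?P, OF P ce sub ex])
      (assumption | (rule that; (assumption | blast)))+
  define \<sigma> where "\<sigma> u t = sel (?S t u)" for u t
  have "dfun2 \<sigma>" unfolding dfun2_def \<sigma>_def by (intro dsc_sel dfn_rules dfun2D[OF g])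
  moreover have "?S t u (\<sigma> u t)" if u: "p < u" "u < q" "c' < t" "t < e'" for u t
  proof -
    have I: "ds1 (?S t u)" unfolding ds1_def by (intro dfn_rules dfun2D[OF g])
    obtain s where "?S t u s" using B(5)[rule_format, OF u(3,4,1,2)] by blast
    from sel_in[where P = "?S t u", OF I this] show ?thesis unfolding \<sigma>_def .
  qed
  ultimately show ?thesis using B(1-4)
    by (intro exI[of _ \<sigma>] exI[of _ p] exI[of _ q] exI[of _ c'] exI[of _ e']) simp
qed

definition fto :: "('a \<Rightarrow> 'a \<Rightarrow> 'a list) \<Rightarrow> 'a \<Rightarrow> 'a \<Rightarrow> 'a \<Rightarrow> 'a \<Rightarrow> bool" where
  "fto F a b c e \<longleftrightarrow> (\<forall>z. finite {(s, t). a < s \<and> s < b \<and> c < t \<and> t < e \<and> F s t = z})"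

lemma fto_infinite:
  assumes "fto F a b c e" "infinite S"
    "\<And>x. x \<in> S \<Longrightarrow> a < f x \<and> f x < b \<and> c < g x \<and> g x < e \<and> F (f x) (g x) = z"
    "inj_on (\<lambda>x. (f x, g x)) S"
  shows False
proof -
  have "(\<lambda>x. (f x, g x)) ` S \<subseteq> {(s, t). a < s \<and> s < b \<and> c < t \<and> t < e \<and> F s t = z}"
    using assms(3) by auto
  then have "finite ((\<lambda>x. (f x, g x)) ` S)" using assms(1) finite_subset unfolding fto_def by blast
  then show False using finite_imageD[OF _ assms(4)] assms(2) by blast
qed

text \<open>The case in which all coordinates before \<open>i\<close> are constant and coordinate
  \<open>i\<close> is injective in the first variable.\<close>

lemma no_box_first:
  assumes F: "dvfun2 F" and X: "thin X" and ab: "a < b" and ce: "c < e" and i: "i < d"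
    and FX: "\<And>u v. a < u \<Longrightarrow> u < b \<Longrightarrow> c < v \<Longrightarrow> v < e \<Longrightarrow> F u v \<in> X"
    and inj: "\<And>s s' t. a < s \<Longrightarrow> s < b \<Longrightarrow> a < s' \<Longrightarrow> s' < b \<Longrightarrow> c < t \<Longrightarrow> t < e \<Longrightarrow> F s t ! i = F s' t ! i \<Longrightarrow> s = s'"
    and c1: "\<And>k u v u' v'. k < i \<Longrightarrow> a < u \<Longrightarrow> u < b \<Longrightarrow> c < v \<Longrightarrow> v < e \<Longrightarrow>
      a < u' \<Longrightarrow> u' < b \<Longrightarrow> c < v' \<Longrightarrow> v' < e \<Longrightarrow> F u v ! k = F u' v' ! k"
    and fin: "fto F a b c e"
  shows False
proof -
  have inj': "\<forall>s s' t. a < s \<longrightarrow> s < b \<longrightarrow> a < s' \<longrightarrow> s' < b \<longrightarrow> c < t \<longrightarrow> t < e \<longrightarrow> F s t ! i = F s' t ! i \<longrightarrow> s = s'"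
    by (intro allI impI; rule inj; assumption)
  obtain \<sigma> p q c1 e1 where \<sigma>: "dfun2 \<sigma>" and B: "p < q" "c \<le> c1" "c1 < e1" "e1 \<le> e"
    and S: "\<forall>u t. p < u \<longrightarrow> u < q \<longrightarrow> c1 < t \<longrightarrow> t < e1 \<longrightarrow> a < \<sigma> u t \<and> \<sigma> u t < b \<and> F (\<sigma> u t) t ! i = u"
    using reparametrize[OF dvfun2_nth[OF F i] ab ce inj'] by blast
  define G where "G u t = F (\<sigma> u t) t" for u t
  have G: "dvfun2 G" unfolding dvfun2_def G_def by (intro dvfun2D[OF F] dfun2D[OF \<sigma>] dsc_sc)
  have S': "a < \<sigma> u t" "\<sigma> u t < b" "c < t" "t < e" "G u t ! i = u"
    if "p < u" "u < q" "c1 < t" "t < e1" for u t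
    using S[rule_format, OF that] that B unfolding G_def by auto
  obtain m n p1 q1 c2 e2 where B1: "p \<le> p1" "p1 < q1" "q1 \<le> q" "c1 \<le> c2" "c2 < e2" "e2 \<le> e1"
    and T: "\<forall>i<d. typed_on (\<lambda>s t. G s t ! i) (m i) (n i) p1 q1 c2 e2"
    using box_types_all[OF G B(1,3)] by blast
  have Lu: "p < u" "u < q" if "p1 < u" "u < q1" for u using that B1 by auto
  have Lt: "c1 < t" "t < e1" if "c2 < t" "t < e2" for t using that B1 by auto
  have mtG: "mt (n k) (\<lambda>t. G u t ! k) c2 e2" if "k < d" "p1 < u" "u < q1" for k u
    using T[rule_format, OF that(1)] that(2,3) unfolding typed_on_def by blast
  obtain u0 where u0: "p1 < u0" "u0 < q1" using dense[OF B1(2)] by blast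
  obtain t0 where t0: "c2 < t0" "t0 < e2" using dense[OF B1(5)] by blast
  obtain t1 where t1: "t0 < t1" "t1 < e2" using dense[OF t0(2)] by blast
  \<comment> \<open>If no coordinate of \<open>G u0\<close> varied, a single point would have
    infinitely many preimages.\<close>
  have "\<exists>j<d. n j \<noteq> 0"
  proof (rule ccontr)
    assume none: "\<not> (\<exists>j<d. n j \<noteq> 0)"
    have const: "G u0 t = G u0 t0" if t: "c2 < t" "t < e2" for t
    proof (rule nth_equalityI)
      fix k assume "k < length (G u0 t)"
      then have k: "k < d" using dvfun2_length[OF G] by simp
      then have n: "n k = 0" using none by blast
      show "G u0 t ! k = G u0 t0 ! k" by (rule mt_const[OF mtG[OF k u0, unfolded n] t t0])
    qed (simp add: dvfun2_length[OF G])
    show False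
    proof (rule fto_infinite[OF fin, of "{c2<..<e2}" "\<lambda>t. \<sigma> u0 t" "\<lambda>t. t" "G u0 t0"])
      show "infinite {c2<..<e2}" using B1(5) by (simp add: infinite_Ioo)
      show "inj_on (\<lambda>x. (\<sigma> u0 x, x)) {c2<..<e2}" by (auto intro: inj_onI)
      fix t assume "t \<in> {c2<..<e2}"
      then have t: "c2 < t" "t < e2" by auto
      show "a < \<sigma> u0 t \<and> \<sigma> u0 t < b \<and> c < t \<and> t < e \<and> F (\<sigma> u0 t) t = G u0 t0"
        using S'[OF Lu[OF u0] Lt[OF t]] const[OF t] unfolding G_def by simp
    qed
  qed
  define j where "j = (LEAST j. j < d \<and> n j \<noteq> 0)"
  have j: "j < d" "n j \<noteq> 0" using \<open>\<exists>j<d. n j \<noteq> 0\<close> LeastI_ex[of "\<lambda>j. j < d \<and> n j \<noteq> 0"]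
    unfolding j_def by blast+
  have jl: "n k = 0" if "k < j" for k
    using not_less_Least[of k "\<lambda>j. j < d \<and> n j \<noteq> 0"] that j(1) unfolding j_def by auto
  \<comment> \<open>In \<open>G\<close> coordinate \<open>i\<close> equals the first parameter and
    the earlier ones are constant, so none of these varies with \<open>t\<close>.\<close>
  have ij: "i < j"
  proof (rule ccontr)
    assume "\<not> i < j"
    then have "j = i \<or> j < i" by auto
    have t1': "c2 < t1" "t1 < e2" using t0 t1 by simp_all
    have "G u0 t0 ! j = G u0 t1 ! j" if "j = i"
      unfolding that S'(5)[OF Lu[OF u0] Lt[OF t0]] S'(5)[OF Lu[OF u0] Lt[OF t1']] ..
    moreover have "G u0 t0 ! j = G u0 t1 ! j" if "j < i"
      unfolding G_def by (rule c1[OF that S'(1-4)[OF Lu[OF u0] Lt[OF t0]] S'(1-4)[OF Lu[OF u0] Lt[OF t1']]])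
    moreover note \<open>j = i \<or> j < i\<close>
    ultimately have "G u0 t0 ! j = G u0 t1 ! j" by blast
    moreover have "c2 < t1" using t0 t1 by simp
    ultimately have "t0 = t1" using mt_inj[OF mtG[OF j(1) u0] j(2) t0] t1(2) by blast
    then show False using t1 by simp
  qed
  have injG: "\<forall>s s' u. c2 < s \<longrightarrow> s < e2 \<longrightarrow> c2 < s' \<longrightarrow> s' < e2 \<longrightarrow> p1 < u \<longrightarrow> u < q1 \<longrightarrow>
      G u s ! j = G u s' ! j \<longrightarrow> s = s'"
  proof (intro allI impI)
    fix s s' u assume h: "c2 < s" "s < e2" "c2 < s'" "s' < e2" "p1 < u" "u < q1" "G u s ! j = G u s' ! j"
    show "s = s'" by (rule mt_inj[OF mtG[OF j(1) h(5,6)] j(2) h(1-4) h(7)])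
  qed
  obtain \<tau> p2 q2 c3 e3 where \<tau>: "dfun2 \<tau>" and B2: "p2 < q2" "p1 \<le> c3" "c3 < e3" "e3 \<le> q1"
    and S2: "\<forall>v u. p2 < v \<longrightarrow> v < q2 \<longrightarrow> c3 < u \<longrightarrow> u < e3 \<longrightarrow> c2 < \<tau> v u \<and> \<tau> v u < e2 \<and> G u (\<tau> v u) ! j = v"
    using reparametrize[OF dfun2_swap[OF dvfun2_nth[OF G j(1)]] B1(5,2) injG] by blast
  \<comment> \<open>In the new parameters coordinate \<open>i\<close> of \<open>K u v\<close> is
    \<open>u\<close> and coordinate \<open>j\<close> is \<open>v\<close>.\<close>
  define K where "K u v = G u (\<tau> v u)" for u v
  have K: "dvfun2 K" unfolding dvfun2_def K_def by (intro dvfun2D[OF G] dfun2D[OF \<tau>] dsc_sc)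
  have L3: "p1 < u" "u < q1" if "c3 < u" "u < e3" for u using that B2 by auto
  have R: "c2 < \<tau> v u" "\<tau> v u < e2" "K u v ! j = v"
    if "p2 < v" "v < q2" "c3 < u" "u < e3" for u v
    using S2[rule_format, OF that] unfolding K_def by auto
  have SK: "a < \<sigma> u (\<tau> v u)" "\<sigma> u (\<tau> v u) < b" "c < \<tau> v u" "\<tau> v u < e" "K u v ! i = u"
    if "c3 < u" "u < e3" "p2 < v" "v < q2" for u v
    using S'[OF Lu[OF L3[OF that(1,2)]] Lt[OF R(1,2)[OF that(3,4,1,2)]]] unfolding K_def by auto
  show False
  proof (rule no_box_coordinates[OF K X B2(3,1) ij j(1)])
    fix u v assume uv: "c3 < u" "u < e3" "p2 < v" "v < q2"
    show "K u v \<in> X" unfolding K_def G_def by (rule FX[OF SK(1-4)[OF uv]])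
    show "K u v ! i = u" by (rule SK(5)[OF uv])
    show "K u v ! j = v" by (rule R(3)[OF uv(3,4,1,2)])
    fix k v' assume v': "p2 < v'" "v' < q2"
    { assume k: "k < j"
      then have n: "n k = 0" "k < d" using jl j(1) by auto
      show "K u v ! k = K u v' ! k"
        unfolding K_def
        by (rule mt_const[OF mtG[OF n(2) L3[OF uv(1,2)], unfolded n(1)]
          R(1,2)[OF uv(3,4,1,2)] R(1,2)[OF v' uv(1,2)]]) }
    fix u' assume k: "k < i" and u': "c3 < u'" "u' < e3"
    show "K u v ! k = K u' v' ! k"
      unfolding K_def G_def by (rule c1[OF k SK(1-4)[OF uv] SK(1-4)[OF u' v']])
  qed
qed

text \<open>Reparametrize the box by the first nonconstant coordinate of \<open>F\<close>, and then by the first later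
  coordinate that is nonconstant in the other variable: the image becomes a cell of dimension two.\<close>

theorem no_box:
  assumes F: "dvfun2 F" and X: "thin X" and ab: "a < b" and ce: "c < e"
    and FX: "\<And>u v. a < u \<Longrightarrow> u < b \<Longrightarrow> c < v \<Longrightarrow> v < e \<Longrightarrow> F u v \<in> X"
    and fin: "fto F a b c e"
  shows False
proof -
  obtain m n a1 b1 c1 e1 where B: "a \<le> a1" "a1 < b1" "b1 \<le> b" "c \<le> c1" "c1 < e1" "e1 \<le> e"
    and T: "\<forall>i<d. typed_on (\<lambda>s t. F s t ! i) (m i) (n i) a1 b1 c1 e1"
    using box_types_all[OF F ab ce] by blast
  have Ls: "a < s" "s < b" if "a1 < s" "s < b1" for s using that B by auto
  have Lt: "c < t" "t < e" if "c1 < t" "t < e1" for t using that B by auto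
  have mt1: "mt (m k) (\<lambda>s. F s t ! k) a1 b1" if "k < d" "c1 < t" "t < e1" for k t
    using T[rule_format, OF that(1)] that(2,3) unfolding typed_on_def by blast
  have mt2: "mt (n k) (\<lambda>t. F s t ! k) c1 e1" if "k < d" "a1 < s" "s < b1" for k s
    using T[rule_format, OF that(1)] that(2,3) unfolding typed_on_def by blast
  have fin1: "fto F a1 b1 c1 e1"
    unfolding fto_def
  proof
    fix z
    have "{(s, t). a1 < s \<and> s < b1 \<and> c1 < t \<and> t < e1 \<and> F s t = z} \<subseteq> {(s, t). a < s \<and> s < b \<and> c < t \<and> t < e \<and> F s t = z}"
      using Ls Lt by auto
    then show "finite {(s, t). a1 < s \<and> s < b1 \<and> c1 < t \<and> t < e1 \<and> F s t = z}"
      using fin[unfolded fto_def, rule_format, of z] finite_subset by blast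
  qed
  have fin2: "fto (\<lambda>t s. F s t) c1 e1 a1 b1"
    unfolding fto_def
  proof
    fix z
    have "{(t, s). c1 < t \<and> t < e1 \<and> a1 < s \<and> s < b1 \<and> F s t = z} =
      (\<lambda>(s, t). (t, s)) ` {(s, t). a1 < s \<and> s < b1 \<and> c1 < t \<and> t < e1 \<and> F s t = z}" by auto
    then show "finite {(t, s). c1 < t \<and> t < e1 \<and> a1 < s \<and> s < b1 \<and> F s t = z}"
      using fin1[unfolded fto_def, rule_format, of z] by simp
  qed
  obtain t0 where t0: "c1 < t0" "t0 < e1" using dense[OF B(5)] by blast
  obtain s0 where s0: "a1 < s0" "s0 < b1" using dense[OF B(2)] by blast
  let ?Q = "\<lambda>i. i < d \<and> (m i \<noteq> 0 \<or> n i \<noteq> 0)"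
  have "\<exists>i. ?Q i"
  proof (rule ccontr)
    assume none: "\<not> (\<exists>i. ?Q i)"
    have const: "F s t0 = F s0 t0" if s: "a1 < s" "s < b1" for s
    proof (rule nth_equalityI)
      fix k assume "k < length (F s t0)"
      then have k: "k < d" using dvfun2_length[OF F] by simp
      then have m: "m k = 0" using none by blast
      show "F s t0 ! k = F s0 t0 ! k" by (rule mt_const[OF mt1[OF k t0, unfolded m] s s0])
    qed (simp add: dvfun2_length[OF F])
    show False
      by (rule fto_infinite[OF fin1, of "{a1<..<b1}" "\<lambda>t. t" "\<lambda>_. t0" "F s0 t0"])
        (use B(2) t0 const in \<open>auto simp: infinite_Ioo intro: inj_onI\<close>)
  qed
  define i where "i = (LEAST i. ?Q i)"
  have i: "i < d" "m i \<noteq> 0 \<or> n i \<noteq> 0" using LeastI_ex[OF \<open>\<exists>i. ?Q i\<close>] unfolding i_def by blast+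
  have il: "m k = 0" "n k = 0" "k < d" if "k < i" for k
    using not_less_Least[of k ?Q] that i(1) unfolding i_def by auto
  have c: "F s t ! k = F s' t' ! k" if k: "k < i" and st: "a1 < s" "s < b1" "c1 < t" "t < e1"
    "a1 < s'" "s' < b1" "c1 < t'" "t' < e1" for k s t s' t'
  proof -
    have "F s t ! k = F s' t ! k"
      by (rule mt_const[OF mt1[OF il(3)[OF k] st(3,4), unfolded il(1)[OF k]] st(1,2,5,6)])
    also have "\<dots> = F s' t' ! k"
      by (rule mt_const[OF mt2[OF il(3)[OF k] st(5,6), unfolded il(2)[OF k]] st(3,4,7,8)])
    finally show ?thesis .
  qed
  show False
  proof (cases "m i = 0")
    case False
    show False
    proof (rule no_box_first[OF F X B(2,5) i(1) _ _ _ fin1])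
      show "F u v \<in> X" if "a1 < u" "u < b1" "c1 < v" "v < e1" for u v
        by (rule FX[OF Ls[OF that(1,2)] Lt[OF that(3,4)]])
      show "s = s'" if "a1 < s" "s < b1" "a1 < s'" "s' < b1" "c1 < t" "t < e1" "F s t ! i = F s' t ! i" for s s' t
        by (rule mt_inj[OF mt1[OF i(1) that(5,6)] False that(1-4) that(7)])
      show "F u v ! k = F u' v' ! k" if "k < i" "a1 < u" "u < b1" "c1 < v" "v < e1" "a1 < u'" "u' < b1" "c1 < v'" "v' < e1" for k u v u' v'
        by (rule c[OF that])
    qed
  next
    case True
    then have ni: "n i \<noteq> 0" using i(2) by blast
    show False
    \<comment> \<open>Coordinate \<open>i\<close> is constant in the first variable and injective in
      the second, so the variables change roles.\<close>
    proof (rule no_box_first[OF dvfun2_swap[OF F] X B(5,2) i(1) _ _ _ fin2])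
      show "F v u \<in> X" if "c1 < u" "u < e1" "a1 < v" "v < b1" for u v
        by (rule FX[OF Ls[OF that(3,4)] Lt[OF that(1,2)]])
      show "s = s'" if "c1 < s" "s < e1" "c1 < s'" "s' < e1" "a1 < t" "t < b1" "F t s ! i = F t s' ! i" for s s' t
        by (rule mt_inj[OF mt2[OF i(1) that(5,6)] ni that(1-4) that(7)])
      show "F v u ! k = F v' u' ! k" if "k < i" "c1 < u" "u < e1" "a1 < v" "v < b1" "c1 < u'" "u' < e1" "a1 < v'" "v' < b1" for k u v u' v'
        by (rule c[OF that(1,4,5,2,3,8,9,6,7)])
    qed
  qed
qed

section \<open>Consequences of one-dimensionality\<close>

text \<open>Some coordinate takes an interval of values on an infinite definable set; choosing one
  point for each value gives a curve parametrized by that coordinate, in particular an injective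
  one.\<close>

lemma curve:
  assumes A: "dset A" and inf: "infinite A"
  shows "\<exists>\<gamma> i a b. dvfun1 \<gamma> \<and> i < d \<and> a < b \<and> (\<forall>t. a < t \<longrightarrow> t < b \<longrightarrow> \<gamma> t \<in> A \<and> \<gamma> t ! i = t)"
proof -
  have P: "dv1 (\<lambda>x. x \<in> A)" and l: "\<And>x. x \<in> A \<Longrightarrow> length x = d"
    using A unfolding dset_def dv1_def by blast+
  have "\<not> finite {x. x \<in> A}" using inf by simp
  moreover have "finite {x. x \<in> A} \<longleftrightarrow>
      (\<forall>i<d. \<not> (\<exists>a b. a < b \<and> (\<forall>t. a < t \<longrightarrow> t < b \<longrightarrow> vsec (\<lambda>x. x \<in> A) i t)))"
    by (rule finite_coords_interval[OF P l])
  ultimately obtain i a b where i: "i < d" "a < b" "\<forall>t. a < t \<longrightarrow> t < b \<longrightarrow> vsec (\<lambda>x. x \<in> A) i t"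
    by blast
  define \<gamma> where "\<gamma> t = vsel (\<lambda>x. x \<in> A \<and> x ! i = t)" for t
  have D: "dfn (\<lambda>e. vc 0 e \<in> A \<and> vc 0 e ! i = sc 0 (sh e))"
    using i(1) by (intro dfn_rules A)
  have "dvfun1 \<gamma>" unfolding dvfun1_def \<gamma>_def
    by (rule dvec_vsel[where P = "\<lambda>e x. x \<in> A \<and> x ! i = sc 0 e", OF D])
  moreover have "\<gamma> t \<in> A \<and> \<gamma> t ! i = t" if t: "a < t" "t < b" for t
  proof -
    obtain y where "length y = d" "y \<in> A \<and> y ! i = t" using i(3)[rule_format, OF t] unfolding vsec_def by blast
    moreover have "dv1 (\<lambda>x. x \<in> A \<and> x ! i = t)" using i(1) unfolding dv1_def by (intro dfn_rules A)
    ultimately show ?thesis unfolding \<gamma>_def using vsel_in[of "\<lambda>x. x \<in> A \<and> x ! i = t" y] by blast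
  qed
  ultimately show ?thesis using i(1,2) by blast
qed

text \<open>Along a curve in each factor \<open>J\<close> becomes a map on a box. It stays
  finite-to-one because each curve has its parameter as a coordinate.\<close>

lemma no_infinite_product:
  assumes X: "thin X" and A: "dset A" "infinite A" and B: "dset B" "infinite B" and J: "dvvfun2 J"
    and JX: "\<And>x y. x \<in> A \<Longrightarrow> y \<in> B \<Longrightarrow> J x y \<in> X"
    and fin: "\<And>z. finite {(x, y). x \<in> A \<and> y \<in> B \<and> J x y = z}"
  shows False
proof -
  obtain \<gamma> i a b where g: "dvfun1 \<gamma>" "i < d" "a < b" "\<forall>t. a < t \<longrightarrow> t < b \<longrightarrow> \<gamma> t \<in> A \<and> \<gamma> t ! i = t"
    using curve[OF A] by blast
  obtain \<delta> j c e where h: "dvfun1 \<delta>" "j < d" "c < e" "\<forall>t. c < t \<longrightarrow> t < e \<longrightarrow> \<delta> t \<in> B \<and> \<delta> t ! j = t"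
    using curve[OF B] by blast
  show False
  proof (rule no_box[where F = "\<lambda>s t. J (\<gamma> s) (\<delta> t)", OF _ X g(3) h(3)])
    show "dvfun2 (\<lambda>s t. J (\<gamma> s) (\<delta> t))"
      unfolding dvfun2_def by (intro dvvfun2D[OF J] dvfun1D[OF g(1)] dvfun1D[OF h(1)] dsc_sc)
    show "J (\<gamma> u) (\<delta> v) \<in> X" if "a < u" "u < b" "c < v" "v < e" for u v
      using JX g(4)[rule_format, OF that(1,2)] h(4)[rule_format, OF that(3,4)] by blast
    show "fto (\<lambda>s t. J (\<gamma> s) (\<delta> t)) a b c e"
      unfolding fto_def
    proof
      fix z
      let ?S = "{(s, t). a < s \<and> s < b \<and> c < t \<and> t < e \<and> J (\<gamma> s) (\<delta> t) = z}"
      let ?f = "\<lambda>(s, t). (\<gamma> s, \<delta> t)"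
      have "inj_on ?f ?S"
      proof (rule inj_onI)
        fix x y assume x: "x \<in> ?S" and y: "y \<in> ?S" and eq: "?f x = ?f y"
        obtain s t s' t' where st: "x = (s, t)" "y = (s', t')" by fastforce
        have "\<gamma> s ! i = s" "\<gamma> s' ! i = s'" "\<delta> t ! j = t" "\<delta> t' ! j = t'"
          using x y g(4) h(4) unfolding st by auto
        moreover have "\<gamma> s = \<gamma> s'" "\<delta> t = \<delta> t'" using eq unfolding st by auto
        ultimately have "s = s'" "t = t'" by metis+
        then show "x = y" unfolding st by simp
      qed
      moreover have "?f ` ?S \<subseteq> {(x, y). x \<in> A \<and> y \<in> B \<and> J x y = z}" using g(4) h(4) by auto
      ultimately show "finite ?S" using finite_imageD[OF finite_subset[OF _ fin[of z]]] by blast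
    qed
  qed
qed

text \<open>After shrinking, one coordinate maps every fibre onto a set containing the same interval
  from \<open>p\<close> to \<open>q\<close>. Choosing a point in the fibre over \<open>t\<close>
  with coordinate \<open>u\<close> gives a map on a box, injective since the fibres are
  disjoint.\<close>

lemma no_infinite_family:
  assumes X: "thin X" and P: "dsv P" and ab: "a < b"
    and PX: "\<And>t x. P t x \<Longrightarrow> x \<in> X \<and> length x = d"
    and inf: "\<And>t. a < t \<Longrightarrow> t < b \<Longrightarrow> infinite {x. P t x}"
    and disj: "\<And>t t' x. P t x \<Longrightarrow> P t' x \<Longrightarrow> t = t'"
  shows False
proof -
  have Pt: "dv1 (P t)" for t unfolding dv1_def by (intro dsvD[OF P] dfn_rules)
  have V: "dfn (\<lambda>e. vsec (P (f e)) i (g e))" if "i < d" "dsc f" "dsc g" for i f g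
    unfolding vsec_def
    by (intro dfn_vex dfn_rules dsvD[OF P] that(1) dsc_sh[OF that(2)] dsc_sh[OF that(3)])
  let ?Q = "\<lambda>i t p q. \<forall>u. p < u \<longrightarrow> u < q \<longrightarrow> vsec (P t) i u"
  have Q1: "ds1 (\<lambda>t. \<exists>p q. p < q \<and> ?Q i t p q)" if "i \<in> {..<d}" for i
    using that unfolding ds1_def by (intro dfn_rules V) auto
  have Q2: "\<exists>i\<in>{..<d}. \<exists>p q. p < q \<and> ?Q i t p q" if t: "a < t" "t < b" for t
  proof -
    have "length x = d" if "P t x" for x using PX that by blast
    then have "finite {x. P t x} \<longleftrightarrow> (\<forall>i<d. \<not> (\<exists>a b. a < b \<and> (\<forall>u. a < u \<longrightarrow> u < b \<longrightarrow> vsec (P t) i u)))"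
      by (rule finite_coords_interval[OF Pt])
    then show ?thesis using inf[OF t] by blast
  qed
  obtain i a1 b1 where i: "i \<in> {..<d}" "a \<le> a1" "a1 < b1" "b1 \<le> b"
    "\<forall>t. a1 < t \<longrightarrow> t < b1 \<longrightarrow> (\<exists>p q. p < q \<and> ?Q i t p q)"
    by (rule interval_pigeonhole[where P = "\<lambda>i t. \<exists>p q. p < q \<and> ?Q i t p q", OF finite_lessThan[of d] Q1 ab Q2])
      (assumption | (rule that; (assumption | blast)))+
  have id: "i < d" using i(1) by simp
  have Q3: "ds3 (?Q i)" using id unfolding ds3_def by (intro dfn_rules V)
  have sub: "?Q i t p' q'" if "?Q i t p q" "p \<le> p'" "p' < q'" "q' \<le> q" for t p q p' q'
  proof (intro allI impI)
    fix u assume "p' < u" "u < q'"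
    then have "p < u" "u < q" using that(2,4) by auto
    then show "vsec (P t) i u" using that(1) by blast
  qed
  have Q4: "\<exists>p q. p < q \<and> ?Q i t p q" if "a1 < t" "t < b1" for t using i(5)[rule_format, OF that] .
  obtain a2 b2 p q where B: "a1 \<le> a2" "a2 < b2" "b2 \<le> b1" "p < q" "\<forall>t. a2 < t \<longrightarrow> t < b2 \<longrightarrow> ?Q i t p q"
    by (rule uniform_interval[where P = "?Q i", OF Q3 i(3) sub Q4])
      (assumption | (rule that; (assumption | blast)))+
  define F where "F t u = vsel (\<lambda>x. P t x \<and> x ! i = u)" for t u
  have D: "dfn (\<lambda>e. P (sc 0 (sh e)) (vc 0 e) \<and> vc 0 e ! i = sc 1 (sh e))"
    using id by (intro dfn_rules dsvD[OF P])
  have F: "dvfun2 F" unfolding dvfun2_def F_def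
    by (rule dvec_vsel[where P = "\<lambda>e x. P (sc 0 e) x \<and> x ! i = sc 1 e", OF D])
  have FP: "P t (F t u) \<and> F t u ! i = u" if t: "a2 < t" "t < b2" and u: "p < u" "u < q" for t u
  proof -
    obtain y where "length y = d" "P t y \<and> y ! i = u"
      using B(5)[rule_format, OF t u] unfolding vsec_def by blast
    moreover have "dv1 (\<lambda>x. P t x \<and> x ! i = u)" using id unfolding dv1_def by (intro dfn_rules dsvD[OF P])
    ultimately show ?thesis unfolding F_def using vsel_in[of "\<lambda>x. P t x \<and> x ! i = u" y] by blast
  qed
  show False
  proof (rule no_box[OF F X B(2,4)])
    show "F u v \<in> X" if "a2 < u" "u < b2" "p < v" "v < q" for u v
      using FP[OF that] PX by blast
    show "fto F a2 b2 p q"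
      unfolding fto_def
    proof
      fix z
      let ?S = "{(s, t). a2 < s \<and> s < b2 \<and> p < t \<and> t < q \<and> F s t = z}"
      have "x = y" if "x \<in> ?S" "y \<in> ?S" for x y
      proof -
        obtain s t s' t' where st: "x = (s, t)" "y = (s', t')" by fastforce
        have "P s z \<and> z ! i = t" "P s' z \<and> z ! i = t'"
          using FP[of s t] FP[of s' t'] that unfolding st by auto
        then show ?thesis using disj[of s z s'] unfolding st by simp
      qed
      then have "?S = {} \<or> (\<exists>x. ?S = {x})" by blast
      then show "finite ?S" by (elim disjE exE) (erule ssubst, simp)+
    qed
  qed
qed

end


section \<open>Commensurability in a distributive lattice\<close>

text \<open>\<open>le\<close> holds only inside \<open>V\<close>, so membership is carried by
  inequalities, while \<open>jn\<close> and \<open>mt\<close> are total functions constrained on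
  \<open>V\<close> alone.\<close>

locale dlat =
  fixes V :: "'b set" and le :: "'b \<Rightarrow> 'b \<Rightarrow> bool" and jn mt :: "'b \<Rightarrow> 'b \<Rightarrow> 'b" and bt tp :: 'b
  assumes leV: "le x y \<Longrightarrow> x \<in> V \<and> y \<in> V"
    and le_refl: "x \<in> V \<Longrightarrow> le x x"
    and le_trans: "le x y \<Longrightarrow> le y z \<Longrightarrow> le x z"
    and le_antisym: "le x y \<Longrightarrow> le y x \<Longrightarrow> x = y"
    and jn1: "x \<in> V \<Longrightarrow> y \<in> V \<Longrightarrow> le x (jn x y)"
    and jn2: "x \<in> V \<Longrightarrow> y \<in> V \<Longrightarrow> le y (jn x y)"
    and jn_least: "le x z \<Longrightarrow> le y z \<Longrightarrow> le (jn x y) z"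
    and mt1: "x \<in> V \<Longrightarrow> y \<in> V \<Longrightarrow> le (mt x y) x"
    and mt2: "x \<in> V \<Longrightarrow> y \<in> V \<Longrightarrow> le (mt x y) y"
    and mt_greatest: "le z x \<Longrightarrow> le z y \<Longrightarrow> le z (mt x y)"
    and distr: "x \<in> V \<Longrightarrow> y \<in> V \<Longrightarrow> z \<in> V \<Longrightarrow> mt x (jn y z) = jn (mt x y) (mt x z)"
    and bt: "x \<in> V \<Longrightarrow> le bt x" and tp: "x \<in> V \<Longrightarrow> le x tp" and btV: "bt \<in> V" and tpV: "tp \<in> V"
begin

lemma jnV [simp]: "x \<in> V \<Longrightarrow> y \<in> V \<Longrightarrow> jn x y \<in> V" using jn1 leV by blast
lemma mtV [simp]: "x \<in> V \<Longrightarrow> y \<in> V \<Longrightarrow> mt x y \<in> V" using mt1 leV by blast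

lemma jn_absorb: "le y x \<Longrightarrow> jn x y = x" "le y x \<Longrightarrow> jn y x = x"
  using leV le_refl jn1 jn2 jn_least le_antisym by meson+

lemma mt_absorb: "le x y \<Longrightarrow> mt x y = x" "le x y \<Longrightarrow> mt y x = x"
  using leV le_refl mt1 mt2 mt_greatest le_antisym by meson+

lemma jn_comm: "x \<in> V \<Longrightarrow> y \<in> V \<Longrightarrow> jn x y = jn y x"
  using jn1 jn2 jn_least le_antisym by meson

lemma mt_comm: "x \<in> V \<Longrightarrow> y \<in> V \<Longrightarrow> mt x y = mt y x"
  using mt1 mt2 mt_greatest le_antisym by meson

lemma jn_mono: "le x x' \<Longrightarrow> le y y' \<Longrightarrow> le (jn x y) (jn x' y')"
  using jn_least le_trans jn1 jn2 leV by meson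

lemma mt_mono: "le x x' \<Longrightarrow> le y y' \<Longrightarrow> le (mt x y) (mt x' y')"
  using mt_greatest le_trans mt1 mt2 leV by meson

lemma jn_assoc: 
  assumes "x \<in> V" "y \<in> V" "z \<in> V"
  shows "jn (jn x y) z = jn x (jn y z)"
proof (rule le_antisym)
  have 1: "le x (jn x (jn y z))" "le (jn y z) (jn x (jn y z))" "le y (jn y z)" "le z (jn y z)"
    using assms jn1 jn2 by simp_all
  show "le (jn (jn x y) z) (jn x (jn y z))"
    by (rule jn_least[OF jn_least[OF 1(1) le_trans[OF 1(3,2)]] le_trans[OF 1(4,2)]])
  have 2: "le x (jn x y)" "le y (jn x y)" "le (jn x y) (jn (jn x y) z)" "le z (jn (jn x y) z)"
    using assms jn1 jn2 by simp_all
  show "le (jn x (jn y z)) (jn (jn x y) z)"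
    by (rule jn_least[OF le_trans[OF 2(1,3)] jn_least[OF le_trans[OF 2(2,3)] 2(4)]])
qed

lemma mt_assoc: 
  assumes "x \<in> V" "y \<in> V" "z \<in> V"
  shows "mt (mt x y) z = mt x (mt y z)"
proof (rule le_antisym)
  have 1: "le (mt x (mt y z)) x" "le (mt x (mt y z)) (mt y z)" "le (mt y z) y" "le (mt y z) z"
    using assms mt1 mt2 by simp_all
  show "le (mt x (mt y z)) (mt (mt x y) z)"
    by (rule mt_greatest[OF mt_greatest[OF 1(1) le_trans[OF 1(2,3)]] le_trans[OF 1(2,4)]])
  have 2: "le (mt x y) x" "le (mt x y) y" "le (mt (mt x y) z) (mt x y)" "le (mt (mt x y) z) z"
    using assms mt1 mt2 by simp_all
  show "le (mt (mt x y) z) (mt x (mt y z))"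
    by (rule mt_greatest[OF le_trans[OF 2(3,1)] mt_greatest[OF le_trans[OF 2(3,2)] 2(4)]])
qed

lemma distr': 
  assumes V: "x \<in> V" "y \<in> V" "z \<in> V"
  shows "jn x (mt y z) = mt (jn x y) (jn x z)"
proof -
  have "mt (jn x y) (jn x z) = jn (mt (jn x y) x) (mt (jn x y) z)" using V by (simp add: distr)
  also have "mt (jn x y) x = x" using V by (simp add: mt_absorb jn1)
  also have "mt (jn x y) z = jn (mt z x) (mt z y)" using V by (simp add: mt_comm[of "jn x y" z] distr)
  also have "jn x (jn (mt z x) (mt z y)) = jn (jn x (mt z x)) (mt z y)" using V by (simp add: jn_assoc)
  also have "jn x (mt z x) = x" using V by (simp add: jn_absorb mt2)
  finally show ?thesis using V by (simp add: mt_comm[of y z])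
qed

definition iv :: "'b \<Rightarrow> 'b \<Rightarrow> 'b set" where
  "iv a b = {x. le a x \<and> le x b}"

text \<open>Makes the join injective on
  \<open>[a \<sqinter> b, a] \<times> [a \<sqinter> b, b]\<close>: by distributivity both arguments
  are recovered by meeting with \<open>a\<close> and with \<open>b\<close>.\<close>

lemma join_recover:
  assumes V: "a \<in> V" "b \<in> V" and x: "x \<in> iv (mt a b) a" and y: "y \<in> iv (mt a b) b"
  shows "mt a (jn x y) = x" "mt b (jn x y) = y"
proof -
  have xV: "x \<in> V" and yV: "y \<in> V" using x y leV unfolding iv_def by auto
  \<comment> \<open>From \<open>a \<sqinter> y \<le> a \<sqinter> b \<le> x\<close>, distributing
    \<open>a\<close> over \<open>x \<squnion> y\<close> leaves \<open>x\<close>.\<close>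
  have "le (mt a y) (mt a b)" using y V le_refl mt_mono unfolding iv_def by blast
  then have "le (mt a y) x" using x le_trans unfolding iv_def by blast
  then show "mt a (jn x y) = x"
    using x V xV yV unfolding iv_def by (simp add: distr mt_absorb jn_absorb)
  have "le (mt b x) (mt a b)" using x V le_refl mt_mono mt_comm[OF V] unfolding iv_def by auto
  then have "le (mt b x) y" using y le_trans unfolding iv_def by blast
  then show "mt b (jn x y) = y"
    using y V xV yV unfolding iv_def by (simp add: distr mt_absorb jn_absorb)
qed

text \<open>In a distributive lattice an element is determined by its meet and its join with
  \<open>b\<close>, so \<open>[a, c]\<close> embeds into
  \<open>[a, b] \<times> [b, c]\<close>.\<close>

lemma iv_compose:
  assumes "le a b" "le b c" "finite (iv a b)" "finite (iv b c)"
  shows "finite (iv a c)"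
proof -
  have V: "a \<in> V" "b \<in> V" "c \<in> V" using assms leV by auto
  let ?f = "\<lambda>x. (mt x b, jn x b)"
  have "inj_on ?f (iv a c)"
  proof (rule inj_onI)
    fix x y assume xy: "x \<in> iv a c" "y \<in> iv a c" "?f x = ?f y"
    have xV: "x \<in> V" and yV: "y \<in> V" using xy leV unfolding iv_def by auto
    have "x = mt x (jn x b)" using xV V by (simp add: mt_absorb jn1)
    also have "\<dots> = mt x (jn y b)" using xy by simp
    also have "\<dots> = jn (mt x y) (mt x b)" using xV yV V by (simp add: distr)
    also have "\<dots> = jn (mt y x) (mt y b)" using xy mt_comm[OF xV yV] by simp
    also have "\<dots> = mt y (jn x b)" using xV yV V by (simp add: distr)
    also have "\<dots> = mt y (jn y b)" using xy by simp
    also have "\<dots> = y" using yV V by (simp add: mt_absorb jn1)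
    finally show "x = y" .
  qed
  moreover have "?f ` iv a c \<subseteq> iv a b \<times> iv b c"
  proof
    fix z assume "z \<in> ?f ` iv a c"
    then obtain x where z: "z = (mt x b, jn x b)" and x: "le a x" "le x c" unfolding iv_def by blast
    have "x \<in> V" using x leV by blast
    then show "z \<in> iv a b \<times> iv b c"
      unfolding z iv_def using x assms(1,2) V by (simp add: mt_greatest mt2 jn2 jn_least)
  qed
  ultimately show ?thesis using assms(3,4) finite_imageD finite_subset finite_cartesian_product by metis
qed

text \<open>The order up to finite error; commensurability is the associated equivalence.\<close>

definition lo :: "'b \<Rightarrow> 'b \<Rightarrow> bool" where
  "lo a b \<longleftrightarrow> a \<in> V \<and> b \<in> V \<and> finite (iv (mt a b) a)"

definition eqv :: "'b \<Rightarrow> 'b \<Rightarrow> bool" where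
  "eqv a b \<longleftrightarrow> lo a b \<and> lo b a"

definition cls :: "'b \<Rightarrow> 'b set" where
  "cls a = {b. eqv a b}"

lemma loV: "lo a b \<Longrightarrow> a \<in> V" "lo a b \<Longrightarrow> b \<in> V" unfolding lo_def by auto

lemma iv_self: "iv a a \<subseteq> {a}" unfolding iv_def using le_antisym by auto

lemma lo_le: "le a b \<Longrightarrow> lo a b"
  unfolding lo_def using leV mt_absorb iv_self finite_subset by fastforce

text \<open>The descent from \<open>a\<close> to \<open>a \<sqinter> b \<sqinter> c\<close> passes
  through \<open>a \<sqinter> b\<close>. Its second part embeds into
  \<open>[b \<sqinter> c, b]\<close> by joining with \<open>b \<sqinter> c\<close>.\<close>

lemma lo_trans:
  assumes "lo a b" "lo b c"
  shows "lo a c"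
proof -
  have V: "a \<in> V" "b \<in> V" "c \<in> V" using assms loV by auto
  let ?m = "mt (mt a b) c"
  have mV: "?m \<in> V" "mt a b \<in> V" "mt b c \<in> V" using V by auto
  have "inj_on (\<lambda>x. jn x (mt b c)) (iv ?m (mt a b))"
  proof (rule inj_on_inverseI[where g = "\<lambda>y. mt (mt a b) y"])
    fix x assume x: "x \<in> iv ?m (mt a b)"
    have xV: "x \<in> V" using x leV unfolding iv_def by auto
    have "mt (mt a b) (mt b c) = ?m"
    proof (rule le_antisym)
      show "le (mt (mt a b) (mt b c)) ?m"
        by (rule mt_greatest[OF mt1[OF mV(2,3)] le_trans[OF mt2[OF mV(2,3)] mt2[OF V(2,3)]]])
      show "le ?m (mt (mt a b) (mt b c))"
        by (rule mt_greatest[OF mt1[OF mV(2) V(3)] mt_greatest[OF le_trans[OF mt1[OF mV(2) V(3)] mt2[OF V(1,2)]] mt2[OF mV(2) V(3)]]])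
    qed
    then have "mt (mt a b) (jn x (mt b c)) = jn (mt (mt a b) x) ?m" using xV mV distr by simp
    also have "\<dots> = x" using x unfolding iv_def by (simp add: mt_absorb jn_absorb)
    finally show "mt (mt a b) (jn x (mt b c)) = x" .
  qed
  moreover have "(\<lambda>x. jn x (mt b c)) ` iv ?m (mt a b) \<subseteq> iv (mt b c) b"
  proof
    fix y assume "y \<in> (\<lambda>x. jn x (mt b c)) ` iv ?m (mt a b)"
    then obtain x where y: "y = jn x (mt b c)" and x: "le ?m x" "le x (mt a b)" unfolding iv_def by blast
    have "x \<in> V" using x leV by blast
    moreover have "le x b" by (rule le_trans[OF x(2) mt2[OF V(1,2)]])
    ultimately show "y \<in> iv (mt b c) b" unfolding y iv_def using V by (simp add: jn2 jn_least mt1)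
  qed
  ultimately have "finite (iv ?m (mt a b))"
    using assms(2) finite_imageD finite_subset unfolding lo_def by metis
  then have "finite (iv ?m a)"
    using iv_compose[OF mt1[OF mV(2) V(3)] mt1[OF V(1,2)]] assms(1) unfolding lo_def by blast
  moreover have "le ?m (mt a c)"
    by (rule mt_mono[OF mt1[OF V(1,2)] le_refl[OF V(3)]])
  then have "iv (mt a c) a \<subseteq> iv ?m a" unfolding iv_def using le_trans by blast
  ultimately show ?thesis using V finite_subset unfolding lo_def by blast
qed

lemma eqv_sym: "eqv a b \<Longrightarrow> eqv b a" unfolding eqv_def by blast
lemma eqv_trans: "eqv a b \<Longrightarrow> eqv b c \<Longrightarrow> eqv a c" unfolding eqv_def using lo_trans by blast
lemma eqv_refl: "a \<in> V \<Longrightarrow> eqv a a" unfolding eqv_def using lo_le le_refl by blast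
lemma eqvV: "eqv a b \<Longrightarrow> a \<in> V" "eqv a b \<Longrightarrow> b \<in> V" unfolding eqv_def lo_def by auto

lemma eqv_mt:
  assumes "lo p q"
  shows "eqv p (mt p q)"
proof -
  have V: "p \<in> V" "q \<in> V" using assms loV by auto
  have "mt p (mt p q) = mt p q" using V by (simp add: mt_absorb mt1)
  then have "lo p (mt p q)" using assms V unfolding lo_def by simp
  moreover have "lo (mt p q) p" by (rule lo_le[OF mt1[OF V]])
  ultimately show ?thesis unfolding eqv_def by blast
qed

text \<open>Meeting with \<open>p\<close> embeds \<open>[q, p \<squnion> q]\<close> into
  \<open>[p \<sqinter> q, p]\<close>, which is finite by assumption.\<close>

lemma eqv_jn:
  assumes "lo p q"
  shows "eqv q (jn p q)"
proof -
  have V: "p \<in> V" "q \<in> V" using assms loV by auto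
  have "inj_on (\<lambda>y. mt y p) (iv q (jn p q))"
  proof (rule inj_on_inverseI[where g = "\<lambda>x. jn q x"])
    fix y assume y: "y \<in> iv q (jn p q)"
    then have "y \<in> V" using leV unfolding iv_def by blast
    then have "jn q (mt y p) = mt (jn q y) (jn p q)" using V by (simp add: distr' jn_comm)
    also have "\<dots> = y" using y unfolding iv_def by (simp add: mt_absorb jn_absorb)
    finally show "jn q (mt y p) = y" .
  qed
  moreover have "(\<lambda>y. mt y p) ` iv q (jn p q) \<subseteq> iv (mt p q) p"
  proof
    fix z assume "z \<in> (\<lambda>y. mt y p) ` iv q (jn p q)"
    then obtain y where z: "z = mt y p" and y: "le q y" unfolding iv_def by blast
    have "y \<in> V" using y leV by blast
    moreover have "le (mt p q) y" by (rule le_trans[OF mt2[OF V] y])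
    ultimately show "z \<in> iv (mt p q) p" unfolding z iv_def using V by (simp add: mt2 mt_greatest mt1)
  qed
  ultimately have "finite (iv q (jn p q))"
    using assms finite_imageD finite_subset unfolding lo_def by metis
  moreover have "mt (jn p q) q = q" using V by (simp add: mt_absorb jn2)
  ultimately have "lo (jn p q) q" unfolding lo_def using V by simp
  moreover have "lo q (jn p q)" by (rule lo_le[OF jn2[OF V]])
  ultimately show ?thesis unfolding eqv_def by blast
qed

lemma finite_lower_bound:
  assumes "finite T" "T \<noteq> {}" "T \<subseteq> S" "S \<subseteq> V" "\<And>x y. x \<in> S \<Longrightarrow> y \<in> S \<Longrightarrow> mt x y \<in> S"
  shows "\<exists>m\<in>S. \<forall>x\<in>T. le m x"
  using assms(1-3)
proof (induction T rule: finite_ne_induct)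
  case (singleton x)
  then show ?case using assms(4) le_refl by blast
next
  case (insert x F)
  then obtain m where m: "m \<in> S" "\<forall>x\<in>F. le m x" by auto
  have xS: "x \<in> S" using insert by blast
  have V: "x \<in> V" "m \<in> V" using xS m assms(4) by auto
  have "le (mt x m) y" if "y \<in> insert x F" for y
  proof (cases "y = x")
    case True
    then show ?thesis using mt1[OF V] by simp
  next
    case False
    then have "le m y" using m that by blast
    then show ?thesis by (rule le_trans[OF mt2[OF V]])
  qed
  then show ?case using assms(5)[OF xS m(1)] by blast
qed

lemma finite_upper_bound:
  assumes "finite T" "T \<noteq> {}" "T \<subseteq> S" "S \<subseteq> V" "\<And>x y. x \<in> S \<Longrightarrow> y \<in> S \<Longrightarrow> jn x y \<in> S"
  shows "\<exists>m\<in>S. \<forall>x\<in>T. le x m"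
  using assms(1-3)
proof (induction T rule: finite_ne_induct)
  case (singleton x)
  then show ?case using assms(4) le_refl by blast
next
  case (insert x F)
  then obtain m where m: "m \<in> S" "\<forall>x\<in>F. le x m" by auto
  have xS: "x \<in> S" using insert by blast
  have V: "x \<in> V" "m \<in> V" using xS m assms(4) by auto
  have "le y (jn x m)" if "y \<in> insert x F" for y
  proof (cases "y = x")
    case True
    then show ?thesis using jn1[OF V] by simp
  next
    case False
    then have "le y m" using m that by blast
    then show ?thesis by (rule le_trans[OF _ jn2[OF V]])
  qed
  then show ?case using assms(5)[OF xS m(1)] by blast
qed

end

text \<open>The two assumptions are what dimension one contributes; the rest of this locale is order
  theory.\<close>

locale spine_lattice = dlat V le jn mt bt tp for V :: "'b set" and le jn mt bt tp +
  assumes lo_total: "a \<in> V \<Longrightarrow> b \<in> V \<Longrightarrow> lo a b \<or> lo b a"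
    and cls_finite: "a \<in> V \<Longrightarrow> finite (cls a)"
begin

lemma cls_mt: "b \<in> cls a \<Longrightarrow> c \<in> cls a \<Longrightarrow> mt b c \<in> cls a"
  unfolding cls_def using eqv_mt[of b c] eqv_trans eqv_sym unfolding eqv_def by blast

lemma cls_jn: "b \<in> cls a \<Longrightarrow> c \<in> cls a \<Longrightarrow> jn b c \<in> cls a"
  unfolding cls_def using eqv_jn[of b c] eqv_trans eqv_sym unfolding eqv_def by blast

lemma clsV: "cls a \<subseteq> V" unfolding cls_def using eqvV by blast

lemma cls_self: "a \<in> V \<Longrightarrow> a \<in> cls a" unfolding cls_def using eqv_refl by blast

lemma cls_eq: "eqv a b \<Longrightarrow> cls a = cls b" unfolding cls_def using eqv_sym eqv_trans by blast

definition spine :: "'b set" where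
  "spine = {x \<in> V. \<forall>y\<in>cls x. le x y}"

definition top_of :: "'b \<Rightarrow> 'b" where
  "top_of x = (THE m. m \<in> cls x \<and> (\<forall>y\<in>cls x. le y m))"

lemma spineV: "x \<in> spine \<Longrightarrow> x \<in> V" unfolding spine_def by blast

lemma bottom_exists: "a \<in> V \<Longrightarrow> \<exists>x\<in>spine. a \<in> cls x"
proof -
  assume a: "a \<in> V"
  obtain m where m: "m \<in> cls a" "\<forall>x\<in>cls a. le m x"
    using finite_lower_bound[OF cls_finite[OF a] _ order_refl clsV cls_mt] cls_self[OF a] by blast
  have e: "eqv a m" using m(1) unfolding cls_def by blast
  then have "m \<in> spine" unfolding spine_def using m(2) cls_eq[OF e] eqvV by blast
  moreover have "a \<in> cls m" unfolding cls_def using eqv_sym[OF e] by blast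
  ultimately show ?thesis by blast
qed

lemma top_of: "x \<in> V \<Longrightarrow> top_of x \<in> cls x \<and> (\<forall>y\<in>cls x. le y (top_of x))"
proof -
  assume a: "x \<in> V"
  obtain m where m: "m \<in> cls x \<and> (\<forall>y\<in>cls x. le y m)"
    using finite_upper_bound[OF cls_finite[OF a] _ order_refl clsV cls_jn] cls_self[OF a] by blast
  show ?thesis unfolding top_of_def
    by (rule theI[of _ m]) (use m le_antisym in blast)+
qed

text \<open>\<open>x \<sqinter> y\<close> lies in the class of \<open>x\<close>, and
  \<open>x\<close> is the least element of that class.\<close>

lemma spine_lo_le: "x \<in> spine \<Longrightarrow> y \<in> V \<Longrightarrow> lo x y \<Longrightarrow> le x y"
proof -
  assume x: "x \<in> spine" and y: "y \<in> V" and l: "lo x y"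
  have "mt x y \<in> cls x" using eqv_mt[OF l] unfolding cls_def by blast
  then have "le x (mt x y)" using x unfolding spine_def by blast
  then show ?thesis using le_trans mt2[OF spineV[OF x] y] by blast
qed

lemma spine_total: "x \<in> spine \<Longrightarrow> y \<in> spine \<Longrightarrow> le x y \<or> le y x"
  using lo_total spine_lo_le spineV by blast

lemma spine_eqv: "x \<in> spine \<Longrightarrow> y \<in> spine \<Longrightarrow> eqv x y \<Longrightarrow> x = y"
  using spine_lo_le spineV le_antisym unfolding eqv_def by blast

definition lt :: "'b \<Rightarrow> 'b \<Rightarrow> bool" where
  "lt x y \<longleftrightarrow> x \<in> spine \<and> y \<in> spine \<and> le x y \<and> x \<noteq> y"

lemma lt_not_lo: "lt x y \<Longrightarrow> \<not> lo y x"
  unfolding lt_def using spine_lo_le spineV le_antisym by blast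

lemma lt_trans: "lt x y \<Longrightarrow> lt y z \<Longrightarrow> lt x z"
  unfolding lt_def using le_trans le_antisym by blast

lemma lt_linear: "x \<in> spine \<Longrightarrow> y \<in> spine \<Longrightarrow> lt x y \<or> x = y \<or> lt y x"
  unfolding lt_def using spine_total by blast

lemma lt_irrefl: "\<not> lt x x" unfolding lt_def by blast

lemma lt_asym: "lt x y \<Longrightarrow> \<not> lt y x" using lt_trans lt_irrefl by blast

text \<open>\<open>[x, y]\<close> is infinite because \<open>lo y x\<close> fails, so some element
  of it lies outside the finite classes of \<open>x\<close> and \<open>y\<close>; the least element
  of its class is strictly between them.\<close>

lemma spine_dense: "lt x y \<Longrightarrow> \<exists>z. lt x z \<and> lt z y"
proof -
  assume xy: "lt x y"
  then have x: "x \<in> spine" "x \<in> V" and y: "y \<in> spine" "y \<in> V" and le: "le x y"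
    unfolding lt_def using spineV by auto
  have "mt y x = x" using le by (simp add: mt_absorb)
  then have "infinite (iv x y)" using lt_not_lo[OF xy] x y unfolding lo_def by simp
  then have "\<not> iv x y \<subseteq> cls x \<union> cls y" using cls_finite x y finite_subset by blast
  then obtain w where w: "le x w" "le w y" "w \<notin> cls x" "w \<notin> cls y" unfolding iv_def by blast
  then have "w \<in> V" using leV by blast
  then obtain z where z: "z \<in> spine" "w \<in> cls z" using bottom_exists by blast
  then have zw: "lo z w" "lo w z" unfolding cls_def eqv_def by auto
  have xw: "lo x w" "lo w y" using w lo_le by auto
  have nz: "\<not> lo z x" using lo_trans[OF zw(2), of x] xw w(3) unfolding cls_def eqv_def by blast
  have ny: "\<not> lo y z" using lo_trans[OF _ zw(1), of y] xw w(4) unfolding cls_def eqv_def by blast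
  have "lt x z" using lt_linear[OF x(1) z(1)] nz lo_le le_refl[OF x(2)] unfolding lt_def by blast
  moreover have "lt z y" using lt_linear[OF z(1) y(1)] ny lo_le le_refl[OF y(2)] unfolding lt_def by blast
  ultimately show ?thesis by blast
qed

lemma cls_disjoint: "x \<in> spine \<Longrightarrow> y \<in> spine \<Longrightarrow> p \<in> cls x \<Longrightarrow> p \<in> cls y \<Longrightarrow> x = y"
  unfolding cls_def using eqv_sym eqv_trans spine_eqv by blast

lemma lt_cls_lo: "lt x y \<Longrightarrow> p \<in> cls x \<Longrightarrow> q \<in> cls y \<Longrightarrow> lo p q"
  unfolding lt_def cls_def eqv_def using lo_le lo_trans by blast

lemma lt_cls_jn: "lt x y \<Longrightarrow> p \<in> cls x \<Longrightarrow> q \<in> cls y \<Longrightarrow> jn p q \<in> cls y"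
  using eqv_jn[OF lt_cls_lo] eqv_trans unfolding cls_def by blast

lemma lt_cls_mt: "lt x y \<Longrightarrow> p \<in> cls x \<Longrightarrow> q \<in> cls y \<Longrightarrow> mt p q \<in> cls x"
  using eqv_mt[OF lt_cls_lo] eqv_trans unfolding cls_def by blast

end


section \<open>The spine of a definable lattice of dimension one\<close>

locale low_lattice = omin R d + dlat V le jn mt bt tp
  for R :: "('a::real_closed_field, 'f, 'r) expansion" and d :: nat
    and V :: "'a list set" and le jn mt bt tp +
  assumes V_dset: "dset V" and le_dv2: "dv2 le" and jn_fun: "dvvfun2 jn" and mt_fun: "dvvfun2 mt"
    and V_thin: "thin V"
begin

lemmas dle = dv2D[OF le_dv2] and djn = dvvfun2D[OF jn_fun] and dmt = dvvfun2D[OF mt_fun]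

lemma V_length: "x \<in> V \<Longrightarrow> length x = d" using V_dset unfolding dset_def by blast

lemma iv_dset:
  assumes "a \<in> V" "b \<in> V"
  shows "dset (iv a b)"
  unfolding dset_def
proof
  show "\<forall>x\<in>iv a b. length x = d" using V_length leV unfolding iv_def by blast
  show "dfn (\<lambda>e. vc 0 e \<in> iv a b)" unfolding iv_def mem_Collect_eq
    using assms V_length by (intro dfn_rules dle) auto
qed

lemma dlo: assumes f: "dvec f" and g: "dvec g" shows "dfn (\<lambda>e. lo (f e) (g e))"
proof -
  have "dfn (\<lambda>e. finite {x. le (mt (f e) (g e)) x \<and> le x (f e)})"
  proof (rule dfn_finite)
    show "dfn (\<lambda>e. le (mt (f (sh e)) (g (sh e))) (vc 0 e) \<and> le (vc 0 e) (f (sh e)))"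
      by (intro dfn_rules dle dmt dvec_sh[OF f] dvec_sh[OF g])
  qed (use V_length leV in blast)
  then show ?thesis unfolding lo_def iv_def by (intro dfn_conj dset_mem[OF V_dset] f g)
qed

lemma deqv: assumes f: "dvec f" and g: "dvec g" shows "dfn (\<lambda>e. eqv (f e) (g e))"
  unfolding eqv_def by (intro dfn_conj dlo f g)

lemma lo_total': "a \<in> V \<Longrightarrow> b \<in> V \<Longrightarrow> lo a b \<or> lo b a"
proof (rule ccontr)
  assume a: "a \<in> V" and b: "b \<in> V" and n: "\<not> (lo a b \<or> lo b a)"
  have inf: "infinite (iv (mt a b) a)" "infinite (iv (mt a b) b)"
    using n a b mt_comm[OF a b] unfolding lo_def by auto
  show False
  proof (rule no_infinite_product[OF V_thin iv_dset inf(1) iv_dset inf(2) jn_fun])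
    show "jn x y \<in> V" if "x \<in> iv (mt a b) a" "y \<in> iv (mt a b) b" for x y
      using that leV jnV unfolding iv_def by blast
    \<comment> \<open>By \<open>join_recover\<close> the fibre over \<open>z\<close> has at most one
      element.\<close>
    show "finite {(x, y). x \<in> iv (mt a b) a \<and> y \<in> iv (mt a b) b \<and> jn x y = z}" for z
      by (rule finite_subset[of _ "{(mt a z, mt b z)}"]) (use join_recover[OF a b] in auto)
  qed (use a b in auto)
qed

lemma cls_finite': "a \<in> V \<Longrightarrow> finite (cls a)"
proof (rule ccontr)
  assume a: "a \<in> V" and inf: "infinite (cls a)"
  define U where "U = {b. le a b \<and> eqv a b}"
  define D where "D = {b. le b a \<and> eqv a b}"
  have UV: "U \<subseteq> V" and DV: "D \<subseteq> V" using leV unfolding U_def D_def by auto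
  have U: "dset U" unfolding dset_def
  proof
    show "\<forall>x\<in>U. length x = d" using UV V_length by blast
    show "dfn (\<lambda>e. vc 0 e \<in> U)" unfolding U_def mem_Collect_eq
      using a V_length by (intro dfn_rules dle deqv) auto
  qed
  have D: "dset D" unfolding dset_def
  proof
    show "\<forall>x\<in>D. length x = d" using DV V_length by blast
    show "dfn (\<lambda>e. vc 0 e \<in> D)" unfolding D_def mem_Collect_eq
      using a V_length by (intro dfn_rules dle deqv) auto
  qed
  have "finite U"
  proof (rule ccontr)
    assume inf: "infinite U"
    show False
    proof (rule no_infinite_product[OF V_thin U inf U inf jn_fun])
      fix z
      show "finite {(x, y). x \<in> U \<and> y \<in> U \<and> jn x y = z}"
      proof (cases "\<exists>x y. x \<in> U \<and> y \<in> U \<and> jn x y = z")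
        case True
        then obtain x y where xy: "x \<in> U" "y \<in> U" "jn x y = z" by blast
        have V: "x \<in> V" "y \<in> V" using xy UV by auto
        have "lo x y" using xy lo_trans[of x a y] unfolding U_def eqv_def by blast
        then have "eqv y z" using eqv_jn xy by blast
        then have "lo z a" using xy(2) lo_trans unfolding U_def eqv_def by blast
        moreover have "le a z" using xy jn1[OF V] le_trans unfolding U_def by blast
        \<comment> \<open>Both arguments of a join equal to \<open>z\<close> lie in
          \<open>[a, z]\<close>, which is finite because \<open>z\<close> is still commensurable
          with \<open>a\<close>.\<close>
        ultimately have "finite (iv a z)" unfolding lo_def using mt_absorb(2) by simp
        moreover have "{(x, y). x \<in> U \<and> y \<in> U \<and> jn x y = z} \<subseteq> iv a z \<times> iv a z"
        proof
          fix p assume "p \<in> {(x, y). x \<in> U \<and> y \<in> U \<and> jn x y = z}"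
          then obtain x y where p: "p = (x, y)" "x \<in> U" "y \<in> U" "jn x y = z" by blast
          then have V': "x \<in> V" "y \<in> V" using UV by auto
          show "p \<in> iv a z \<times> iv a z"
            using p(2,3) jn1[OF V'] jn2[OF V'] unfolding p(1) p(4)[symmetric] U_def iv_def by simp
        qed
        ultimately show ?thesis using finite_subset finite_cartesian_product by blast
      next
        case False
        then have "{(x, y). x \<in> U \<and> y \<in> U \<and> jn x y = z} = {}" by blast
        then show ?thesis by (simp only: finite.emptyI)
      qed
    qed (use UV jnV in blast)
  qed
  moreover have "finite D"
  proof (rule ccontr)
    assume inf: "infinite D"
    show False
    proof (rule no_infinite_product[OF V_thin D inf D inf mt_fun])
      fix z
      show "finite {(x, y). x \<in> D \<and> y \<in> D \<and> mt x y = z}"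
      proof (cases "\<exists>x y. x \<in> D \<and> y \<in> D \<and> mt x y = z")
        case True
        then obtain x y where xy: "x \<in> D" "y \<in> D" "mt x y = z" by blast
        have V: "x \<in> V" "y \<in> V" using xy DV by auto
        have "lo x y" using xy lo_trans[of x a y] unfolding D_def eqv_def by blast
        then have "eqv x z" using eqv_mt xy by blast
        then have "lo a z" using xy(1) lo_trans unfolding D_def eqv_def by blast
        moreover have "le z a" using xy mt1[OF V] le_trans unfolding D_def by blast
        ultimately have "finite (iv z a)" unfolding lo_def using mt_absorb(2) by simp
        moreover have "{(x, y). x \<in> D \<and> y \<in> D \<and> mt x y = z} \<subseteq> iv z a \<times> iv z a"
        proof
          fix p assume "p \<in> {(x, y). x \<in> D \<and> y \<in> D \<and> mt x y = z}"
          then obtain x y where p: "p = (x, y)" "x \<in> D" "y \<in> D" "mt x y = z" by blast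
          then have V': "x \<in> V" "y \<in> V" using DV by auto
          show "p \<in> iv z a \<times> iv z a"
            using p(2,3) mt1[OF V'] mt2[OF V'] unfolding p(1) p(4)[symmetric] D_def iv_def by simp
        qed
        ultimately show ?thesis using finite_subset finite_cartesian_product by blast
      next
        case False
        then have "{(x, y). x \<in> D \<and> y \<in> D \<and> mt x y = z} = {}" by blast
        then show ?thesis by (simp only: finite.emptyI)
      qed
    qed (use DV mtV in blast)
  qed
  \<comment> \<open>An element of the class is determined by its meet and its join with
    \<open>a\<close>, which lie in the finite sets \<open>D\<close> and \<open>U\<close>.\<close>
  moreover have "inj_on (\<lambda>b. (mt a b, jn a b)) (cls a)"
  proof (rule inj_onI)
    fix x y assume xy: "x \<in> cls a" "y \<in> cls a" "(mt a x, jn a x) = (mt a y, jn a y)"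
    have V: "x \<in> V" "y \<in> V" using xy eqvV unfolding cls_def by auto
    have "x = mt x (jn a x)" using V a by (simp add: mt_absorb jn2)
    also have "\<dots> = mt x (jn a y)" using xy by simp
    also have "\<dots> = jn (mt x a) (mt x y)" using V a by (simp add: distr)
    also have "\<dots> = jn (mt y a) (mt y x)" using xy V a by (simp add: mt_comm[of _ a] mt_comm[of x y])
    also have "\<dots> = mt y (jn a x)" using V a by (simp add: distr)
    also have "\<dots> = mt y (jn a y)" using xy by simp
    also have "\<dots> = y" using V a by (simp add: mt_absorb jn2)
    finally show "x = y" .
  qed
  moreover have "(\<lambda>b. (mt a b, jn a b)) ` cls a \<subseteq> D \<times> U"
  proof
    fix z assume "z \<in> (\<lambda>b. (mt a b, jn a b)) ` cls a"
    then obtain b where z: "z = (mt a b, jn a b)" and b: "eqv a b" unfolding cls_def by blast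
    have V: "b \<in> V" using b eqvV by blast
    have "eqv a (mt a b)" using eqv_mt b unfolding eqv_def by blast
    moreover have "eqv a (jn a b)" using eqv_jn[of a b] b eqv_trans[OF b] unfolding eqv_def by blast
    ultimately show "z \<in> D \<times> U" unfolding z D_def U_def using mt1[OF a V] jn1[OF a V] by blast
  qed
  ultimately show False using inf finite_imageD finite_subset finite_cartesian_product by metis
qed

sublocale spine_lattice V le jn mt bt tp
  using lo_total' cls_finite' by unfold_locales

lemma spine_length: "x \<in> spine \<Longrightarrow> length x = d" using spineV V_length by blast

lemma spine_dset: "dset spine"
proof -
  have "spine = {x \<in> V. \<forall>y\<in>V. eqv x y \<longrightarrow> le x y}" unfolding spine_def cls_def using eqvV by blast
  moreover have "dfn (\<lambda>e. vc 0 e \<in> V \<and> (\<forall>y\<in>V. eqv (vc 0 e) y \<longrightarrow> le (vc 0 e) y))"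
    by (intro dfn_rules dle deqv V_dset)
  ultimately show ?thesis unfolding dset_def using spine_length by simp
qed

lemma dlt: assumes f: "dvec f" and g: "dvec g" shows "dfn (\<lambda>e. lt (f e) (g e))"
  unfolding lt_def by (intro dfn_rules dle f g spine_dset)

lemma finite_chain_min: "finite T \<Longrightarrow> T \<noteq> {} \<Longrightarrow> T \<subseteq> spine \<Longrightarrow> \<exists>m\<in>T. \<forall>x\<in>T. le m x"
proof -
  assume T: "finite T" "T \<noteq> {}" "T \<subseteq> spine"
  have "mt x y \<in> T" if "x \<in> T" "y \<in> T" for x y
  proof -
    have "le x y \<or> le y x" using spine_total that T(3) by blast
    then show ?thesis using mt_absorb that by metis
  qed
  moreover have "T \<subseteq> V" using T(3) spineV by blast
  ultimately show ?thesis using finite_lower_bound[OF T(1,2) order_refl] by blast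
qed

lemma lt_infinite: "lt x y \<Longrightarrow> infinite {z. lt x z \<and> lt z y}"
proof
  assume xy: "lt x y" and fin: "finite {z. lt x z \<and> lt z y}"
  have "{z. lt x z \<and> lt z y} \<noteq> {}" using spine_dense[OF xy] by blast
  moreover have "{z. lt x z \<and> lt z y} \<subseteq> spine" unfolding lt_def by blast
  ultimately obtain m where m: "lt x m" "lt m y" "\<forall>z\<in>{z. lt x z \<and> lt z y}. le m z"
    using finite_chain_min[OF fin] by blast
  obtain z where z: "lt x z" "lt z m" using spine_dense[OF m(1)] by blast
  then have "le m z" using m lt_trans by blast
  then show False using z(2) le_antisym unfolding lt_def by blast
qed

lemma le_lt: "x \<in> spine \<Longrightarrow> y \<in> spine \<Longrightarrow> le x y \<longleftrightarrow> x = y \<or> lt x y"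
  unfolding lt_def using le_refl spineV by blast

lemma not_le_lt: "x \<in> spine \<Longrightarrow> y \<in> spine \<Longrightarrow> \<not> le x y \<longleftrightarrow> lt y x"
  using lt_linear[of x y] le_lt[of x y] lt_asym lt_irrefl by blast

lemma le_lt_trans: "le x y \<Longrightarrow> lt y z \<Longrightarrow> x \<in> spine \<Longrightarrow> lt x z"
  unfolding lt_def using le_trans le_antisym by blast

lemma lt_le_trans: "lt x y \<Longrightarrow> le y z \<Longrightarrow> z \<in> spine \<Longrightarrow> lt x z"
  unfolding lt_def using le_trans le_antisym by blast

lemma ltS: "lt x y \<Longrightarrow> x \<in> spine" "lt x y \<Longrightarrow> y \<in> spine" unfolding lt_def by auto
lemma lt_le: "lt x y \<Longrightarrow> le x y" unfolding lt_def by auto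

section \<open>Gapless curves in the spine\<close>

definition sgn_of :: "bool \<Rightarrow> 'a" where "sgn_of b = (if b then 1 else - 1)"

text \<open>\<open>interval_ramsey\<close> with the colours increasing and decreasing. A decreasing
  curve is run backwards, which is why its coordinate is the parameter up to a sign.\<close>

lemma monotone_curve:
  assumes A: "dset A" "infinite A" "A \<subseteq> spine"
  shows "\<exists>\<gamma> i s a b. dvfun1 \<gamma> \<and> i < d \<and> a < b \<and>
    (\<forall>t. a < t \<longrightarrow> t < b \<longrightarrow> \<gamma> t \<in> A \<and> \<gamma> t ! i = sgn_of s * t) \<and>
    (\<forall>t t'. a < t \<longrightarrow> t < t' \<longrightarrow> t' < b \<longrightarrow> lt (\<gamma> t) (\<gamma> t'))"
proof -
  obtain \<gamma> i a b where g: "dvfun1 \<gamma>" "i < d" "a < b" "\<forall>t. a < t \<longrightarrow> t < b \<longrightarrow> \<gamma> t \<in> A \<and> \<gamma> t ! i = t"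
    using curve[OF A(1,2)] by blast
  note dg = dvfun1D[OF g(1)]
  let ?Q = "\<lambda>k s t. (k = True \<longrightarrow> lt (\<gamma> s) (\<gamma> t)) \<and> (k = False \<longrightarrow> lt (\<gamma> t) (\<gamma> s))"
  have Q: "ds2 (?Q k)" for k unfolding ds2_def by (intro dfn_rules dlt dg)
  have ex: "\<exists>k\<in>{True, False}. ?Q k s t" if "a < s" "s < t" "t < b" for s t
  proof -
    have 1: "a < t" "s < b" using that by auto
    have "\<gamma> s \<in> A" "\<gamma> t \<in> A" "\<gamma> s ! i = s" "\<gamma> t ! i = t"
      using g(4)[rule_format, OF that(1) 1(2)] g(4)[rule_format, OF 1(1) that(3)] by auto
    then have "\<gamma> s \<noteq> \<gamma> t" "\<gamma> s \<in> spine" "\<gamma> t \<in> spine" using that(2) A(3) by auto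
    then show ?thesis using lt_linear[of "\<gamma> s" "\<gamma> t"] by auto
  qed
  have fin: "finite {True, False}" by simp
  obtain k a1 b1 where k: "a \<le> a1" "a1 < b1" "b1 \<le> b" "\<forall>s t. a1 < s \<longrightarrow> s < t \<longrightarrow> t < b1 \<longrightarrow> ?Q k s t"
    by (rule interval_ramsey[where Q = ?Q, OF fin Q g(3) ex])
      (assumption | (rule that; (assumption | blast)))+
  have L: "a < t" "t < b" if "a1 < t" "t < b1" for t using that k by auto
  show ?thesis
  proof (cases k)
    case True
    have "\<forall>t. a1 < t \<longrightarrow> t < b1 \<longrightarrow> \<gamma> t \<in> A \<and> \<gamma> t ! i = sgn_of True * t"
      using g(4) L by (simp add: sgn_of_def)
    moreover have "\<forall>t t'. a1 < t \<longrightarrow> t < t' \<longrightarrow> t' < b1 \<longrightarrow> lt (\<gamma> t) (\<gamma> t')" using k(4) True by blast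
    ultimately show ?thesis using g(1,2) k(2) by blast
  next
    case False
    let ?g = "\<lambda>t. \<gamma> (- t)"
    have m: "a1 < - t" "- t < b1" if "- b1 < t" "t < - a1" for t using that by (auto simp: less_minus_iff minus_less_iff)
    have "\<forall>t. - b1 < t \<longrightarrow> t < - a1 \<longrightarrow> ?g t \<in> A \<and> ?g t ! i = sgn_of False * t"
      using g(4) L m by (simp add: sgn_of_def)
    moreover have "lt (?g t) (?g t')" if t: "- b1 < t" "t < t'" "t' < - a1" for t t'
    proof -
      have "a1 < - t'" "- t' < - t" "- t < b1" using t by (auto simp: less_minus_iff minus_less_iff)
      then show ?thesis using k(4)[rule_format, of "- t'" "- t"] False by simp
    qed
    moreover have "dvfun1 ?g" unfolding dvfun1_def by (intro dg dfn_rules)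
    moreover have "- b1 < - a1" using k(2) by simp
    ultimately show ?thesis using g(2) by blast
  qed
qed

text \<open>Otherwise the parameters with a nonempty fibre would contain an interval, and
  \<open>no_infinite_family\<close> excludes disjoint infinite fibres over an interval.\<close>

lemma few_gaps:
  assumes P: "dsv P" and PX: "\<And>t x. P t x \<Longrightarrow> x \<in> spine"
    and inf: "\<And>t x. P t x \<Longrightarrow> infinite {x. P t x}"
    and disj: "\<And>t t' x. P t x \<Longrightarrow> P t' x \<Longrightarrow> t = t'"
  shows "finite {t. \<exists>x\<in>spine. P t x}"
proof (rule ccontr)
  assume I: "infinite {t. \<exists>x\<in>spine. P t x}"
  have D: "ds1 (\<lambda>t. \<exists>x\<in>spine. P t x)" unfolding ds1_def by (intro dfn_rules spine_dset dsvD[OF P])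
  obtain a b where ab: "a < b" "\<forall>t. a < t \<longrightarrow> t < b \<longrightarrow> (\<exists>x\<in>spine. P t x)"
    by (rule infinite_interval[OF D I]) (rule that; (assumption | blast))
  show False
  proof (rule no_infinite_family[OF V_thin P ab(1)])
    show "x \<in> V \<and> length x = d" if "P t x" for t x
      using PX[OF that] spineV spine_length by blast
    show "infinite {x. P t x}" if "a < t" "t < b" for t
      using ab(2)[rule_format, OF that] inf by blast
    show "t = t'" if "P t x" "P t' x" for t t' x by (rule disj[OF that])
  qed
qed

text \<open>The parts of the spine skipped by a monotone curve just above or below its points are pairwise
  disjoint, and infinite unless empty by density.\<close>

lemma good_curve:
  assumes A: "dset A" "infinite A" "A \<subseteq> spine"
  shows "\<exists>\<gamma> i s a b. dvfun1 \<gamma> \<and> i < d \<and> a < b \<and>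
    (\<forall>t. a < t \<longrightarrow> t < b \<longrightarrow> \<gamma> t \<in> A \<and> \<gamma> t ! i = sgn_of s * t) \<and>
    (\<forall>t t'. a < t \<longrightarrow> t < t' \<longrightarrow> t' < b \<longrightarrow> lt (\<gamma> t) (\<gamma> t')) \<and>
    (\<forall>t t' x. a < t \<longrightarrow> t < t' \<longrightarrow> t' < b \<longrightarrow> x \<in> spine \<longrightarrow> le (\<gamma> t) x \<longrightarrow> le x (\<gamma> t') \<longrightarrow>
      (\<exists>\<tau>. t \<le> \<tau> \<and> \<tau> \<le> t' \<and> x = \<gamma> \<tau>))"
proof -
  obtain \<gamma> i s a b where g: "dvfun1 \<gamma>" "i < d" "a < b"
    "\<forall>t. a < t \<longrightarrow> t < b \<longrightarrow> \<gamma> t \<in> A \<and> \<gamma> t ! i = sgn_of s * t"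
    "\<forall>t t'. a < t \<longrightarrow> t < t' \<longrightarrow> t' < b \<longrightarrow> lt (\<gamma> t) (\<gamma> t')"
    using monotone_curve[OF A] by blast
  note dg = dvfun1D[OF g(1)]
  have gS: "\<gamma> t \<in> spine" if "a < t" "t < b" for t using g(4)[rule_format, OF that] A(3) by blast
  have glt: "lt (\<gamma> t) (\<gamma> t')" if "a < t" "t < t'" "t' < b" for t t' using g(5)[rule_format, OF that] .
  \<comment> \<open>\<open>?P t\<close> is the gap directly above \<open>\<gamma> t\<close>,
    \<open>?Q t\<close> the gap directly below.\<close>
  let ?P = "\<lambda>t x. (a < t \<and> t < b) \<and> lt (\<gamma> t) x \<and> (\<forall>t'. t < t' \<longrightarrow> t' < b \<longrightarrow> lt x (\<gamma> t'))"
  let ?Q = "\<lambda>t x. (a < t \<and> t < b) \<and> lt x (\<gamma> t) \<and> (\<forall>t'. a < t' \<longrightarrow> t' < t \<longrightarrow> lt (\<gamma> t') x)"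
  have fP: "finite {t. \<exists>x\<in>spine. ?P t x}"
  proof (rule few_gaps)
    show "dsv ?P" unfolding dsv_def by (intro dfn_rules dlt dg)
    show "x \<in> spine" if "?P t x" for t x using that ltS by blast
    show "t = t'" if "?P t x" "?P t' x" for t t' x
    proof (rule ccontr)
      assume "t \<noteq> t'"
      then consider "t < t'" | "t' < t" by fastforce
      then show False
      proof cases
        case 1
        then have "lt x (\<gamma> t')" "lt (\<gamma> t') x" using that by blast+
        then show False using lt_asym by blast
      next
        case 2
        then have "lt x (\<gamma> t)" "lt (\<gamma> t) x" using that by blast+
        then show False using lt_asym by blast
      qed
    qed
    show "infinite {x. ?P t x}" if P: "?P t x" for t x
    proof (rule infinite_super)
      show "{z. lt (\<gamma> t) z \<and> lt z x} \<subseteq> {x. ?P t x}" using P lt_trans by blast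
      show "infinite {z. lt (\<gamma> t) z \<and> lt z x}" using P lt_infinite by blast
    qed
  qed
  have fQ: "finite {t. \<exists>x\<in>spine. ?Q t x}"
  proof (rule few_gaps)
    show "dsv ?Q" unfolding dsv_def by (intro dfn_rules dlt dg)
    show "x \<in> spine" if "?Q t x" for t x using that ltS by blast
    show "t = t'" if "?Q t x" "?Q t' x" for t t' x
    proof (rule ccontr)
      assume "t \<noteq> t'"
      then consider "t < t'" | "t' < t" by fastforce
      then show False
      proof cases
        case 1
        then have "lt x (\<gamma> t)" "lt (\<gamma> t) x" using that by blast+
        then show False using lt_asym by blast
      next
        case 2
        then have "lt x (\<gamma> t')" "lt (\<gamma> t') x" using that by blast+
        then show False using lt_asym by blast
      qed
    qed
    show "infinite {x. ?Q t x}" if Q: "?Q t x" for t x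
    proof (rule infinite_super)
      show "{z. lt x z \<and> lt z (\<gamma> t)} \<subseteq> {x. ?Q t x}" using Q lt_trans by blast
      show "infinite {z. lt x z \<and> lt z (\<gamma> t)}" using Q lt_infinite by blast
    qed
  qed
  have D: "ds1 (\<lambda>t. (\<exists>x\<in>spine. ?P t x) \<or> (\<exists>x\<in>spine. ?Q t x))"
    unfolding ds1_def by (intro dfn_rules dlt dg spine_dset)
  have fin: "finite {t. (\<exists>x\<in>spine. ?P t x) \<or> (\<exists>x\<in>spine. ?Q t x)}"
    using finite_UnI[OF fP fQ] by (simp only: Collect_disj_eq)
  \<comment> \<open>Only finitely many parameters have gaps, so an initial stretch of the curve has
    none.\<close>
  obtain c where c: "a < c" "\<forall>t. a < t \<longrightarrow> t < c \<longrightarrow> \<not> ((\<exists>x\<in>spine. ?P t x) \<or> (\<exists>x\<in>spine. ?Q t x))"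
  proof (cases rule: germ_right[OF D, of a, consumes 0])
    case (1 c)
    have "infinite {t. (\<exists>x\<in>spine. ?P t x) \<or> (\<exists>x\<in>spine. ?Q t x)}" by (rule interval_infinite[OF 1])
    then show ?thesis using fin by (rule notE)
  next
    case (2 c)
    show ?thesis by (rule that[OF 2(1)], intro allI impI, rule 2(2))
  qed
  define c' where "c' = min b c"
  have c': "a < c'" "c' \<le> b" "c' \<le> c" using c(1) g(3) unfolding c'_def by auto
  have L: "t < b" "t < c" if "t < c'" for t using that c' by auto
  have "\<exists>\<tau>. t \<le> \<tau> \<and> \<tau> \<le> t' \<and> x = \<gamma> \<tau>"
    if t: "a < t" "t < t'" "t' < c'" and x: "x \<in> spine" "le (\<gamma> t) x" "le x (\<gamma> t')" for t t' x
  proof -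
    \<comment> \<open>At the supremum \<open>\<tau>\<close> of the parameters with value at most
      \<open>x\<close>, a value other than \<open>x\<close> would place \<open>x\<close> in one of
      the two gaps at \<open>\<tau>\<close>.\<close>
    let ?S = "\<lambda>\<tau>. (t \<le> \<tau> \<and> \<tau> \<le> t') \<and> le (\<gamma> \<tau>) x"
    have S: "ds1 ?S" unfolding ds1_def using spine_length[OF x(1)] by (intro dfn_rules dle dg) auto
    have "?S t" using t x by simp
    then obtain \<tau> where \<tau>: "is_lub ?S \<tau>"
      using lub_exists[OF S, of t t'] by blast
    have tt: "t \<le> \<tau>" using \<tau> \<open>?S t\<close> unfolding is_lub_def by blast
    have tt': "\<tau> \<le> t'" using \<tau> unfolding is_lub_def by (meson not_le)
    have \<tau>B: "a < \<tau>" "\<tau> < b" "\<tau> < c" using tt tt' t L[of \<tau>] by auto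
    have noP: "\<not> ?P \<tau> x" and noQ: "\<not> ?Q \<tau> x" using c(2)[rule_format, OF \<tau>B(1,3)] x(1) by blast+
    have "\<not> lt (\<gamma> \<tau>) x"
    proof
      assume l: "lt (\<gamma> \<tau>) x"
      have "lt x (\<gamma> u)" if u: "\<tau> < u" "u < b" for u
      proof (cases "u \<le> t'")
        case True
        have "\<not> ?S u" using \<tau> u(1) unfolding is_lub_def by (meson not_le)
        then have "\<not> le (\<gamma> u) x" using True tt u by auto
        moreover have "\<gamma> u \<in> spine" using gS u \<tau>B by auto
        ultimately show ?thesis using not_le_lt x(1) by blast
      next
        case False
        then have "lt (\<gamma> t') (\<gamma> u)" using glt[of t' u] t u by auto
        then show ?thesis using le_lt_trans x by blast
      qed
      then show False using noP l \<tau>B by blast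
    qed
    moreover have "\<not> lt x (\<gamma> \<tau>)"
    proof
      assume l: "lt x (\<gamma> \<tau>)"
      have "lt (\<gamma> u) x" if u: "a < u" "u < \<tau>" for u
      proof -
        obtain w where w: "u < w" "?S w" using \<tau> u(2) unfolding is_lub_def by blast
        then have "lt (\<gamma> u) (\<gamma> w)" using glt[of u w] u t L[of t'] by auto
        then show ?thesis using lt_le_trans w x(1) by blast
      qed
      then show False using noQ l \<tau>B by blast
    qed
    ultimately have "x = \<gamma> \<tau>" using lt_linear[OF x(1) gS[OF \<tau>B(1,2)]] by blast
    then show ?thesis using tt tt' by blast
  qed
  moreover have "\<forall>t. a < t \<longrightarrow> t < c' \<longrightarrow> \<gamma> t \<in> A \<and> \<gamma> t ! i = sgn_of s * t" using g(4) L by blast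
  moreover have "\<forall>t t'. a < t \<longrightarrow> t < t' \<longrightarrow> t' < c' \<longrightarrow> lt (\<gamma> t) (\<gamma> t')" using g(5) L by blast
  ultimately show ?thesis using g(1,2) c'(1)
    by (intro exI[of _ \<gamma>] exI[of _ i] exI[of _ s] exI[of _ a] exI[of _ c']) simp
qed

lemma dset_singleton: "length z = d \<Longrightarrow> dset {z}"
  unfolding dset_def singleton_iff by (intro conjI ballI dfn_veq dvec_vc dvec_const) simp_all

section \<open>Decomposition of the spine\<close>

text \<open>The hypotheses make being equal or \<open>\<Phi> k\<close>-related a convex equivalence relation on the spine;
  it has finitely many nontrivial classes since a definable infinite set of representatives would
  contain an interval.\<close>

lemma decomposition:
  fixes \<Phi> :: "'k \<Rightarrow> 'a list \<Rightarrow> 'a list \<Rightarrow> bool"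
  assumes K: "finite K" and D: "\<And>k. k \<in> K \<Longrightarrow> dv2 (\<Phi> k)"
    and her: "\<And>k u v u' v'. \<Phi> k u v \<Longrightarrow> le u u' \<Longrightarrow> lt u' v' \<Longrightarrow> le v' v \<Longrightarrow> u \<in> spine \<Longrightarrow> v \<in> spine \<Longrightarrow> \<Phi> k u' v'"
    and glue: "\<And>k u v w. \<Phi> k u v \<Longrightarrow> \<Phi> k v w \<Longrightarrow> lt u v \<Longrightarrow> lt v w \<Longrightarrow> \<Phi> k u w"
    and ex: "\<And>A. dset A \<Longrightarrow> infinite A \<Longrightarrow> A \<subseteq> spine \<Longrightarrow> \<exists>u v. \<exists>k\<in>K. u \<in> A \<and> lt u v \<and> \<Phi> k u v"
  shows "\<exists>\<C>. finite \<C> \<and> \<Union>\<C> = spine \<and> (\<forall>C\<in>\<C>. dset C \<and>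
    (\<forall>x y z. x \<in> C \<longrightarrow> z \<in> C \<longrightarrow> lt x y \<longrightarrow> lt y z \<longrightarrow> y \<in> C) \<and>
    ((\<exists>x. C = {x}) \<or> (\<exists>k\<in>K. \<forall>u\<in>C. \<forall>v\<in>C. lt u v \<longrightarrow> \<Phi> k u v)))"
proof -
  define E where "E k x y \<longleftrightarrow> x \<in> spine \<and> y \<in> spine \<and> (x = y \<or> (lt x y \<and> \<Phi> k x y) \<or> (lt y x \<and> \<Phi> k y x))" for k x y
  have dE: "dfn (\<lambda>e. E k (f e) (g e))" if "k \<in> K" "dvec f" "dvec g" for k f g
    unfolding E_def by (intro dfn_rules dlt dv2D[OF D] spine_dset that)
  have E_sym: "E k x y \<Longrightarrow> E k y x" for k x y unfolding E_def by blast
  have E_refl: "x \<in> spine \<Longrightarrow> E k x x" for k x unfolding E_def by blast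
  have E_lt: "\<Phi> k x y" if "E k x y" "lt x y" for k x y
    using that lt_asym lt_irrefl unfolding E_def by blast
  have conv: "E k x y" "E k y z" if "E k x z" "lt x y" "lt y z" for k x y z
  proof -
    have "\<Phi> k x z" using E_lt[OF that(1)] lt_trans that by blast
    then have "\<Phi> k x y" "\<Phi> k y z"
      using her[of k x z x y] her[of k x z y z] that le_refl spineV ltS lt_le by blast+
    then show "E k x y" "E k y z" using that ltS unfolding E_def by blast+
  qed
  have E_trans0: "E k x z" if "E k x y" "E k y z" "lt x z" for k x y z
  proof -
    have S: "x \<in> spine" "y \<in> spine" "z \<in> spine" using that unfolding E_def by auto
    consider "x = y" | "y = z" | "lt y x" | "lt x y" "lt y z" | "lt z y"
      using lt_linear[OF S(1,2)] lt_linear[OF S(2,3)] by blast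
    then show ?thesis
    proof cases
      case 3
      then show ?thesis using conv(2)[OF that(2) 3 that(3)] by blast
    next
      case 4
      then have "\<Phi> k x z" using glue E_lt that by blast
      then show ?thesis using that(3) S unfolding E_def by blast
    next
      case 5
      then show ?thesis using conv(1)[OF that(1) that(3) 5] by blast
    qed (use that in simp_all)
  qed
  have E_trans: "E k x z" if "E k x y" "E k y z" for k x y z
  proof -
    have S: "x \<in> spine" "z \<in> spine" using that unfolding E_def by auto
    show ?thesis
      using lt_linear[OF S] E_trans0[OF that] E_trans0[OF E_sym[OF that(2)] E_sym[OF that(1)]] E_sym E_refl[OF S(1)] by blast
  qed
  define rep where "rep k x = vsel (E k x)" for k x
  have drep: "dvec (\<lambda>e. rep k (f e))" if "k \<in> K" "dvec f" for k f
    unfolding rep_def by (rule dvec_vsel) (intro dE that(1) dvec_sh[OF that(2)] dvec_vc)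
  have dv1E: "dv1 (E k x)" if "k \<in> K" "x \<in> spine" for k x
    unfolding dv1_def using spine_length[OF that(2)] by (intro dE that(1) dfn_rules) auto
  have repE: "E k x (rep k x)" if "k \<in> K" "x \<in> spine" for k x
    unfolding rep_def by (rule vsel_in[OF dv1E[OF that] spine_length[OF that(2)] E_refl[OF that(2)]])
  \<comment> \<open>The choice sees a class only as a predicate, so equivalent points receive the
    same representative.\<close>
  have rep_eq: "rep k x = rep k y" if "E k x y" for k x y
  proof -
    have "E k x = E k y" using E_trans E_sym that by blast
    then show ?thesis unfolding rep_def by simp
  qed
  \<comment> \<open>\<open>Y k\<close> has one representative for each nontrivial class of
    \<open>E k\<close>; \<open>Z\<close> collects the points whose classes are trivial for every
    \<open>k\<close>.\<close>
  define Y where "Y k = {x \<in> spine. rep k x = x \<and> (\<exists>y\<in>spine. E k x y \<and> y \<noteq> x)}" for k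
  define Z where "Z = {x \<in> spine. \<forall>k\<in>K. \<not> (\<exists>y\<in>spine. E k x y \<and> y \<noteq> x)}"
  have YS: "Y k \<subseteq> spine" for k unfolding Y_def by blast
  have dY: "dset (Y k)" if "k \<in> K" for k
  proof -
    have "dfn (\<lambda>e. vc 0 e \<in> spine \<and> rep k (vc 0 e) = vc 0 e \<and> (\<exists>y\<in>spine. E k (vc 0 e) y \<and> \<not> y = vc 0 e))"
      by (intro dfn_rules dE drep that spine_dset)
    then show ?thesis unfolding dset_def Y_def using spine_length by simp
  qed
  have dZ: "dset Z"
  proof -
    have "dfn (\<lambda>e. vc 0 e \<in> spine \<and> (\<forall>k\<in>K. \<not> (\<exists>y\<in>spine. E k (vc 0 e) y \<and> \<not> y = vc 0 e)))"
      by (intro dfn_conj dfn_ball_finite dfn_not dfn_vbex dfn_veq dset_mem dE dvec_vc dvec_vc1 spine_dset K)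
    then show ?thesis unfolding dset_def Z_def using spine_length by simp
  qed
  have finZ: "finite Z"
  proof (rule ccontr)
    assume "infinite Z"
    then obtain u v k where "k \<in> K" "u \<in> Z" "lt u v" "\<Phi> k u v" using ex[OF dZ] unfolding Z_def by blast
    then have "E k u v" "v \<noteq> u" "v \<in> spine" using ltS lt_irrefl unfolding E_def by blast+
    then show False using \<open>u \<in> Z\<close> \<open>k \<in> K\<close> unfolding Z_def by blast
  qed
  \<comment> \<open>By \<open>good_curve\<close> an infinite \<open>Y k\<close> contains every spine
    point between two of its members. Inside such a stretch the nontrivial class of a point, being
    convex, contains a second point of \<open>Y k\<close>, which is absurd.\<close>
  have finY: "finite (Y k)" if k: "k \<in> K" for k
  proof (rule ccontr)
    assume "infinite (Y k)"
    from good_curve[OF dY[OF k] this YS] obtain \<gamma> i s a b where g: "a < b"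
      "\<forall>t. a < t \<longrightarrow> t < b \<longrightarrow> \<gamma> t \<in> Y k \<and> \<gamma> t ! i = sgn_of s * t"
      "\<forall>t t'. a < t \<longrightarrow> t < t' \<longrightarrow> t' < b \<longrightarrow> lt (\<gamma> t) (\<gamma> t')"
      "\<forall>t t' x. a < t \<longrightarrow> t < t' \<longrightarrow> t' < b \<longrightarrow> x \<in> spine \<longrightarrow> le (\<gamma> t) x \<longrightarrow> le x (\<gamma> t') \<longrightarrow>
        (\<exists>\<tau>. t \<le> \<tau> \<and> \<tau> \<le> t' \<and> x = \<gamma> \<tau>)"
      by blast
    obtain t1 where t1: "a < t1" "t1 < b" using dense[OF g(1)] by blast
    obtain t2 where t2: "t1 < t2" "t2 < b" using dense[OF t1(2)] by blast
    define u v where "u = \<gamma> t1" and "v = \<gamma> t2"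
    have uv: "lt u v" unfolding u_def v_def using g(3) t1 t2 by blast
    have inY: "x \<in> Y k" if x: "lt u x" "lt x v" for x
    proof -
      obtain \<tau> where "t1 \<le> \<tau>" "\<tau> \<le> t2" "x = \<gamma> \<tau>"
        using g(4)[rule_format, OF t1(1) t2, of x] x lt_le ltS unfolding u_def v_def by blast
      then show ?thesis using g(2)[rule_format, of \<tau>] t1 t2 by simp
    qed
    obtain w where w: "lt u w" "lt w v" using spine_dense[OF uv] by blast
    obtain w' where w': "w' \<in> spine" "E k w w'" "w' \<noteq> w" using inY[OF w] unfolding Y_def by blast
    have eqY: "x = y" if "x \<in> Y k" "y \<in> Y k" "E k x y" for x y
      using that rep_eq unfolding Y_def by (metis (mono_tags, lifting) mem_Collect_eq)
    have wS: "w \<in> spine" using w ltS by blast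
    consider "lt w w'" | "lt w' w" using lt_linear[OF wS w'(1)] w'(3) by blast
    then show False
    proof cases
      case 1
      \<comment> \<open>\<open>m\<close> is the smaller of \<open>w'\<close> and \<open>v\<close>:
        below it, points above \<open>w\<close> lie both in the class of \<open>w\<close> and in the
        stretch.\<close>
      obtain m where m: "lt w m" "le m w'" "le m v"
        using lt_linear[OF w'(1) ltS(2)[OF uv]] 1 w(2) lt_le le_refl spineV ltS by blast
      obtain z where z: "lt w z" "lt z m" using spine_dense[OF m(1)] by blast
      have "lt z w'" "lt z v" using lt_le_trans[OF z(2)] m w'(1) ltS(2)[OF uv] by blast+
      then have "E k w z" "z \<in> Y k" using conv(1)[OF w'(2) z(1)] inY lt_trans[OF w(1) z(1)] by blast+
      then have "w = z" using eqY[OF inY[OF w]] by blast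
      then show False using z(1) lt_irrefl by blast
    next
      case 2
      obtain m where m: "lt m w" "le w' m" "le u m"
        using lt_linear[OF w'(1) ltS(1)[OF uv]] 2 w(1) lt_le le_refl spineV ltS by blast
      obtain z where z: "lt m z" "lt z w" using spine_dense[OF m(1)] by blast
      have "lt w' z" "lt u z" using le_lt_trans[OF _ z(1)] m w'(1) ltS(1)[OF uv] by blast+
      then have "E k z w" "z \<in> Y k" using conv(2)[OF E_sym[OF w'(2)] _ z(2)] inY lt_trans[OF z(2) w(2)] by blast+
      then have "z = w" using eqY[OF _ inY[OF w]] by blast
      then show False using z(2) lt_irrefl by blast
    qed
  qed
  define \<C> where "\<C> = (\<Union>k\<in>K. (\<lambda>y. {x. E k y x}) ` Y k) \<union> (\<lambda>x. {x}) ` Z"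
  have f1: "finite \<C>" unfolding \<C>_def using K finY finZ by simp
  have f2: "\<Union>\<C> = spine"
  proof (intro equalityI subsetI)
    fix x assume "x \<in> \<Union>\<C>"
    then show "x \<in> spine" unfolding \<C>_def E_def Z_def by blast
  next
    fix x assume x: "x \<in> spine"
    show "x \<in> \<Union>\<C>"
    proof (cases "x \<in> Z")
      case True
      then show ?thesis unfolding \<C>_def by blast
    next
      case False
      then obtain k y where k: "k \<in> K" "y \<in> spine" "E k x y" "y \<noteq> x" using x unfolding Z_def by blast
      let ?r = "rep k x"
      have r: "E k x ?r" by (rule repE[OF k(1) x])
      have "?r \<in> spine" using r unfolding E_def by blast
      moreover have "rep k ?r = ?r" using rep_eq[OF r] by simp
      moreover have "\<exists>y\<in>spine. E k ?r y \<and> y \<noteq> ?r"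
      proof (cases "?r = x")
        case True
        then show ?thesis using k by auto
      next
        case False
        then have "E k ?r x \<and> x \<noteq> ?r" using E_sym[OF r] by simp
        then show ?thesis using x by (rule bexI)
      qed
      ultimately have "?r \<in> Y k" unfolding Y_def by blast
      moreover have "x \<in> {z. E k ?r z}" using E_sym[OF r] by blast
      ultimately have "{z. E k ?r z} \<in> \<C>" unfolding \<C>_def using k(1) by auto
      then show ?thesis using \<open>x \<in> {z. E k ?r z}\<close> by (rule UnionI)
    qed
  qed
  have f3: "dset C \<and> (\<forall>x y z. x \<in> C \<longrightarrow> z \<in> C \<longrightarrow> lt x y \<longrightarrow> lt y z \<longrightarrow> y \<in> C) \<and>
    ((\<exists>x. C = {x}) \<or> (\<exists>k\<in>K. \<forall>u\<in>C. \<forall>v\<in>C. lt u v \<longrightarrow> \<Phi> k u v))" if C: "C \<in> \<C>" for C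
  proof -
    consider k y where "k \<in> K" "y \<in> Y k" "C = {x. E k y x}" | z where "z \<in> Z" "C = {z}"
      using C unfolding \<C>_def by auto
    then show ?thesis
    proof cases
      case (1 k y)
      have y: "y \<in> spine" using 1 YS by blast
      have "dset C" unfolding dset_def
      proof
        show "\<forall>x\<in>C. length x = d" unfolding 1(3) E_def using spine_length by blast
        show "dfn (\<lambda>e. vc 0 e \<in> C)" using dv1E[OF 1(1) y] unfolding 1(3) dv1_def by simp
      qed
      moreover have "y' \<in> C" if "x \<in> C" "z \<in> C" "lt x y'" "lt y' z" for x y' z
      proof -
        have x: "E k y x" and "E k y z" using that unfolding 1(3) by auto
        then have "E k x z" using E_trans[OF E_sym[OF x]] by blast
        then have "E k y y'" using E_trans[OF x conv(1)[OF _ that(3,4)]] by blast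
        then show ?thesis unfolding 1(3) by blast
      qed
      moreover have "\<Phi> k u v" if "u \<in> C" "v \<in> C" "lt u v" for u v
        using that E_lt E_trans E_sym unfolding 1(3) by blast
      ultimately show ?thesis using 1(1) by blast
    next
      case (2 z)
      have z: "z \<in> spine" using 2 unfolding Z_def by blast
      have "dset C" unfolding 2(2) by (rule dset_singleton[OF spine_length[OF z]])
      moreover have "\<forall>x y z. x \<in> C \<longrightarrow> z \<in> C \<longrightarrow> lt x y \<longrightarrow> lt y z \<longrightarrow> y \<in> C"
        unfolding 2(2) using lt_asym by blast
      ultimately show ?thesis using 2(2) by blast
    qed
  qed
  show ?thesis
    by (rule exI[of _ \<C>], intro conjI f1 f2, rule ballI, rule f3)
qed

end


section \<open>Uniform finiteness\<close>

context omin
begin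

text \<open>One direction of a matching of two fibres by proximity; with both directions the fibres
  have equal size.\<close>

definition close_to :: "('a \<Rightarrow> 'a \<Rightarrow> bool) \<Rightarrow> 'a \<Rightarrow> 'a \<Rightarrow> 'a \<Rightarrow> bool" where
  "close_to A h s t \<longleftrightarrow> (\<forall>y. A s y \<longrightarrow> (\<exists>z. A t z \<and> y < z + h \<and> z < y + h) \<and>
     (\<forall>z z'. A t z \<longrightarrow> y < z + h \<longrightarrow> z < y + h \<longrightarrow> A t z' \<longrightarrow> y < z' + h \<longrightarrow> z' < y + h \<longrightarrow> z = z'))"

lemma close_to_card:
  assumes fin: "finite {y. A s y}" "finite {y. A t y}" and c: "close_to A h s t" "close_to A h t s"
  shows "card {y. A s y} = card {y. A t y}"
proof -
  have le: "card {y. A s y} \<le> card {y. A t y}"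
    if fin: "finite {y. A t y}" and c: "close_to A h s t" "close_to A h t s" for s t
  proof -
    have "\<forall>y. A s y \<longrightarrow> (\<exists>z. A t z \<and> y < z + h \<and> z < y + h)" using c(1) unfolding close_to_def by blast
    then obtain f where f: "\<And>y. A s y \<Longrightarrow> A t (f y) \<and> y < f y + h \<and> f y < y + h" by metis
    have "inj_on f {y. A s y}"
    proof (rule inj_onI)
      fix x y assume xy: "x \<in> {y. A s y}" "y \<in> {y. A s y}" "f x = f y"
      have z: "A t (f x)" "x < f x + h" "f x < x + h" "y < f x + h" "f x < y + h"
        using f[of x] f[of y] xy by auto
      show "x = y" using c(2)[unfolded close_to_def, rule_format, OF z(1), THEN conjunct2, rule_format, of x y] z xy by simp
    qed
    moreover have "f ` {y. A s y} \<subseteq> {y. A t y}" using f by blast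
    ultimately show ?thesis using fin by (rule card_inj_on_le)
  qed
  show ?thesis using le[OF fin(2) c] le[OF fin(1) c(2,1)] by simp
qed

lemma finite_gap:
  assumes "finite (S::'a set)"
  shows "\<exists>s>0. \<forall>y z. y \<in> S \<longrightarrow> z \<in> S \<longrightarrow> y < z \<longrightarrow> y + s \<le> z"
proof -
  \<comment> \<open>The extra 1 keeps the minimum meaningful for a fibre with at most one
    element.\<close>
  let ?D = "insert 1 ((\<lambda>(y, z). z - y) ` {p \<in> S \<times> S. fst p < snd p})"
  have fin: "finite ?D" using assms by simp
  have "0 < Min ?D" using fin by (subst Min_gr_iff) auto
  moreover have "y + Min ?D \<le> z" if "y \<in> S" "z \<in> S" "y < z" for y z
  proof -
    have "(\<lambda>(y, z). z - y) (y, z) \<in> ?D" using that by (intro insertI2 imageI) simp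
    then have "Min ?D \<le> z - y" using Min_le[OF fin] by simp
    then show ?thesis by (simp add: algebra_simps)
  qed
  ultimately show ?thesis by blast
qed

text \<open>A bound on a finite set, written as a reciprocal scale so that it passes to smaller
  \<open>s\<close> as \<open>uniform_bound\<close> requires.\<close>

lemma finite_scale:
  assumes "finite (S::'a set)"
  shows "\<exists>s>0. \<forall>y. y \<in> S \<longrightarrow> y * s < 1 \<and> - 1 < y * s"
proof -
  let ?m = "Max (insert 1 (abs ` S)) + 1"
  have m: "\<bar>y\<bar> < ?m" if "y \<in> S" for y
  proof -
    have "\<bar>y\<bar> \<le> Max (insert 1 (abs ` S))" using assms that by (intro Max_ge) auto
    then show ?thesis by (rule le_less_trans) (rule less_add_one)
  qed
  have "1 \<le> Max (insert 1 (abs ` S))" using assms by (intro Max_ge) auto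
  then have m0: "0 < ?m" by (meson add_pos_pos less_le_trans zero_less_one)
  have "y * (1 / ?m) < 1 \<and> - 1 < y * (1 / ?m)" if "y \<in> S" for y
  proof -
    have "y < ?m" "- y < ?m" using m[OF that] by (auto simp: abs_less_iff)
    then show ?thesis using m0 by (simp add: divide_less_eq less_divide_eq minus_less_iff)
  qed
  moreover have "0 < 1 / ?m" using m0 by simp
  ultimately show ?thesis by blast
qed

text \<open>The limit is the supremum of the eventual strict lower bounds; a larger value is not one
  of them and is therefore, by eventual constancy, an eventual upper bound.\<close>

lemma one_sided_limit:
  assumes y: "dfun1 y" and bound: "\<And>s. t < s \<Longrightarrow> s < c \<Longrightarrow> - K < y s \<and> y s < K" and tc: "t < c"
  shows "\<exists>v. \<forall>h>0. \<exists>c'>t. c' \<le> c \<and> (\<forall>s. t < s \<longrightarrow> s < c' \<longrightarrow> v - h < y s \<and> y s < v + h)"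
proof -
  let ?S = "\<lambda>v. \<exists>c'. t < c' \<and> (\<forall>s. t < s \<longrightarrow> s < c' \<longrightarrow> v < y s)"
  have S: "ds1 ?S" unfolding ds1_def by (intro dfn_rules dfun1D[OF y])
  have "?S (- K)" using bound tc by blast
  moreover have "v \<le> K" if Sv: "?S v" for v
  proof -
    obtain c' where c': "t < c'" "\<forall>s. t < s \<longrightarrow> s < c' \<longrightarrow> v < y s" using Sv by blast
    then have "t < min c c'" using tc by simp
    then obtain s where "t < s" "s < min c c'" using dense by blast
    then have "v < y s" "y s < K" using c'(2) bound by auto
    then show ?thesis by simp
  qed
  ultimately obtain v where v: "is_lub ?S v" using lub_exists[OF S] by blast
  have "\<exists>c'>t. c' \<le> c \<and> (\<forall>s. t < s \<longrightarrow> s < c' \<longrightarrow> v - h < y s \<and> y s < v + h)" if h: "0 < h" for h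
  proof -
    have "v - h < v" using h by simp
    then obtain w where w: "v - h < w" "?S w" using v unfolding is_lub_def by blast
    then obtain c1 where c1: "t < c1" "\<forall>s. t < s \<longrightarrow> s < c1 \<longrightarrow> w < y s" by blast
    have h2: "0 < h / 2" using h by simp
    have nS: "\<not> ?S (v + h / 2)"
    proof
      assume "?S (v + h / 2)"
      then have "v + h / 2 \<le> v" using v unfolding is_lub_def by blast
      then show False using h2 by simp
    qed
    have D: "ds1 (\<lambda>s. v + h / 2 < y s)" unfolding ds1_def by (intro dfn_rules dfun1D[OF y])
    obtain c2 where c2: "t < c2" "\<forall>s. t < s \<longrightarrow> s < c2 \<longrightarrow> \<not> v + h / 2 < y s"
    proof (cases rule: germ_right[OF D, of t, consumes 0])
      case (1 c2)
      then have "?S (v + h / 2)" by blast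
      then show ?thesis using nS by (rule notE[rotated])
    next
      case (2 c2)
      show ?thesis by (rule that[OF 2(1)], intro allI impI, rule 2(2))
    qed
    have "v - h < y s \<and> y s < v + h" if "t < s" "s < min c (min c1 c2)" for s
    proof -
      have "w < y s" using c1(2) that by simp
      moreover have "\<not> v + h / 2 < y s" using c2(2) that by simp
      moreover have "v + h / 2 < v + h" using h by simp
      ultimately show ?thesis using w(1) by (meson less_trans not_le order_le_less_trans)
    qed
    then show ?thesis using tc c1(1) c2(1) by (intro exI[of _ "min c (min c1 c2)"]) simp
  qed
  then show ?thesis by blast
qed

text \<open>After shrinking, the fibres have a common minimal gap and a common bound. To the right
  of a point \<open>t0\<close> they stay near the finite set \<open>L\<close> of their limits at
  \<open>t0\<close>, one fibre point near each limit, so any two of them match through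
  \<open>L\<close>.\<close>

lemma locally_close:
  assumes A: "ds2 A" and fin: "\<And>t. finite {y. A t y}" and ab: "a < b"
  shows "\<exists>a' b' h. a \<le> a' \<and> a' < b' \<and> b' \<le> b \<and> 0 < h \<and>
    (\<forall>s t. a' < s \<longrightarrow> s < b' \<longrightarrow> a' < t \<longrightarrow> t < b' \<longrightarrow> close_to A h s t)"
proof -
  note dA = ds2D[OF A]
  let ?G = "\<lambda>t s. \<forall>y z. A t y \<longrightarrow> A t z \<longrightarrow> y < z \<longrightarrow> y + s \<le> z"
  have G: "ds2 ?G" unfolding ds2_def by (intro dfn_rules dA)
  have G1: "?G t s'" if G: "?G t s" and s': "0 < s'" "s' \<le> s" for t s s'
  proof (intro allI impI)
    fix y z assume "A t y" "A t z" "y < z"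
    then have "y + s \<le> z" using G by blast
    moreover have "y + s' \<le> y + s" using s' by simp
    ultimately show "y + s' \<le> z" by simp
  qed
  have G2: "\<exists>s>0. ?G t s" for t using finite_gap[OF fin[of t]] by simp
  \<comment> \<open>\<open>g\<close> bounds the gaps inside all fibres from below; in the same way
    \<open>1 / k\<close> will bound their elements.\<close>
  obtain a1 b1 g where 1: "a \<le> a1" "a1 < b1" "b1 \<le> b" "0 < g" "\<forall>t. a1 < t \<longrightarrow> t < b1 \<longrightarrow> ?G t g"
    by (rule uniform_bound[where P = ?G, OF G ab G1 G2])
      (assumption | (rule that; (assumption | blast)))+
  let ?B = "\<lambda>t s. \<forall>y. A t y \<longrightarrow> y * s < 1 \<and> - 1 < y * s"
  have B: "ds2 ?B" unfolding ds2_def by (intro dfn_rules dA)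
  have B1: "?B t s'" if Bs: "?B t s" and s': "0 < s'" "s' \<le> s" for t s s'
  proof (intro allI impI)
    fix y assume "A t y"
    then have ys: "y * s < 1" "- 1 < y * s" using Bs by blast+
    show "y * s' < 1 \<and> - 1 < y * s'"
    proof (cases "0 \<le> y")
      case True
      then have "y * s' \<le> y * s" "0 \<le> y * s'" using s' by (simp_all add: mult_left_mono)
      moreover have "- 1 < (0::'a)" by simp
      ultimately show ?thesis using ys by (meson le_less_trans less_le_trans)
    next
      case False
      then have "y * s \<le> y * s'" "y * s' \<le> 0" using s' by (simp_all add: mult_left_mono_neg mult_nonpos_nonneg)
      moreover have "(0::'a) < 1" by simp
      ultimately show ?thesis using ys by (meson le_less_trans less_le_trans)
    qed
  qed
  have B2: "\<exists>s>0. ?B t s" for t using finite_scale[OF fin[of t]] by simp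
  obtain a2 b2 k where 2: "a1 \<le> a2" "a2 < b2" "b2 \<le> b1" "0 < k" "\<forall>t. a2 < t \<longrightarrow> t < b2 \<longrightarrow> ?B t k"
    by (rule uniform_bound[where P = ?B, OF B 1(2) B1 B2])
      (assumption | (rule that; (assumption | blast)))+
  have gap: "y + g \<le> z" if "a2 < t" "t < b2" "A t y" "A t z" "y < z" for t y z
  proof -
    have "a1 < t" "t < b1" using that 2 by auto
    then show ?thesis using 1(5) that by blast
  qed
  have bd: "- (1 / k) < y \<and> y < 1 / k" if "a2 < t" "t < b2" "A t y" for t y
  proof -
    have "y * k < 1" "- 1 < y * k" using 2(5)[rule_format, OF that] by auto
    then have "y < 1 / k" "(- 1) / k < y" by (simp_all only: pos_less_divide_eq[OF 2(4)] pos_divide_less_eq[OF 2(4)])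
    then show ?thesis by (simp only: minus_divide_left simp_thms)
  qed
  obtain t0 where t0: "a2 < t0" "t0 < b2" using dense[OF 2(2)] by blast
  \<comment> \<open>Right limits at \<open>t0\<close> of points of the fibres.\<close>
  define L where "L = {y. \<forall>h. 0 < h \<longrightarrow> (\<exists>c. t0 < c \<and> (\<forall>s. t0 < s \<longrightarrow> s < c \<longrightarrow> (\<exists>y'. A s y' \<and> y < y' + h \<and> y' < y + h)))}"
  have dL: "dfn (\<lambda>e. f e \<in> L)" if "dsc f" for f
    unfolding L_def mem_Collect_eq
    by (intro dfn_rules dA dsc_shifts[OF that])
  \<comment> \<open>Two limits are approached by two distinct fibre points, which are
    \<open>g\<close> apart; errors below \<open>g / 4\<close> on either side leave more than
    \<open>g / 2\<close>. The bound by \<open>(l' - l) / 2\<close> keeps the two fibre points in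
    order.\<close>
  have L_sep: "g / 2 < l' - l" if l: "l \<in> L" "l' \<in> L" "l < l'" for l l'
  proof -
    let ?h = "min ((l' - l) / 2) (g / 4)"
    have h: "0 < ?h" "?h \<le> (l' - l) / 2" "?h \<le> g / 4"
      using l(3) 1(4) by (simp, intro min.cobounded1, intro min.cobounded2)
    obtain c c' where c: "t0 < c" "\<forall>s. t0 < s \<longrightarrow> s < c \<longrightarrow> (\<exists>y'. A s y' \<and> l < y' + ?h \<and> y' < l + ?h)"
      "t0 < c'" "\<forall>s. t0 < s \<longrightarrow> s < c' \<longrightarrow> (\<exists>y'. A s y' \<and> l' < y' + ?h \<and> y' < l' + ?h)"
      using l(1,2) h(1) unfolding L_def by blast
    have "t0 < min b2 (min c c')" using t0 c by simp
    then obtain s where s: "t0 < s" "s < min b2 (min c c')" using dense by blast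
    obtain y where y: "A s y" "l < y + ?h" "y < l + ?h" using c(2)[rule_format, of s] s by auto
    obtain y' where y': "A s y'" "l' < y' + ?h" "y' < l' + ?h" using c(4)[rule_format, of s] s by auto
    have "y < l + (l' - l) / 2" using y(3) h(2) by linarith
    moreover have "l' - (l' - l) / 2 < y'" using y'(2) h(2) by linarith
    moreover have "l + (l' - l) / 2 = l' - (l' - l) / 2" by (simp add: field_simps)
    ultimately have "y < y'" by simp
    then have "y + g \<le> y'" using gap[OF _ _ y(1) y'(1)] s t0 by auto
    then show ?thesis using y y' h(3) by linarith
  qed
  have "finite L"
  proof (rule ccontr)
    assume "infinite L"
    then have I: "infinite {y. y \<in> L}" by simp
    have D: "ds1 (\<lambda>y. y \<in> L)" unfolding ds1_def by (intro dL dsc_sc)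
    obtain p q where pq: "p < q" "\<forall>y. p < y \<longrightarrow> y < q \<longrightarrow> y \<in> L"
      by (rule infinite_interval[OF D I]) (rule that; (assumption | blast))
    have "p < min q (p + g / 2)" using pq(1) 1(4) by simp
    then obtain y where y: "p < y" "y < min q (p + g / 2)" using dense by blast
    obtain z where z: "p < z" "z < y" using dense[OF y(1)] by blast
    have "g / 2 < y - z" using L_sep[of z y] pq(2) y z by simp
    moreover have "y < p + g / 2" using y(2) by simp
    ultimately show False using z(1) by linarith
  qed
  have g4: "0 < g / 4" using 1(4) by simp
  have "\<exists>c>t0. \<forall>s. t0 < s \<longrightarrow> s < c \<longrightarrow> (\<exists>y. A s y \<and> l < y + g / 4 \<and> y < l + g / 4)" if "l \<in> L" for l
    using that g4 unfolding L_def by blast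
  then obtain c where c: "\<And>l. l \<in> L \<Longrightarrow> t0 < c l"
    "\<And>l. l \<in> L \<Longrightarrow> \<forall>s. t0 < s \<longrightarrow> s < c l \<longrightarrow> (\<exists>y. A s y \<and> l < y + g / 4 \<and> y < l + g / 4)" by metis
  define c1 where "c1 = Min (insert b2 (c ` L))"
  have c1: "t0 < c1" "c1 \<le> b2" "\<And>l. l \<in> L \<Longrightarrow> c1 \<le> c l"
    unfolding c1_def using \<open>finite L\<close> t0 c(1) by auto
  have near1: "\<exists>y. A s y \<and> l < y + g / 4 \<and> y < l + g / 4" if "l \<in> L" "t0 < s" "s < c1" for l s
    using c(2)[OF that(1), rule_format, of s] c1(3)[OF that(1)] that by auto
  let ?far = "\<lambda>s y. A s y \<and> (\<forall>l. l \<in> L \<longrightarrow> \<not> (l < y + g / 4 \<and> y < l + g / 4))"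
  have D: "ds1 (\<lambda>s. \<exists>y. ?far s y)" unfolding ds1_def by (intro dfn_rules dA dL)
  \<comment> \<open>If points far from \<open>L\<close> occurred arbitrarily close to
    \<open>t0\<close> on the right, they could be chosen definably there and, being bounded, would
    have a limit. That limit belongs to \<open>L\<close>, contradicting the distance
    \<open>g / 4\<close>.\<close>
  obtain c2 where c2: "t0 < c2" "\<forall>s. t0 < s \<longrightarrow> s < c2 \<longrightarrow> \<not> (\<exists>y. ?far s y)"
  proof (cases rule: germ_right[OF D, of t0, consumes 0])
    case (1 c2)
    define y where "y s = sel (?far s)" for s
    have yd: "dfun1 y" unfolding dfun1_def y_def by (intro dsc_sel dfn_rules dA dL)
    have yf: "?far s (y s)" if s: "t0 < s" "s < c2" for s
    proof -
      obtain z where z: "?far s z" using 1(2)[OF s] by blast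
      have "ds1 (?far s)" unfolding ds1_def by (intro dfn_rules dA dL)
      from sel_in[where P = "?far s", OF this z] show ?thesis unfolding y_def .
    qed
    have "t0 < min c2 b2" using 1(1) t0 by simp
    moreover have "- (1 / k) < y s \<and> y s < 1 / k" if "t0 < s" "s < min c2 b2" for s
    proof -
      have "A s (y s)" using yf[of s] that by simp
      then show ?thesis using bd[of s "y s"] that t0 by simp
    qed
    ultimately obtain v where v: "\<forall>h>0. \<exists>c'>t0. c' \<le> min c2 b2 \<and> (\<forall>s. t0 < s \<longrightarrow> s < c' \<longrightarrow> v - h < y s \<and> y s < v + h)"
      using one_sided_limit[OF yd, of t0 "min c2 b2" "1 / k"] by blast
    have "v \<in> L"
      unfolding L_def mem_Collect_eq
    proof (intro allI impI)
      fix h :: 'a assume "0 < h"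
      then obtain c' where c': "t0 < c'" "c' \<le> min c2 b2" "\<forall>s. t0 < s \<longrightarrow> s < c' \<longrightarrow> v - h < y s \<and> y s < v + h"
        using v by blast
      have "A s (y s) \<and> v < y s + h \<and> y s < v + h" if s: "t0 < s" "s < c'" for s
      proof -
        have "?far s (y s)" using yf[of s] s c'(2) by simp
        moreover have "v - h < y s \<and> y s < v + h" using c'(3) s by blast
        ultimately show ?thesis by (simp add: less_diff_eq diff_less_eq)
      qed
      then show "\<exists>c>t0. \<forall>s. t0 < s \<longrightarrow> s < c \<longrightarrow> (\<exists>y'. A s y' \<and> v < y' + h \<and> y' < v + h)"
        using c'(1) by blast
    qed
    obtain c' where c': "t0 < c'" "c' \<le> min c2 b2" "\<forall>s. t0 < s \<longrightarrow> s < c' \<longrightarrow> v - g / 4 < y s \<and> y s < v + g / 4"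
      using v g4 by blast
    obtain s where s: "t0 < s" "s < c'" using dense[OF c'(1)] by blast
    have "\<not> (v < y s + g / 4 \<and> y s < v + g / 4)" using yf[of s] s c'(2) \<open>v \<in> L\<close> by simp
    moreover have "v - g / 4 < y s" "y s < v + g / 4" using c'(3) s by blast+
    ultimately show ?thesis by (simp add: diff_less_eq)
  next
    case (2 c2)
    show ?thesis by (rule that[OF 2(1)], intro allI impI, rule 2(2))
  qed
  let ?c = "min c1 c2"
  \<comment> \<open>The partner is found through a common limit, at distance \<open>g / 4\<close>
    from either point; it is unique because two candidates would be less than \<open>g\<close>
    apart.\<close>
  have close: "close_to A (g / 2) s t" if st: "t0 < s" "s < ?c" "t0 < t" "t < ?c" for s t
    unfolding close_to_def
  proof (intro allI impI conjI)
    fix y assume y: "A s y"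
    obtain l where l: "l \<in> L" "l < y + g / 4" "y < l + g / 4"
      using c2(2)[rule_format, of s] st y by auto
    obtain z where z: "A t z" "l < z + g / 4" "z < l + g / 4" using near1[OF l(1), of t] st by auto
    have "y < z + g / 2" "z < y + g / 2" using l z by linarith+
    then show "\<exists>z. A t z \<and> y < z + g / 2 \<and> z < y + g / 2" using z(1) by blast
  next
    fix y z z' assume "A s y" and z: "A t z" "y < z + g / 2" "z < y + g / 2"
      and z': "A t z'" "y < z' + g / 2" "z' < y + g / 2"
    have t: "a2 < t" "t < b2" using st t0 c1 by auto
    have "z < z' + g" "z' < z + g" using z z' by linarith+
    then show "z = z'" using gap[OF t z(1) z'(1)] gap[OF t z'(1) z(1)] by (meson not_le not_less_iff_gr_or_eq)
  qed
  show ?thesis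
    using 1(1-4) 2(1-3) t0 c1(1,2) c2(1) close
    by (intro exI[of _ t0] exI[of _ ?c] exI[of _ "g / 2"]) auto
qed

text \<open>Counts fibre points from below by nested quantifiers, which makes the cardinality of a
  finite fibre definable.\<close>

primrec many_above :: "('a \<Rightarrow> 'a \<Rightarrow> bool) \<Rightarrow> nat \<Rightarrow> 'a \<Rightarrow> 'a \<Rightarrow> bool" where
  "many_above A 0 t x = True"
| "many_above A (Suc n) t x = (\<exists>y. (x < y \<and> A t y) \<and> many_above A n t y)"

lemma ds2_many_above: "ds2 A \<Longrightarrow> ds2 (many_above A n)"
proof (induction n)
  case 0
  then show ?case unfolding ds2_def by (simp add: dfn_const)
next
  case (Suc n)
  then have IH: "ds2 (many_above A n)" by blast
  show ?case unfolding ds2_def many_above.simps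
    by (intro dfn_rules ds2D[OF Suc.prems] ds2D[OF IH])
qed

lemma many_above_card:
  assumes fin: "finite {y. A t y}"
  shows "many_above A n t x \<longleftrightarrow> n \<le> card {y. A t y \<and> x < y}"
proof (induction n arbitrary: x)
  case (Suc n)
  have f: "finite {y. A t y \<and> z < y}" for z using fin by (rule rev_finite_subset) blast
  show ?case
  proof
    assume "many_above A (Suc n) t x"
    then obtain y where y: "x < y" "A t y" "n \<le> card {z. A t z \<and> y < z}" using Suc by auto
    have "card (insert y {z. A t z \<and> y < z}) \<le> card {z. A t z \<and> x < z}"
      by (rule card_mono[OF f]) (use y in auto)
    then show "Suc n \<le> card {y. A t y \<and> x < y}" using y f[of y] by simp
  next
    assume n: "Suc n \<le> card {y. A t y \<and> x < y}"
    let ?S = "{y. A t y \<and> x < y}"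
    have "?S \<noteq> {}" using n by (metis card.empty not_less_eq_eq zero_le)
    then have m: "Min ?S \<in> ?S" using f by (rule Min_in[rotated])
    have "?S \<subseteq> insert (Min ?S) {z. A t z \<and> Min ?S < z}"
    proof
      fix y assume "y \<in> ?S"
      then show "y \<in> insert (Min ?S) {z. A t z \<and> Min ?S < z}"
        using Min_le[OF f, of y x] by (auto simp: order_le_less)
    qed
    then have "card ?S \<le> Suc (card {z. A t z \<and> Min ?S < z})"
      using card_mono[of "insert (Min ?S) {z. A t z \<and> Min ?S < z}" ?S] f[of "Min ?S"] by simp
    then have "many_above A n t (Min ?S)" using n Suc by simp
    then show "many_above A (Suc n) t x" using m by auto
  qed
qed simp

lemma card_ge_iff:
  assumes fin: "finite {y. A t y}"
  shows "n \<le> card {y. A t y} \<longleftrightarrow> (\<exists>x. many_above A n t x)"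
proof
  assume n: "n \<le> card {y. A t y}"
  \<comment> \<open>A point below the whole fibre; the inserted 0 covers the empty fibre.\<close>
  have "Min (insert 0 {y. A t y}) - 1 < y" if "A t y" for y
  proof -
    have "Min (insert 0 {y. A t y}) \<le> y" using fin that by (intro Min_le) auto
    then show ?thesis unfolding diff_less_eq by (rule le_less_trans) (rule less_add_one)
  qed
  then have "{y. A t y \<and> Min (insert 0 {y. A t y}) - 1 < y} = {y. A t y}" by blast
  then show "\<exists>x. many_above A n t x" using n many_above_card[where A = A and t = t, OF fin, of n] by metis
next
  assume "\<exists>x. many_above A n t x"
  then obtain x where "n \<le> card {y. A t y \<and> x < y}" using many_above_card[where A = A and t = t, OF fin] by blast
  moreover have "card {y. A t y \<and> x < y} \<le> card {y. A t y}" by (rule card_mono[OF fin]) blast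
  ultimately show "n \<le> card {y. A t y}" by simp
qed

lemma dsc_sc7: "dsc (\<lambda>e. sc n (sh (sh (sh (sh (sh (sh (sh e))))))))" using dsc_sc by simp

text \<open>By \<open>locally_close\<close> the exceptional points, near which the fibres do not
  match, contain no interval and so are finite in number. Between them the size is locally constant,
  hence constant.\<close>

theorem uniform_finiteness:
  assumes A: "ds2 A" and fin: "\<And>t. finite {y. A t y}"
  shows "\<exists>N. \<forall>t. card {y. A t y} \<le> N"
proof -
  note dA = ds2D[OF A]
  define N where "N t \<longleftrightarrow> (\<exists>h u v. 0 < h \<and> u < t \<and> t < v \<and> (\<forall>s s'. u < s \<longrightarrow> s < v \<longrightarrow> u < s' \<longrightarrow> s' < v \<longrightarrow> close_to A h s s'))" for t
  have dN: "ds1 N" unfolding ds1_def N_def close_to_def by (intro dfn_rules dsc_sc7 dA)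
  have dN': "ds1 (\<lambda>t. \<not> N t)" unfolding ds1_def by (intro dfn_rules ds1D[OF dN])
  have B: "finite {t. \<not> N t}"
  proof (rule ccontr)
    assume I: "infinite {t. \<not> N t}"
    obtain a b where ab: "a < b" "\<forall>t. a < t \<longrightarrow> t < b \<longrightarrow> \<not> N t"
      by (rule infinite_interval[OF dN' I]) (rule that; (assumption | blast))
    obtain a' b' h where c: "a \<le> a'" "a' < b'" "b' \<le> b" "0 < h"
      "\<forall>s t. a' < s \<longrightarrow> s < b' \<longrightarrow> a' < t \<longrightarrow> t < b' \<longrightarrow> close_to A h s t"
      using locally_close[OF A fin ab(1)] by blast
    obtain t where t: "a' < t" "t < b'" using dense[OF c(2)] by blast
    have "N t" unfolding N_def using c(4,5) t by blast
    then show False using ab(2) t c(1,3) by auto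
  qed
  have dcard: "ds1 (\<lambda>t. card {y. A t y} = n)" for n
  proof -
    have "card {y. A t y} = n \<longleftrightarrow> (\<exists>x. many_above A n t x) \<and> \<not> (\<exists>x. many_above A (Suc n) t x)" for t
      using card_ge_iff[where A = A and t = t, OF fin[of t], of n] card_ge_iff[where A = A and t = t, OF fin[of t], of "Suc n"] by auto
    moreover have "dfn (\<lambda>e. (\<exists>x. many_above A n (sc 0 e) x) \<and> \<not> (\<exists>x. many_above A (Suc n) (sc 0 e) x))"
      by (intro dfn_rules ds2D[OF ds2_many_above[OF A]])
    ultimately show ?thesis unfolding ds1_def by (simp only:)
  qed
  have loc: "\<exists>u v. u < t \<and> t < v \<and> (\<forall>s s'. u < s \<longrightarrow> s < v \<longrightarrow> u < s' \<longrightarrow> s' < v \<longrightarrow> card {y. A s y} = card {y. A s' y})"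
    if N: "N t" for t
  proof -
    obtain h u v where h: "u < t" "t < v" "\<forall>s s'. u < s \<longrightarrow> s < v \<longrightarrow> u < s' \<longrightarrow> s' < v \<longrightarrow> close_to A h s s'"
      using N unfolding N_def by blast
    have "card {y. A s y} = card {y. A s' y}" if "u < s" "s < v" "u < s'" "s' < v" for s s'
      by (rule close_to_card[OF fin fin h(3)[rule_format, OF that] h(3)[rule_format, OF that(3,4,1,2)]])
    then show ?thesis using h(1,2) by blast
  qed
  \<comment> \<open>Definable connectedness: the supremum \<open>\<sigma>\<close> of the parameters
    up to which the size is constant has a neighbourhood of constant size, so it cannot stop short
    of \<open>t\<close>.\<close>
  have const: "card {y. A t y} = card {y. A s y}" if st: "s < t" and nice: "\<forall>\<tau>. s \<le> \<tau> \<longrightarrow> \<tau> \<le> t \<longrightarrow> N \<tau>" for s t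
  proof -
    let ?n = "card {y. A s y}"
    let ?S = "\<lambda>\<tau>. (s \<le> \<tau> \<and> \<tau> \<le> t) \<and> (\<forall>\<tau>'. s \<le> \<tau>' \<longrightarrow> \<tau>' \<le> \<tau> \<longrightarrow> card {y. A \<tau>' y} = ?n)"
    have S: "ds1 ?S" unfolding ds1_def by (intro dfn_rules ds1D[OF dcard])
    have Ss: "?S s" using st by auto
    obtain \<sigma> where \<sigma>: "is_lub ?S \<sigma>"
      using lub_exists[OF S, of s t] Ss by blast
    have s\<sigma>: "s \<le> \<sigma>" by (rule \<sigma>[unfolded is_lub_def, THEN conjunct1, rule_format, OF Ss])
    have \<sigma>t: "\<sigma> \<le> t" using \<sigma> unfolding is_lub_def by (meson not_le)
    obtain u v where uv: "u < \<sigma>" "\<sigma> < v"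
      "\<forall>x x'. u < x \<longrightarrow> x < v \<longrightarrow> u < x' \<longrightarrow> x' < v \<longrightarrow> card {y. A x y} = card {y. A x' y}"
      using loc[of \<sigma>] nice s\<sigma> \<sigma>t by blast
    obtain \<tau> where \<tau>: "u < \<tau>" "?S \<tau>" using \<sigma> uv(1) unfolding is_lub_def by blast
    have "\<tau> \<le> \<sigma>" using \<sigma> \<tau>(2) unfolding is_lub_def by blast
    then have "\<tau> < v" using uv(2) by simp
    have eq: "card {y. A x y} = ?n" if x: "s \<le> x" "x < v" for x
    proof (cases "x \<le> \<tau>")
      case True
      then show ?thesis using \<tau>(2) x(1) by blast
    next
      case False
      then have "u < x" using \<tau>(1) by simp
      then have "card {y. A x y} = card {y. A \<tau> y}" using uv(3) x(2) \<tau>(1) \<open>\<tau> < v\<close> by blast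
      moreover have "card {y. A \<tau> y} = ?n" using \<tau>(2) by blast
      ultimately show ?thesis by simp
    qed
    have "\<sigma> = t"
    proof (rule ccontr)
      assume "\<sigma> \<noteq> t"
      then have "\<sigma> < min v t" using \<sigma>t uv(2) by simp
      then obtain x where x: "\<sigma> < x" "x < min v t" using dense by blast
      have xs: "s \<le> x" "x \<le> t" "x < v" using x s\<sigma> by simp_all
      have e1: "card {y. A \<tau>' y} = ?n" if "s \<le> \<tau>'" "\<tau>' \<le> x" for \<tau>'
        by (rule eq[OF that(1)]) (use that(2) xs(3) in simp)
      have "?S x" by (intro conjI allI impI xs(1,2)) (rule e1)
      then have "x \<le> \<sigma>" by (rule \<sigma>[unfolded is_lub_def, THEN conjunct1, rule_format])
      then show False using x(1) by simp
    qed
    then show ?thesis using eq[of t] st uv(2) by simp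
  qed
  \<comment> \<open>The stretch of good parameters to which \<open>t\<close> belongs is encoded by
    the set of exceptional points below \<open>t\<close>.\<close>
  let ?B = "{t. \<not> N t}"
  let ?key = "\<lambda>t. {x \<in> ?B. x < t}"
  have key: "card {y. A t y} = card {y. A s y}" if "N s" "N t" "?key s = ?key t" for s t
  proof -
    have nice: "N \<tau>" if "N s'" "N t'" "?key s' = ?key t'" "s' \<le> \<tau>" "\<tau> \<le> t'" for s' t' \<tau>
    proof (rule ccontr)
      assume nN: "\<not> N \<tau>"
      then have "\<tau> \<noteq> t'" using that(2) by blast
      then have "\<tau> \<in> ?key t'" using nN that(5) by auto
      then have "\<tau> \<in> ?key s'" using that(3) by blast
      then show False using that(4) by simp
    qed
    show ?thesis
    proof (cases s t rule: linorder_cases)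
      case less
      then show ?thesis using const[OF less] nice[OF that] by blast
    next
      case greater
      then show ?thesis using const[OF greater] nice[OF that(2,1) that(3)[symmetric]] by simp
    qed simp
  qed
  define f where "f S = card {y. A (SOME t. N t \<and> ?key t = S) y}" for S
  have c: "card {y. A t y} \<in> f ` Pow ?B \<union> (\<lambda>t. card {y. A t y}) ` ?B" for t
  proof (cases "N t")
    case True
    have "N (SOME x. N x \<and> ?key x = ?key t) \<and> ?key (SOME x. N x \<and> ?key x = ?key t) = ?key t"
      by (rule someI[of "\<lambda>x. N x \<and> ?key x = ?key t" t]) (use True in simp)
    then have fk: "f (?key t) = card {y. A t y}" unfolding f_def using key[OF True, of "SOME x. N x \<and> ?key x = ?key t"] by simp
    have "?key t \<in> Pow ?B" by blast
    then have "f (?key t) \<in> f ` Pow ?B" by (rule imageI)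
    then show ?thesis unfolding fk by (rule UnI1)
  next
    case False
    then show ?thesis by (intro UnI2 imageI CollectI)
  qed
  have "finite (f ` Pow ?B \<union> (\<lambda>t. card {y. A t y}) ` ?B)" using B by simp
  then show ?thesis by (intro exI allI) (rule Max_ge[OF _ c])
qed

end


section \<open>Homogeneous pieces of the spine\<close>

context low_lattice
begin

text \<open>\<open>\<kappa>\<close> consists of a coordinate index and a sign, the sign making the
  coordinate increase along the spine.\<close>

definition cc :: "nat \<times> bool \<Rightarrow> 'a list \<Rightarrow> 'a" where
  "cc \<kappa> x = sgn_of (snd \<kappa>) * x ! fst \<kappa>"

text \<open>The signed coordinate is an order embedding of the spine interval from \<open>u\<close>
  to \<open>v\<close> with convex image.\<close>

definition coord :: "nat \<times> bool \<Rightarrow> 'a list \<Rightarrow> 'a list \<Rightarrow> bool" where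
  "coord \<kappa> u v \<longleftrightarrow> (\<forall>x\<in>spine. \<forall>y\<in>spine. le u x \<longrightarrow> lt x y \<longrightarrow> le y v \<longrightarrow> cc \<kappa> x < cc \<kappa> y) \<and>
     (\<forall>t. cc \<kappa> u < t \<longrightarrow> t < cc \<kappa> v \<longrightarrow> (\<exists>x\<in>spine. (le u x \<and> le x v) \<and> cc \<kappa> x = t))"

lemma dcc: assumes f: "dvec f" and \<kappa>: "fst \<kappa> < d" shows "dsc (\<lambda>e. cc \<kappa> (f e))"
  unfolding cc_def by (intro dfn_rules f \<kappa>)

lemma dvec_sh2: "dvec f \<Longrightarrow> dvec (\<lambda>e. f (sh (sh e)))" by (rule dvec_sh[OF dvec_sh])

lemma dcoord: assumes f: "dvec f" and g: "dvec g" and \<kappa>: "fst \<kappa> < d" shows "dfn (\<lambda>e. coord \<kappa> (f e) (g e))"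
  unfolding coord_def
  by (intro dfn_rules dlt dle dcc \<kappa> spine_dset f g dvec_sh[OF f] dvec_sh[OF g] dvec_sh2[OF f] dvec_sh2[OF g])

lemma coord_mono: "coord \<kappa> u v \<Longrightarrow> le u x \<Longrightarrow> lt x y \<Longrightarrow> le y v \<Longrightarrow> cc \<kappa> x < cc \<kappa> y"
  unfolding coord_def using ltS by blast

lemma coord_conv: "coord \<kappa> u v \<Longrightarrow> cc \<kappa> u < t \<Longrightarrow> t < cc \<kappa> v \<Longrightarrow> \<exists>x\<in>spine. le u x \<and> le x v \<and> cc \<kappa> x = t"
  unfolding coord_def by blast

lemma coord_hereditary:
  assumes c: "coord \<kappa> u v" and l: "le u u'" "lt u' v'" "le v' v" and S: "u \<in> spine" "v \<in> spine"
  shows "coord \<kappa> u' v'"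
  unfolding coord_def
proof (intro conjI ballI allI impI)
  fix x y assume "le u' x" "lt x y" "le y v'"
  then show "cc \<kappa> x < cc \<kappa> y" using coord_mono[OF c] le_trans[OF l(1)] le_trans[OF _ l(3)] by blast
next
  fix t assume t: "cc \<kappa> u' < t" "t < cc \<kappa> v'"
  have S': "u' \<in> spine" "v' \<in> spine" using l(2) ltS by auto
  have "cc \<kappa> u \<le> cc \<kappa> u'"
    using l(1) le_lt[OF S(1) S'(1)] coord_mono[OF c le_refl[OF spineV[OF S(1)]], of u'] le_trans[OF lt_le[OF l(2)] l(3)]
    by (metis order_le_less)
  moreover have "cc \<kappa> v' \<le> cc \<kappa> v"
    using l(3) le_lt[OF S'(2) S(2)] coord_mono[OF c le_trans[OF l(1) lt_le[OF l(2)]] _ le_refl[OF spineV[OF S(2)]]]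
    by (metis order_le_less)
  ultimately obtain x where x: "x \<in> spine" "le u x" "le x v" "cc \<kappa> x = t"
    using coord_conv[OF c, of t] t by force
  have "le u' x"
  proof (rule ccontr)
    assume "\<not> le u' x"
    then have "lt x u'" using not_le_lt[OF S'(1) x(1)] by blast
    then have "cc \<kappa> x < cc \<kappa> u'" using coord_mono[OF c x(2) _ le_trans[OF lt_le[OF l(2)] l(3)]] by blast
    then show False using t(1) x(4) by simp
  qed
  moreover have "le x v'"
  proof (rule ccontr)
    assume "\<not> le x v'"
    then have "lt v' x" using not_le_lt[OF x(1) S'(2)] by blast
    then have "cc \<kappa> v' < cc \<kappa> x" using coord_mono[OF c le_trans[OF l(1) lt_le[OF l(2)]] _ x(3)] by blast
    then show False using t(2) x(4) by simp
  qed
  ultimately show "\<exists>x\<in>spine. (le u' x \<and> le x v') \<and> cc \<kappa> x = t" using x by blast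
qed

text \<open>Points on different sides of \<open>v\<close> are compared through \<open>v\<close>, and
  an intermediate value is attained on one of the two sides or at \<open>v\<close> itself.\<close>

lemma coord_glue:
  assumes c: "coord \<kappa> u v" "coord \<kappa> v w" and l: "lt u v" "lt v w"
  shows "coord \<kappa> u w"
  unfolding coord_def
proof (intro conjI ballI allI impI)
  note S = ltS[OF l(1)] ltS[OF l(2)]
  note rv = le_refl[OF spineV[OF S(2)]]
  fix x y assume x: "x \<in> spine" and y: "y \<in> spine" and xy: "le u x" "lt x y" "le y w"
  consider "le y v" | "le v x" | "lt x v" "lt v y" using not_le_lt S x y by blast
  then show "cc \<kappa> x < cc \<kappa> y"
  proof cases
    case 1
    then show ?thesis using coord_mono[OF c(1) xy(1,2)] by blast
  next
    case 2
    then show ?thesis using coord_mono[OF c(2) _ xy(2,3)] by blast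
  next
    case 3
    have "cc \<kappa> x < cc \<kappa> v" by (rule coord_mono[OF c(1) xy(1) 3(1) rv])
    also have "\<dots> < cc \<kappa> y" by (rule coord_mono[OF c(2) rv 3(2) xy(3)])
    finally show ?thesis .
  qed
next
  note S = ltS[OF l(1)] ltS[OF l(2)]
  fix t assume t: "cc \<kappa> u < t" "t < cc \<kappa> w"
  consider "t < cc \<kappa> v" | "t = cc \<kappa> v" | "cc \<kappa> v < t" by fastforce
  then show "\<exists>x\<in>spine. (le u x \<and> le x w) \<and> cc \<kappa> x = t"
  proof cases
    case 1
    then show ?thesis using coord_conv[OF c(1) t(1) 1] le_trans[OF _ lt_le[OF l(2)]] by blast
  next
    case 2
    then show ?thesis using lt_le[OF l(1)] lt_le[OF l(2)] S(2) by blast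
  next
    case 3
    then show ?thesis using coord_conv[OF c(2) 3 t(2)] le_trans[OF lt_le[OF l(1)]] by blast
  qed
qed

lemma sgn_of_square: "sgn_of s * (sgn_of s * t) = t"
  by (simp add: sgn_of_def)

text \<open>On a gapless curve every spine point between two curve points is on the curve, so there
  the signed coordinate is inverse to the parametrization.\<close>

lemma coord_exists:
  assumes A: "dset A" "infinite A" "A \<subseteq> spine"
  shows "\<exists>\<gamma> a b \<kappa>. \<kappa> \<in> {..<d} \<times> UNIV \<and> dvfun1 \<gamma> \<and> a < b \<and> (\<forall>t. a < t \<longrightarrow> t < b \<longrightarrow> \<gamma> t \<in> A) \<and>
    (\<forall>t t'. a < t \<longrightarrow> t < t' \<longrightarrow> t' < b \<longrightarrow> lt (\<gamma> t) (\<gamma> t') \<and> coord \<kappa> (\<gamma> t) (\<gamma> t') \<and>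
      (\<forall>x\<in>spine. le (\<gamma> t) x \<longrightarrow> le x (\<gamma> t') \<longrightarrow> (\<exists>\<tau>. t \<le> \<tau> \<and> \<tau> \<le> t' \<and> x = \<gamma> \<tau>)))"
proof -
  obtain \<gamma> i s a b where g: "dvfun1 \<gamma>" "i < d" "a < b"
    "\<forall>t. a < t \<longrightarrow> t < b \<longrightarrow> \<gamma> t \<in> A \<and> \<gamma> t ! i = sgn_of s * t"
    "\<forall>t t'. a < t \<longrightarrow> t < t' \<longrightarrow> t' < b \<longrightarrow> lt (\<gamma> t) (\<gamma> t')"
    "\<forall>t t' x. a < t \<longrightarrow> t < t' \<longrightarrow> t' < b \<longrightarrow> x \<in> spine \<longrightarrow> le (\<gamma> t) x \<longrightarrow> le x (\<gamma> t') \<longrightarrow>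
      (\<exists>\<tau>. t \<le> \<tau> \<and> \<tau> \<le> t' \<and> x = \<gamma> \<tau>)"
    using good_curve[OF A] by blast
  let ?k = "(i, s)"
  have cg: "cc ?k (\<gamma> t) = t" if "a < t" "t < b" for t
    using g(4)[rule_format, OF that] by (simp add: cc_def sgn_of_square)
  have gS: "\<gamma> t \<in> spine" if "a < t" "t < b" for t using g(4)[rule_format, OF that] A(3) by blast
  have "coord ?k (\<gamma> t) (\<gamma> t')" if t: "a < t" "t < t'" "t' < b" for t t'
    unfolding coord_def
  proof (intro conjI ballI allI impI)
    fix x y assume x: "x \<in> spine" and y: "y \<in> spine" and xy: "le (\<gamma> t) x" "lt x y" "le y (\<gamma> t')"
    obtain \<tau> where \<tau>: "t \<le> \<tau>" "\<tau> \<le> t'" "x = \<gamma> \<tau>"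
      using g(6)[rule_format, OF t x xy(1)] le_trans[OF lt_le[OF xy(2)] xy(3)] by blast
    obtain \<tau>' where \<tau>': "t \<le> \<tau>'" "\<tau>' \<le> t'" "y = \<gamma> \<tau>'"
      using g(6)[rule_format, OF t y _ xy(3)] le_trans[OF xy(1) lt_le[OF xy(2)]] by blast
    have B: "a < \<tau>" "\<tau> < b" "a < \<tau>'" "\<tau>' < b" using \<tau> \<tau>' t by auto
    have "\<tau> < \<tau>'"
    proof (rule ccontr)
      assume "\<not> \<tau> < \<tau>'"
      then consider "\<tau> = \<tau>'" | "\<tau>' < \<tau>" by fastforce
      then show False
      proof cases
        case 1
        then show False using xy(2) \<tau> \<tau>' lt_irrefl by simp
      next
        case 2
        then have "lt y x" unfolding \<tau>(3) \<tau>'(3) using g(5) B by blast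
        then show False using xy(2) lt_asym by blast
      qed
    qed
    then show "cc ?k x < cc ?k y" unfolding \<tau>(3) \<tau>'(3) using cg B by simp
  next
    fix r assume r: "cc ?k (\<gamma> t) < r" "r < cc ?k (\<gamma> t')"
    have B: "a < t'" "t < b" using t by auto
    have r': "t < r" "r < t'" using r cg[OF t(1) B(2)] cg[OF B(1) t(3)] by simp_all
    have B': "a < r" "r < b" using r' t by auto
    have "lt (\<gamma> t) (\<gamma> r)" "lt (\<gamma> r) (\<gamma> t')" using g(5) r' t B' by blast+
    then show "\<exists>x\<in>spine. (le (\<gamma> t) x \<and> le x (\<gamma> t')) \<and> cc ?k x = r"
      using gS[OF B'] cg[OF B'] lt_le by blast
  qed
  then have "\<forall>t t'. a < t \<longrightarrow> t < t' \<longrightarrow> t' < b \<longrightarrow> lt (\<gamma> t) (\<gamma> t') \<and> coord ?k (\<gamma> t) (\<gamma> t') \<and>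
      (\<forall>x\<in>spine. le (\<gamma> t) x \<longrightarrow> le x (\<gamma> t') \<longrightarrow> (\<exists>\<tau>. t \<le> \<tau> \<and> \<tau> \<le> t' \<and> x = \<gamma> \<tau>))"
    using g(5,6) by blast
  moreover have "\<forall>t. a < t \<longrightarrow> t < b \<longrightarrow> \<gamma> t \<in> A" using g(4) by blast
  moreover have "?k \<in> {..<d} \<times> UNIV" using g(2) by simp
  ultimately show ?thesis using g(1,3)
    by (intro exI[of _ \<gamma>] exI[of _ a] exI[of _ b] exI[of _ ?k]) (intro conjI; assumption)
qed

text \<open>A decomposition by coordinates alone. It comes before the labels because the bound on
  class sizes needs pieces indexed by one element of the field.\<close>

lemma coord_pieces:
  "\<exists>\<C>. finite \<C> \<and> \<Union>\<C> = spine \<and> (\<forall>C\<in>\<C>. dset C \<and>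
    (\<forall>x y z. x \<in> C \<longrightarrow> z \<in> C \<longrightarrow> lt x y \<longrightarrow> lt y z \<longrightarrow> y \<in> C) \<and>
    ((\<exists>x. C = {x}) \<or> (\<exists>k\<in>{..<d} \<times> UNIV. \<forall>u\<in>C. \<forall>v\<in>C. lt u v \<longrightarrow> coord k u v)))"
proof (rule decomposition)
  show "finite ({..<d} \<times> (UNIV :: bool set))" by simp
  show "dv2 (coord k)" if "k \<in> {..<d} \<times> UNIV" for k
    unfolding dv2_def using that by (intro dcoord dfn_rules) auto
  show "coord k u' v'" if "coord k u v" "le u u'" "lt u' v'" "le v' v" "u \<in> spine" "v \<in> spine" for k u v u' v'
    by (rule coord_hereditary[OF that])
  show "coord k u w" if "coord k u v" "coord k v w" "lt u v" "lt v w" for k u v w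
    by (rule coord_glue[OF that])
  fix A assume A: "dset A" "infinite A" "A \<subseteq> spine"
  obtain \<gamma> a b k where g: "k \<in> {..<d} \<times> UNIV" "dvfun1 \<gamma>" "a < b" "\<forall>t. a < t \<longrightarrow> t < b \<longrightarrow> \<gamma> t \<in> A"
    "\<forall>t t'. a < t \<longrightarrow> t < t' \<longrightarrow> t' < b \<longrightarrow> lt (\<gamma> t) (\<gamma> t') \<and> coord k (\<gamma> t) (\<gamma> t') \<and>
      (\<forall>x\<in>spine. le (\<gamma> t) x \<longrightarrow> le x (\<gamma> t') \<longrightarrow> (\<exists>\<tau>. t \<le> \<tau> \<and> \<tau> \<le> t' \<and> x = \<gamma> \<tau>))"
    using coord_exists[OF A] by (elim exE conjE) (rule that)
  obtain t where t: "a < t" "t < b" using dense[OF g(3)] by blast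
  obtain t' where t': "t < t'" "t' < b" using dense[OF t(2)] by blast
  show "\<exists>u v. \<exists>k\<in>{..<d} \<times> UNIV. u \<in> A \<and> lt u v \<and> coord k u v"
    using g(4)[rule_format, OF t] g(5)[rule_format, OF t(1) t'] g(1)
    by (intro exI[of _ "\<gamma> t"] exI[of _ "\<gamma> t'"] bexI[of _ k]) simp_all
qed

lemma card_lists_bound:
  assumes "finite X" "\<And>x. x \<in> X \<Longrightarrow> length x = d" "\<And>k. k < d \<Longrightarrow> card ((\<lambda>x. x ! k) ` X) \<le> M k"
  shows "card X \<le> (\<Sum>k<d. M k) ^ d"
proof -
  let ?S = "\<Union>k<d. (\<lambda>x. x ! k) ` X"
  have fS: "finite ?S" using assms(1) by simp
  have "X \<subseteq> {xs. set xs \<subseteq> ?S \<and> length xs = d}" using assms(2) by (fastforce simp: set_conv_nth)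
  then have "card X \<le> card {xs. set xs \<subseteq> ?S \<and> length xs = d}"
    by (rule card_mono[OF finite_lists_length_eq[OF fS]])
  also have "\<dots> = card ?S ^ d" by (rule card_lists_length_eq[OF fS])
  also have "card ?S \<le> (\<Sum>k<d. card ((\<lambda>x. x ! k) ` X))" by (rule card_UN_le) simp
  also have "\<dots> \<le> (\<Sum>k<d. M k)" using assms(3) by (intro sum_mono) simp
  finally show ?thesis by (simp add: power_mono)
qed

text \<open>On a piece charted by a signed coordinate, \<open>uniform_finiteness\<close> applies to
  each coordinate of the members of the classes, and tuples with few values in each coordinate are
  few.\<close>

lemma cls_card_bounded: "\<exists>N. \<forall>x\<in>spine. card (cls x) \<le> N"
proof -
  obtain \<C> where C: "finite \<C>" "\<Union>\<C> = spine" "\<forall>C\<in>\<C>. dset C \<and>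
    (\<forall>x y z. x \<in> C \<longrightarrow> z \<in> C \<longrightarrow> lt x y \<longrightarrow> lt y z \<longrightarrow> y \<in> C) \<and>
    ((\<exists>x. C = {x}) \<or> (\<exists>k\<in>{..<d} \<times> UNIV. \<forall>u\<in>C. \<forall>v\<in>C. lt u v \<longrightarrow> coord k u v))"
    using coord_pieces by (elim exE conjE) (rule that)
  have "\<exists>N. \<forall>x\<in>C. card (cls x) \<le> N" if CC: "C \<in> \<C>" for C
  proof -
    have CS: "C \<subseteq> spine" using C(2) CC by blast
    note h = C(3)[THEN bspec, OF CC]
    have dC: "dset C" using h by (rule conjunct1)
    have "(\<exists>x. C = {x}) \<or> (\<exists>k\<in>{..<d} \<times> UNIV. \<forall>u\<in>C. \<forall>v\<in>C. lt u v \<longrightarrow> coord k u v)"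
      using h by (elim conjE)
    then consider x where "C = {x}" | k where "k \<in> {..<d} \<times> UNIV" "\<forall>u\<in>C. \<forall>v\<in>C. lt u v \<longrightarrow> coord k u v"
      by blast
    then show ?thesis
    proof cases
      case (1 x)
      then show ?thesis by blast
    next
      case (2 k)
      have kd: "fst k < d" using 2(1) by auto
      have lt_cc: "cc k x < cc k y" if "x \<in> C" "y \<in> C" "lt x y" for x y
        using coord_mono[OF 2(2)[rule_format, OF that] le_refl that(3) le_refl] that CS spineV by blast
      have inj: "x = y" if "x \<in> C" "y \<in> C" "cc k x = cc k y" for x y
        using lt_cc[of x y] lt_cc[of y x] lt_linear[of x y] that CS by force
      \<comment> \<open>The fibre over \<open>t\<close> consists of the \<open>j\<close>-th
        coordinates of the class of the point of \<open>C\<close> whose signed coordinate is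
        \<open>t\<close>.\<close>
      define A where "A j t y \<longleftrightarrow> (\<exists>x\<in>C. cc k x = t \<and> (\<exists>p\<in>V. eqv x p \<and> p ! j = y))" for j t y
      have dA: "ds2 (A j)" if "j < d" for j
        unfolding ds2_def A_def by (intro dfn_rules dcc kd deqv that dC V_dset)
      have Aeq: "{y. A j (cc k x) y} = (\<lambda>p. p ! j) ` cls x" if x: "x \<in> C" for j x
      proof (intro equalityI subsetI)
        fix y assume "y \<in> {y. A j (cc k x) y}"
        then obtain x' p where "x' \<in> C" "cc k x' = cc k x" "eqv x' p" "p ! j = y" unfolding A_def by blast
        then have "x' = x" using inj x by blast
        then show "y \<in> (\<lambda>p. p ! j) ` cls x" using \<open>eqv x' p\<close> \<open>p ! j = y\<close> unfolding cls_def by blast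
      next
        fix y assume "y \<in> (\<lambda>p. p ! j) ` cls x"
        then obtain p where "eqv x p" "p ! j = y" unfolding cls_def by blast
        then show "y \<in> {y. A j (cc k x) y}" unfolding A_def using x eqvV by blast
      qed
      have fin: "finite {y. A j t y}" for j t
      proof (cases "\<exists>x\<in>C. cc k x = t")
        case True
        then obtain x where x: "x \<in> C" "cc k x = t" by blast
        have "finite (cls x)" using cls_finite[OF spineV] CS x(1) by blast
        then show ?thesis using Aeq[OF x(1)] x(2) by simp
      next
        case False
        then have "{y. A j t y} = {}" unfolding A_def by blast
        then show ?thesis by simp
      qed
      have "\<forall>j<d. \<exists>N. \<forall>t. card {y. A j t y} \<le> N" using uniform_finiteness[OF dA fin] by blast
      then obtain M where M: "\<And>j t. j < d \<Longrightarrow> card {y. A j t y} \<le> M j" by metis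
      have "card (cls x) \<le> (\<Sum>k<d. M k) ^ d" if x: "x \<in> C" for x
      proof (rule card_lists_bound)
        show "finite (cls x)" using cls_finite[OF spineV] CS x by blast
        show "length p = d" if "p \<in> cls x" for p using that clsV V_length by blast
        show "card ((\<lambda>p. p ! j) ` cls x) \<le> M j" if "j < d" for j
          using M[OF that, of "cc k x"] Aeq[OF x] by simp
      qed
      then show ?thesis by blast
    qed
  qed
  then obtain N where N: "\<And>C x. C \<in> \<C> \<Longrightarrow> x \<in> C \<Longrightarrow> card (cls x) \<le> N C" by metis
  have "card (cls x) \<le> (\<Sum>C\<in>\<C>. N C)" if xs: "x \<in> spine" for x
  proof -
    have "x \<in> \<Union>\<C>" using xs unfolding C(2) .
    then obtain D where D: "D \<in> \<C>" "x \<in> D" by (rule UnionE)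
    have "card (cls x) \<le> N D" by (rule N[OF D])
    also have "\<dots> \<le> (\<Sum>C\<in>\<C>. N C)" by (rule member_le_sum[OF D(1)]) (simp_all add: C(1))
    finally show ?thesis .
  qed
  then show ?thesis by blast
qed

text \<open>The elements of a class are labelled from 1 in the order in which definable choice picks them.\<close>

primrec rem :: "'a list \<Rightarrow> nat \<Rightarrow> 'a list \<Rightarrow> bool" where
  "rem x 0 p = eqv x p"
| "rem x (Suc k) p = (rem x k p \<and> (k = 0 \<or> p \<noteq> vsel (rem x k)))"

definition lab :: "'a list \<Rightarrow> nat \<Rightarrow> 'a list" where
  "lab x k = vsel (rem x k)"

lemma drem: "dvec f \<Longrightarrow> dvec g \<Longrightarrow> dfn (\<lambda>e. rem (f e) k (g e))"
proof (induction k arbitrary: f g)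
  case 0
  then show ?case by (simp add: deqv)
next
  case (Suc k)
  have "dvec (\<lambda>e. vsel (rem (f e) k))"
    by (rule dvec_vsel) (rule Suc.IH[OF dvec_sh[OF Suc.prems(1)] dvec_vc])
  then show ?case unfolding rem.simps by (intro dfn_rules Suc)
qed

lemma dlab: "dvec f \<Longrightarrow> dvec (\<lambda>e. lab (f e) k)"
  unfolding lab_def by (rule dvec_vsel) (rule drem[OF dvec_sh dvec_vc])

lemma rem_cls: "rem x k p \<Longrightarrow> p \<in> cls x"
  by (induction k) (auto simp: cls_def)

text \<open>The passage from stage 0 to stage 1 removes nothing, so before label
  \<open>Suc k\<close> is chosen exactly \<open>k\<close> elements are gone; this is why labels
  start at 1.\<close>

lemma rem_card:
  assumes x: "x \<in> V"
  shows "k \<le> card (cls x) \<Longrightarrow> card {p. rem x (Suc k) p} = card (cls x) - k"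
proof (induction k)
  case 0
  then show ?case by (simp add: cls_def)
next
  case (Suc k)
  have c: "card {p. rem x (Suc k) p} = card (cls x) - k" using Suc by simp
  have fin: "finite {p. rem x (Suc k) p}"
    by (rule finite_subset[OF _ cls_finite[OF x]]) (use rem_cls in blast)
  have "{p. rem x (Suc k) p} \<noteq> {}"
  proof
    assume "{p. rem x (Suc k) p} = {}"
    then show False using c Suc.prems by (metis card.empty diff_is_0_eq not_less_eq_eq)
  qed
  then obtain q where q: "rem x (Suc k) q" by blast
  have qV: "length q = d" using rem_cls[OF q] clsV V_length by blast
  have dv: "dv1 (rem x (Suc k))" unfolding dv1_def
    by (intro drem dvec_const dvec_vc V_length x)
  have l: "rem x (Suc k) (vsel (rem x (Suc k)))" by (rule vsel_in[OF dv qV q])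
  have "{p. rem x (Suc (Suc k)) p} = {p. rem x (Suc k) p} - {vsel (rem x (Suc k))}"
    by (subst rem.simps(2)) blast
  then have "card {p. rem x (Suc (Suc k)) p} = card {p. rem x (Suc k) p} - 1"
    using l fin by (simp only: card_Diff_singleton mem_Collect_eq)
  then show ?case using c by simp
qed

lemma lab_rem: "x \<in> V \<Longrightarrow> k \<in> {1..card (cls x)} \<Longrightarrow> rem x k (lab x k)"
proof -
  assume x: "x \<in> V" and k: "k \<in> {1..card (cls x)}"
  obtain j where j: "k = Suc j" "j < card (cls x)" using k by (cases k) auto
  have "card {p. rem x k p} \<noteq> 0" using rem_card[OF x, of j] j by simp
  then obtain q where q: "rem x k q" by fastforce
  have "length q = d" using rem_cls[OF q] clsV V_length by blast
  moreover have "dv1 (rem x k)" unfolding dv1_def by (intro drem dvec_const dvec_vc V_length x)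
  ultimately show ?thesis unfolding lab_def using vsel_in q by blast
qed

lemma rem_le: "rem x k p \<Longrightarrow> j < k \<Longrightarrow> j \<noteq> 0 \<Longrightarrow> p \<noteq> lab x j"
  by (induction k) (auto simp: lab_def less_Suc_eq)

lemma lab_bij: "x \<in> V \<Longrightarrow> bij_betw (lab x) {1..card (cls x)} (cls x)"
proof -
  assume x: "x \<in> V"
  have inj: "inj_on (lab x) {1..card (cls x)}"
  proof (rule inj_onI)
    fix j k assume jk: "j \<in> {1..card (cls x)}" "k \<in> {1..card (cls x)}" "lab x j = lab x k"
    show "j = k"
      using rem_le[OF lab_rem[OF x jk(1)], of k] rem_le[OF lab_rem[OF x jk(2)], of j] jk
      by (metis One_nat_def atLeastAtMost_iff linorder_neqE_nat not_one_le_zero)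
  qed
  have sub: "lab x ` {1..card (cls x)} \<subseteq> cls x" using rem_cls lab_rem[OF x] by blast
  have "card (lab x ` {1..card (cls x)}) = card (cls x)" using card_image[OF inj] by simp
  then have "lab x ` {1..card (cls x)} = cls x" using card_subset_eq[OF cls_finite[OF x] sub] by simp
  then show ?thesis using inj unfolding bij_betw_def by blast
qed

lemma card_cls_pos: "x \<in> V \<Longrightarrow> 1 \<le> card (cls x)"
  using cls_self cls_finite by (metis One_nat_def Suc_leI card_gt_0_iff empty_iff)

text \<open>Size and order type of a class in first-order form: some element is available for label
  \<open>n\<close> and none for label \<open>n + 1\<close>, and \<open>r\<close> records the order
  of the labels.\<close>

definition str :: "nat \<Rightarrow> (nat \<times> nat) set \<Rightarrow> 'a list \<Rightarrow> bool" where
  "str n r x \<longleftrightarrow> (\<exists>p\<in>V. rem x n p) \<and> \<not> (\<exists>p\<in>V. rem x (Suc n) p) \<and>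
     (\<forall>q\<in>{1..n} \<times> {1..n}. (q \<in> r) \<longleftrightarrow> le (lab x (fst q)) (lab x (snd q)))"

text \<open>Joins with \<open>y\<close> determine the joins with all members of the class of
  \<open>y\<close>, because \<open>y\<close> is its least element.\<close>

definition lnk :: "nat \<Rightarrow> (nat \<times> nat) set \<Rightarrow> 'a list \<Rightarrow> 'a list \<Rightarrow> bool" where
  "lnk n l x y \<longleftrightarrow> (\<forall>q\<in>{1..n} \<times> {1..n}. (q \<in> l) \<longleftrightarrow> jn (lab x (fst q)) y = lab y (snd q))"

lemma dstr: assumes f: "dvec f" shows "dfn (\<lambda>e. str n r (f e))"
  unfolding str_def
  by (intro dfn_conj dfn_not dfn_vbex dfn_ball_finite dfn_iff dfn_const dle dlab drem dvec_sh[OF f] f dvec_vc V_dset) simp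

lemma dlnk: assumes f: "dvec f" and g: "dvec g" shows "dfn (\<lambda>e. lnk n r (f e) (g e))"
  unfolding lnk_def
  by (intro dfn_ball_finite dfn_iff dfn_const dfn_veq djn dlab f g) simp

lemma str_card:
  assumes x: "x \<in> V" and n: "1 \<le> n"
  shows "(\<exists>p\<in>V. rem x n p) \<and> \<not> (\<exists>p\<in>V. rem x (Suc n) p) \<longleftrightarrow> n = card (cls x)"
proof -
  have ex: "(\<exists>p\<in>V. rem x (Suc k) p) \<longleftrightarrow> k < card (cls x)" for k
  proof (cases "k \<le> card (cls x)")
    case True
    have fin: "finite {p. rem x (Suc k) p}"
      by (rule finite_subset[OF _ cls_finite[OF x]]) (use rem_cls in blast)
    have "(\<exists>p\<in>V. rem x (Suc k) p) \<longleftrightarrow> {p. rem x (Suc k) p} \<noteq> {}" using rem_cls clsV by blast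
    also have "\<dots> \<longleftrightarrow> card {p. rem x (Suc k) p} \<noteq> 0" using fin by (metis card_0_eq)
    also have "\<dots> \<longleftrightarrow> k < card (cls x)" using rem_card[OF x True] by auto
    finally show ?thesis .
  next
    case False
    have mono: "rem x (i + j) p \<Longrightarrow> rem x i p" for i j p by (induction j) auto
    have "finite {p. rem x (Suc (card (cls x))) p}"
      by (rule finite_subset[OF _ cls_finite[OF x]]) (use rem_cls in blast)
    then have e: "{p. rem x (Suc (card (cls x))) p} = {}" using rem_card[OF x, of "card (cls x)"] by (metis card_0_eq diff_self_eq_0 order_refl)
    have s: "Suc (card (cls x)) + (k - card (cls x)) = Suc k" using False by simp
    have "\<not> rem x (Suc k) p" for p
    proof
      assume "rem x (Suc k) p"
      then have "rem x (Suc (card (cls x))) p" using mono[of "Suc (card (cls x))" "k - card (cls x)" p] unfolding s by blast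
      then show False using e by blast
    qed
    then show ?thesis using False by simp
  qed
  obtain k where "n = Suc k" using n by (cases n) auto
  then show ?thesis using ex[of k] ex[of n] by auto
qed

lemma str_iff:
  assumes "x \<in> V" "1 \<le> n"
  shows "str n r x \<longleftrightarrow> n = card (cls x) \<and> (\<forall>j\<in>{1..n}. \<forall>k\<in>{1..n}. (j, k) \<in> r \<longleftrightarrow> le (lab x j) (lab x k))"
proof -
  have "(\<forall>q\<in>{1..n} \<times> {1..n}. (q \<in> r) \<longleftrightarrow> le (lab x (fst q)) (lab x (snd q))) \<longleftrightarrow>
    (\<forall>j\<in>{1..n}. \<forall>k\<in>{1..n}. (j, k) \<in> r \<longleftrightarrow> le (lab x j) (lab x k))" by auto
  then show ?thesis unfolding str_def using str_card[OF assms] by blast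
qed

end


section \<open>Homogeneous intervals of the spine\<close>

context low_lattice
begin

definition hom :: "(nat \<times> bool) \<times> nat \<times> (nat \<times> nat) set \<times> (nat \<times> nat) set \<Rightarrow> 'a list \<Rightarrow> 'a list \<Rightarrow> bool" where
  "hom \<tau> u v \<longleftrightarrow> coord (fst \<tau>) u v \<and> (\<forall>x\<in>spine. \<forall>y\<in>spine. le u x \<longrightarrow> lt x y \<longrightarrow> le y v \<longrightarrow>
     (str (fst (snd \<tau>)) (fst (snd (snd \<tau>))) x \<and> str (fst (snd \<tau>)) (fst (snd (snd \<tau>))) y) \<and>
     lnk (fst (snd \<tau>)) (snd (snd (snd \<tau>))) x y)"

lemma homD:
  assumes "hom (\<kappa>, n, r, l) u v" "le u x" "lt x y" "le y v"
  shows "str n r x" "str n r y" "lnk n l x y"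
  using assms ltS[OF assms(3)] unfolding hom_def by simp_all

lemma label_of:
  assumes "x \<in> V" "p \<in> cls x"
  shows "\<exists>k\<in>{1..card (cls x)}. lab x k = p"
proof -
  have "p \<in> lab x ` {1..card (cls x)}"
    using assms(2) bij_betw_imp_surj_on[OF lab_bij[OF assms(1)]] by simp
  then show ?thesis by auto
qed

lemma lab_cls: "x \<in> V \<Longrightarrow> k \<in> {1..card (cls x)} \<Longrightarrow> lab x k \<in> cls x"
  using bij_betwE[OF lab_bij, of x] by simp

lemma lab_inj: "x \<in> V \<Longrightarrow> j \<in> {1..card (cls x)} \<Longrightarrow> k \<in> {1..card (cls x)} \<Longrightarrow> lab x j = lab x k \<Longrightarrow> j = k"
  using inj_onD[OF bij_betw_imp_inj_on[OF lab_bij]] by blast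

lemma link_exists:
  assumes xy: "lt x y" and j: "j \<in> {1..card (cls x)}"
  shows "\<exists>k\<in>{1..card (cls y)}. jn (lab x j) y = lab y k"
proof -
  have V: "x \<in> V" "y \<in> V" using ltS[OF xy] spineV by auto
  have "jn (lab x j) y \<in> cls y" by (rule lt_cls_jn[OF xy lab_cls[OF V(1) j] cls_self[OF V(2)]])
  then show ?thesis using label_of[OF V(2)] by metis
qed

lemma jn_trans: "p \<in> V \<Longrightarrow> le z y \<Longrightarrow> jn (jn p z) y = jn p y"
  using leV[of z y] by (simp add: jn_assoc jn_absorb)

lemma lnkD: "lnk n l x y \<Longrightarrow> j \<in> {1..n} \<Longrightarrow> k \<in> {1..n} \<Longrightarrow> (j, k) \<in> l \<longleftrightarrow> jn (lab x j) y = lab y k"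
  unfolding lnk_def by auto

lemma lnk_compose:
  assumes l: "lt x z" "lt z y" and L: "lnk n l x z" "lnk n l z y" and n: "n = card (cls x)"
    and T: "j \<in> {1..n}" "m \<in> {1..n}" "k \<in> {1..n}" and jm: "(j, m) \<in> l" "(m, k) \<in> l"
  shows "jn (lab x j) y = lab y k"
proof -
  have xV: "x \<in> V" using ltS[OF l(1)] spineV by blast
  have "lab x j \<in> cls x" by (rule lab_cls[OF xV T(1)[unfolded n]])
  then have "lab x j \<in> V" using clsV by blast
  then have "jn (lab x j) y = jn (jn (lab x j) z) y" using jn_trans[OF _ lt_le[OF l(2)]] by simp
  also have "jn (lab x j) z = lab z m" using lnkD[OF L(1) T(1,2)] jm(1) by simp
  also have "jn (lab z m) y = lab y k" using lnkD[OF L(2) T(2,3)] jm(2) by simp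
  finally show ?thesis .
qed

text \<open>Links compose, so the link from \<open>x\<close> to \<open>y\<close> is the relation
  \<open>l\<close> composed with itself. The additional point \<open>z\<close> between
  \<open>x\<close> and \<open>v\<close> shows in the same way that this composite is
  \<open>l\<close>.\<close>

lemma lnk_glue:
  assumes xz: "lt x z" and zv: "lt z v" and vy: "lt v y"
    and L: "lnk n l x z" "lnk n l z v" "lnk n l x v" "lnk n l v y"
    and n: "n = card (cls x)" "n = card (cls z)" "n = card (cls v)" "n = card (cls y)"
  shows "lnk n l x y"
  unfolding lnk_def
proof
  fix q assume "q \<in> {1..n} \<times> {1..n}"
  then obtain j k where q: "q = (j, k)" and j: "j \<in> {1..n}" and k: "k \<in> {1..n}" by blast
  have xv: "lt x v" by (rule lt_trans[OF xz zv])
  have V: "v \<in> V" "y \<in> V" using ltS[OF vy] spineV by auto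
  obtain m where m: "m \<in> {1..n}" "jn (lab x j) v = lab v m" using link_exists[OF xv] j n by metis
  obtain k' where k': "k' \<in> {1..n}" "jn (lab v m) y = lab y k'" using link_exists[OF vy] m(1) n by metis
  have jm: "(j, m) \<in> l" using lnkD[OF L(3) j m(1)] m(2) by simp
  have mk: "(m, k') \<in> l" using lnkD[OF L(4) m(1) k'(1)] k'(2) by simp
  have e: "jn (lab x j) y = lab y k'" by (rule lnk_compose[OF xv vy L(3,4) n(1) j m(1) k'(1) jm mk])
  \<comment> \<open>The link from \<open>x\<close> to \<open>v\<close> is now computed through
    \<open>z\<close>; comparison with the direct link gives idempotence.\<close>
  have "jn (lab x j) v = lab v k'" by (rule lnk_compose[OF xz zv L(1,2) n(1) j m(1) k'(1) jm mk])
  then have m': "m = k'" using lab_inj[OF V(1), of m k'] m k'(1) n(3) by simp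
  have "(j, k) \<in> l \<longleftrightarrow> k = k'"
    using lnkD[OF L(3) j k] m(2) lab_inj[OF V(1), of m k] m(1) k n(3) m' by auto
  moreover have "jn (lab x j) y = lab y k \<longleftrightarrow> k = k'"
    unfolding e using lab_inj[OF V(2), of k' k] k k'(1) n(4) by auto
  ultimately show "(q \<in> l) = (jn (lab x (fst q)) y = lab y (snd q))" unfolding q by simp
qed

lemma str_cardD: "str n r x \<Longrightarrow> 1 \<le> n \<Longrightarrow> x \<in> spine \<Longrightarrow> n = card (cls x)"
  using str_iff spineV by blast

lemma hom_glue:
  assumes h: "hom (\<kappa>, n, r, l) u v" "hom (\<kappa>, n, r, l) v w" and uv: "lt u v" and vw: "lt v w" and n: "1 \<le> n"
  shows "hom (\<kappa>, n, r, l) u w"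
proof -
  note S = ltS[OF uv] ltS[OF vw]
  note rv = le_refl[OF spineV[OF S(2)]]
  have "coord \<kappa> u w" using coord_glue[OF _ _ uv vw] h unfolding hom_def by simp
  moreover have "(str n r x \<and> str n r y) \<and> lnk n l x y"
    if x: "x \<in> spine" and y: "y \<in> spine" and xy: "le u x" "lt x y" "le y w" for x y
  proof -
    consider "le y v" | "le v x" | "lt x v" "lt v y" using not_le_lt S x y by blast
    then show ?thesis
    proof cases
      case 1
      show ?thesis using homD[OF h(1) xy(1,2) 1] by blast
    next
      case 2
      show ?thesis using homD[OF h(2) 2 xy(2,3)] by blast
    next
      case 3
      \<comment> \<open>Density supplies the intermediate point for \<open>lnk_glue\<close>.\<close>
      obtain z where z: "lt x z" "lt z v" using spine_dense[OF 3(1)] by blast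
      note h1 = homD[OF h(1) xy(1) z(1) lt_le[OF z(2)]]
      note h2 = homD[OF h(1) le_trans[OF xy(1) lt_le[OF z(1)]] z(2) rv]
      note h3 = homD[OF h(1) xy(1) 3(1) rv]
      note h4 = homD[OF h(2) rv 3(2) xy(3)]
      have "lnk n l x y"
        by (rule lnk_glue[OF z 3(2) h1(3) h2(3) h3(3) h4(3)])
          (use str_cardD[OF _ n] h1 h2 h4 x y ltS[OF z(2)] in blast)+
      then show ?thesis using h1(1) h4(2) by blast
    qed
  qed
  ultimately show ?thesis unfolding hom_def by simp
qed

lemma hom_hereditary:
  assumes h: "hom \<tau> u v" and l: "le u u'" "lt u' v'" "le v' v" and S: "u \<in> spine" "v \<in> spine"
  shows "hom \<tau> u' v'"
  unfolding hom_def
proof (intro conjI[OF _ ballI[OF ballI]] impI)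
  show "coord (fst \<tau>) u' v'" using coord_hereditary[OF _ l S] h unfolding hom_def by blast
  fix x y assume x: "x \<in> spine" "y \<in> spine" and xy: "le u' x" "lt x y" "le y v'"
  show "(str (fst (snd \<tau>)) (fst (snd (snd \<tau>))) x \<and> str (fst (snd \<tau>)) (fst (snd (snd \<tau>))) y) \<and>
     lnk (fst (snd \<tau>)) (snd (snd (snd \<tau>))) x y"
    using h x xy le_trans[OF l(1) xy(1)] le_trans[OF xy(3) l(3)] unfolding hom_def by blast
qed

text \<open>Along a gapless curve, pigeonhole fixes the size and order of the labels, and then
  \<open>interval_ramsey\<close> fixes the link, which depends on two points. All spine points
  between two curve points are on the curve, so the result holds on a spine interval.\<close>

lemma hom_exists:
  assumes N: "\<forall>x\<in>spine. card (cls x) \<le> N" and A: "dset A" "infinite A" "A \<subseteq> spine"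
  shows "\<exists>u v \<tau>. \<tau> \<in> ({..<d} \<times> UNIV) \<times> {1..N} \<times> Pow ({1..N} \<times> {1..N}) \<times> Pow ({1..N} \<times> {1..N}) \<and>
    u \<in> A \<and> lt u v \<and> hom \<tau> u v"
proof -
  let ?W = "{1..N} \<times> {1..N}"
  obtain \<gamma> a b \<kappa> where g: "\<kappa> \<in> {..<d} \<times> UNIV" "dvfun1 \<gamma>" "a < b" "\<forall>t. a < t \<longrightarrow> t < b \<longrightarrow> \<gamma> t \<in> A"
    "\<forall>t t'. a < t \<longrightarrow> t < t' \<longrightarrow> t' < b \<longrightarrow> lt (\<gamma> t) (\<gamma> t') \<and> coord \<kappa> (\<gamma> t) (\<gamma> t') \<and>
      (\<forall>x\<in>spine. le (\<gamma> t) x \<longrightarrow> le x (\<gamma> t') \<longrightarrow> (\<exists>\<tau>. t \<le> \<tau> \<and> \<tau> \<le> t' \<and> x = \<gamma> \<tau>))"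
    using coord_exists[OF A] by (elim exE conjE) (rule that)
  note dg = dvfun1D[OF g(2)]
  have gS: "\<gamma> t \<in> spine" if "a < t" "t < b" for t using g(4)[rule_format, OF that] A(3) by blast
  have P1: "ds1 (\<lambda>t. str (fst k) (snd k) (\<gamma> t))" if "k \<in> {1..N} \<times> Pow ?W" for k
    unfolding ds1_def by (intro dstr dg dsc_sc)
  have P2: "\<exists>k\<in>{1..N} \<times> Pow ?W. str (fst k) (snd k) (\<gamma> t)" if t: "a < t" "t < b" for t
  proof -
    let ?n = "card (cls (\<gamma> t))"
    let ?r = "{(j, k). j \<in> {1..?n} \<and> k \<in> {1..?n} \<and> le (lab (\<gamma> t) j) (lab (\<gamma> t) k)}"
    have V: "\<gamma> t \<in> V" using gS[OF t] spineV by blast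
    have n: "1 \<le> ?n" "?n \<le> N" using card_cls_pos[OF V] N gS[OF t] by auto
    have "str ?n ?r (\<gamma> t)" using str_iff[OF V n(1), of ?r] by simp
    moreover have "?r \<subseteq> ?W" using n(2) by auto
    ultimately show ?thesis using n by (intro bexI[of _ "(?n, ?r)"]) simp_all
  qed
  have f1: "finite ({1..N} \<times> Pow ?W)" by simp
  obtain k a1 b1 where k: "k \<in> {1..N} \<times> Pow ?W" "a \<le> a1" "a1 < b1" "b1 \<le> b"
    "\<forall>t. a1 < t \<longrightarrow> t < b1 \<longrightarrow> str (fst k) (snd k) (\<gamma> t)"
    by (rule interval_pigeonhole[where P = "\<lambda>k t. str (fst k) (snd k) (\<gamma> t)", OF f1 P1 g(3) P2])
      (assumption | (rule that; (assumption | blast)))+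
  obtain n r where nr: "k = (n, r)" by fastforce
  have nN: "n \<in> {1..N}" "r \<in> Pow ?W" using k(1) nr by auto
  have st: "str n r (\<gamma> t)" if "a1 < t" "t < b1" for t using k(5)[rule_format, OF that] nr by simp
  have L1: "a < t" "t < b" if "a1 < t" "t < b1" for t using that k(2,4) by auto
  have Q1: "ds2 (\<lambda>s t. lnk n l (\<gamma> s) (\<gamma> t))" if "l \<in> Pow ?W" for l
    unfolding ds2_def by (intro dlnk dg dsc_sc)
  have Q2: "\<exists>l\<in>Pow ?W. lnk n l (\<gamma> s) (\<gamma> t)" for s t
  proof -
    let ?l = "{(j, k). j \<in> {1..n} \<and> k \<in> {1..n} \<and> jn (lab (\<gamma> s) j) (\<gamma> t) = lab (\<gamma> t) k}"
    have "lnk n ?l (\<gamma> s) (\<gamma> t)" unfolding lnk_def by auto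
    moreover have "?l \<in> Pow ?W" using nN(1) by auto
    ultimately show ?thesis by blast
  qed
  have f2: "finite (Pow ?W)" by simp
  obtain l a2 b2 where l: "l \<in> Pow ?W" "a1 \<le> a2" "a2 < b2" "b2 \<le> b1"
    "\<forall>s t. a2 < s \<longrightarrow> s < t \<longrightarrow> t < b2 \<longrightarrow> lnk n l (\<gamma> s) (\<gamma> t)"
    by (rule interval_ramsey[where Q = "\<lambda>l s t. lnk n l (\<gamma> s) (\<gamma> t)", OF f2 Q1 k(3) Q2])
      (assumption | (rule that; (assumption | blast)))+
  have L2: "a1 < t" "t < b1" if "a2 < t" "t < b2" for t using that l(2,4) by auto
  obtain t where t: "a2 < t" "t < b2" using dense[OF l(3)] by blast
  obtain t' where t': "t < t'" "t' < b2" using dense[OF t(2)] by blast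
  have t'2: "a2 < t'" using t t' by simp
  note B = L1[OF L2[OF t]] L1[OF L2[OF t'2 t'(2)]]
  note gg = g(5)[rule_format, OF B(1) t'(1) B(4)]
  have "hom (\<kappa>, n, r, l) (\<gamma> t) (\<gamma> t')"
    unfolding hom_def fst_conv snd_conv
  proof (intro conjI[OF _ ballI[OF ballI]] impI)
    show "coord \<kappa> (\<gamma> t) (\<gamma> t')" using gg by blast
    fix x y assume x: "x \<in> spine" and y: "y \<in> spine" and xy: "le (\<gamma> t) x" "lt x y" "le y (\<gamma> t')"
    have "le x (\<gamma> t')" by (rule le_trans[OF lt_le[OF xy(2)] xy(3)])
    then obtain \<tau> where \<tau>: "t \<le> \<tau>" "\<tau> \<le> t'" "x = \<gamma> \<tau>" using gg x xy(1) by blast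
    have "le (\<gamma> t) y" by (rule le_trans[OF xy(1) lt_le[OF xy(2)]])
    then obtain \<tau>' where \<tau>': "t \<le> \<tau>'" "\<tau>' \<le> t'" "y = \<gamma> \<tau>'" using gg y xy(3) by blast
    have C: "a2 < \<tau>" "\<tau> < b2" "a2 < \<tau>'" "\<tau>' < b2" using \<tau> \<tau>' t t' by auto
    have "\<tau> < \<tau>'"
    proof (rule ccontr)
      assume "\<not> \<tau> < \<tau>'"
      then consider "\<tau> = \<tau>'" | "\<tau>' < \<tau>" by fastforce
      then show False
      proof cases
        case 1
        then show False using xy(2) \<tau>(3) \<tau>'(3) lt_irrefl by simp
      next
        case 2
        have "lt (\<gamma> \<tau>') (\<gamma> \<tau>)"
          using g(5)[rule_format, OF L1(1)[OF L2[OF C(3,4)]] 2 L1(2)[OF L2[OF C(1,2)]]] by blast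
        then show False using xy(2) \<tau>(3) \<tau>'(3) lt_asym by simp
      qed
    qed
    then show "(str n r x \<and> str n r y) \<and> lnk n l x y"
      unfolding \<tau>(3) \<tau>'(3) using st[OF L2[OF C(1,2)]] st[OF L2[OF C(3,4)]] l(5) C by blast
  qed
  moreover have "\<gamma> t \<in> A" "lt (\<gamma> t) (\<gamma> t')" using g(4) B gg by blast+
  moreover have "(\<kappa>, n, r, l) \<in> ({..<d} \<times> UNIV) \<times> {1..N} \<times> Pow ?W \<times> Pow ?W" using g(1) nN l(1) by blast
  ultimately show ?thesis by (intro exI conjI)
qed

lemma homogeneous_pieces:
  "\<exists>\<C> N. 1 \<le> N \<and> (\<forall>x\<in>spine. card (cls x) \<le> N) \<and> finite \<C> \<and> \<Union>\<C> = spine \<and> (\<forall>C\<in>\<C>. dset C \<and>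
    (\<forall>x y z. x \<in> C \<longrightarrow> z \<in> C \<longrightarrow> lt x y \<longrightarrow> lt y z \<longrightarrow> y \<in> C) \<and>
    ((\<exists>x. C = {x}) \<or> (\<exists>\<tau>\<in>({..<d} \<times> UNIV) \<times> {1..N} \<times> Pow ({1..N} \<times> {1..N}) \<times> Pow ({1..N} \<times> {1..N}).
      \<forall>u\<in>C. \<forall>v\<in>C. lt u v \<longrightarrow> hom \<tau> u v)))"
proof -
  obtain N0 where N0: "\<forall>x\<in>spine. card (cls x) \<le> N0" using cls_card_bounded by blast
  \<comment> \<open>The successor ensures that the label bound is positive.\<close>
  define N where "N = Suc N0"
  have N: "\<forall>x\<in>spine. card (cls x) \<le> N" using N0 unfolding N_def by auto
  let ?K = "({..<d} \<times> (UNIV :: bool set)) \<times> {1..N} \<times> Pow ({1..N} \<times> {1..N}) \<times> Pow ({1..N} \<times> {1..N})"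
  \<comment> \<open>The glueing hypothesis of \<open>decomposition\<close> ranges over all indices,
    so positivity of the class size is built into the relation.\<close>
  have "\<exists>\<C>. finite \<C> \<and> \<Union>\<C> = spine \<and> (\<forall>C\<in>\<C>. dset C \<and>
    (\<forall>x y z. x \<in> C \<longrightarrow> z \<in> C \<longrightarrow> lt x y \<longrightarrow> lt y z \<longrightarrow> y \<in> C) \<and>
    ((\<exists>x. C = {x}) \<or> (\<exists>\<tau>\<in>?K. \<forall>u\<in>C. \<forall>v\<in>C. lt u v \<longrightarrow> 1 \<le> fst (snd \<tau>) \<and> hom \<tau> u v)))"
  proof (rule decomposition)
    show "finite ?K" by simp
    show "dv2 (\<lambda>u v. 1 \<le> fst (snd \<tau>) \<and> hom \<tau> u v)" if "\<tau> \<in> ?K" for \<tau>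
      unfolding dv2_def hom_def
      using that by (intro dfn_rules dlt dle dcoord dstr dlnk spine_dset) auto
    show "1 \<le> fst (snd \<tau>) \<and> hom \<tau> u' v'"
      if "1 \<le> fst (snd \<tau>) \<and> hom \<tau> u v" "le u u'" "lt u' v'" "le v' v" "u \<in> spine" "v \<in> spine" for \<tau> u v u' v'
      using that(1) hom_hereditary[OF _ that(2-6)] by blast
    show "1 \<le> fst (snd \<tau>) \<and> hom \<tau> u w"
      if "1 \<le> fst (snd \<tau>) \<and> hom \<tau> u v" "1 \<le> fst (snd \<tau>) \<and> hom \<tau> v w" "lt u v" "lt v w" for \<tau> u v w
    proof -
      obtain \<kappa> n r l where "\<tau> = (\<kappa>, n, r, l)" by (cases \<tau>) auto
      then show ?thesis using that hom_glue[of \<kappa> n r l u v w] by simp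
    qed
    fix A assume A: "dset A" "infinite A" "A \<subseteq> spine"
    obtain u v \<tau> where h: "\<tau> \<in> ?K" "u \<in> A" "lt u v" "hom \<tau> u v"
      using hom_exists[OF N A] by (elim exE conjE) (rule that)
    have "1 \<le> fst (snd \<tau>)" using h(1) by auto
    then show "\<exists>u v. \<exists>\<tau>\<in>?K. u \<in> A \<and> lt u v \<and> 1 \<le> fst (snd \<tau>) \<and> hom \<tau> u v" using h
      by (intro exI[of _ u] exI[of _ v] bexI[of _ \<tau>] conjI)
  qed
  then obtain \<C> where C: "finite \<C>" "\<Union>\<C> = spine" "\<forall>C\<in>\<C>. dset C \<and>
    (\<forall>x y z. x \<in> C \<longrightarrow> z \<in> C \<longrightarrow> lt x y \<longrightarrow> lt y z \<longrightarrow> y \<in> C) \<and>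
    ((\<exists>x. C = {x}) \<or> (\<exists>\<tau>\<in>?K. \<forall>u\<in>C. \<forall>v\<in>C. lt u v \<longrightarrow> 1 \<le> fst (snd \<tau>) \<and> hom \<tau> u v))"
    by (elim exE conjE) (rule that)
  have C': "dset C \<and> (\<forall>x y z. x \<in> C \<longrightarrow> z \<in> C \<longrightarrow> lt x y \<longrightarrow> lt y z \<longrightarrow> y \<in> C) \<and>
    ((\<exists>x. C = {x}) \<or> (\<exists>\<tau>\<in>?K. \<forall>u\<in>C. \<forall>v\<in>C. lt u v \<longrightarrow> hom \<tau> u v))" if "C \<in> \<C>" for C
  proof -
    note c = C(3)[THEN bspec, OF that]
    have "(\<exists>x. C = {x}) \<or> (\<exists>\<tau>\<in>?K. \<forall>u\<in>C. \<forall>v\<in>C. lt u v \<longrightarrow> hom \<tau> u v)"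
      using c[THEN conjunct2, THEN conjunct2]
    proof
      assume "\<exists>\<tau>\<in>?K. \<forall>u\<in>C. \<forall>v\<in>C. lt u v \<longrightarrow> 1 \<le> fst (snd \<tau>) \<and> hom \<tau> u v"
      then obtain \<tau> where "\<tau> \<in> ?K" "\<forall>u\<in>C. \<forall>v\<in>C. lt u v \<longrightarrow> 1 \<le> fst (snd \<tau>) \<and> hom \<tau> u v" by (rule bexE)
      then show ?thesis by (intro disjI2 bexI[of _ \<tau>]) simp_all
    qed (rule disjI1)
    then show ?thesis using c by (intro conjI) (elim conjE; assumption)+
  qed
  have "1 \<le> N" unfolding N_def by simp
  then show ?thesis using N C(1,2) C'
    by (intro exI[of _ \<C>] exI[of _ N] conjI ballI) (assumption | rule N[rule_format] | (drule C'; elim conjE; assumption))+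
qed

end


section \<open>Laying out the pieces on the line\<close>

text \<open>A definable increasing bijection of the field onto \<open>(-1, 1)\<close>; it makes room
  for all pieces on one line.\<close>

definition squeeze :: "'a::linordered_field \<Rightarrow> 'a" where
  "squeeze t = t / (1 + \<bar>t\<bar>)"

lemma squeeze_pos: "0 < 1 + \<bar>t\<bar>" for t :: "'a::linordered_field"
  by (rule add_pos_nonneg) simp_all

lemma squeeze_less:
  fixes s t :: "'a::linordered_field"
  assumes "s < t"
  shows "squeeze s < squeeze t"
proof -
  have "s * (1 + \<bar>t\<bar>) < t * (1 + \<bar>s\<bar>)"
  proof -
    consider "0 \<le> s" "0 \<le> t" | "s < 0" "0 \<le> t" | "s < 0" "t < 0" using assms by force
    then show ?thesis
    proof cases
      case 2
      have "s * (1 + \<bar>t\<bar>) < 0" by (rule mult_neg_pos[OF 2(1) squeeze_pos])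
      also have "0 \<le> t * (1 + \<bar>s\<bar>)" using 2(2) squeeze_pos[of s] by simp
      finally show ?thesis .
    qed (use assms in \<open>simp_all add: algebra_simps\<close>)
  qed
  then show ?thesis unfolding squeeze_def
    by (simp only: pos_divide_less_eq[OF squeeze_pos] times_divide_eq_left pos_less_divide_eq[OF squeeze_pos])
qed

lemma squeeze_bound:
  fixes t :: "'a::linordered_field"
  shows "- 1 < squeeze t" "squeeze t < 1"
proof -
  have "t < 1 + \<bar>t\<bar>" by (rule le_less_trans[OF abs_ge_self]) simp
  then show "squeeze t < 1" unfolding squeeze_def by (simp add: pos_divide_less_eq[OF squeeze_pos])
  have "- t < 1 + \<bar>t\<bar>" by (rule le_less_trans[OF abs_ge_minus_self]) simp
  then have "- 1 * (1 + \<bar>t\<bar>) < t" by (simp add: minus_less_iff)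
  then show "- 1 < squeeze t" unfolding squeeze_def by (simp only: pos_less_divide_eq[OF squeeze_pos])
qed

lemma squeeze_onto:
  fixes s :: "'a::linordered_field"
  assumes "- 1 < s" "s < 1"
  shows "squeeze (s / (1 - \<bar>s\<bar>)) = s"
proof -
  have p: "0 < 1 - \<bar>s\<bar>" using assms by (simp add: abs_less_iff minus_less_iff)
  then have "1 + \<bar>s / (1 - \<bar>s\<bar>)\<bar> = 1 / (1 - \<bar>s\<bar>)"
    by (simp add: abs_divide field_simps)
  then show ?thesis unfolding squeeze_def using p by simp
qed

text \<open>The division-free form serves to show that the charted pieces are definable.\<close>

lemma squeeze_eq_iff: "squeeze t = y \<longleftrightarrow> y * (1 + \<bar>t\<bar>) = t" for t y :: "'a::linordered_field"
  using squeeze_pos[of t] unfolding squeeze_def by (auto simp: divide_eq_eq)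

context low_lattice
begin

definition up :: "'a list set \<Rightarrow> bool" where
  "up U \<longleftrightarrow> U \<subseteq> spine \<and> dset U \<and> (\<forall>x y. x \<in> U \<longrightarrow> lt x y \<longrightarrow> y \<in> U)"

text \<open>For an up-set this is \<open>U\<close> without its least element, if there is
  one.\<close>

definition inn :: "'a list set \<Rightarrow> 'a list set" where
  "inn U = {x \<in> spine. \<exists>y\<in>U. lt y x}"

text \<open>For an up-set this is \<open>U\<close> together with the greatest element of its
  complement, if there is one.\<close>

definition out :: "'a list set \<Rightarrow> 'a list set" where
  "out U = {x \<in> spine. \<forall>y\<in>spine. lt x y \<longrightarrow> y \<in> U}"

lemma dset_spineI: "dfn (\<lambda>e. P (vc 0 e)) \<Longrightarrow> dset {x \<in> spine. P x}"
proof -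
  assume "dfn (\<lambda>e. P (vc 0 e))"
  then have "dfn (\<lambda>e. vc 0 e \<in> spine \<and> P (vc 0 e))" by (intro dfn_conj dset_mem spine_dset dvec_vc)
  then show ?thesis unfolding dset_def using spine_length by simp
qed

lemma up_inn: "up U \<Longrightarrow> up (inn U)"
  unfolding up_def[of "inn U"]
proof (intro conjI allI impI)
  assume U: "up U"
  show "inn U \<subseteq> spine" unfolding inn_def by blast
  show "dset (inn U)" unfolding inn_def using U unfolding up_def
    by (intro dset_spineI dfn_vbex dlt dvec_vc dvec_vc1) simp
  show "y \<in> inn U" if "x \<in> inn U" "lt x y" for x y
    using that lt_trans ltS unfolding inn_def by blast
qed

lemma up_out: "up U \<Longrightarrow> up (out U)"
  unfolding up_def[of "out U"]
proof (intro conjI allI impI)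
  assume U: "up U"
  show "out U \<subseteq> spine" unfolding out_def by blast
  show "dset (out U)" unfolding out_def using U unfolding up_def
    by (intro dset_spineI dfn_vball dfn_imp dlt dset_mem dvec_vc dvec_vc1 spine_dset) simp
  show "y \<in> out U" if "x \<in> out U" "lt x y" for x y
    using that lt_trans ltS unfolding out_def by blast
qed

lemma common_below:
  assumes "finite F" "\<And>U. U \<in> F \<Longrightarrow> up U" "\<And>U. U \<in> F \<Longrightarrow> \<exists>z. lt z x \<and> z \<in> U" "lt z0 x"
  shows "\<exists>z. lt z x \<and> (\<forall>U\<in>F. z \<in> U)"
  using assms(1-3)
proof (induction F rule: finite_induct)
  case empty
  then show ?case using assms(4) by blast
next
  case (insert U F)
  obtain z where z: "lt z x" "\<forall>U\<in>F. z \<in> U" using insert by auto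
  obtain w where w: "lt w x" "w \<in> U" using insert.prems(2)[of U] by blast
  have S: "z \<in> spine" "w \<in> spine" using ltS(1)[OF z(1)] ltS(1)[OF w(1)] .
  have Fup: "y \<in> W" if "W \<in> insert U F" "x \<in> W" "lt x y" for W x y
    using insert.prems(1)[OF that(1)] that(2,3) unfolding up_def by blast
  show ?case
  proof (cases "lt z w")
    case True
    then have "\<forall>W\<in>insert U F. w \<in> W" using Fup[OF _ _ True] z(2) w(2) by blast
    then show ?thesis using w(1) by blast
  next
    case False
    then have "w = z \<or> lt w z" using lt_linear[OF S] by blast
    then have "z \<in> U" using Fup[OF insertI1 w(2)] w(2) by blast
    then show ?thesis using z by blast
  qed
qed

lemma common_above:
  assumes "finite F" "\<And>U. U \<in> F \<Longrightarrow> up U" "\<And>U. U \<in> F \<Longrightarrow> \<exists>z. lt x z \<and> z \<notin> U" "lt x z0"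
  shows "\<exists>z. lt x z \<and> (\<forall>U\<in>F. z \<notin> U)"
  using assms(1-3)
proof (induction F rule: finite_induct)
  case empty
  then show ?case using assms(4) by blast
next
  case (insert U F)
  obtain z where z: "lt x z" "\<forall>U\<in>F. z \<notin> U" using insert by auto
  obtain w where w: "lt x w" "w \<notin> U" using insert.prems(2)[of U] by blast
  have S: "z \<in> spine" "w \<in> spine" using ltS(2)[OF z(1)] ltS(2)[OF w(1)] .
  have Fup: "y \<in> W" if "W \<in> insert U F" "x \<in> W" "lt x y" for W x y
    using insert.prems(1)[OF that(1)] that(2,3) unfolding up_def by blast
  show ?case
  proof (cases "lt w z")
    case True
    then have "\<forall>W\<in>insert U F. w \<notin> W" using Fup[OF _ _ True] z(2) w(2) by blast
    then show ?thesis using w(1) by blast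
  next
    case False
    then have "w = z \<or> lt z w" using lt_linear[OF S] by blast
    then have "z \<notin> U" using Fup[OF insertI1, of z w] w(2) by blast
    then show ?thesis using z by blast
  qed
qed

text \<open>Adding \<open>inn U\<close> and \<open>out U\<close> for every up-set \<open>U\<close> makes every class of the induced partition a
  singleton or a set without endpoints.\<close>

lemma partition_class:
  assumes fin: "finite \<U>" and up: "\<And>U. U \<in> \<U> \<Longrightarrow> up U" and triv: "spine \<in> \<U>" "{} \<in> \<U>"
    and W: "\<W> = \<U> \<union> inn ` \<U> \<union> out ` \<U>" and x: "x \<in> spine"
  shows "(\<forall>y\<in>spine. (\<forall>U\<in>\<W>. y \<in> U \<longleftrightarrow> x \<in> U) \<longrightarrow> y = x) \<or>
    (\<exists>z. lt z x \<and> (\<forall>U\<in>\<W>. z \<in> U \<longleftrightarrow> x \<in> U)) \<and> (\<exists>z. lt x z \<and> (\<forall>U\<in>\<W>. z \<in> U \<longleftrightarrow> x \<in> U))"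
proof (cases "\<exists>U\<in>\<U>. (x \<in> U \<and> x \<notin> inn U) \<or> (x \<in> out U \<and> x \<notin> U)")
  case True
  \<comment> \<open>Here \<open>x\<close> is the least element of \<open>U\<close> or the greatest
    element of its complement, so \<open>U\<close> together with \<open>inn U\<close> or
    \<open>out U\<close> separates it from all other points.\<close>
  then obtain U where U: "U \<in> \<U>" "(x \<in> U \<and> x \<notin> inn U) \<or> (x \<in> out U \<and> x \<notin> U)" by blast
  have UW: "U \<in> \<W>" "inn U \<in> \<W>" "out U \<in> \<W>" using U(1) W by auto
  have "y = x" if y: "y \<in> spine" "\<forall>U\<in>\<W>. y \<in> U \<longleftrightarrow> x \<in> U" for y
  proof (rule ccontr)
    assume "y \<noteq> x"
    have e: "y \<in> U \<longleftrightarrow> x \<in> U" "y \<in> inn U \<longleftrightarrow> x \<in> inn U" "y \<in> out U \<longleftrightarrow> x \<in> out U"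
      using y(2) UW by blast+
    consider "lt x y" | "lt y x" using lt_linear[OF x y(1)] \<open>y \<noteq> x\<close> by blast
    then show False
      using U(2) e x y(1) unfolding inn_def out_def by cases blast+
  qed
  then show ?thesis by blast
next
  case False
  then have nin: "x \<in> U \<Longrightarrow> x \<in> inn U" and nout: "x \<in> out U \<Longrightarrow> x \<in> U" if "U \<in> \<U>" for U
    using that by blast+
  have upW: "up U" if "U \<in> \<W>" for U using that up up_inn up_out W by auto
  have finW: "finite \<W>" using fin W by simp
  have "\<exists>z. lt z x \<and> (\<forall>U\<in>\<W>. z \<in> U \<longleftrightarrow> x \<in> U)"
  proof -
    \<comment> \<open>As \<open>spine\<close> is among the up-sets, \<open>x\<close> is not the
      least point of the spine.\<close>
    obtain z0 where z0: "lt z0 x" using nin[OF triv(1) x] unfolding inn_def by blast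
    have "\<exists>z. lt z x \<and> (\<forall>U\<in>{U \<in> \<W>. x \<in> U}. z \<in> U)"
    proof (rule common_below[OF _ _ _ z0])
      show "finite {U \<in> \<W>. x \<in> U}" using finW by simp
      show "up U" if "U \<in> {U \<in> \<W>. x \<in> U}" for U using upW that by blast
      fix W' assume "W' \<in> {U \<in> \<W>. x \<in> U}"
      then have xW: "x \<in> W'" and "W' \<in> \<W>" by auto
      then consider U where "U \<in> \<U>" "W' = U" | U where "U \<in> \<U>" "W' = inn U" | U where "U \<in> \<U>" "W' = out U"
        using W by blast
      then show "\<exists>z. lt z x \<and> z \<in> W'"
      proof cases
        case (1 U)
        then show ?thesis using nin[OF 1(1)] xW unfolding inn_def by blast
      next
        case (2 U)
        then obtain y where y: "y \<in> U" "lt y x" using xW unfolding inn_def by blast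
        obtain z where "lt y z" "lt z x" using spine_dense[OF y(2)] by blast
        then show ?thesis using y(1) ltS unfolding 2(2) inn_def by blast
      next
        case (3 U)
        have "x \<in> inn U" using nin[OF 3(1)] nout[OF 3(1)] xW 3(2) by blast
        then obtain y where y: "y \<in> U" "lt y x" unfolding inn_def by blast
        have "y \<in> out U" unfolding out_def using up[OF 3(1)] y ltS unfolding up_def by blast
        then show ?thesis using y(2) 3(2) by blast
      qed
    qed
    then obtain z where z: "lt z x" "\<forall>U\<in>{U \<in> \<W>. x \<in> U}. z \<in> U" by blast
    have "z \<in> U \<longleftrightarrow> x \<in> U" if "U \<in> \<W>" for U
      using z upW[OF that] that unfolding up_def by blast
    then show ?thesis using z(1) by blast
  qed
  moreover have "\<exists>z. lt x z \<and> (\<forall>U\<in>\<W>. z \<in> U \<longleftrightarrow> x \<in> U)"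
  proof -
    \<comment> \<open>As the empty set is among the up-sets, \<open>x\<close> is not the greatest
      point of the spine.\<close>
    have "x \<notin> out {}" using nout[OF triv(2)] by blast
    then obtain z0 where z0: "lt x z0" using x unfolding out_def by blast
    have "\<exists>z. lt x z \<and> (\<forall>U\<in>{U \<in> \<W>. x \<notin> U}. z \<notin> U)"
    proof (rule common_above[OF _ _ _ z0])
      show "finite {U \<in> \<W>. x \<notin> U}" using finW by simp
      show "up U" if "U \<in> {U \<in> \<W>. x \<notin> U}" for U using upW that by blast
      fix W' assume "W' \<in> {U \<in> \<W>. x \<notin> U}"
      then have xW: "x \<notin> W'" and "W' \<in> \<W>" by auto
      then consider U where "U \<in> \<U>" "W' = U" | U where "U \<in> \<U>" "W' = inn U" | U where "U \<in> \<U>" "W' = out U"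
        using W by blast
      then show "\<exists>z. lt x z \<and> z \<notin> W'"
      proof cases
        case (1 U)
        then have "x \<notin> out U" using nout[OF 1(1)] xW by blast
        then show ?thesis using x unfolding 1(2) out_def by blast
      next
        case (2 U)
        have "x \<notin> U" using nin[OF 2(1)] xW 2(2) by blast
        then have "x \<notin> out U" using nout[OF 2(1)] by blast
        then obtain y where y: "lt x y" "y \<notin> U" using x unfolding out_def by blast
        have "y \<notin> inn U" unfolding inn_def using up[OF 2(1)] y unfolding up_def by blast
        then show ?thesis using y(1) 2(2) by blast
      next
        case (3 U)
        then obtain y where y: "lt x y" "y \<notin> U" using xW x unfolding out_def by blast
        obtain z where z: "lt x z" "lt z y" using spine_dense[OF y(1)] by blast
        have "z \<notin> out U" using z(2) y ltS unfolding out_def by blast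
        then show ?thesis using z(1) 3(2) by blast
      qed
    qed
    then obtain z where z: "lt x z" "\<forall>U\<in>{U \<in> \<W>. x \<notin> U}. z \<notin> U" by blast
    have "z \<in> U \<longleftrightarrow> x \<in> U" if "U \<in> \<W>" for U
      using z upW[OF that] that unfolding up_def by blast
    then show ?thesis using z(1) by blast
  qed
  ultimately show ?thesis by blast
qed

definition fib :: "('a list \<Rightarrow> nat) \<Rightarrow> nat \<Rightarrow> 'a list set" where
  "fib idx i = {x \<in> spine. idx x = i}"

lemma spine_nonempty: "spine \<noteq> {}" using bottom_exists btV by blast

text \<open>The pieces may overlap and come in no order. Each is convex, hence a difference of two
  up-sets, and all these up-sets with their variants \<open>inn\<close> and \<open>out\<close> cut
  the spine into an ordered refinement. The number of up-sets containing a point grows along the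
  spine and provides the index.\<close>

lemma layout:
  "\<exists>n N idx. 1 \<le> N \<and> (\<forall>x\<in>spine. card (cls x) \<le> N) \<and> idx ` spine = {1..n} \<and>
    (\<forall>x y. lt x y \<longrightarrow> idx x \<le> idx y) \<and>
    (\<forall>i\<in>{1..n}. dset (fib idx i) \<and> ((\<exists>x. fib idx i = {x}) \<or>
      (\<exists>\<kappa> m r l. fst \<kappa> < d \<and> 1 \<le> m \<and> (\<forall>u\<in>fib idx i. \<forall>v\<in>fib idx i. lt u v \<longrightarrow> hom (\<kappa>, m, r, l) u v) \<and>
        (\<forall>x\<in>fib idx i. \<exists>z\<in>fib idx i. lt z x) \<and> (\<forall>x\<in>fib idx i. \<exists>z\<in>fib idx i. lt x z))))"
proof -
  obtain \<C> N where N: "1 \<le> N" "\<forall>x\<in>spine. card (cls x) \<le> N" and C: "finite \<C>" "\<Union>\<C> = spine" "\<forall>C\<in>\<C>. dset C \<and>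
    (\<forall>x y z. x \<in> C \<longrightarrow> z \<in> C \<longrightarrow> lt x y \<longrightarrow> lt y z \<longrightarrow> y \<in> C) \<and>
    ((\<exists>x. C = {x}) \<or> (\<exists>\<tau>\<in>({..<d} \<times> UNIV) \<times> {1..N} \<times> Pow ({1..N} \<times> {1..N}) \<times> Pow ({1..N} \<times> {1..N}).
      \<forall>u\<in>C. \<forall>v\<in>C. lt u v \<longrightarrow> hom \<tau> u v))"
    using homogeneous_pieces by (elim exE conjE) (rule that)
  define upc where "upc C = {x \<in> spine. \<exists>y\<in>C. le y x}" for C
  define abv where "abv C = {x \<in> spine. \<forall>y\<in>C. lt y x}" for C
  define \<U> where "\<U> = {spine, {}} \<union> upc ` \<C> \<union> abv ` \<C>"
  define \<W> where "\<W> = \<U> \<union> inn ` \<U> \<union> out ` \<U>"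
  have CS: "C \<subseteq> spine" if "C \<in> \<C>" for C using that C(2) by blast
  have dC: "dset C" if "C \<in> \<C>" for C using C(3)[THEN bspec, OF that] by (rule conjunct1)
  have up_upc: "up (upc C)" if "C \<in> \<C>" for C
    unfolding up_def
  proof (intro conjI allI impI)
    show "upc C \<subseteq> spine" unfolding upc_def by blast
    show "dset (upc C)" unfolding upc_def by (intro dset_spineI dfn_vbex dle dC that dvec_vc dvec_vc1)
    show "y \<in> upc C" if "x \<in> upc C" "lt x y" for x y
      using that ltS le_trans[OF _ lt_le] unfolding upc_def by blast
  qed
  have up_abv: "up (abv C)" if "C \<in> \<C>" for C
    unfolding up_def
  proof (intro conjI allI impI)
    show "abv C \<subseteq> spine" unfolding abv_def by blast
    show "dset (abv C)" unfolding abv_def by (intro dset_spineI dfn_vball dlt dC that dvec_vc dvec_vc1)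
    show "y \<in> abv C" if "x \<in> abv C" "lt x y" for x y
      using that ltS lt_trans unfolding abv_def by blast
  qed
  have "dset {}" unfolding dset_def using dfn_const[of False] by simp
  then have "up {}" unfolding up_def by blast
  moreover have "up spine" unfolding up_def using spine_dset ltS by blast
  ultimately have upU: "up U" if "U \<in> \<U>" for U
    using that up_upc up_abv unfolding \<U>_def by blast
  have upW: "up U" if "U \<in> \<W>" for U using that upU up_inn up_out unfolding \<W>_def by auto
  have finU: "finite \<U>" unfolding \<U>_def using C(1) by simp
  have finW: "finite \<W>" unfolding \<W>_def using finU by simp
  define sig where "sig x = {U \<in> \<W>. x \<in> U}" for x
  have sig_fin: "finite (sig x)" for x unfolding sig_def using finW by simp
  have sig_iff: "sig y = sig x \<longleftrightarrow> (\<forall>U\<in>\<W>. y \<in> U \<longleftrightarrow> x \<in> U)" for x y unfolding sig_def by blast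
  have sig_mono: "sig x \<subseteq> sig y" if "lt x y" for x y
    using that upW unfolding sig_def up_def by blast
  \<comment> \<open>The traces \<open>sig x\<close> are nested along the spine, so each is
    determined by its size.\<close>
  define g where "g x = card (sig x)" for x
  have g_mono: "g x \<le> g y" if "lt x y" for x y
    unfolding g_def by (rule card_mono[OF sig_fin sig_mono[OF that]])
  have g_sig: "sig x = sig y" if "x \<in> spine" "y \<in> spine" "g x = g y" for x y
    using lt_linear[OF that(1,2)] card_subset_eq[OF sig_fin sig_mono] that(3) unfolding g_def by metis
  define G where "G = g ` spine"
  have "G \<subseteq> {..card \<W>}" unfolding G_def g_def sig_def using finW by (auto intro: card_mono)
  then have finG: "finite G" using finite_subset by blast
  \<comment> \<open>Ranks the values of \<open>g\<close>, so that the indices run through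
    \<open>1..n\<close> without omissions.\<close>
  define idx where "idx x = card {k \<in> G. k \<le> g x}" for x
  define n where "n = card G"
  have idx_mono: "idx x \<le> idx y" if "lt x y" for x y
    unfolding idx_def by (rule card_mono) (use finG g_mono[OF that] in auto)
  have idx_g: "g x = g y" if "x \<in> spine" "y \<in> spine" "idx x = idx y" for x y
  proof -
    have *: "g y \<le> g x" if "x \<in> spine" "y \<in> spine" "idx x = idx y" "g x \<le> g y" for x y
    proof -
      have "{k \<in> G. k \<le> g x} \<subseteq> {k \<in> G. k \<le> g y}" using that(4) by auto
      then have "{k \<in> G. k \<le> g x} = {k \<in> G. k \<le> g y}"
        using card_subset_eq[of "{k \<in> G. k \<le> g y}"] finG that(3) unfolding idx_def by simp
      moreover have "g y \<in> {k \<in> G. k \<le> g y}" using that(2) unfolding G_def by simp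
      ultimately show ?thesis by blast
    qed
    show ?thesis
      using *[OF that] *[OF that(2,1) that(3)[symmetric]] by (metis linear order_antisym)
  qed
  have idx_iff: "idx x = idx y \<longleftrightarrow> sig x = sig y" if "x \<in> spine" "y \<in> spine" for x y
    using idx_g[OF that] g_sig[OF that] unfolding idx_def g_def by auto
  have idx_img: "idx ` spine = {1..n}"
  proof (rule card_subset_eq)
    show "idx ` spine \<subseteq> {1..n}"
    proof
      fix i assume "i \<in> idx ` spine"
      then obtain x where x: "x \<in> spine" "i = idx x" by blast
      have "g x \<in> {k \<in> G. k \<le> g x}" using x(1) unfolding G_def by simp
      then have "0 < idx x" unfolding idx_def using finG by (subst card_gt_0_iff) auto
      moreover have "idx x \<le> n" unfolding idx_def n_def by (rule card_mono) (use finG in auto)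
      ultimately show "i \<in> {1..n}" using x(2) by simp
    qed
    define h where "h k = card {j \<in> G. j \<le> k}" for k
    have "idx ` spine = h ` G" unfolding G_def h_def idx_def by (simp add: image_image)
    moreover have "inj_on h G"
    proof (rule inj_onI)
      fix j k assume "j \<in> G" "k \<in> G" "h j = h k"
      then obtain x y where "x \<in> spine" "y \<in> spine" "j = g x" "k = g y" unfolding G_def by blast
      then show "j = k" using idx_g[of x y] \<open>h j = h k\<close> unfolding idx_def h_def by simp
    qed
    ultimately show "card (idx ` spine) = card {1..n}" using card_image unfolding n_def by simp
  qed simp
  have piece: "dset (fib idx i) \<and> ((\<exists>x. fib idx i = {x}) \<or>
      (\<exists>\<kappa> m r l. fst \<kappa> < d \<and> 1 \<le> m \<and> (\<forall>u\<in>fib idx i. \<forall>v\<in>fib idx i. lt u v \<longrightarrow> hom (\<kappa>, m, r, l) u v) \<and>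
        (\<forall>x\<in>fib idx i. \<exists>z\<in>fib idx i. lt z x) \<and> (\<forall>x\<in>fib idx i. \<exists>z\<in>fib idx i. lt x z)))"
    if i: "i \<in> {1..n}" for i
  proof -
    obtain x0 where x0: "x0 \<in> spine" "idx x0 = i" using i idx_img by (metis imageE)
    have F: "fib idx i = {x \<in> spine. \<forall>U\<in>\<W>. x \<in> U \<longleftrightarrow> x0 \<in> U}"
    proof (rule Set.set_eqI)
      fix x
      show "x \<in> fib idx i \<longleftrightarrow> x \<in> {x \<in> spine. \<forall>U\<in>\<W>. x \<in> U \<longleftrightarrow> x0 \<in> U}"
      proof (cases "x \<in> spine")
        case True
        then show ?thesis
          using idx_iff[OF True x0(1)] x0(2) sig_iff[of x x0] unfolding fib_def by simp
      qed (simp add: fib_def)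
    qed
    have dF: "dset (fib idx i)" unfolding F
      by (intro dset_spineI dfn_ball_finite finW dfn_iff dfn_const dset_mem dvec_vc)
        (use upW in \<open>auto simp: up_def\<close>)
    have FI: "z \<in> fib idx i" if "x \<in> fib idx i" "z \<in> spine" "\<forall>U\<in>\<W>. z \<in> U \<longleftrightarrow> x \<in> U" for x z
    proof -
      have "\<forall>U\<in>\<W>. x \<in> U \<longleftrightarrow> x0 \<in> U" using that(1) unfolding F by blast
      then have "\<forall>U\<in>\<W>. z \<in> U \<longleftrightarrow> x0 \<in> U" using that(3) by simp
      then show ?thesis using that(2) unfolding F by simp
    qed
    show ?thesis
    proof (cases "\<exists>x. fib idx i = {x}")
      case True
      then show ?thesis using dF by blast
    next
      case False
      have no_end: "(\<exists>z. lt z x \<and> (\<forall>U\<in>\<W>. z \<in> U \<longleftrightarrow> x \<in> U)) \<and> (\<exists>z. lt x z \<and> (\<forall>U\<in>\<W>. z \<in> U \<longleftrightarrow> x \<in> U))"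
        if x: "x \<in> fib idx i" for x
      proof -
        have xs: "x \<in> spine" using x unfolding fib_def by blast
        have t: "spine \<in> \<U>" "{} \<in> \<U>" unfolding \<U>_def by auto
        have "\<not> (\<forall>y\<in>spine. (\<forall>U\<in>\<W>. y \<in> U \<longleftrightarrow> x \<in> U) \<longrightarrow> y = x)"
        proof
          assume h: "\<forall>y\<in>spine. (\<forall>U\<in>\<W>. y \<in> U \<longleftrightarrow> x \<in> U) \<longrightarrow> y = x"
          have x': "\<forall>U\<in>\<W>. x \<in> U \<longleftrightarrow> x0 \<in> U" using x unfolding F by simp
          have "y = x" if "y \<in> fib idx i" for y
          proof -
            have y: "y \<in> spine" "\<forall>U\<in>\<W>. y \<in> U \<longleftrightarrow> x0 \<in> U" using that unfolding F by simp_all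
            have "\<forall>U\<in>\<W>. y \<in> U \<longleftrightarrow> x \<in> U" using y(2) x' by simp
            then show ?thesis using h y(1) by simp
          qed
          then have "fib idx i = {x}" using x by blast
          then show False using False by blast
        qed
        moreover have "(\<forall>y\<in>spine. (\<forall>U\<in>\<W>. y \<in> U \<longleftrightarrow> x \<in> U) \<longrightarrow> y = x) \<or>
            (\<exists>z. lt z x \<and> (\<forall>U\<in>\<W>. z \<in> U \<longleftrightarrow> x \<in> U)) \<and> (\<exists>z. lt x z \<and> (\<forall>U\<in>\<W>. z \<in> U \<longleftrightarrow> x \<in> U))"
          by (rule partition_class[OF finU _ t \<W>_def xs]) (rule upU)
        ultimately show ?thesis by (elim disjE) (erule notE, assumption, assumption)
      qed
      have below: "\<forall>x\<in>fib idx i. \<exists>z\<in>fib idx i. lt z x"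
      proof
        fix x assume x: "x \<in> fib idx i"
        obtain z where z: "lt z x" "\<forall>U\<in>\<W>. z \<in> U \<longleftrightarrow> x \<in> U" using no_end[OF x] by blast
        then show "\<exists>z\<in>fib idx i. lt z x" using FI[OF x ltS(1)[OF z(1)] z(2)] by (intro bexI[of _ z])
      qed
      have above: "\<forall>x\<in>fib idx i. \<exists>z\<in>fib idx i. lt x z"
      proof
        fix x assume x: "x \<in> fib idx i"
        obtain z where z: "lt x z" "\<forall>U\<in>\<W>. z \<in> U \<longleftrightarrow> x \<in> U" using no_end[OF x] by blast
        then show "\<exists>z\<in>fib idx i. lt x z" using FI[OF x ltS(2)[OF z(1)] z(2)] by (intro bexI[of _ z])
      qed
      have "x0 \<in> \<Union>\<C>" using x0(1) unfolding C(2) .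
      then obtain D where D: "D \<in> \<C>" "x0 \<in> D" by (rule UnionE)
      note c = C(3)[THEN bspec, OF D(1)]
      have conv: "\<forall>x y z. x \<in> D \<longrightarrow> z \<in> D \<longrightarrow> lt x y \<longrightarrow> lt y z \<longrightarrow> y \<in> D"
        using c[THEN conjunct2] by (rule conjunct1)
      \<comment> \<open>By convexity \<open>D\<close> is the difference of the up-set it generates
        and the up-set of points above all of it; so no class of the refinement meets
        \<open>D\<close> only in part.\<close>
      have memD: "x \<in> D \<longleftrightarrow> x \<in> upc D \<and> x \<notin> abv D" if x: "x \<in> spine" for x
      proof
        assume "x \<in> D"
        then show "x \<in> upc D \<and> x \<notin> abv D"
          unfolding upc_def abv_def using x le_refl[OF spineV[OF x]] lt_irrefl by blast
      next
        assume h: "x \<in> upc D \<and> x \<notin> abv D"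
        then obtain y y' where y: "y \<in> D" "le y x" "y' \<in> D" "\<not> lt y' x" using x unfolding upc_def abv_def by blast
        have S: "y \<in> spine" "y' \<in> spine" using y CS[OF D(1)] by auto
        have "y = x \<or> lt y x" using y(2) le_lt[OF S(1) x] by blast
        moreover have "y' = x \<or> lt x y'" using lt_linear[OF S(2) x] y(4) by blast
        ultimately show "x \<in> D" using conv y(1,3) by blast
      qed
      have DW: "upc D \<in> \<W>" "abv D \<in> \<W>" using D(1) unfolding \<W>_def \<U>_def by auto
      have FD: "fib idx i \<subseteq> D"
      proof
        fix x assume "x \<in> fib idx i"
        then have x: "x \<in> spine" "\<forall>U\<in>\<W>. x \<in> U \<longleftrightarrow> x0 \<in> U" unfolding F by auto
        then show "x \<in> D"
          using memD[OF x(1)] memD[OF x0(1)] x(2)[rule_format, OF DW(1)] x(2)[rule_format, OF DW(2)] D(2) by simp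
      qed
      have x0F: "x0 \<in> fib idx i" using x0 unfolding fib_def by blast
      have "\<not> (\<exists>x. D = {x})"
      proof
        assume "\<exists>x. D = {x}"
        then have "fib idx i = {x0}" using FD x0F D(2) by blast
        then show False using False by blast
      qed
      then have "\<exists>\<tau>\<in>({..<d} \<times> UNIV) \<times> {1..N} \<times> Pow ({1..N} \<times> {1..N}) \<times> Pow ({1..N} \<times> {1..N}).
          \<forall>u\<in>D. \<forall>v\<in>D. lt u v \<longrightarrow> hom \<tau> u v"
        using c[THEN conjunct2, THEN conjunct2] by (elim disjE) (erule notE, assumption, assumption)
      then obtain \<tau> where \<tau>: "\<tau> \<in> ({..<d} \<times> UNIV) \<times> {1..N} \<times> Pow ({1..N} \<times> {1..N}) \<times> Pow ({1..N} \<times> {1..N})"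
        "\<forall>u\<in>D. \<forall>v\<in>D. lt u v \<longrightarrow> hom \<tau> u v" by (rule bexE)
      obtain \<kappa> m r l where t: "\<tau> = (\<kappa>, m, r, l)" by (cases \<tau>) auto
      have "fst \<kappa> < d" "1 \<le> m" using \<tau>(1) unfolding t by auto
      moreover have "\<forall>u\<in>fib idx i. \<forall>v\<in>fib idx i. lt u v \<longrightarrow> hom (\<kappa>, m, r, l) u v"
        using \<tau>(2) FD unfolding t by blast
      ultimately show ?thesis using dF below above
        by (intro conjI disjI2 exI[of _ \<kappa>] exI[of _ m] exI[of _ r] exI[of _ l])
    qed
  qed
  have mono: "\<forall>x y. lt x y \<longrightarrow> idx x \<le> idx y" using idx_mono by blast
  show ?thesis
    by (rule exI[of _ n], rule exI[of _ N], rule exI[of _ idx], rule conjI[OF N(1)], rule conjI[OF N(2)],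
      rule conjI[OF idx_img], rule conjI[OF mono], rule ballI, rule piece)
qed

end


section \<open>Charts of the pieces\<close>

context low_lattice
begin

text \<open>The chart puts piece \<open>i\<close> into \<open>(2 * i - 1, 2 * i + 1)\<close>: steps
  of 2 leave room for the squeezed coordinate, of absolute value below 1.\<close>

lemma chart_less:
  fixes idx :: "'a list \<Rightarrow> nat" and K :: "nat \<Rightarrow> nat \<times> bool"
  assumes mono: "\<forall>x y. lt x y \<longrightarrow> idx x \<le> idx y"
    and cm: "\<And>x y. lt x y \<Longrightarrow> idx x = idx y \<Longrightarrow> cc (K (idx x)) x < cc (K (idx y)) y"
    and xy: "lt x y"
  shows "of_nat (2 * idx x) + squeeze (cc (K (idx x)) x) < of_nat (2 * idx y) + squeeze (cc (K (idx y)) y)"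
proof (cases "idx x = idx y")
  case True
  have "squeeze (cc (K (idx x)) x) < squeeze (cc (K (idx y)) y)" by (rule squeeze_less[OF cm[OF xy True]])
  then show ?thesis using True by simp
next
  case False
  then have "Suc (idx x) \<le> idx y" using mono xy by (metis Suc_leI le_neq_implies_less)
  then have "2 * idx x + 2 \<le> 2 * idx y" by simp
  then have "(of_nat (2 * idx x + 2) :: 'a) \<le> of_nat (2 * idx y)" by (rule of_nat_mono)
  then have le: "of_nat (2 * idx x) + 2 \<le> (of_nat (2 * idx y) :: 'a)" by simp
  have "of_nat (2 * idx x) + squeeze (cc (K (idx x)) x) < of_nat (2 * idx x) + 1"
    using squeeze_bound(2) by simp
  also have "of_nat (2 * idx x) + 1 = of_nat (2 * idx x) + 2 + (- 1 :: 'a)" by simp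
  also have "\<dots> \<le> of_nat (2 * idx y) + (- 1)" using le by simp
  also have "\<dots> < of_nat (2 * idx y) + squeeze (cc (K (idx y)) y)"
    using squeeze_bound(1) by simp
  finally show ?thesis .
qed

text \<open>A convex definable set that is bounded and contains neither a least nor a greatest
  element is the open interval between its infimum and its supremum.\<close>

lemma image_interval:
  fixes th :: "'a list \<Rightarrow> 'a"
  assumes D: "ds1 (\<lambda>t. t \<in> th ` F)" and ne: "F \<noteq> {}"
    and bd: "\<And>x. x \<in> F \<Longrightarrow> p < th x \<and> th x < q"
    and below: "\<And>x. x \<in> F \<Longrightarrow> \<exists>z\<in>F. th z < th x" and above: "\<And>x. x \<in> F \<Longrightarrow> \<exists>z\<in>F. th x < th z"
    and conv: "\<And>x y t. x \<in> F \<Longrightarrow> y \<in> F \<Longrightarrow> th x < t \<Longrightarrow> t < th y \<Longrightarrow> t \<in> th ` F"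
  shows "is_interval (th ` F)"
proof -
  obtain x0 where x0: "x0 \<in> F" using ne by blast
  have c: "th x0 \<in> th ` F" using x0 by (rule imageI)
  obtain s where s: "is_lub (\<lambda>t. t \<in> th ` F) s"
  proof (rule lub_exists[where P = "\<lambda>t. t \<in> th ` F" and c = "th x0" and B = q, OF D c])
    fix t assume "t \<in> th ` F"
    then obtain x where "x \<in> F" "t = th x" by blast
    then show "t \<le> q" using bd[of x] by simp
  qed
  obtain g where g: "\<forall>t. t \<in> th ` F \<longrightarrow> g \<le> t" "\<forall>u. g < u \<longrightarrow> (\<exists>t. t < u \<and> t \<in> th ` F)"
  proof (rule glb_exists[where P = "\<lambda>t. t \<in> th ` F" and c = "th x0" and B = p, OF D c])
    fix t assume "t \<in> th ` F"
    then obtain x where "x \<in> F" "t = th x" by blast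
    then show "p \<le> t" using bd[of x] by simp
  qed (rule that; blast)
  have "th ` F = {g<..<s}"
  proof (intro equalityI subsetI)
    fix t assume "t \<in> th ` F"
    then obtain x where x: "x \<in> F" "t = th x" by blast
    obtain z where z: "z \<in> F" "th z < th x" using below[OF x(1)] by blast
    obtain w where w: "w \<in> F" "th x < th w" using above[OF x(1)] by blast
    have "g \<le> th z" by (rule g(1)[rule_format, OF imageI[OF z(1)]])
    moreover have "th w \<le> s" by (rule s[unfolded is_lub_def, THEN conjunct1, rule_format, OF imageI[OF w(1)]])
    ultimately show "t \<in> {g<..<s}" using z(2) w(2) x(2) by simp
  next
    fix t assume t: "t \<in> {g<..<s}"
    then have t': "g < t" "t < s" by auto
    obtain u where "u < t" "u \<in> th ` F" using g(2)[rule_format, OF t'(1)] by blast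
    then obtain x where x: "x \<in> F" "th x < t" by blast
    obtain v where "t < v" "v \<in> th ` F"
      using s[unfolded is_lub_def, THEN conjunct2, rule_format, OF t'(2)] by blast
    then obtain y where y: "y \<in> F" "t < th y" by blast
    show "t \<in> th ` F" by (rule conv[OF x(1) y(1) x(2) y(2)])
  qed
  then show ?thesis unfolding is_interval_def using ne by blast
qed

lemma chart_exists:
  "\<exists>n N idx th. 1 \<le> N \<and> (\<forall>x\<in>spine. card (cls x) \<le> N) \<and> idx ` spine = {1..n} \<and>
    (\<forall>x y. lt x y \<longrightarrow> idx x \<le> idx y) \<and> (\<forall>x y. lt x y \<longrightarrow> th x < (th y :: 'a)) \<and>
    (\<forall>i\<in>{1..n}. (is_point (th ` fib idx i) \<or> is_interval (th ` fib idx i)) \<and> ds1 (\<lambda>t. t \<in> th ` fib idx i) \<and>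
      ((\<exists>x. fib idx i = {x}) \<or>
      (\<exists>m r l. 1 \<le> m \<and> (\<forall>u\<in>fib idx i. \<forall>v\<in>fib idx i. lt u v \<longrightarrow> (str m r u \<and> str m r v) \<and> lnk m l u v) \<and>
        (\<forall>x\<in>fib idx i. \<exists>z\<in>fib idx i. lt z x) \<and> (\<forall>x\<in>fib idx i. \<exists>z\<in>fib idx i. lt x z))))"
proof -
  obtain n N idx where L: "1 \<le> N" "\<forall>x\<in>spine. card (cls x) \<le> N" "idx ` spine = {1..n}"
    "\<forall>x y. lt x y \<longrightarrow> idx x \<le> idx y"
    "\<forall>i\<in>{1..n}. dset (fib idx i) \<and> ((\<exists>x. fib idx i = {x}) \<or>
      (\<exists>\<kappa> m r l. fst \<kappa> < d \<and> 1 \<le> m \<and> (\<forall>u\<in>fib idx i. \<forall>v\<in>fib idx i. lt u v \<longrightarrow> hom (\<kappa>, m, r, l) u v) \<and>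
        (\<forall>x\<in>fib idx i. \<exists>z\<in>fib idx i. lt z x) \<and> (\<forall>x\<in>fib idx i. \<exists>z\<in>fib idx i. lt x z)))"
    using layout by (elim exE conjE) (rule that)
  let ?T = "\<lambda>i \<kappa>. \<exists>m r l. fst \<kappa> < d \<and> 1 \<le> m \<and> (\<forall>u\<in>fib idx i. \<forall>v\<in>fib idx i. lt u v \<longrightarrow> hom (\<kappa>, m, r, l) u v) \<and>
        (\<forall>x\<in>fib idx i. \<exists>z\<in>fib idx i. lt z x) \<and> (\<forall>x\<in>fib idx i. \<exists>z\<in>fib idx i. lt x z)"
  \<comment> \<open>On a one-point piece the value is arbitrary, since the chart sends that piece to
    a point in any case.\<close>
  define K where "K i = (SOME \<kappa>. ?T i \<kappa>)" for i
  have K: "(\<exists>x. fib idx i = {x}) \<or> ?T i (K i)" if "i \<in> {1..n}" for i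
    using L(5)[THEN bspec, OF that, THEN conjunct2]
  proof
    assume "\<exists>\<kappa>. ?T i \<kappa>"
    then have "?T i (K i)" unfolding K_def by (rule someI_ex)
    then show ?thesis by (rule disjI2)
  qed (rule disjI1)
  define th where "th x = of_nat (2 * idx x) + squeeze (cc (K (idx x)) x)" for x
  have cm: "cc (K (idx x)) x < cc (K (idx y)) y" if xy: "lt x y" "idx x = idx y" for x y
  proof -
    have S: "x \<in> spine" "y \<in> spine" using ltS[OF xy(1)] .
    have i: "idx x \<in> {1..n}" using L(3) S(1) by blast
    have F: "x \<in> fib idx (idx x)" "y \<in> fib idx (idx x)" using S xy(2) unfolding fib_def by auto
    have ns: "\<not> (\<exists>z. fib idx (idx x) = {z})"
    proof
      assume "\<exists>z. fib idx (idx x) = {z}"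
      then obtain z where z: "fib idx (idx x) = {z}" by (rule exE)
      have "x = z" "y = z" using F[unfolded z] by simp_all
      then show False using xy(1) lt_irrefl by blast
    qed
    have "?T (idx x) (K (idx x))" using K[OF i] by (elim disjE) (erule notE[OF ns], assumption)
    then obtain m r l where "\<forall>u\<in>fib idx (idx x). \<forall>v\<in>fib idx (idx x). lt u v \<longrightarrow> hom (K (idx x), m, r, l) u v"
      by (elim exE conjE) (rule that)
    then have "hom (K (idx x), m, r, l) x y" using F xy(1) by blast
    then have "coord (K (idx x)) x y" unfolding hom_def by simp
    from coord_mono[OF this le_refl[OF spineV[OF S(1)]] xy(1) le_refl[OF spineV[OF S(2)]]]
    show ?thesis unfolding xy(2)[symmetric] .
  qed
  have th_less: "th x < th y" if "lt x y" for x y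
    unfolding th_def by (rule chart_less[OF L(4) cm that])
  have th_refl: "lt x y" if "x \<in> spine" "y \<in> spine" "th x < th y" for x y
    using lt_linear[OF that(1,2)] th_less[of y x] that(3) by auto
  have piece: "(is_point (th ` fib idx i) \<or> is_interval (th ` fib idx i)) \<and> ds1 (\<lambda>t. t \<in> th ` fib idx i) \<and>
      ((\<exists>x. fib idx i = {x}) \<or>
      (\<exists>m r l. 1 \<le> m \<and> (\<forall>u\<in>fib idx i. \<forall>v\<in>fib idx i. lt u v \<longrightarrow> (str m r u \<and> str m r v) \<and> lnk m l u v) \<and>
        (\<forall>x\<in>fib idx i. \<exists>z\<in>fib idx i. lt z x) \<and> (\<forall>x\<in>fib idx i. \<exists>z\<in>fib idx i. lt x z)))"
    if i: "i \<in> {1..n}" for i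
    using K[OF i]
  proof
    assume "\<exists>x. fib idx i = {x}"
    then obtain x where x: "fib idx i = {x}" by blast
    have "is_point (th ` fib idx i)" unfolding x is_point_def by simp
    moreover have "ds1 (\<lambda>t. t \<in> th ` fib idx i)" unfolding x ds1_def by (simp add: dfn_eq dsc_sc dsc_const)
    ultimately show ?thesis using x by blast
  next
    assume "?T i (K i)"
    then obtain m r l where T: "fst (K i) < d" "1 \<le> m"
      "\<forall>u\<in>fib idx i. \<forall>v\<in>fib idx i. lt u v \<longrightarrow> hom (K i, m, r, l) u v"
      "\<forall>x\<in>fib idx i. \<exists>z\<in>fib idx i. lt z x" "\<forall>x\<in>fib idx i. \<exists>z\<in>fib idx i. lt x z" by (elim exE conjE) (rule that)
    let ?F = "fib idx i"
    have FS: "x \<in> spine" "idx x = i" if "x \<in> ?F" for x using that unfolding fib_def by auto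
    have thF: "th x = of_nat (2 * i) + squeeze (cc (K i) x)" if "x \<in> ?F" for x
      unfolding th_def FS(2)[OF that] ..
    have dF: "dset ?F" using L(5)[THEN bspec, OF i] by (rule conjunct1)
    have D: "ds1 (\<lambda>t. t \<in> th ` ?F)"
    proof -
      \<comment> \<open>Clears the denominator of \<open>squeeze\<close> and spells out the absolute
        value, leaving ring operations, the order and a case distinction.\<close>
      have "t \<in> th ` ?F \<longleftrightarrow> (\<exists>x\<in>?F. (t - of_nat (2 * i)) * (1 + (if cc (K i) x < 0 then - cc (K i) x else cc (K i) x)) = cc (K i) x)" for t
      proof -
        have "t = th x \<longleftrightarrow> (t - of_nat (2 * i)) * (1 + (if cc (K i) x < 0 then - cc (K i) x else cc (K i) x)) = cc (K i) x"
          if x: "x \<in> ?F" for x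
        proof -
          have "t = th x \<longleftrightarrow> squeeze (cc (K i) x) = t - of_nat (2 * i)" unfolding thF[OF x] by auto
          then show ?thesis unfolding squeeze_eq_iff abs_if .
        qed
        then show ?thesis by (auto simp: image_iff)
      qed
      moreover have "dfn (\<lambda>e. \<exists>x\<in>?F. (sc 0 e - of_nat (2 * i)) * (1 + (if cc (K i) x < 0 then - cc (K i) x else cc (K i) x)) = cc (K i) x)"
        by (intro dfn_rules dcc T(1) dF)
      ultimately show ?thesis unfolding ds1_def by simp
    qed
    have "i \<in> idx ` spine" using i unfolding L(3) .
    then have ne: "?F \<noteq> {}" unfolding fib_def by blast
    have I: "is_interval (th ` ?F)"
    proof (rule image_interval[OF D ne])
      show "of_nat (2 * i) - 1 < th x \<and> th x < of_nat (2 * i) + 1" if "x \<in> ?F" for x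
        using squeeze_bound[of "cc (K i) x"] unfolding thF[OF that] by linarith
      show "\<exists>z\<in>?F. th z < th x" if "x \<in> ?F" for x using T(4)[THEN bspec, OF that] th_less by blast
      show "\<exists>z\<in>?F. th x < th z" if "x \<in> ?F" for x using T(5)[THEN bspec, OF that] th_less by blast
      fix x y t assume x: "x \<in> ?F" and y: "y \<in> ?F" and t: "th x < t" "t < th y"
      let ?w = "t - of_nat (2 * i)"
      have w: "squeeze (cc (K i) x) < ?w" "?w < squeeze (cc (K i) y)"
        using t unfolding thF[OF x] thF[OF y] by (simp_all add: less_diff_eq diff_less_eq add.commute)
      have w1: "- 1 < ?w" "?w < 1"
        using less_trans[OF squeeze_bound(1) w(1)] less_trans[OF w(2) squeeze_bound(2)] .
      \<comment> \<open>The signed coordinate that the chart sends to \<open>t\<close>;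
        \<open>coord_conv\<close> yields a spine point with this coordinate.\<close>
      let ?c = "?w / (1 - \<bar>?w\<bar>)"
      have sq: "squeeze ?c = ?w" by (rule squeeze_onto[OF w1])
      have refl: "s < u" if "squeeze s < squeeze u" for s u :: 'a
        using that squeeze_less[of u s] by (cases s u rule: linorder_cases) auto
      have c: "cc (K i) x < ?c" "?c < cc (K i) y" by (rule refl, unfold sq, rule w)+
      have xy: "lt x y" by (rule th_refl[OF FS(1)[OF x] FS(1)[OF y] less_trans[OF t]])
      have "coord (K i) x y" using T(3) x y xy unfolding hom_def by simp
      from coord_conv[OF this c] obtain z where z: "z \<in> spine" "le x z" "le z y" "cc (K i) z = ?c" by blast
      have "idx x \<le> idx z" using z(2) le_lt[OF FS(1)[OF x] z(1)] L(4) by auto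
      moreover have "idx z \<le> idx y" using z(3) le_lt[OF z(1) FS(1)[OF y]] L(4) by auto
      ultimately have zF: "z \<in> ?F" using FS(2)[OF x] FS(2)[OF y] z(1) unfolding fib_def by simp
      have "th z = t" unfolding thF[OF zF] z(4) sq by simp
      then show "t \<in> th ` ?F" using zF by blast
    qed
    have "\<forall>u\<in>?F. \<forall>v\<in>?F. lt u v \<longrightarrow> (str m r u \<and> str m r v) \<and> lnk m l u v"
    proof (intro ballI impI)
      fix u v assume uv: "u \<in> ?F" "v \<in> ?F" "lt u v"
      have h: "hom (K i, m, r, l) u v" using T(3) uv by blast
      show "(str m r u \<and> str m r v) \<and> lnk m l u v"
        using homD[OF h le_refl[OF spineV[OF ltS(1)[OF uv(3)]]] uv(3) le_refl[OF spineV[OF ltS(2)[OF uv(3)]]]] by blast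
    qed
    then show ?thesis using I D T(2,4,5)
      by (intro conjI disjI2 exI[of _ m] exI[of _ r] exI[of _ l])
  qed
  have thl: "\<forall>x y. lt x y \<longrightarrow> th x < th y" using th_less by blast
  show ?thesis
    by (rule exI[of _ n], rule exI[of _ N], rule exI[of _ idx], rule exI[of _ th], rule conjI[OF L(1)],
      rule conjI[OF L(2)], rule conjI[OF L(3)], rule conjI[OF L(4)], rule conjI[OF thl], rule ballI, rule piece)
qed

end

section \<open>Finite lattices of labels\<close>

context dlat
begin

text \<open>The labels carry only an order; their lattice operations are computed by transport along
  \<open>h\<close> to a sublattice with least and greatest element.\<close>

lemma transfer_lattice:
  fixes h :: "nat \<Rightarrow> 'b" and HH :: "nat gorder"
  assumes S: "S \<subseteq> V" and Sj: "\<And>p q. p \<in> S \<Longrightarrow> q \<in> S \<Longrightarrow> jn p q \<in> S" and Sm: "\<And>p q. p \<in> S \<Longrightarrow> q \<in> S \<Longrightarrow> mt p q \<in> S"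
    and b: "b \<in> S" "\<And>p. p \<in> S \<Longrightarrow> le b p" and t: "t \<in> S" "\<And>p. p \<in> S \<Longrightarrow> le p t"
    and h: "bij_betw h (carrier HH) S" and eq: "eq HH = (=)"
    and leH: "\<And>p q. p \<in> carrier HH \<Longrightarrow> q \<in> carrier HH \<Longrightarrow> p \<sqsubseteq>\<^bsub>HH\<^esub> q \<longleftrightarrow> le (h p) (h q)"
  shows "bounded_distrib_lattice HH"
    and "\<And>p q. p \<in> carrier HH \<Longrightarrow> q \<in> carrier HH \<Longrightarrow> h (p \<squnion>\<^bsub>HH\<^esub> q) = jn (h p) (h q)"
    and "\<And>p q. p \<in> carrier HH \<Longrightarrow> q \<in> carrier HH \<Longrightarrow> h (p \<sqinter>\<^bsub>HH\<^esub> q) = mt (h p) (h q)"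
    and "h \<bottom>\<^bsub>HH\<^esub> = b" and "h \<top>\<^bsub>HH\<^esub> = t"
proof -
  let ?T = "carrier HH"
  have hS: "h p \<in> S" "h p \<in> V" if "p \<in> ?T" for p using bij_betwE[OF h] that S by auto
  have inj: "p = q" if "p \<in> ?T" "q \<in> ?T" "h p = h q" for p q
    using inj_onD[OF bij_betw_imp_inj_on[OF h] that(3,1,2)] .
  define g where "g = inv_into ?T h"
  have g: "g s \<in> ?T" "h (g s) = s" if "s \<in> S" for s
    using that bij_betw_imp_surj_on[OF h] unfolding g_def by (auto intro: inv_into_into f_inv_into_f)
  interpret po: partial_order HH
    by unfold_locales (auto simp: eq leH hS le_refl intro: le_trans inj le_antisym)
  have lub: "least HH (g (jn (h p) (h q))) (Upper HH {p, q})" if "p \<in> ?T" "q \<in> ?T" for p q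
  proof -
    note G = g[OF Sj[OF hS(1)[OF that(1)] hS(1)[OF that(2)]]]
    show ?thesis
      unfolding least_def Upper_def
      using that G hS jn1 jn2 jn_least by (auto simp: leH)
  qed
  have glb: "greatest HH (g (mt (h p) (h q))) (Lower HH {p, q})" if "p \<in> ?T" "q \<in> ?T" for p q
  proof -
    note G = g[OF Sm[OF hS(1)[OF that(1)] hS(1)[OF that(2)]]]
    show ?thesis
      unfolding greatest_def Lower_def
      using that G hS mt1 mt2 mt_greatest by (auto simp: leH)
  qed
  interpret la: lattice HH
    by unfold_locales (use lub glb in blast)+
  show j: "h (p \<squnion>\<^bsub>HH\<^esub> q) = jn (h p) (h q)" if "p \<in> ?T" "q \<in> ?T" for p q
  proof -
    note G = g[OF Sj[OF hS(1)[OF that(1)] hS(1)[OF that(2)]]]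
    note C = la.join_closed[OF that]
    have "le (jn (h p) (h q)) (h (p \<squnion>\<^bsub>HH\<^esub> q))"
      using la.join_left[OF that] la.join_right[OF that] leH that C by (intro jn_least) auto
    moreover have "p \<squnion>\<^bsub>HH\<^esub> q \<sqsubseteq>\<^bsub>HH\<^esub> g (jn (h p) (h q))"
      using leH that G hS jn1 jn2 by (intro la.join_le) auto
    then have "le (h (p \<squnion>\<^bsub>HH\<^esub> q)) (jn (h p) (h q))" using leH[OF C G(1)] G(2) by simp
    ultimately show ?thesis using le_antisym by blast
  qed
  show m: "h (p \<sqinter>\<^bsub>HH\<^esub> q) = mt (h p) (h q)" if "p \<in> ?T" "q \<in> ?T" for p q
  proof -
    note G = g[OF Sm[OF hS(1)[OF that(1)] hS(1)[OF that(2)]]]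
    note C = la.meet_closed[OF that]
    have "le (h (p \<sqinter>\<^bsub>HH\<^esub> q)) (mt (h p) (h q))"
      using la.meet_left[OF that] la.meet_right[OF that] leH that C by (intro mt_greatest) auto
    moreover have "g (mt (h p) (h q)) \<sqsubseteq>\<^bsub>HH\<^esub> p \<sqinter>\<^bsub>HH\<^esub> q"
      using leH that G hS mt1 mt2 by (intro la.meet_le) auto
    then have "le (mt (h p) (h q)) (h (p \<sqinter>\<^bsub>HH\<^esub> q))" using leH[OF G(1) C] G(2) by simp
    ultimately show ?thesis using le_antisym by blast
  qed
  interpret bl: bounded_lattice HH
  proof unfold_locales
    show "\<exists>x. least HH x ?T"
      by (rule exI[of _ "g b"]) (use g[OF b(1)] b(2) hS in \<open>auto simp: least_def leH\<close>)
    show "\<exists>x. greatest HH x ?T"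
      by (rule exI[of _ "g t"]) (use g[OF t(1)] t(2) hS in \<open>auto simp: greatest_def leH\<close>)
  qed
  show "bounded_distrib_lattice HH"
  proof unfold_locales
    fix x y z assume x: "x \<in> ?T" and y: "y \<in> ?T" and z: "z \<in> ?T"
    show "x \<sqinter>\<^bsub>HH\<^esub> (y \<squnion>\<^bsub>HH\<^esub> z) = (x \<sqinter>\<^bsub>HH\<^esub> y) \<squnion>\<^bsub>HH\<^esub> (x \<sqinter>\<^bsub>HH\<^esub> z)"
      by (rule inj) (use x y z hS la.join_closed la.meet_closed in \<open>simp_all add: j m distr\<close>)
  qed
  have "le (h \<bottom>\<^bsub>HH\<^esub>) (h (g b))" using leH bl.bottom_lower[OF g(1)[OF b(1)]] g(1)[OF b(1)] by simp
  then show "h \<bottom>\<^bsub>HH\<^esub> = b" using b hS g(2)[OF b(1)] le_antisym by simp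
  have "le (h (g t)) (h \<top>\<^bsub>HH\<^esub>)" using leH bl.top_higher[OF g(1)[OF t(1)]] g(1)[OF t(1)] by simp
  then show "h \<top>\<^bsub>HH\<^esub> = t" using t hS g(2)[OF t(1)] le_antisym by simp
qed

end


section \<open>The cohesive tower\<close>

definition label_order :: "nat set \<Rightarrow> (nat \<Rightarrow> nat \<Rightarrow> bool) \<Rightarrow> nat gorder" where
  "label_order T r = \<lparr>carrier = T, eq = (=), le = r\<rparr>"

lemma label_order_simps [simp]:
  "carrier (label_order T r) = T" "eq (label_order T r) = (=)" "p \<sqsubseteq>\<^bsub>label_order T r\<^esub> q = r p q"
  by (simp_all add: label_order_def)

text \<open>Evaluates the supremum in \<open>bp_r\<close>, where the set in question turns out to
  have a greatest element.\<close>

lemma (in partial_order) sup_greatest_element: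
  assumes "A \<subseteq> carrier L" "p \<in> A" "\<And>q. q \<in> A \<Longrightarrow> q \<sqsubseteq> p"
  shows "\<Squnion>A = p"
proof -
  have pL: "p \<in> carrier L" using assms by blast
  have l: "least L p (Upper L A)"
    unfolding least_def Upper_def using assms pL by auto
  show ?thesis
    unfolding sup_def
  proof (rule some_equality[where P = "\<lambda>x. least L x (Upper L A)"])
    fix x assume x: "least L x (Upper L A)"
    have "x \<in> carrier L" using x unfolding least_def Upper_def by blast
    moreover have "x \<sqsubseteq> p" "p \<sqsubseteq> x" using x l unfolding least_def by blast+
    ultimately show "x = p" using le_antisym pL by blast
  qed (rule l)
qed

locale charted = low_lattice R d V le jn mt bt tp
  for R :: "('a::real_closed_field, 'f, 'r) expansion" and d :: nat
    and V :: "'a list set" and le jn mt bt tp +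
  fixes n N :: nat and idx :: "'a list \<Rightarrow> nat" and th :: "'a list \<Rightarrow> 'a"
  assumes N1: "1 \<le> N" and cardN: "x \<in> spine \<Longrightarrow> card (cls x) \<le> N" and idx_img: "idx ` spine = {1..n}"
    and idx_mono: "lt x y \<Longrightarrow> idx x \<le> idx y" and th_less: "lt x y \<Longrightarrow> th x < th y"
    and part: "i \<in> {1..n} \<Longrightarrow> is_point (th ` fib idx i) \<or> is_interval (th ` fib idx i)"
    and dpart: "i \<in> {1..n} \<Longrightarrow> ds1 (\<lambda>t. t \<in> th ` fib idx i)"
    and homog: "i \<in> {1..n} \<Longrightarrow> (\<exists>x. fib idx i = {x}) \<or>
      (\<exists>m r l. 1 \<le> m \<and> (\<forall>u\<in>fib idx i. \<forall>v\<in>fib idx i. lt u v \<longrightarrow> (str m r u \<and> str m r v) \<and> lnk m l u v) \<and>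
        (\<forall>x\<in>fib idx i. \<exists>z\<in>fib idx i. lt z x) \<and> (\<forall>x\<in>fib idx i. \<exists>z\<in>fib idx i. lt x z))"
begin

abbreviation F :: "nat \<Rightarrow> 'a list set" where "F i \<equiv> fib idx i"

abbreviation T :: "'a list \<Rightarrow> nat set" where "T x \<equiv> {1..card (cls x)}"

lemma FD: "x \<in> F i \<Longrightarrow> x \<in> spine" "x \<in> F i \<Longrightarrow> x \<in> V" "x \<in> F i \<Longrightarrow> idx x = i"
  using spineV unfolding fib_def by auto

lemma FI: "x \<in> spine \<Longrightarrow> x \<in> F (idx x)" unfolding fib_def by blast

lemma idx_range: "x \<in> spine \<Longrightarrow> idx x \<in> {1..n}" using idx_img by blast

lemma F_range: "x \<in> F i \<Longrightarrow> i \<in> {1..n}" using idx_range FD by blast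

lemma F_nonempty: "i \<in> {1..n} \<Longrightarrow> \<exists>x. x \<in> F i"
proof -
  assume "i \<in> {1..n}"
  then have "i \<in> idx ` spine" unfolding idx_img .
  then show ?thesis unfolding fib_def by blast
qed

lemma idx_less_lt: "x \<in> spine \<Longrightarrow> y \<in> spine \<Longrightarrow> idx x < idx y \<Longrightarrow> lt x y"
  using lt_linear[of x y] idx_mono[of y x] by auto

lemma th_inj: "x \<in> spine \<Longrightarrow> y \<in> spine \<Longrightarrow> th x = th y \<Longrightarrow> x = y"
  using lt_linear[of x y] th_less[of x y] th_less[of y x] by auto

lemma homogE:
  assumes xy: "x \<in> F i" "y \<in> F i" "x \<noteq> y"
  shows "\<exists>m r l. 1 \<le> m \<and> (\<forall>u\<in>F i. \<forall>v\<in>F i. lt u v \<longrightarrow> (str m r u \<and> str m r v) \<and> lnk m l u v) \<and>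
        (\<forall>x\<in>F i. \<exists>z\<in>F i. lt z x) \<and> (\<forall>x\<in>F i. \<exists>z\<in>F i. lt x z)"
proof -
  have ns: "\<not> (\<exists>z. F i = {z})"
  proof
    assume "\<exists>z. F i = {z}"
    then obtain z where z: "F i = {z}" by (rule exE)
    show False using xy unfolding z by simp
  qed
  show ?thesis using homog[OF F_range[OF xy(1)]] by (elim disjE) (erule notE[OF ns], assumption)
qed

lemma same_structure:
  assumes x: "x \<in> F i" and y: "y \<in> F i"
  shows "card (cls x) = card (cls y)"
    and "p \<in> T x \<Longrightarrow> q \<in> T x \<Longrightarrow> le (lab x p) (lab x q) \<longleftrightarrow> le (lab y p) (lab y q)"
proof -
  have *: "card (cls x) = card (cls y) \<and>
    (\<forall>p\<in>T x. \<forall>q\<in>T x. le (lab x p) (lab x q) \<longleftrightarrow> le (lab y p) (lab y q))"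
  proof (cases "x = y")
    case False
    obtain m r l where h: "1 \<le> m" "\<forall>u\<in>F i. \<forall>v\<in>F i. lt u v \<longrightarrow> (str m r u \<and> str m r v) \<and> lnk m l u v"
      using homogE[OF x y False] by (elim exE conjE) (rule that)
    have "str m r x" "str m r y"
      using h(2) x y lt_linear[OF FD(1)[OF x] FD(1)[OF y]] False by blast+
    then have s: "m = card (cls x)" "\<forall>j\<in>{1..m}. \<forall>k\<in>{1..m}. (j, k) \<in> r \<longleftrightarrow> le (lab x j) (lab x k)"
      "m = card (cls y)" "\<forall>j\<in>{1..m}. \<forall>k\<in>{1..m}. (j, k) \<in> r \<longleftrightarrow> le (lab y j) (lab y k)"
      using str_iff[OF FD(2)[OF x] h(1)] str_iff[OF FD(2)[OF y] h(1)] by blast+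
    show ?thesis using s(2,4) unfolding s(1)[symmetric] s(3)[symmetric] by blast
  qed simp
  then show "card (cls x) = card (cls y)" by blast
  show "p \<in> T x \<Longrightarrow> q \<in> T x \<Longrightarrow> le (lab x p) (lab x q) \<longleftrightarrow> le (lab y p) (lab y q)" using * by blast
qed

definition rp :: "nat \<Rightarrow> 'a list" where "rp i = (SOME x. x \<in> F i)"

text \<open>The label order of one class of the piece; by \<open>same_structure\<close> every class
  of the piece gives the same order.\<close>

definition HH :: "nat \<Rightarrow> nat gorder" where
  "HH i = label_order (T (rp i)) (\<lambda>p q. le (lab (rp i) p) (lab (rp i) q))"

lemma rp: "i \<in> {1..n} \<Longrightarrow> rp i \<in> F i"
  unfolding rp_def using someI_ex[OF F_nonempty] .

lemma HH_carrier: "x \<in> F i \<Longrightarrow> carrier (HH i) = T x"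
  unfolding HH_def using same_structure(1)[OF rp[OF F_range]] by simp

lemma HH_le:
  assumes "x \<in> F i" "p \<in> T x" "q \<in> T x"
  shows "p \<sqsubseteq>\<^bsub>HH i\<^esub> q \<longleftrightarrow> le (lab x p) (lab x q)"
  unfolding HH_def using same_structure(2)[OF assms(1) rp[OF F_range[OF assms(1)]] assms(2,3)] by simp

lemma HH_lattice:
  assumes x: "x \<in> F i"
  shows "bounded_distrib_lattice (HH i)"
    and "p \<in> T x \<Longrightarrow> q \<in> T x \<Longrightarrow> lab x (p \<squnion>\<^bsub>HH i\<^esub> q) = jn (lab x p) (lab x q)"
    and "p \<in> T x \<Longrightarrow> q \<in> T x \<Longrightarrow> lab x (p \<sqinter>\<^bsub>HH i\<^esub> q) = mt (lab x p) (lab x q)"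
    and "lab x \<bottom>\<^bsub>HH i\<^esub> = x" and "lab x \<top>\<^bsub>HH i\<^esub> = top_of x"
proof -
  note V = FD(2)[OF x]
  note C = HH_carrier[OF x]
  have b: "x \<in> cls x" "\<And>p. p \<in> cls x \<Longrightarrow> le x p" using cls_self[OF V] FD(1)[OF x] unfolding spine_def by auto
  have t: "top_of x \<in> cls x" "\<And>p. p \<in> cls x \<Longrightarrow> le p (top_of x)" using top_of[OF V] by auto
  have h: "bij_betw (lab x) (carrier (HH i)) (cls x)" unfolding C by (rule lab_bij[OF V])
  have e: "eq (HH i) = (=)" unfolding HH_def by simp
  have l: "p \<sqsubseteq>\<^bsub>HH i\<^esub> q \<longleftrightarrow> le (lab x p) (lab x q)" if "p \<in> carrier (HH i)" "q \<in> carrier (HH i)" for p q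
    using HH_le[OF x] that unfolding C by blast
  have j: "jn p q \<in> cls x" and m: "mt p q \<in> cls x" if "p \<in> cls x" "q \<in> cls x" for p q
    using cls_jn cls_mt that by blast+
  note TL = transfer_lattice[where S = "cls x" and h = "lab x" and b = x and t = "top_of x" and HH = "HH i"]
  show "bounded_distrib_lattice (HH i)"
    by (rule TL(1)) (assumption | rule clsV j m b t h e l)+
  show "lab x (p \<squnion>\<^bsub>HH i\<^esub> q) = jn (lab x p) (lab x q)" if "p \<in> T x" "q \<in> T x"
    by (rule TL(2)) (assumption | rule clsV j m b t h e l | use that C in simp)+
  show "lab x (p \<sqinter>\<^bsub>HH i\<^esub> q) = mt (lab x p) (lab x q)" if "p \<in> T x" "q \<in> T x"
    by (rule TL(3)) (assumption | rule clsV j m b t h e l | use that C in simp)+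
  show "lab x \<bottom>\<^bsub>HH i\<^esub> = x"
    by (rule TL(4)) (assumption | rule clsV j m b t h e l)+
  show "lab x \<top>\<^bsub>HH i\<^esub> = top_of x"
    by (rule TL(5)) (assumption | rule clsV j m b t h e l)+
qed

lemma HH_closed:
  assumes x: "x \<in> F i"
  shows "p \<in> T x \<Longrightarrow> q \<in> T x \<Longrightarrow> p \<squnion>\<^bsub>HH i\<^esub> q \<in> T x"
    and "p \<in> T x \<Longrightarrow> q \<in> T x \<Longrightarrow> p \<sqinter>\<^bsub>HH i\<^esub> q \<in> T x"
    and "\<bottom>\<^bsub>HH i\<^esub> \<in> T x" and "\<top>\<^bsub>HH i\<^esub> \<in> T x"
proof -
  interpret L: bounded_distrib_lattice "HH i" by (rule HH_lattice(1)[OF x])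
  show "p \<in> T x \<Longrightarrow> q \<in> T x \<Longrightarrow> p \<squnion>\<^bsub>HH i\<^esub> q \<in> T x" using L.join_closed[of p q] unfolding HH_carrier[OF x] .
  show "p \<in> T x \<Longrightarrow> q \<in> T x \<Longrightarrow> p \<sqinter>\<^bsub>HH i\<^esub> q \<in> T x" using L.meet_closed[of p q] unfolding HH_carrier[OF x] .
  show "\<bottom>\<^bsub>HH i\<^esub> \<in> T x" using L.bottom_closed unfolding HH_carrier[OF x] .
  show "\<top>\<^bsub>HH i\<^esub> \<in> T x" using L.top_closed unfolding HH_carrier[OF x] .
qed

section \<open>Links between classes as maps of labels\<close>

definition lk :: "'a list \<Rightarrow> 'a list \<Rightarrow> nat \<Rightarrow> nat" where
  "lk x y p = (SOME k. k \<in> T y \<and> jn (lab x p) y = lab y k)"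

lemma lk:
  assumes "lt x y" "p \<in> T x"
  shows "lk x y p \<in> T y" "lab y (lk x y p) = jn (lab x p) y"
proof -
  have "\<exists>k. k \<in> T y \<and> jn (lab x p) y = lab y k" using link_exists[OF assms] by blast
  from someI_ex[OF this] show "lk x y p \<in> T y" "lab y (lk x y p) = jn (lab x p) y"
    unfolding lk_def by auto
qed

lemma labV: "x \<in> spine \<Longrightarrow> p \<in> T x \<Longrightarrow> lab x p \<in> V"
  using lab_cls[OF spineV] clsV by blast

text \<open>Comes from \<open>(p \<squnion> z) \<squnion> y = p \<squnion> y\<close> for
  \<open>z \<le> y\<close>; it becomes the composition law of the blueprint.\<close>

lemma lk_comp:
  assumes l: "lt x z" "lt z y" and p: "p \<in> T x"
  shows "lk x y p = lk z y (lk x z p)"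
proof (rule lab_inj[OF spineV[OF ltS(2)[OF l(2)]]])
  note xy = lt_trans[OF l]
  show "lk x y p \<in> T y" by (rule lk(1)[OF xy p])
  show "lk z y (lk x z p) \<in> T y" by (rule lk(1)[OF l(2) lk(1)[OF l(1) p]])
  show "lab y (lk x y p) = lab y (lk z y (lk x z p))"
    unfolding lk(2)[OF xy p] lk(2)[OF l(2) lk(1)[OF l(1) p]] lk(2)[OF l(1) p]
    using jn_trans[OF labV[OF ltS(1)[OF l(1)] p] lt_le[OF l(2)]] by simp
qed

lemma lk_same:
  assumes x: "x \<in> F i" "y \<in> F i" "lt x y" and x': "x' \<in> F i" "y' \<in> F i" "lt x' y'" and p: "p \<in> T x"
  shows "lk x y p = lk x' y' p"
proof -
  have ne: "x \<noteq> y" using x(3) lt_irrefl by blast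
  obtain m r l where h: "1 \<le> m" "\<forall>u\<in>F i. \<forall>v\<in>F i. lt u v \<longrightarrow> (str m r u \<and> str m r v) \<and> lnk m l u v"
    using homogE[OF x(1,2) ne] by (elim exE conjE) (rule that)
  have s: "str m r x" "lnk m l x y" "lnk m l x' y'" using h(2) x x' by blast+
  have m: "m = card (cls x)" by (rule str_cardD[OF s(1) h(1) FD(1)[OF x(1)]])
  have c: "card (cls y) = m" "card (cls x') = m" "card (cls y') = m"
    using same_structure(1)[OF x(1,2)] same_structure(1)[OF x(1) x'(1)] same_structure(1)[OF x(1) x'(2)] m by simp_all
  have p': "p \<in> {1..m}" "p \<in> T x'" using p c m by simp_all
  have k: "lk x y p \<in> {1..m}" "lk x' y' p \<in> {1..m}" using lk(1)[OF x(3) p] lk(1)[OF x'(3) p'(2)] c by simp_all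
  have "(p, lk x y p) \<in> l" using lnkD[OF s(2) p'(1) k(1)] lk(2)[OF x(3) p] by simp
  then have "jn (lab x' p) y' = lab y' (lk x y p)" using lnkD[OF s(3) p'(1) k(1)] by simp
  then have "lab y' (lk x' y' p) = lab y' (lk x y p)" using lk(2)[OF x'(3) p'(2)] by simp
  then show ?thesis using lab_inj[OF FD(2)[OF x'(2)], of "lk x' y' p" "lk x y p"] k c by simp
qed

lemma F_above:
  assumes "x \<in> F i" "x' \<in> F i" "x \<noteq> x'"
  shows "\<exists>z\<in>F i. lt x z \<and> lt x' z"
proof -
  have a: "\<forall>x\<in>F i. \<exists>z\<in>F i. lt x z" using homogE[OF assms] by (elim exE conjE)
  have "lt x x' \<or> lt x' x" using lt_linear[OF FD(1)[OF assms(1)] FD(1)[OF assms(2)]] assms(3) by blast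
  then show ?thesis
  proof
    assume l: "lt x x'"
    obtain z where z: "z \<in> F i" "lt x' z" using a assms(2) by blast
    then show ?thesis using lt_trans[OF l] by blast
  next
    assume l: "lt x' x"
    obtain z where z: "z \<in> F i" "lt x z" using a assms(1) by blast
    then show ?thesis using lt_trans[OF l] by blast
  qed
qed

lemma F_below:
  assumes "x \<in> F i" "x' \<in> F i" "x \<noteq> x'"
  shows "\<exists>z\<in>F i. lt z x \<and> lt z x'"
proof -
  have a: "\<forall>x\<in>F i. \<exists>z\<in>F i. lt z x" using homogE[OF assms] by (elim exE conjE)
  have "lt x x' \<or> lt x' x" using lt_linear[OF FD(1)[OF assms(1)] FD(1)[OF assms(2)]] assms(3) by blast
  then show ?thesis
  proof
    assume l: "lt x x'"
    obtain z where z: "z \<in> F i" "lt z x" using a assms(1) by blast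
    then show ?thesis using lt_trans[OF _ l] by blast
  next
    assume l: "lt x' x"
    obtain z where z: "z \<in> F i" "lt z x'" using a assms(2) by blast
    then show ?thesis using lt_trans[OF _ l] by blast
  qed
qed

text \<open>Between distinct pieces the link is constant since it factors through a common third point of
  either piece, and links inside a piece are constant.\<close>

lemma lk_const:
  assumes x: "x \<in> F i" "x' \<in> F i" and y: "y \<in> F j" "y' \<in> F j" and l: "lt x y" "lt x' y'" and p: "p \<in> T x"
  shows "lk x y p = lk x' y' p"
proof (cases "i = j")
  case True
  show ?thesis by (rule lk_same[where i = i]) (use assms True in simp_all)
next
  case False
  have "i \<le> j" using idx_mono[OF l(1)] FD(3)[OF x(1)] FD(3)[OF y(1)] by simp
  then have ij: "lt u v" if "u \<in> F i" "v \<in> F j" for u v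
    using idx_less_lt[of u v] FD[OF that(1)] FD[OF that(2)] False by simp
  have px: "p \<in> T x'" using p same_structure(1)[OF x] by simp
  have "lk x y p = lk x' y p"
  proof (cases "x = x'")
    case ne: False
    obtain z where z: "z \<in> F i" "lt x z" "lt x' z" using F_above[OF x ne] by blast
    have "lk x y p = lk z y (lk x z p)" by (rule lk_comp[OF z(2) ij[OF z(1) y(1)] p])
    also have "lk x z p = lk x' z p" by (rule lk_same[OF x(1) z(1,2) x(2) z(1,3) p])
    also have "lk z y (lk x' z p) = lk x' y p" by (rule lk_comp[OF z(3) ij[OF z(1) y(1)] px, symmetric])
    finally show ?thesis .
  qed simp
  also have "\<dots> = lk x' y' p"
  proof (cases "y = y'")
    case ne: False
    obtain z where z: "z \<in> F j" "lt z y" "lt z y'" using F_below[OF y ne] by blast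
    have xz: "lt x' z" by (rule ij[OF x(2) z(1)])
    have "lk x' y p = lk z y (lk x' z p)" by (rule lk_comp[OF xz z(2) px])
    also have "\<dots> = lk z y' (lk x' z p)" by (rule lk_same[OF z(1) y(1) z(2) z(1) y(2) z(3) lk(1)[OF xz px]])
    also have "\<dots> = lk x' y' p" by (rule lk_comp[OF xz z(3) px, symmetric])
    finally show ?thesis .
  qed simp
  finally show ?thesis .
qed

text \<open>For a one-point piece and \<open>i = j\<close> there is no pair of points to read a link
  from; the default is the identity, as the cohesion laws demand there.\<close>

definition Lm :: "nat \<Rightarrow> nat \<Rightarrow> nat \<Rightarrow> nat" where
  "Lm i j p = (if \<exists>x y. x \<in> F i \<and> y \<in> F j \<and> lt x y
     then (let z = SOME z. fst z \<in> F i \<and> snd z \<in> F j \<and> lt (fst z) (snd z) in lk (fst z) (snd z) p) else p)"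

lemma Lm_lk:
  assumes "x \<in> F i" "y \<in> F j" "lt x y" "p \<in> T x"
  shows "Lm i j p = lk x y p"
proof -
  define z where "z = (SOME z. fst z \<in> F i \<and> snd z \<in> F j \<and> lt (fst z) (snd z))"
  have "fst z \<in> F i \<and> snd z \<in> F j \<and> lt (fst z) (snd z)"
    unfolding z_def by (rule someI[of _ "(x, y)"]) (use assms in simp)
  then have z: "fst z \<in> F i" "snd z \<in> F j" "lt (fst z) (snd z)" by auto
  have "\<exists>x y. x \<in> F i \<and> y \<in> F j \<and> lt x y" using assms by blast
  then have "Lm i j p = lk (fst z) (snd z) p" unfolding Lm_def z_def[symmetric] Let_def by (rule if_P)
  also have "\<dots> = lk x y p" by (rule lk_const[OF assms(1) z(1) assms(2) z(2) assms(3) z(3) assms(4), symmetric])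
  finally show ?thesis .
qed

lemma Lm_lab:
  assumes "x \<in> F i" "y \<in> F j" "lt x y" "p \<in> T x"
  shows "Lm i j p \<in> T y" "lab y (Lm i j p) = jn (lab x p) y"
  unfolding Lm_lk[OF assms] using lk[OF assms(3,4)] by auto

lemma Lm_single: "F i = {x} \<Longrightarrow> Lm i i p = p"
proof -
  assume F: "F i = {x}"
  have "\<not> (\<exists>u v. u \<in> F i \<and> v \<in> F i \<and> lt u v)" unfolding F using lt_irrefl by blast
  then show ?thesis unfolding Lm_def by (rule if_not_P)
qed

definition single :: "nat \<Rightarrow> bool" where "single i \<longleftrightarrow> (\<exists>x. F i = {x})"

lemma Lm_single': "single i \<Longrightarrow> Lm i i p = p" unfolding single_def using Lm_single by blast

text \<open>Between different pieces the index decides; inside a piece with several points there is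
  no least element.\<close>

lemma go_below:
  assumes i: "i \<in> {1..n}" "i \<le> j" "\<not> (i = j \<and> single i)" and y: "y \<in> F j"
  shows "\<exists>x\<in>F i. lt x y"
proof (cases "i = j")
  case True
  have "\<exists>x\<in>F i. x \<noteq> y" using i(3) True y unfolding single_def by blast
  then obtain x where x: "x \<in> F i" "x \<noteq> y" by blast
  show ?thesis using F_below[OF x(1) _ x(2)] y True by blast
next
  case False
  obtain x where x: "x \<in> F i" using F_nonempty[OF i(1)] by blast
  have "lt x y" using idx_less_lt[of x y] FD[OF x] FD[OF y] False i(2) by simp
  then show ?thesis using x by blast
qed

lemma go_above:
  assumes j: "j \<in> {1..n}" "i \<le> j" "\<not> (i = j \<and> single i)" and x: "x \<in> F i"
  shows "\<exists>y\<in>F j. lt x y"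
proof (cases "i = j")
  case True
  have "\<exists>y\<in>F j. y \<noteq> x" using j(3) True x unfolding single_def by blast
  then obtain y where y: "y \<in> F j" "y \<noteq> x" by blast
  show ?thesis using F_above[OF y(1) _ y(2)] x True by blast
next
  case False
  obtain y where y: "y \<in> F j" using F_nonempty[OF j(1)] by blast
  have "lt x y" using idx_less_lt[of x y] FD[OF x] FD[OF y] False j(2) by simp
  then show ?thesis using y by blast
qed

text \<open>In the first case \<open>Lm\<close> is the identity; in the second the laws of the
  blueprint can be checked in the classes of \<open>x\<close> and \<open>y\<close>.\<close>

lemma pair_exists:
  assumes "i \<in> {1..n}" "j \<in> {1..n}" "i \<le> j"
  shows "(i = j \<and> single i) \<or> (\<exists>x y. x \<in> F i \<and> y \<in> F j \<and> lt x y)"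
proof (cases "i = j \<and> single i")
  case False
  obtain x where x: "x \<in> F i" using F_nonempty[OF assms(1)] by blast
  show ?thesis using go_above[OF assms(2,3) False x] x by blast
next
  case True
  then show ?thesis by (rule disjI1)
qed

section \<open>The blueprint and its cohesion laws\<close>

definition BB :: "'a blueprint" where
  "BB = \<lparr>bp_n = n, bp_N = N, bp_M = (\<Union>i\<in>{1..n}. th ` F i), bp_part = (\<lambda>i. th ` F i), bp_H = HH, bp_l = Lm\<rparr>"

lemma BB_simps [simp]: "bp_n BB = n" "bp_N BB = N" "bp_M BB = (\<Union>i\<in>{1..n}. th ` F i)"
  "bp_part BB = (\<lambda>i. th ` F i)" "bp_H BB = HH" "bp_l BB = Lm"
  by (simp_all add: BB_def)

lemma M_eq: "(\<Union>i\<in>{1..n}. th ` F i) = th ` spine"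
  using FI idx_range FD(1) by blast

text \<open>\<open>r\<close> is adjoint to joining with \<open>y\<close>: as \<open>y\<close> is
  below \<open>q\<close>, the join \<open>p \<squnion> y\<close> is below \<open>q\<close> iff
  \<open>p\<close> is, and \<open>p\<close> always lies below \<open>top_of x\<close>. So the
  largest admissible label is that of \<open>q \<sqinter> top_of x\<close>, which belongs to the
  class of \<open>x\<close>.\<close>

lemma r_lab:
  assumes x: "x \<in> F i" and y: "y \<in> F j" and xy: "lt x y" and q: "q \<in> T y"
  shows "bp_r BB j i q \<in> T x" "lab x (bp_r BB j i q) = mt (lab y q) (top_of x)"
proof -
  interpret L: bounded_distrib_lattice "HH i" by (rule HH_lattice(1)[OF x])
  note S = FD(1)[OF x] FD(1)[OF y]
  note V = FD(2)[OF x] FD(2)[OF y]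
  have t: "top_of x \<in> cls x" "\<And>p. p \<in> cls x \<Longrightarrow> le p (top_of x)" using top_of[OF V(1)] by auto
  have tV: "top_of x \<in> V" using t(1) clsV by blast
  have qc: "lab y q \<in> cls y" by (rule lab_cls[OF V(2) q])
  have qV: "lab y q \<in> V" using qc clsV by blast
  have yq: "le y (lab y q)" using qc S(2) unfolding spine_def by blast
  have "mt (top_of x) (lab y q) \<in> cls x" by (rule lt_cls_mt[OF xy t(1) qc])
  then have mc: "mt (lab y q) (top_of x) \<in> cls x" using mt_comm[OF tV qV] by simp
  obtain p0 where p0: "p0 \<in> T x" "lab x p0 = mt (lab y q) (top_of x)" using label_of[OF V(1) mc] by blast
  have iff: "Lm i j p \<sqsubseteq>\<^bsub>HH j\<^esub> q \<longleftrightarrow> p \<sqsubseteq>\<^bsub>HH i\<^esub> p0" if p: "p \<in> T x" for p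
  proof -
    have pc: "lab x p \<in> cls x" by (rule lab_cls[OF V(1) p])
    have pV: "lab x p \<in> V" using pc clsV by blast
    have "Lm i j p \<sqsubseteq>\<^bsub>HH j\<^esub> q \<longleftrightarrow> le (jn (lab x p) y) (lab y q)"
      using HH_le[OF y Lm_lab(1)[OF x y xy p] q] Lm_lab(2)[OF x y xy p] by simp
    also have "\<dots> \<longleftrightarrow> le (lab x p) (lab y q)"
      using jn_least[OF _ yq] le_trans[OF jn1[OF pV V(2)]] by blast
    also have "\<dots> \<longleftrightarrow> le (lab x p) (mt (lab y q) (top_of x))"
      using mt_greatest[OF _ t(2)[OF pc]] le_trans[OF _ mt1[OF qV tV]] by blast
    also have "\<dots> \<longleftrightarrow> p \<sqsubseteq>\<^bsub>HH i\<^esub> p0" using HH_le[OF x p p0(1)] p0(2) by simp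
    finally show ?thesis .
  qed
  have "bp_r BB j i q = p0"
    unfolding bp_r_def BB_simps HH_carrier[OF x]
  proof (rule L.sup_greatest_element)
    show "{p \<in> T x. Lm i j p \<sqsubseteq>\<^bsub>HH j\<^esub> q} \<subseteq> carrier (HH i)" unfolding HH_carrier[OF x] by blast
    have "p0 \<sqsubseteq>\<^bsub>HH i\<^esub> p0" using HH_le[OF x p0(1) p0(1)] le_refl[OF labV[OF S(1) p0(1)]] by simp
    then show "p0 \<in> {p \<in> T x. Lm i j p \<sqsubseteq>\<^bsub>HH j\<^esub> q}" using iff[OF p0(1)] p0(1) by simp
    show "p \<sqsubseteq>\<^bsub>HH i\<^esub> p0" if "p \<in> {p \<in> T x. Lm i j p \<sqsubseteq>\<^bsub>HH j\<^esub> q}" for p using iff[of p] that by simp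
  qed
  then show "bp_r BB j i q \<in> T x" "lab x (bp_r BB j i q) = mt (lab y q) (top_of x)" using p0 by simp_all
qed

lemma r_single:
  assumes "single i" "q \<in> carrier (HH i)" "i \<in> {1..n}"
  shows "bp_r BB i i q = q"
proof -
  obtain x where x: "x \<in> F i" using F_nonempty[OF assms(3)] by blast
  interpret L: bounded_distrib_lattice "HH i" by (rule HH_lattice(1)[OF x])
  show ?thesis
    unfolding bp_r_def BB_simps Lm_single'[OF assms(1)]
    by (rule L.sup_greatest_element) (use assms(2) in auto)
qed

text \<open>Every law is an identity between elements of the lattice, transferred to labels by
  injectivity of \<open>lab\<close>. The two laws relating \<open>l\<close> and \<open>r\<close>
  come from distributivity in its modular form.\<close>

lemma cohesive: "cohesive_blueprint R BB"
proof (rule cohesive_blueprint.intro)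
  obtain x0 where x0: "x0 \<in> spine" using spine_nonempty by blast
  show "1 \<le> bp_n BB" using idx_range[OF x0] by simp
  show "1 \<le> bp_N BB" using N1 by simp
  show "definable R 1 ((\<lambda>m. [m]) ` bp_M BB)"
  proof -
    have "ds1 (\<lambda>t. t \<in> bp_M BB)"
      unfolding ds1_def BB_simps UN_iff by (intro dfn_bex_finite finite_atLeastAtMost ds1D[OF dpart] dsc_sc)
    from dfn_ren[OF this[unfolded ds1_def], of "\<lambda>_. 0"] have "dfn (\<lambda>e. e 0 \<in> bp_M BB)" by (simp add: sc_def)
    then show ?thesis unfolding definable_def dfn_def by (auto simp: image_iff)
  qed
  have btS: "bt \<in> spine" unfolding spine_def using btV bt clsV by blast
  have bt_least: "th bt \<le> th x" if "x \<in> spine" for x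
    using le_lt[OF btS that] bt[OF spineV[OF that]] th_less[of bt x] by auto
  \<comment> \<open>The least element of the class of \<open>tp\<close> is the greatest point of the
    spine.\<close>
  obtain x1 where x1: "x1 \<in> spine" "tp \<in> cls x1" using bottom_exists[OF tpV] by blast
  have x1_greatest: "le x x1" if "x \<in> spine" for x
  proof (rule spine_lo_le[OF that spineV[OF x1(1)]])
    have "lo x tp" by (rule lo_le[OF tp[OF spineV[OF that]]])
    moreover have "lo tp x1" using x1(2) unfolding cls_def eqv_def by blast
    ultimately show "lo x x1" by (rule lo_trans)
  qed
  show "\<exists>a\<in>bp_M BB. \<forall>m\<in>bp_M BB. a \<le> m" unfolding BB_simps M_eq using btS bt_least by blast
  have "th x \<le> th x1" if "x \<in> spine" for x
    using le_lt[OF that x1(1)] x1_greatest[OF that] th_less[of x x1] by auto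
  then show "\<exists>b\<in>bp_M BB. \<forall>m\<in>bp_M BB. m \<le> b" unfolding BB_simps M_eq using x1(1) by blast
  show "bp_M BB = (\<Union>i\<in>{1..bp_n BB}. bp_part BB i)" by simp
  show "is_point (bp_part BB i) \<or> is_interval (bp_part BB i)" if "i \<in> {1..bp_n BB}" for i
    using part that by simp
  show "x < y" if h: "i \<in> {1..bp_n BB}" "j \<in> {1..bp_n BB}" "i < j" "x \<in> bp_part BB i" "y \<in> bp_part BB j" for i j x y
  proof -
    obtain u v where u: "u \<in> F i" "x = th u" and v: "v \<in> F j" "y = th v" using h(4,5) by auto
    have "lt u v" using idx_less_lt[of u v] FD[OF u(1)] FD[OF v(1)] h(3) by simp
    then show ?thesis unfolding u(2) v(2) by (rule th_less)
  qed
  have Lat: "bounded_distrib_lattice (HH i)" if "i \<in> {1..n}" for i using HH_lattice(1)[OF rp[OF that]] .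
  show "bounded_distrib_lattice (bp_H BB i)" if "i \<in> {1..bp_n BB}" for i using that Lat[of i] by simp
  show "carrier (bp_H BB i) \<subseteq> {1..bp_N BB}" if "i \<in> {1..bp_n BB}" for i
  proof -
    have i: "i \<in> {1..n}" using that by simp
    show ?thesis unfolding BB_simps HH_carrier[OF rp[OF i]] using cardN[OF FD(1)[OF rp[OF i]]] by auto
  qed
  have lat: "lattice (HH i)" if "i \<in> {1..n}" for i
    using Lat[OF that] by (simp add: bounded_distrib_lattice_def bounded_lattice_def)
  show "bot_lattice_hom (bp_H BB i) (bp_H BB j) (bp_l BB i j)"
    if "i \<in> {1..bp_n BB}" "j \<in> {1..bp_n BB}" "i \<le> j" for i j
  proof -
    have i: "i \<in> {1..n}" and j: "j \<in> {1..n}" using that by auto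
    show ?thesis
      unfolding BB_simps using pair_exists[OF i j that(3)]
    proof
      assume h: "i = j \<and> single i"
      then have "Lm i j p = p" for p using Lm_single' by blast
      then show "bot_lattice_hom (HH i) (HH j) (Lm i j)" using h lat[OF i]
        unfolding bot_lattice_hom_def join_pres_def meet_pres_def by simp
    next
      assume "\<exists>x y. x \<in> F i \<and> y \<in> F j \<and> lt x y"
      then obtain x y where x: "x \<in> F i" and y: "y \<in> F j" and xy: "lt x y" by blast
      note L = Lm_lab[OF x y xy]
      note V = FD(2)[OF x] FD(2)[OF y]
      note inj = lab_inj[OF V(2)]
      have pV: "lab x p \<in> V" if "p \<in> T x" for p by (rule labV[OF FD(1)[OF x] that])
      have "Lm i j (p \<squnion>\<^bsub>HH i\<^esub> q) = Lm i j p \<squnion>\<^bsub>HH j\<^esub> Lm i j q" if p: "p \<in> T x" and q: "q \<in> T x" for p q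
      proof (rule inj)
        note C = HH_closed(1)[OF x p q]
        show "Lm i j (p \<squnion>\<^bsub>HH i\<^esub> q) \<in> T y" by (rule L(1)[OF C])
        show "Lm i j p \<squnion>\<^bsub>HH j\<^esub> Lm i j q \<in> T y" by (rule HH_closed(1)[OF y L(1)[OF p] L(1)[OF q]])
        have "jn (jn (lab x p) (lab x q)) y = jn (jn (lab x p) y) (jn (lab x q) y)"
          (is "?a = ?b")
        proof (rule le_antisym)
          note P = pV[OF p] and Q = pV[OF q]
          note J = jnV[OF P Q] jnV[OF P V(2)] jnV[OF Q V(2)]
          note B = jn1[OF J(2,3)] jn2[OF J(2,3)]
          have "le (lab x p) ?b" by (rule le_trans[OF jn1[OF P V(2)] B(1)])
          moreover have "le (lab x q) ?b" by (rule le_trans[OF jn1[OF Q V(2)] B(2)])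
          moreover have "le y ?b" by (rule le_trans[OF jn2[OF P V(2)] B(1)])
          ultimately show "le ?a ?b" by (intro jn_least)
          have "le (jn (lab x p) y) ?a" by (rule jn_mono[OF jn1[OF P Q] le_refl[OF V(2)]])
          moreover have "le (jn (lab x q) y) ?a" by (rule jn_mono[OF jn2[OF P Q] le_refl[OF V(2)]])
          ultimately show "le ?b ?a" by (rule jn_least)
        qed
        then show "lab y (Lm i j (p \<squnion>\<^bsub>HH i\<^esub> q)) = lab y (Lm i j p \<squnion>\<^bsub>HH j\<^esub> Lm i j q)"
          unfolding L(2)[OF C] HH_lattice(2)[OF x p q] HH_lattice(2)[OF y L(1)[OF p] L(1)[OF q]] L(2)[OF p] L(2)[OF q] .
      qed
      moreover have "Lm i j (p \<sqinter>\<^bsub>HH i\<^esub> q) = Lm i j p \<sqinter>\<^bsub>HH j\<^esub> Lm i j q" if p: "p \<in> T x" and q: "q \<in> T x" for p q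
      proof (rule inj)
        note C = HH_closed(2)[OF x p q]
        show "Lm i j (p \<sqinter>\<^bsub>HH i\<^esub> q) \<in> T y" by (rule L(1)[OF C])
        show "Lm i j p \<sqinter>\<^bsub>HH j\<^esub> Lm i j q \<in> T y" by (rule HH_closed(2)[OF y L(1)[OF p] L(1)[OF q]])
        \<comment> \<open>Joining with \<open>y\<close> preserves meets by the dual distributive
          law.\<close>
        have "jn (mt (lab x p) (lab x q)) y = mt (jn (lab x p) y) (jn (lab x q) y)"
          using distr'[OF V(2) pV[OF p] pV[OF q]] jn_comm[OF V(2)] pV[OF p] pV[OF q] mtV[OF pV[OF p] pV[OF q]] by simp
        then show "lab y (Lm i j (p \<sqinter>\<^bsub>HH i\<^esub> q)) = lab y (Lm i j p \<sqinter>\<^bsub>HH j\<^esub> Lm i j q)"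
          unfolding L(2)[OF C] HH_lattice(3)[OF x p q] HH_lattice(3)[OF y L(1)[OF p] L(1)[OF q]] L(2)[OF p] L(2)[OF q] .
      qed
      moreover have "Lm i j \<bottom>\<^bsub>HH i\<^esub> = \<bottom>\<^bsub>HH j\<^esub>"
      proof (rule inj)
        note C = HH_closed(3)[OF x]
        show "Lm i j \<bottom>\<^bsub>HH i\<^esub> \<in> T y" by (rule L(1)[OF C])
        show "\<bottom>\<^bsub>HH j\<^esub> \<in> T y" by (rule HH_closed(3)[OF y])
        show "lab y (Lm i j \<bottom>\<^bsub>HH i\<^esub>) = lab y \<bottom>\<^bsub>HH j\<^esub>"
          unfolding L(2)[OF C] HH_lattice(4)[OF x] HH_lattice(4)[OF y] by (rule jn_absorb(2)[OF lt_le[OF xy]])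
      qed
      ultimately show "bot_lattice_hom (HH i) (HH j) (Lm i j)"
        unfolding bot_lattice_hom_def join_pres_def meet_pres_def HH_carrier[OF x] HH_carrier[OF y]
        using lat[OF i] lat[OF j] L(1) by blast
    qed
  qed
  show "bp_l BB i k p = bp_l BB j k (bp_l BB i j p)"
    if ijk: "i \<in> {1..bp_n BB}" "j \<in> {1..bp_n BB}" "k \<in> {1..bp_n BB}" "i \<le> j" "j \<le> k" "p \<in> carrier (bp_H BB i)" for i j k p
  proof -
    have i: "i \<in> {1..n}" and j: "j \<in> {1..n}" and k: "k \<in> {1..n}" and pc: "p \<in> carrier (HH i)" using ijk by auto
    show ?thesis
    proof (cases "(i = j \<and> single i) \<or> (j = k \<and> single j)")
      case True
      then show ?thesis
      proof
        assume h: "i = j \<and> single i"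
        then have "Lm i j p = p" using Lm_single' by blast
        then show ?thesis using h by simp
      next
        assume h: "j = k \<and> single j"
        then have "Lm j k q = q" for q using Lm_single' by blast
        then show ?thesis using h by simp
      qed
    next
      case False
      \<comment> \<open>The middle point is chosen first and then a point below and one above it, so
        that all three maps are read off a single chain.\<close>
      obtain y where y: "y \<in> F j" using F_nonempty[OF j] by blast
      obtain x where x: "x \<in> F i" "lt x y" using go_below[OF i ijk(4) _ y] False by blast
      obtain z where z: "z \<in> F k" "lt y z" using go_above[OF k ijk(5) _ y] False by blast
      have p: "p \<in> T x" using pc unfolding HH_carrier[OF x(1)] .
      have "Lm i k p = lk x z p" by (rule Lm_lk[OF x(1) z(1) lt_trans[OF x(2) z(2)] p])
      also have "\<dots> = lk y z (lk x y p)" by (rule lk_comp[OF x(2) z(2) p])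
      also have "lk x y p = Lm i j p" by (rule Lm_lk[OF x(1) y x(2) p, symmetric])
      also have "lk y z (Lm i j p) = Lm j k (Lm i j p)"
        by (rule Lm_lk[OF y z(1,2) Lm_lab(1)[OF x(1) y x(2) p], symmetric])
      finally show ?thesis by simp
    qed
  qed
  show "bp_r BB j i (bp_l BB i j p) = p \<squnion>\<^bsub>bp_H BB i\<^esub> bp_r BB j i \<bottom>\<^bsub>bp_H BB j\<^esub>"
    if "i \<in> {1..bp_n BB}" "j \<in> {1..bp_n BB}" "i \<le> j" "p \<in> carrier (bp_H BB i)" for i j p
  proof -
    have i: "i \<in> {1..n}" and j: "j \<in> {1..n}" and pc: "p \<in> carrier (HH i)" using that by auto
    interpret L: bounded_distrib_lattice "HH i" by (rule Lat[OF i])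
    show ?thesis
      unfolding BB_simps using pair_exists[OF i j that(3)]
    proof
      assume h: "i = j \<and> single i"
      then have "Lm i j p = p" using Lm_single' by blast
      moreover have "p \<squnion>\<^bsub>HH i\<^esub> \<bottom>\<^bsub>HH i\<^esub> = p"
      proof (rule L.le_antisym)
        show "p \<squnion>\<^bsub>HH i\<^esub> \<bottom>\<^bsub>HH i\<^esub> \<sqsubseteq>\<^bsub>HH i\<^esub> p" using pc by (intro L.join_le) auto
        show "p \<sqsubseteq>\<^bsub>HH i\<^esub> p \<squnion>\<^bsub>HH i\<^esub> \<bottom>\<^bsub>HH i\<^esub>" using pc by (intro L.join_left) auto
      qed (use pc in auto)
      ultimately show "bp_r BB j i (Lm i j p) = p \<squnion>\<^bsub>HH i\<^esub> bp_r BB j i \<bottom>\<^bsub>HH j\<^esub>"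
        using h[THEN conjunct1] r_single[OF h[THEN conjunct2]] pc i L.bottom_closed by simp
    next
      assume "\<exists>x y. x \<in> F i \<and> y \<in> F j \<and> lt x y"
      then obtain x y where x: "x \<in> F i" and y: "y \<in> F j" and xy: "lt x y" by blast
      note V = FD(2)[OF x] FD(2)[OF y]
      have p: "p \<in> T x" using pc unfolding HH_carrier[OF x] .
      have pV: "lab x p \<in> V" by (rule labV[OF FD(1)[OF x] p])
      have t: "top_of x \<in> V" "le (lab x p) (top_of x)" using top_of[OF V(1)] clsV lab_cls[OF V(1) p] by auto
      note L = Lm_lab[OF x y xy p]
      note r1 = r_lab[OF x y xy L(1)] and r2 = r_lab[OF x y xy HH_closed(3)[OF y]]
      show "bp_r BB j i (Lm i j p) = p \<squnion>\<^bsub>HH i\<^esub> bp_r BB j i \<bottom>\<^bsub>HH j\<^esub>"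
      proof (rule lab_inj[OF V(1) r1(1) HH_closed(1)[OF x p r2(1)]])
        \<comment> \<open>The modular law, as \<open>lab x p\<close> is below
          \<open>top_of x\<close>.\<close>
        have "mt (jn (lab x p) y) (top_of x) = jn (lab x p) (mt y (top_of x))"
          using distr[OF t(1) pV V(2)] mt_comm[OF t(1)] jnV[OF pV V(2)] V(2) pV mt_absorb(1)[OF t(2)] by simp
        then show "lab x (bp_r BB j i (Lm i j p)) = lab x (p \<squnion>\<^bsub>HH i\<^esub> bp_r BB j i \<bottom>\<^bsub>HH j\<^esub>)"
          unfolding r1(2) L(2) HH_lattice(2)[OF x p r2(1)] r2(2) HH_lattice(4)[OF y] .
      qed
    qed
  qed
  show "bp_l BB i j (bp_r BB j i q) = q \<sqinter>\<^bsub>bp_H BB j\<^esub> bp_l BB i j \<top>\<^bsub>bp_H BB i\<^esub>"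
    if "i \<in> {1..bp_n BB}" "j \<in> {1..bp_n BB}" "i \<le> j" "q \<in> carrier (bp_H BB j)" for i j q
  proof -
    have i: "i \<in> {1..n}" and j: "j \<in> {1..n}" and qc: "q \<in> carrier (HH j)" using that by auto
    interpret L: bounded_distrib_lattice "HH j" by (rule Lat[OF j])
    show ?thesis
      unfolding BB_simps using pair_exists[OF i j that(3)]
    proof
      assume h: "i = j \<and> single i"
      then have "Lm i j p = p" for p using Lm_single' by blast
      moreover have "q \<sqinter>\<^bsub>HH j\<^esub> \<top>\<^bsub>HH j\<^esub> = q"
      proof (rule L.le_antisym)
        show "q \<sqsubseteq>\<^bsub>HH j\<^esub> q \<sqinter>\<^bsub>HH j\<^esub> \<top>\<^bsub>HH j\<^esub>" using qc by (intro L.meet_le) auto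
        show "q \<sqinter>\<^bsub>HH j\<^esub> \<top>\<^bsub>HH j\<^esub> \<sqsubseteq>\<^bsub>HH j\<^esub> q" using qc by (intro L.meet_left) auto
      qed (use qc in auto)
      ultimately show "Lm i j (bp_r BB j i q) = q \<sqinter>\<^bsub>HH j\<^esub> Lm i j \<top>\<^bsub>HH i\<^esub>"
        using h[THEN conjunct1] r_single[OF h[THEN conjunct2]] qc i by simp
    next
      assume "\<exists>x y. x \<in> F i \<and> y \<in> F j \<and> lt x y"
      then obtain x y where x: "x \<in> F i" and y: "y \<in> F j" and xy: "lt x y" by blast
      note V = FD(2)[OF x] FD(2)[OF y]
      have q: "q \<in> T y" using qc unfolding HH_carrier[OF y] .
      have qV: "lab y q \<in> V" by (rule labV[OF FD(1)[OF y] q])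
      have yq: "le y (lab y q)" using lab_cls[OF V(2) q] FD(1)[OF y] unfolding spine_def by blast
      have t: "top_of x \<in> V" using top_of[OF V(1)] clsV by auto
      note r = r_lab[OF x y xy q]
      note L1 = Lm_lab[OF x y xy r(1)] and L2 = Lm_lab[OF x y xy HH_closed(4)[OF x]]
      show "Lm i j (bp_r BB j i q) = q \<sqinter>\<^bsub>HH j\<^esub> Lm i j \<top>\<^bsub>HH i\<^esub>"
      proof (rule lab_inj[OF V(2) L1(1) HH_closed(2)[OF y q L2(1)]])
        \<comment> \<open>The modular law again, as \<open>y\<close> is below
          \<open>lab y q\<close>.\<close>
        have "jn (mt (lab y q) (top_of x)) y = mt (lab y q) (jn (top_of x) y)"
          using distr'[OF V(2) qV t] jn_comm[OF V(2)] mtV[OF qV t] t jn_absorb(2)[OF yq] by simp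
        then show "lab y (Lm i j (bp_r BB j i q)) = lab y (q \<sqinter>\<^bsub>HH j\<^esub> Lm i j \<top>\<^bsub>HH i\<^esub>)"
          unfolding L1(2) r(2) HH_lattice(3)[OF y q L2(1)] L2(2) HH_lattice(5)[OF x] .
      qed
    qed
  qed
qed

section \<open>The isomorphism with the tower\<close>

definition ph :: "'a list \<Rightarrow> nat \<times> 'a \<times> nat" where
  "ph v = (let z = SOME z. fst z \<in> spine \<and> snd z \<in> T (fst z) \<and> lab (fst z) (snd z) = v
    in (idx (fst z), th (fst z), snd z))"

text \<open>An element is named by the least element of its class and its label there; uniqueness of
  this name makes \<open>ph\<close> well defined.\<close>

lemma lab_unique:
  assumes "x \<in> spine" "y \<in> spine" "p \<in> T x" "q \<in> T y" "lab x p = lab y q"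
  shows "x = y" "p = q"
proof -
  have "lab x p \<in> cls x" "lab x p \<in> cls y"
    using lab_cls[OF spineV[OF assms(1)] assms(3)] lab_cls[OF spineV[OF assms(2)] assms(4)] assms(5) by simp_all
  then show xy: "x = y" by (rule cls_disjoint[OF assms(1,2)])
  show "p = q" using lab_inj[OF spineV[OF assms(1)] assms(3), of q] assms(4,5) unfolding xy by simp
qed

lemma ph_lab: "x \<in> spine \<Longrightarrow> p \<in> T x \<Longrightarrow> ph (lab x p) = (idx x, th x, p)"
proof -
  assume x: "x \<in> spine" and p: "p \<in> T x"
  define z where "z = (SOME z. fst z \<in> spine \<and> snd z \<in> T (fst z) \<and> lab (fst z) (snd z) = lab x p)"
  have "fst z \<in> spine \<and> snd z \<in> T (fst z) \<and> lab (fst z) (snd z) = lab x p"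
    unfolding z_def by (rule someI[of _ "(x, p)"]) (use x p in simp)
  then have "fst z = x" "snd z = p" using lab_unique[of "fst z" x "snd z" p] x p by simp_all
  then show ?thesis unfolding ph_def z_def[symmetric] Let_def by simp
qed

lemma lab_onto: "v \<in> V \<Longrightarrow> \<exists>x p. x \<in> spine \<and> p \<in> T x \<and> v = lab x p"
  using bottom_exists[of v] label_of[OF spineV] by metis

lemma ph_join:
  assumes x: "x \<in> spine" and y: "y \<in> spine" and p: "p \<in> T x" and q: "q \<in> T y"
  shows "ph (jn (lab x p) (lab y q)) = tower_join BB (idx x, th x, p) (idx y, th y, q)"
proof -
  have main: "jn (lab x p) (lab y q) = lab y (Lm (idx x) (idx y) p \<squnion>\<^bsub>HH (idx y)\<^esub> q)"
    "Lm (idx x) (idx y) p \<squnion>\<^bsub>HH (idx y)\<^esub> q \<in> T y"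
    if "lt x y" "x \<in> spine" "y \<in> spine" "p \<in> T x" "q \<in> T y" for x y p q
  proof -
    note L = Lm_lab[OF FI[OF that(2)] FI[OF that(3)] that(1,4)]
    note V = labV[OF that(2,4)] spineV[OF that(3)] labV[OF that(3,5)]
    have "le y (lab y q)" using lab_cls[OF spineV[OF that(3)] that(5)] that(3) unfolding spine_def by blast
    \<comment> \<open>\<open>y\<close> is below \<open>lab y q\<close>, so joining with
      \<open>y\<close> first changes nothing; this is why the link to \<open>y\<close> determines
      the join.\<close>
    then have "jn (jn (lab x p) y) (lab y q) = jn (lab x p) (lab y q)" by (rule jn_trans[OF V(1)])
    then show "jn (lab x p) (lab y q) = lab y (Lm (idx x) (idx y) p \<squnion>\<^bsub>HH (idx y)\<^esub> q)"
      unfolding HH_lattice(2)[OF FI[OF that(3)] L(1) that(5)] L(2) by simp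
    show "Lm (idx x) (idx y) p \<squnion>\<^bsub>HH (idx y)\<^esub> q \<in> T y"
      by (rule HH_closed(1)[OF FI[OF that(3)] L(1) that(5)])
  qed
  consider "x = y" | "lt x y" | "lt y x" using lt_linear[OF x y] by blast
  then show ?thesis
  proof cases
    case 1
    have q': "q \<in> T x" using q 1 by simp
    have "ph (jn (lab x p) (lab x q)) = (idx x, th x, p \<squnion>\<^bsub>HH (idx x)\<^esub> q)"
      unfolding HH_lattice(2)[OF FI[OF x] p q', symmetric] by (rule ph_lab[OF x HH_closed(1)[OF FI[OF x] p q']])
    then show ?thesis using 1 by simp
  next
    case 2
    note m = main[OF 2 x y p q]
    show ?thesis unfolding m(1) ph_lab[OF y m(2)] using th_less[OF 2] by simp
  next
    case 3
    note m = main[OF 3 y x q p]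
    show ?thesis
      unfolding jn_comm[OF labV[OF x p] labV[OF y q]] m(1) ph_lab[OF x m(2)] using th_less[OF 3] by simp
  qed
qed

lemma ph_meet:
  assumes x: "x \<in> spine" and y: "y \<in> spine" and p: "p \<in> T x" and q: "q \<in> T y"
  shows "ph (mt (lab x p) (lab y q)) = tower_meet BB (idx x, th x, p) (idx y, th y, q)"
proof -
  have main: "mt (lab x p) (lab y q) = lab x (p \<sqinter>\<^bsub>HH (idx x)\<^esub> bp_r BB (idx y) (idx x) q)"
    "p \<sqinter>\<^bsub>HH (idx x)\<^esub> bp_r BB (idx y) (idx x) q \<in> T x"
    if "lt x y" "x \<in> spine" "y \<in> spine" "p \<in> T x" "q \<in> T y" for x y p q
  proof -
    note r = r_lab[OF FI[OF that(2)] FI[OF that(3)] that(1,5)]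
    note V = labV[OF that(2,4)] spineV[OF that(2)] labV[OF that(3,5)]
    have t: "top_of x \<in> V" "le (lab x p) (top_of x)"
      using top_of[OF V(2)] clsV lab_cls[OF V(2) that(4)] by auto
    \<comment> \<open>\<open>lab x p\<close> is below \<open>top_of x\<close>, so cutting the other
      argument down to the class of \<open>x\<close> changes nothing.\<close>
    have "mt (lab x p) (mt (lab y q) (top_of x)) = mt (mt (lab x p) (top_of x)) (lab y q)"
      using mt_assoc[OF V(1) t(1) V(3)] mt_comm[OF V(3) t(1)] by simp
    then have "mt (lab x p) (mt (lab y q) (top_of x)) = mt (lab x p) (lab y q)"
      using mt_absorb(1)[OF t(2)] by simp
    then show "mt (lab x p) (lab y q) = lab x (p \<sqinter>\<^bsub>HH (idx x)\<^esub> bp_r BB (idx y) (idx x) q)"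
      unfolding HH_lattice(3)[OF FI[OF that(2)] that(4) r(1)] r(2) by simp
    show "p \<sqinter>\<^bsub>HH (idx x)\<^esub> bp_r BB (idx y) (idx x) q \<in> T x"
      by (rule HH_closed(2)[OF FI[OF that(2)] that(4) r(1)])
  qed
  consider "x = y" | "lt x y" | "lt y x" using lt_linear[OF x y] by blast
  then show ?thesis
  proof cases
    case 1
    have q': "q \<in> T x" using q 1 by simp
    have "ph (mt (lab x p) (lab x q)) = (idx x, th x, p \<sqinter>\<^bsub>HH (idx x)\<^esub> q)"
      unfolding HH_lattice(3)[OF FI[OF x] p q', symmetric] by (rule ph_lab[OF x HH_closed(2)[OF FI[OF x] p q']])
    then show ?thesis using 1 by simp
  next
    case 2
    note m = main[OF 2 x y p q]
    show ?thesis unfolding m(1) ph_lab[OF x m(2)] using th_less[OF 2] by simp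
  next
    case 3
    note m = main[OF 3 y x q p]
    show ?thesis
      unfolding mt_comm[OF labV[OF x p] labV[OF y q]] m(1) ph_lab[OF y m(2)] using th_less[OF 3] by simp
  qed
qed

lemma ph_bij: "bij_betw ph V (carrier (tower BB))"
  unfolding bij_betw_def
proof
  show "inj_on ph V"
  proof (rule inj_onI)
    fix v w assume v: "v \<in> V" and w: "w \<in> V" and eq: "ph v = ph w"
    obtain x p where x: "x \<in> spine" "p \<in> T x" "v = lab x p" using lab_onto[OF v] by blast
    obtain y q where y: "y \<in> spine" "q \<in> T y" "w = lab y q" using lab_onto[OF w] by blast
    have "th x = th y" "p = q" using eq unfolding x(3) y(3) ph_lab[OF x(1,2)] ph_lab[OF y(1,2)] by simp_all
    then show "v = w" using th_inj[OF x(1) y(1)] x(3) y(3) by simp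
  qed
  show "ph ` V = carrier (tower BB)"
  proof (intro equalityI subsetI)
    fix z assume "z \<in> ph ` V"
    then obtain v where v: "v \<in> V" "z = ph v" by blast
    obtain x p where x: "x \<in> spine" "p \<in> T x" "v = lab x p" using lab_onto[OF v(1)] by blast
    have "z = (idx x, th x, p)" unfolding v(2) x(3) by (rule ph_lab[OF x(1,2)])
    moreover have "p \<in> carrier (HH (idx x))" unfolding HH_carrier[OF FI[OF x(1)]] by (rule x(2))
    ultimately show "z \<in> carrier (tower BB)"
      unfolding tower_def using idx_range[OF x(1)] FI[OF x(1)] by simp
  next
    fix z assume "z \<in> carrier (tower BB)"
    then obtain i m p where z: "z = (i, m, p)" "m \<in> th ` F i" "p \<in> carrier (HH i)" unfolding tower_def by auto
    then obtain x where x: "x \<in> F i" "m = th x" by blast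
    have p: "p \<in> T x" using z(3) unfolding HH_carrier[OF x(1)] .
    have "ph (lab x p) = z" unfolding ph_lab[OF FD(1)[OF x(1)] p] z(1) x(2) FD(3)[OF x(1)] ..
    then show "z \<in> ph ` V" using labV[OF FD(1)[OF x(1)] p] by blast
  qed
qed

text \<open>\<open>bt\<close> is the least element of its class and the first point of the spine,
  hence lies in piece 1 and has the least chart value.\<close>

lemma ph_bot: "ph bt = Bot (tower BB)"
proof -
  have S: "bt \<in> spine" unfolding spine_def using btV bt clsV by blast
  have l: "bt = x \<or> lt bt x" if "x \<in> spine" for x using le_lt[OF S that] bt[OF spineV[OF that]] by blast
  have L: "(LEAST m. m \<in> bp_M BB) = th bt"
  proof (rule Least_equality)
    show "th bt \<in> bp_M BB" unfolding BB_simps M_eq using S by blast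
    show "th bt \<le> m" if mM: "m \<in> bp_M BB" for m
    proof -
      obtain x where x: "x \<in> spine" "m = th x" using mM unfolding BB_simps M_eq by blast
      show ?thesis using l[OF x(1)] th_less[of bt x] x(2) by auto
    qed
  qed
  have 1: "1 \<in> idx ` spine" unfolding idx_img using idx_range[OF S] by simp
  then obtain x where x: "x \<in> spine" "idx x = 1" by force
  have "idx bt \<le> 1" using l[OF x(1)] idx_mono[of bt x] x(2) by auto
  then have i: "idx bt = 1" using idx_range[OF S] by simp
  have "ph (lab bt \<bottom>\<^bsub>HH (idx bt)\<^esub>) = (idx bt, th bt, \<bottom>\<^bsub>HH (idx bt)\<^esub>)"
    by (rule ph_lab[OF S HH_closed(3)[OF FI[OF S]]])
  then have "ph bt = (idx bt, th bt, \<bottom>\<^bsub>HH (idx bt)\<^esub>)" unfolding HH_lattice(4)[OF FI[OF S]] .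
  then show ?thesis using L unfolding tower_def lattice_alg.simps BB_simps i by simp
qed

text \<open>\<open>tp\<close> is the greatest element of the class of the last spine point
  \<open>x1\<close>, so it carries the top label of the last piece.\<close>

lemma ph_top: "ph tp = Top (tower BB)"
proof -
  obtain x1 where x1: "x1 \<in> spine" "tp \<in> cls x1" using bottom_exists[OF tpV] by blast
  have l: "x = x1 \<or> lt x x1" if "x \<in> spine" for x
  proof -
    have "lo x tp" by (rule lo_le[OF tp[OF spineV[OF that]]])
    moreover have "lo tp x1" using x1(2) unfolding cls_def eqv_def by blast
    ultimately have "le x x1" using spine_lo_le[OF that spineV[OF x1(1)]] lo_trans by blast
    then show ?thesis using le_lt[OF that x1(1)] by blast
  qed
  have L: "(GREATEST m. m \<in> bp_M BB) = th x1"
  proof (rule Greatest_equality)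
    show "th x1 \<in> bp_M BB" unfolding BB_simps M_eq using x1(1) by blast
    show "m \<le> th x1" if mM: "m \<in> bp_M BB" for m
    proof -
      obtain x where x: "x \<in> spine" "m = th x" using mM unfolding BB_simps M_eq by blast
      show ?thesis using l[OF x(1)] th_less[of x x1] x(2) by auto
    qed
  qed
  have "n \<in> idx ` spine" unfolding idx_img using idx_range[OF x1(1)] by simp
  then obtain x where x: "x \<in> spine" "idx x = n" by force
  have "n \<le> idx x1" using l[OF x(1)] idx_mono[of x x1] x(2) by auto
  then have i: "idx x1 = n" using idx_range[OF x1(1)] by simp
  have "top_of x1 = tp"
    using top_of[OF spineV[OF x1(1)]] x1(2) tp clsV le_antisym by blast
  moreover have "ph (lab x1 \<top>\<^bsub>HH (idx x1)\<^esub>) = (idx x1, th x1, \<top>\<^bsub>HH (idx x1)\<^esub>)"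
    by (rule ph_lab[OF x1(1) HH_closed(4)[OF FI[OF x1(1)]]])
  ultimately have "ph tp = (idx x1, th x1, \<top>\<^bsub>HH (idx x1)\<^esub>)" unfolding HH_lattice(5)[OF FI[OF x1(1)]] by simp
  then show ?thesis using L unfolding tower_def lattice_alg.simps BB_simps i by simp
qed

lemma ph_iso: "bij_betw ph V (carrier (tower BB))"
  "v \<in> V \<Longrightarrow> w \<in> V \<Longrightarrow> ph (jn v w) = Join (tower BB) (ph v) (ph w)"
  "v \<in> V \<Longrightarrow> w \<in> V \<Longrightarrow> ph (mt v w) = Meet (tower BB) (ph v) (ph w)"
  "ph bt = Bot (tower BB)" "ph tp = Top (tower BB)"
proof -
  show "ph (jn v w) = Join (tower BB) (ph v) (ph w)" if v: "v \<in> V" and w: "w \<in> V"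
  proof -
    obtain x p where x: "x \<in> spine" "p \<in> T x" "v = lab x p" using lab_onto[OF v] by blast
    obtain y q where y: "y \<in> spine" "q \<in> T y" "w = lab y q" using lab_onto[OF w] by blast
    show ?thesis unfolding x(3) y(3) ph_lab[OF x(1,2)] ph_lab[OF y(1,2)] tower_def lattice_alg.simps
      by (rule ph_join[OF x(1) y(1) x(2) y(2)])
  qed
  show "ph (mt v w) = Meet (tower BB) (ph v) (ph w)" if v: "v \<in> V" and w: "w \<in> V"
  proof -
    obtain x p where x: "x \<in> spine" "p \<in> T x" "v = lab x p" using lab_onto[OF v] by blast
    obtain y q where y: "y \<in> spine" "q \<in> T y" "w = lab y q" using lab_onto[OF w] by blast
    show ?thesis unfolding x(3) y(3) ph_lab[OF x(1,2)] ph_lab[OF y(1,2)] tower_def lattice_alg.simps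
      by (rule ph_meet[OF x(1) y(1) x(2) y(2)])
  qed
qed (rule ph_bij ph_bot ph_top)+

end

theorem (in low_lattice) tower_exists:
  "\<exists>B f. cohesive_blueprint R B \<and> bij_betw f V (carrier (tower B)) \<and>
    (\<forall>v\<in>V. \<forall>w\<in>V. f (jn v w) = Join (tower B) (f v) (f w)) \<and>
    (\<forall>v\<in>V. \<forall>w\<in>V. f (mt v w) = Meet (tower B) (f v) (f w)) \<and>
    f bt = Bot (tower B) \<and> f tp = Top (tower B)"
proof -
  obtain n N idx th where C: "1 \<le> N" "\<forall>x\<in>spine. card (cls x) \<le> N" "idx ` spine = {1..n}"
    "\<forall>x y. lt x y \<longrightarrow> idx x \<le> idx y" "\<forall>x y. lt x y \<longrightarrow> th x < (th y :: 'a)"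
    "\<forall>i\<in>{1..n}. (is_point (th ` fib idx i) \<or> is_interval (th ` fib idx i)) \<and> ds1 (\<lambda>t. t \<in> th ` fib idx i) \<and>
      ((\<exists>x. fib idx i = {x}) \<or>
      (\<exists>m r l. 1 \<le> m \<and> (\<forall>u\<in>fib idx i. \<forall>v\<in>fib idx i. lt u v \<longrightarrow> (str m r u \<and> str m r v) \<and> lnk m l u v) \<and>
        (\<forall>x\<in>fib idx i. \<exists>z\<in>fib idx i. lt z x) \<and> (\<forall>x\<in>fib idx i. \<exists>z\<in>fib idx i. lt x z)))"
    using chart_exists by (elim exE conjE) (rule that)
  interpret c: charted R d V le jn mt bt tp n N idx th
  proof unfold_locales
    fix i assume i: "i \<in> {1..n}"
    note c = C(6)[THEN bspec, OF i]
    show "is_point (th ` fib idx i) \<or> is_interval (th ` fib idx i)" by (rule c[THEN conjunct1])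
    show "ds1 (\<lambda>t. t \<in> th ` fib idx i)" by (rule c[THEN conjunct2, THEN conjunct1])
    show "(\<exists>x. fib idx i = {x}) \<or>
      (\<exists>m r l. 1 \<le> m \<and> (\<forall>u\<in>fib idx i. \<forall>v\<in>fib idx i. lt u v \<longrightarrow> (str m r u \<and> str m r v) \<and> lnk m l u v) \<and>
        (\<forall>x\<in>fib idx i. \<exists>z\<in>fib idx i. lt z x) \<and> (\<forall>x\<in>fib idx i. \<exists>z\<in>fib idx i. lt x z))"
      by (rule c[THEN conjunct2, THEN conjunct2])
  qed (use C(1-5) in blast)+
  show ?thesis
    by (intro exI[of _ c.BB] exI[of _ c.ph] conjI ballI c.cohesive c.ph_iso)
qed

section \<open>From carrier and order of a definable lattice to definable operations\<close>

theorem corollary2p41: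
  fixes R :: "('a::real_closed_field, 'f, 'r) expansion"
    and H :: "'a list gorder" and d :: nat
  assumes "o_minimal R"
    and "definable_lattice R d H"
    and "bounded_distrib_lattice H"
    and "o_dim R (carrier H) = 1"
  shows "\<exists>B. cohesive_blueprint R B \<and> isomorphic_alg (alg_of H) (tower B)"
proof -
  interpret bounded_distrib_lattice H by fact
  interpret om: omin R d by unfold_locales fact
  define V where "V = carrier H"
  define l where "l x y \<longleftrightarrow> x \<in> V \<and> y \<in> V \<and> x \<sqsubseteq>\<^bsub>H\<^esub> y" for x y
  \<comment> \<open>Outside \<open>V\<close> the operations take the zero vector as value, so that
    they are total functions into vectors of length \<open>d\<close>, as \<open>dvvfun2\<close>
    requires.\<close>
  define j where "j x y = (if x \<in> V \<and> y \<in> V then x \<squnion>\<^bsub>H\<^esub> y else replicate d 0)" for x y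
  define m where "m x y = (if x \<in> V \<and> y \<in> V then x \<sqinter>\<^bsub>H\<^esub> y else replicate d 0)" for x y
  have dV: "definable R d V" and dl: "definable R (d + d) {x @ y | x y. x \<in> V \<and> y \<in> V \<and> x \<sqsubseteq>\<^bsub>H\<^esub> y}"
    using assms(2) unfolding definable_lattice_def V_def by blast+
  have Vd: "om.dset V"
  proof -
    have "map e [0..<d] = om.vc 0 e" for e :: "nat \<Rightarrow> 'a" unfolding om.vc_def by simp
    then show ?thesis using dV unfolding definable_def om.dset_def om.dfn_def by simp
  qed
  have lenV: "length x = d" if "x \<in> V" for x using Vd that unfolding om.dset_def by blast
  have ld: "om.dv2 l"
  proof -
    let ?A = "{x @ y | x y. x \<in> V \<and> y \<in> V \<and> x \<sqsubseteq>\<^bsub>H\<^esub> y}"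
    have "om.dfn (\<lambda>e. map e [0..<d + d] \<in> ?A)" using dl unfolding definable_def om.dfn_def by blast
    \<comment> \<open>Skips position \<open>d\<close>, the scalar slot of the first block, so that
      the two halves of the list become \<open>vc 0\<close> and \<open>vc 1\<close>.\<close>
    from om.dfn_ren[OF this, of "\<lambda>i. if i < d then i else Suc i"]
    have "om.dfn (\<lambda>e. map (\<lambda>i. e (if i < d then i else Suc i)) [0..<d + d] \<in> ?A)" .
    moreover have "map (\<lambda>i. e (if i < d then i else Suc i)) [0..<d + d] = om.vc 0 e @ om.vc 1 e" for e :: "nat \<Rightarrow> 'a"
      by (rule nth_equalityI) (auto simp: om.vc_def nth_append)
    moreover have "om.vc 0 e @ om.vc 1 e \<in> ?A \<longleftrightarrow> l (om.vc 0 e) (om.vc 1 e)" for e :: "nat \<Rightarrow> 'a"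
      unfolding l_def using lenV by auto
    ultimately show ?thesis unfolding om.dv2_def by simp
  qed
  have jm: "om.dvvfun2 j" "om.dvvfun2 m"
  proof -
    have len: "length (j x y) = d" "length (m x y) = d" for x y
      unfolding j_def m_def using lenV join_closed meet_closed unfolding V_def by auto
    \<comment> \<open>Describes the join by the order alone, in first-order terms, which makes its
      graph definable.\<close>
    have join: "z = x \<squnion>\<^bsub>H\<^esub> y \<longleftrightarrow> z \<in> V \<and> (l x z \<and> l y z) \<and> (\<forall>w\<in>V. l x w \<and> l y w \<longrightarrow> l z w)"
      if "x \<in> V" "y \<in> V" for x y z
    proof (intro iffI conjI ballI impI)
      assume z: "z = x \<squnion>\<^bsub>H\<^esub> y"
      note C = that[unfolded V_def] join_closed[OF that[unfolded V_def]]
      show "z \<in> V" unfolding V_def z by (rule C(3))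
      show "l x z" "l y z" unfolding l_def V_def z using C join_left[OF C(1,2)] join_right[OF C(1,2)] by simp_all
      show "l z w" if "w \<in> V" "l x w \<and> l y w" for w
        using that C join_le[of x w y] unfolding l_def V_def z by simp
    next
      assume z: "z \<in> V \<and> (l x z \<and> l y z) \<and> (\<forall>w\<in>V. l x w \<and> l y w \<longrightarrow> l z w)"
      note C = that[unfolded V_def] join_closed[OF that[unfolded V_def]]
      have "l x (x \<squnion>\<^bsub>H\<^esub> y) \<and> l y (x \<squnion>\<^bsub>H\<^esub> y)"
        unfolding l_def V_def using C join_left[OF C(1,2)] join_right[OF C(1,2)] by simp
      then have "l z (x \<squnion>\<^bsub>H\<^esub> y)" using z[THEN conjunct2, THEN conjunct2, THEN bspec, of "x \<squnion>\<^bsub>H\<^esub> y"] C(3)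
        unfolding V_def by simp
      moreover have "l (x \<squnion>\<^bsub>H\<^esub> y) z" using z C join_le[of x z y] unfolding l_def V_def by simp
      ultimately show "z = x \<squnion>\<^bsub>H\<^esub> y" using le_antisym[of z "x \<squnion>\<^bsub>H\<^esub> y"] unfolding l_def V_def by simp
    qed
    have meet: "z = x \<sqinter>\<^bsub>H\<^esub> y \<longleftrightarrow> z \<in> V \<and> (l z x \<and> l z y) \<and> (\<forall>w\<in>V. l w x \<and> l w y \<longrightarrow> l w z)"
      if "x \<in> V" "y \<in> V" for x y z
    proof (intro iffI conjI ballI impI)
      assume z: "z = x \<sqinter>\<^bsub>H\<^esub> y"
      note C = that[unfolded V_def] meet_closed[OF that[unfolded V_def]]
      show "z \<in> V" unfolding V_def z by (rule C(3))
      show "l z x" "l z y" unfolding l_def V_def z using C meet_left[OF C(1,2)] meet_right[OF C(1,2)] by simp_all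
      show "l w z" if "w \<in> V" "l w x \<and> l w y" for w
        using that C meet_le[of w x y] unfolding l_def V_def z by simp
    next
      assume z: "z \<in> V \<and> (l z x \<and> l z y) \<and> (\<forall>w\<in>V. l w x \<and> l w y \<longrightarrow> l w z)"
      note C = that[unfolded V_def] meet_closed[OF that[unfolded V_def]]
      have "l (x \<sqinter>\<^bsub>H\<^esub> y) x \<and> l (x \<sqinter>\<^bsub>H\<^esub> y) y"
        unfolding l_def V_def using C meet_left[OF C(1,2)] meet_right[OF C(1,2)] by simp
      then have "l (x \<sqinter>\<^bsub>H\<^esub> y) z" using z[THEN conjunct2, THEN conjunct2, THEN bspec, of "x \<sqinter>\<^bsub>H\<^esub> y"] C(3)
        unfolding V_def by simp
      moreover have "l z (x \<sqinter>\<^bsub>H\<^esub> y)" using z C meet_le[of z x y] unfolding l_def V_def by simp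
      ultimately show "z = x \<sqinter>\<^bsub>H\<^esub> y" using le_antisym[of z "x \<sqinter>\<^bsub>H\<^esub> y"] unfolding l_def V_def by simp
    qed
    note dle = om.dv2D[OF ld]
    show "om.dvvfun2 j"
      unfolding om.dvvfun2_def
    proof (rule om.dvec_graph[where P = "\<lambda>e z. ((om.vc 0 e \<in> V \<and> om.vc 1 e \<in> V) \<longrightarrow>
        z \<in> V \<and> (l (om.vc 0 e) z \<and> l (om.vc 1 e) z) \<and> (\<forall>w\<in>V. l (om.vc 0 e) w \<and> l (om.vc 1 e) w \<longrightarrow> l z w)) \<and>
        (\<not> (om.vc 0 e \<in> V \<and> om.vc 1 e \<in> V) \<longrightarrow> z = replicate d 0)"])
      show "om.dfn (\<lambda>e. ((om.vc 0 (om.sh e) \<in> V \<and> om.vc 1 (om.sh e) \<in> V) \<longrightarrow>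
        om.vc 0 e \<in> V \<and> (l (om.vc 0 (om.sh e)) (om.vc 0 e) \<and> l (om.vc 1 (om.sh e)) (om.vc 0 e)) \<and>
          (\<forall>w\<in>V. l (om.vc 0 (om.sh e)) w \<and> l (om.vc 1 (om.sh e)) w \<longrightarrow> l (om.vc 0 e) w)) \<and>
        (\<not> (om.vc 0 (om.sh e) \<in> V \<and> om.vc 1 (om.sh e) \<in> V) \<longrightarrow> om.vc 0 e = replicate d 0))"
        by (intro om.dfn_rules dle Vd) simp
    qed (use len join in \<open>auto simp: j_def\<close>)
    show "om.dvvfun2 m"
      unfolding om.dvvfun2_def
    proof (rule om.dvec_graph[where P = "\<lambda>e z. ((om.vc 0 e \<in> V \<and> om.vc 1 e \<in> V) \<longrightarrow>
        z \<in> V \<and> (l z (om.vc 0 e) \<and> l z (om.vc 1 e)) \<and> (\<forall>w\<in>V. l w (om.vc 0 e) \<and> l w (om.vc 1 e) \<longrightarrow> l w z)) \<and>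
        (\<not> (om.vc 0 e \<in> V \<and> om.vc 1 e \<in> V) \<longrightarrow> z = replicate d 0)"])
      show "om.dfn (\<lambda>e. ((om.vc 0 (om.sh e) \<in> V \<and> om.vc 1 (om.sh e) \<in> V) \<longrightarrow>
        om.vc 0 e \<in> V \<and> (l (om.vc 0 e) (om.vc 0 (om.sh e)) \<and> l (om.vc 0 e) (om.vc 1 (om.sh e))) \<and>
          (\<forall>w\<in>V. l w (om.vc 0 (om.sh e)) \<and> l w (om.vc 1 (om.sh e)) \<longrightarrow> l w (om.vc 0 e))) \<and>
        (\<not> (om.vc 0 (om.sh e) \<in> V \<and> om.vc 1 (om.sh e) \<in> V) \<longrightarrow> om.vc 0 e = replicate d 0))"
        by (intro om.dfn_rules dle Vd) simp
    qed (use len meet in \<open>auto simp: m_def\<close>)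
  qed
  have thin: "om.thin V"
    unfolding om.thin_def
  proof (intro allI impI)
    fix ds C assume C: "cell R ds C" "C \<subseteq> V"
    \<comment> \<open>The cell contributes to the supremum that defines the dimension.\<close>
    have "ereal (real (sum_list ds)) \<le> o_dim R V"
      unfolding o_dim_def by (rule SUP_upper) (use C in blast)
    then show "sum_list ds \<le> 1" using assms(4) unfolding V_def by (simp add: one_ereal_def)
  qed
  interpret L: low_lattice R d V l j m "\<bottom>\<^bsub>H\<^esub>" "\<top>\<^bsub>H\<^esub>"
  proof unfold_locales
    show "m x (j y z) = j (m x y) (m x z)" if "x \<in> V" "y \<in> V" "z \<in> V" for x y z
      using that meet_join_distrib[of x y z] unfolding m_def j_def V_def by simp
    show "l (j x y) z" if "l x z" "l y z" for x y z
      using that join_le[of x z y] unfolding l_def j_def V_def by simp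
    show "l z (m x y)" if "l z x" "l z y" for x y z
      using that meet_le[of z x y] unfolding l_def m_def V_def by simp
    show "l x z" if "l x y" "l y z" for x y z
      using that le_trans[of x y z] unfolding l_def V_def by blast
    show "x = y" if "l x y" "l y x" for x y
      using that le_antisym[of x y] unfolding l_def V_def by blast
  qed (use Vd ld jm thin in \<open>auto simp: l_def j_def m_def V_def join_left join_right meet_left meet_right\<close>)
  obtain B f where B: "cohesive_blueprint R B" "bij_betw f V (carrier (tower B))"
    "\<forall>v\<in>V. \<forall>w\<in>V. f (j v w) = Join (tower B) (f v) (f w)"
    "\<forall>v\<in>V. \<forall>w\<in>V. f (m v w) = Meet (tower B) (f v) (f w)"
    "f \<bottom>\<^bsub>H\<^esub> = Bot (tower B)" "f \<top>\<^bsub>H\<^esub> = Top (tower B)"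
    using L.tower_exists by (elim exE conjE) (rule that)
  have "isomorphic_alg (alg_of H) (tower B)"
    unfolding isomorphic_alg_def alg_of_def lattice_alg.simps partial_object.simps V_def[symmetric]
    by (intro exI[of _ f] conjI B(2,5,6) ballI) (use B(3,4) in \<open>auto simp: j_def m_def\<close>)
  then show ?thesis using B(1) by blast
qed


end
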